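(* Let $n>0$ and let $K$ be the simplicial model of $S^{2n+1}$ with exactly two nondegenerate simplices, in degrees $0$ and $2n+1$. Let $\Upsilon: C^*K\,\widetilde\otimes\,\mathcal B C^*K\to CU^*\mathcal L S^{2n+1}$ be the thin free loop model quasi-isomorphism. Then there is a quasi-isomorphism of cochain complexes $$\widetilde\Upsilon:(\Lambda\upsilon\otimes C^*K\,\widetilde\otimes\,\mathcal B C^*K,\widetilde D)\longrightarrow(\Lambda\upsilon\otimes CU^*\mathcal L S^{2n+1},D^\sharp)$$ such that $\widetilde\Upsilon$ restricted to $(\Lambda\upsilon,0)$ is the inclusion $(\Lambda\upsilon,0)\hookrightarrow(\Lambda\upsilon\otimes CU^*\mathcal L S^{2n+1},D^\sharp)$, and $\pi\circ\widetilde\Upsilon=\Upsilon\circ\pi$, where $\pi$ denotes the obvious projections $\Lambda\upsilon\otimes C^*K\,\widetilde\otimes\,\mathcal B C^*K\to C^*K\,\widetilde\otimes\,\mathcal B C^*K$ and $\Lambda\upsilon\otimes CU^*\mathcal L S^{2n+1}\to CU^*\mathcal L S^{2n+1}$ (sending $\upsilon^k\otimes(-)$ to $0$ for $k>0$ and being the identity on $\upsilon^0\otimes(-)$).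
   Context: All coefficients are $\mathbb Z$. The differential and tensor products of maps obey the Koszul sign rule, except that cubical cochains are dualized without signs as stated below. **Bar and cobar constructions.** For cochain (upper) gradings $s$ lowers degree by 1 and $s^{-1}$ raises degree by 1. For a graded module $V$, $\perp V$ is the cofree coassociative coalgebra (tensor coalgebra, elements $v_1|\cdots|v_m$, deconcatenation coproduct). For a cochain algebra $A$, $\mathcal BA=(\perp sA^{+},d_{\mathcal B})$ where $d_{\mathcal B}$ is the coderivation whose linear part sends $sa\mapsto -s(da)$, $sa_1|sa_2\mapsto(-1)^{|a_1|+1}s(a_1a_2)$, and longer words to $0$. For a (co)chain coalgebra $C$, $\Omega C=T(s^{-1}C_+)$ with $d_\Omega=-s^{-1}ds+(s^{-1}\otimes s^{-1})\overline\Delta s$ on generators. **The product $\star$.** $C_*K$, $C^*K$ are the normalized chains and cochains of a finite-type, 1-reduced simplicial set $K$. Let $\psi_K:\Omega C_*K\to\Omega C_*K\otimes\Omega C_*K$ be the Alexander–Whitney cobar diagonal, the composite of $\Omega$ of the map $C_*K\to C_*(K\times K)$ induced by the diagonal, the natural chain algebra map $\Omega C_*(K\times K)\to\Omega(C_*K\otimes C_*K)$ of Gugenheim–Munkholm whose linear part is the Alexander–Whitney map, and Milgram's algebra map $\rho:\Omega(C_*K\otimes C_*K)\to\Omega C_*K\otimes\Omega C_*K$ ($\rho(s^{-1}(x\otimes1))=s^{-1}x\otimes 1$, $\rho(s^{-1}(1\otimes y))=1\otimes s^{-1}y$, $\rho(s^{-1}(x\otimes y))=0$ for $x,y$ of positive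 degree). Its dual $\psi_K^\sharp$ is an associative product on $\mathcal BC^*K=(\Omega C_*K)^\sharp$, written $a\star b$, and a coalgebra map; put $\varphi=\Omega\psi_K^\sharp:\Omega(\mathcal BC^*K\otimes\mathcal BC^*K)\to\Omega\mathcal BC^*K$. For the $K$ of the claim, $C^*K=\Lambda z$ with $|z|=2n+1$ and $\mathcal BC^*K=\Gamma(sz)$ is the divided power algebra, with $sz(m)=sz|\cdots|sz$ ($m$ factors) and $sz(a)\star sz(b)=\binom{a+b}{a}sz(a+b)$. Let $\varepsilon_K:\Omega\mathcal BC^*K\to C^*K$ be the counit of the cobar–bar adjunction: the algebra map with $s^{-1}(sx)\mapsto x$ and $s^{-1}(w)\mapsto0$ for words $w$ of length $>1$. **The path model.** $\Omega(\mathcal BC^*K\otimes\mathcal BC^*K)\odot\mathcal BC^*K$ is the free right $\Omega(\mathcal BC^*K\otimes\mathcal BC^*K)$-module on $\mathcal BC^*K$, $(w\otimes c)\cdot w'=(-1)^{|w'||c|}ww'\otimes c$, with commuting left action and differential $D$ (derivation for the action) given recursively, with $\theta_j=j+\sum_{i\le j}|x_i|$ (signs $(-1)^{b\cdot\theta}$ use $|b|$), by $$(s^{-1}(a\otimes b)\otimes1)(1\otimes sx_1|\cdots|sx_m)=s^{-1}(a\otimes b)\otimes sx_1|\cdots|sx_m+(-1)^{b\theta_m}\big(s^{-1}(a\otimes((sx_1|\cdots|sx_m)\star b))-s^{-1}((a\star(sx_1|\cdots|sx_m))\otimes b)\big)$$ $$+\sum_{j=1}^{m-1}\big[-(-1)^{b\theta_j}s^{-1}((a\star(sx_1|\cdots|sx_j))\otimes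 b)\cdot(1\otimes sx_{j+1}|\cdots|sx_m)+(-1)^{(b+\theta_j)(\theta_m-\theta_j)}s^{-1}(a\otimes((sx_{j+1}|\cdots|sx_m)\star b))\otimes sx_1|\cdots|sx_j\big],$$ $$D(1\otimes sx_1|\cdots|sx_m)=1\otimes d_{\mathcal B}(sx_1|\cdots|sx_m)+s^{-1}(sx_1|\cdots|sx_m\otimes1)-s^{-1}(1\otimes sx_1|\cdots|sx_m)$$ $$+\sum_{j=1}^{m-1}\big[s^{-1}(sx_1|\cdots|sx_j\otimes1)\cdot(1\otimes sx_{j+1}|\cdots|sx_m)-(-1)^{\theta_j(\theta_m-\theta_j)}s^{-1}(1\otimes sx_{j+1}|\cdots|sx_m)\otimes sx_1|\cdots|sx_j\big].$$ On $\Omega\mathcal BC^*K\odot\mathcal BC^*K$ (free right $\Omega\mathcal BC^*K$-module on $\mathcal BC^*K$) the differential is $\overline D(1\otimes c)=(\varphi\otimes Id)D(1\otimes c)$, extended as a right-module derivation. **Cubical chains and cochains.** $CU_*Y$ is the chain complex of singular cubes modulo degenerate ones (independent of some coordinate), with $dT=\sum_{i}(-1)^i(T|_{t_i=1}-T|_{t_i=0})$ and coproduct $\Delta T=\sum_L\rho_L\,T|_{t_j=0,\,j\notin L}\otimes T|_{t_j=1,\,j\in L}$, $L$ ranging over subsets of coordinates, $\rho_L$ the sign of the shuffle $(L,L^c)$. $CU^*Y$ is the dual cochain algebra, with $d^\sharp f=f\circ d$ and product $(fg)(T)=(f\otimes g)(\Delta T)$ (no extra signs). **The map $\Upsilon$.**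 Let $X$ be a 1-connected space with $|K|\simeq X$ (here $X=S^{2n+1}$). Fix a commutative square $CU^*\Delta\circ\tilde\alpha=\tilde\gamma\circ\varphi$ with $\tilde\alpha:\Omega(\mathcal BC^*K\otimes\mathcal BC^*K)\to CU^*(X\times X)$ and $\tilde\gamma:\Omega\mathcal BC^*K\to CU^*X$ quasi-isomorphisms inducing algebra maps in cohomology, $\ker\varepsilon_K\subseteq\ker\tilde\gamma$, and $\tilde\alpha\iota_k=CU^*pr_k\circ\tilde\gamma$ for the tensor-factor inclusions $\iota_k$ and projections $pr_k$, $k=1,2$. Let $i:X\to X^I$ send a point to the constant path, $p:X^I\to X\times X$, $p(\ell)=(\ell(0),\ell(1))$, $j:\mathcal LX\to X^I$ the inclusion, $e:\mathcal LX\to X$ evaluation at the basepoint. For $f\in\ker CU^*i$ let $(Jf)(T)=-f(H(T))$, where $H(T)(t_0,\dots,t_m)(u)=T(t_1,\dots,t_m)(t_0u)$. Define $\tilde\beta$ on $\Omega(\mathcal BC^*K\otimes\mathcal BC^*K)\odot\mathcal BC^*K$ with values in $CU^*X^I$ recursively by $\tilde\beta(1\otimes 1)=1$, $\tilde\beta(1\otimes c)=J\tilde\beta D(1\otimes c)$ for $|c|>0$, $\tilde\beta(w\otimes c)=(-1)^{|w||c|}\tilde\beta(1\otimes c)\cdot CU^*p\,\tilde\alpha(w)$. Define $\tilde\delta:\Omega\mathcal BC^*K\odot\mathcal BC^*K\to CU^*\mathcal LX$ by $\tilde\delta(1\otimes1)=1$, $\tilde\delta(1\otimes c)=CU^*j\,J\tilde\beta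 D(1\otimes c)$ for $|c|>0$, $\tilde\delta(w\otimes c)=(-1)^{|w||c|}\tilde\delta(1\otimes c)\cdot CU^*e\,\tilde\gamma(w)$. Let $C^*K\,\widetilde\otimes\,\mathcal BC^*K$ be the free right $C^*K$-module $C^*K\otimes\mathcal BC^*K$ with differential $\check D(1\otimes c)=(\varepsilon_K\otimes Id)\overline D(1\otimes c)$ extended as a right-module derivation (for the $K$ of the claim, $\check D=0$). Let $\hat\sigma:C^*K\,\widetilde\otimes\,\mathcal BC^*K\to\Omega\mathcal BC^*K\odot\mathcal BC^*K$ be a cochain section of $\varepsilon_K\otimes Id$ with $\hat\sigma(x\otimes c)=s^{-1}(sx)\otimes c$ (and $\hat\sigma(1\otimes c)=1\otimes c$) for words $c$ of length $\le2$. Then $\Upsilon=\tilde\delta\circ\hat\sigma$; it is a standing fact that $\tilde\beta,\tilde\delta,\hat\sigma$, hence $\Upsilon$, are quasi-isomorphisms of cochain complexes. Since $\ker\varepsilon_K\subseteq\ker\tilde\gamma$, $\Upsilon(x\otimes c)=\tilde\delta(s^{-1}(sx)\otimes c)$. The pair $(C^*K\,\widetilde\otimes\,\mathcal BC^*K,\Upsilon)$ is called a thin free loop model for $X$. **Homotopy orbit complexes.** $\Lambda\upsilon$ is the free graded commutative (polynomial) algebra on $\upsilon$ of degree 2. Let $S^1$ act on $\mathcal LX$ by rotation, $(w\cdot\ell)(u)=\ell(wu)$, and let $\kappa:CU_*S^1\otimes CU_*\mathcal LX\to CU_*\mathcal LX$ be $\kappa(U\otimes V)(s,t)=U(s)\cdot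 V(t)$. Let $T_k=\sum_{f\in F_k}e^{2\pi i f}\in CU_{2k+1}S^1$, where $F_0=\{t\mapsto t\}$ and $F_k$ is the family of all functions $t_0\big(g(t_1,\dots,t_{2l+1})+h(t_{2l+2},\dots,t_{2k})\big)$ on $I^{2k+1}$ with $0\le l\le k-1$, $g\in F_l$, $h\in F_{k-1-l}$. Let $\omega_k(f)=f\circ\kappa(T_k\otimes-)$, a linear map $CU^*\mathcal LX\to CU^{*-(2k+1)}\mathcal LX$. Then $D^\sharp(\upsilon^m\otimes f)=\upsilon^m\otimes d^\sharp f+\sum_{k\ge0}\upsilon^{m+k+1}\otimes\omega_k(f)$. On $\Lambda\upsilon\otimes C^*K\otimes\mathcal BC^*K$, $\widetilde D(\upsilon^k\otimes y\otimes c)=\upsilon^k\otimes\check D(y\otimes c)+\upsilon^{k+1}\otimes S(y\otimes c)$, where $S(1\otimes c)=0$, $S(y\otimes1)=1\otimes sy$ and $S(y\otimes sx_1|\cdots|sx_m)=\sum_{j=1}^{m+1}\pm1\otimes sx_j|\cdots|sx_m|sy|sx_1|\cdots|sx_{j-1}$ for $y\in C^+K$ (Koszul signs). For the $K$ of the claim, $S(z\otimes sz(m))=(m+1)\,1\otimes sz(m+1)$. *)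

theory Defs
  imports "HOL-Analysis.Analysis" "HOL-Homology.Homology" "HOL-Library.Function_Algebras"
begin

section \<open>Cochain complexes and quasi-isomorphisms\<close>

definition psign :: "nat \<Rightarrow> int" where
  "psign k = (- 1) ^ k"

record 'a cochain_complex =
  comp :: "nat \<Rightarrow> 'a set"
  diff :: "'a \<Rightarrow> 'a"

definition is_cochain_complex :: "'a::ab_group_add cochain_complex \<Rightarrow> bool" where
  "is_cochain_complex C \<longleftrightarrow> (\<forall>p.
     0 \<in> comp C p \<and>
     (\<forall>x\<in>comp C p. \<forall>y\<in>comp C p. x - y \<in> comp C p \<and> diff C (x - y) = diff C x - diff C y) \<and>
     (\<forall>x\<in>comp C p. diff C x \<in> comp C (Suc p) \<and> diff C (diff C x) = 0))"

definition cocycles :: "'a::ab_group_add cochain_complex \<Rightarrow> nat \<Rightarrow> 'a set" where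
  "cocycles C p = {x \<in> comp C p. diff C x = 0}"

definition coboundaries :: "'a::ab_group_add cochain_complex \<Rightarrow> nat \<Rightarrow> 'a set" where
  "coboundaries C p = (case p of 0 \<Rightarrow> {0} | Suc q \<Rightarrow> diff C ` comp C q)"

definition coh_class :: "'a::ab_group_add cochain_complex \<Rightarrow> nat \<Rightarrow> 'a \<Rightarrow> 'a set" where
  "coh_class C p x = {y \<in> cocycles C p. y - x \<in> coboundaries C p}"

definition cohomology :: "'a::ab_group_add cochain_complex \<Rightarrow> nat \<Rightarrow> 'a set set" where
  "cohomology C p = coh_class C p ` cocycles C p"

definition cochain_map ::
  "'a::ab_group_add cochain_complex \<Rightarrow> 'b::ab_group_add cochain_complex \<Rightarrow> ('a \<Rightarrow> 'b) \<Rightarrow> bool" where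
  "cochain_map C D f \<longleftrightarrow> (\<forall>p.
     (\<forall>x\<in>comp C p. f x \<in> comp D p \<and> f (diff C x) = diff D (f x)) \<and>
     (\<forall>x\<in>comp C p. \<forall>y\<in>comp C p. f (x + y) = f x + f y))"

definition quasi_iso ::
  "'a::ab_group_add cochain_complex \<Rightarrow> 'b::ab_group_add cochain_complex \<Rightarrow> ('a \<Rightarrow> 'b) \<Rightarrow> bool" where
  "quasi_iso C D f \<longleftrightarrow>
     is_cochain_complex C \<and> is_cochain_complex D \<and> cochain_map C D f \<and>
     (\<forall>p. bij_betw (\<lambda>c. \<Union>x\<in>c. coh_class D p (f x)) (cohomology C p) (cohomology D p))"

definition coh_algebra_map ::
  "'a::ab_group_add cochain_complex \<Rightarrow> ('a \<Rightarrow> 'a \<Rightarrow> 'a) \<Rightarrow> 'a \<Rightarrow>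
   'b::ab_group_add cochain_complex \<Rightarrow> ('b \<Rightarrow> 'b \<Rightarrow> 'b) \<Rightarrow> 'b \<Rightarrow> ('a \<Rightarrow> 'b) \<Rightarrow> bool" where
  "coh_algebra_map C mC uC D mD uD f \<longleftrightarrow>
     coh_class D 0 (f uC) = coh_class D 0 uD \<and>
     (\<forall>p q. \<forall>x\<in>cocycles C p. \<forall>y\<in>cocycles C q.
        coh_class D (p + q) (f (mC x y)) = coh_class D (p + q) (mD (f x) (f y)))"


section \<open>Free complexes, algebras and coalgebras with a homogeneous basis\<close>

text \<open>A free graded module is given by its homogeneous basis; its elements are the
  finitely supported integer combinations of type \<open>'b \<Rightarrow>\<^sub>0 int\<close>. Structure maps are
  given on the basis and extended by \<open>frag_extend\<close>.\<close>

record 'b based =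
  bas :: "'b set"
  deg :: "'b \<Rightarrow> nat"
  dif :: "'b \<Rightarrow> ('b \<Rightarrow>\<^sub>0 int)"

record 'b based_algebra = "'b based" +
  mul :: "'b \<Rightarrow> 'b \<Rightarrow> ('b \<Rightarrow>\<^sub>0 int)"
  unt :: 'b

record 'b based_coalgebra = "'b based" +
  cop :: "'b \<Rightarrow> ('b \<times> 'b \<Rightarrow>\<^sub>0 int)"
  gl :: 'b

definition complex_of :: "('b, 'z) based_scheme \<Rightarrow> ('b \<Rightarrow>\<^sub>0 int) cochain_complex" where
  "complex_of B = \<lparr>comp = (\<lambda>p. {x. Poly_Mapping.keys x \<subseteq> {b \<in> bas B. deg B b = p}}),
                   diff = frag_extend (dif B)\<rparr>"

definition mult_of ::
  "('b, 'z) based_algebra_scheme \<Rightarrow> ('b \<Rightarrow>\<^sub>0 int) \<Rightarrow> ('b \<Rightarrow>\<^sub>0 int) \<Rightarrow> ('b \<Rightarrow>\<^sub>0 int)" where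
  "mult_of A x y = frag_extend (\<lambda>a. frag_extend (mul A a) y) x"

definition tensor_coalgebra ::
  "'b based_coalgebra \<Rightarrow> 'c based_coalgebra \<Rightarrow> ('b \<times> 'c) based_coalgebra" where
  "tensor_coalgebra C D =
    \<lparr>bas = bas C \<times> bas D,
     deg = (\<lambda>(a, b). deg C a + deg D b),
     dif = (\<lambda>(a, b). frag_extend (\<lambda>a'. frag_of (a', b)) (dif C a)
              + frag_cmul (psign (deg C a)) (frag_extend (\<lambda>b'. frag_of (a, b')) (dif D b))),
     cop = (\<lambda>(a, b). frag_extend (\<lambda>(a1, a2). frag_extend (\<lambda>(b1, b2).
              frag_cmul (psign (deg C a2 * deg D b1)) (frag_of ((a1, b1), (a2, b2))))
              (cop D b)) (cop C a)),
     gl = (gl C, gl D)\<rparr>"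

text \<open>Bar construction: the words \<open>sx\<^sub>1|\<dots>|sx\<^sub>m\<close> are lists of basis elements other
  than the unit, and \<open>theta A [x\<^sub>1,\<dots>,x\<^sub>j] = j + |x\<^sub>1| + \<dots> + |x\<^sub>j|\<close>, which has the
  parity of the degree of the word. The signs in \<open>bar_dif\<close> are those of the given linear
  part times the Koszul sign for passing the preceding letters.\<close>

definition theta :: "('x, 'z) based_scheme \<Rightarrow> 'x list \<Rightarrow> nat" where
  "theta A xs = (\<Sum>x\<leftarrow>xs. deg A x + 1)"

definition bar_deg :: "('x, 'z) based_scheme \<Rightarrow> 'x list \<Rightarrow> nat" where
  "bar_deg A xs = (\<Sum>x\<leftarrow>xs. deg A x - 1)"

definition bar_dif :: "'x based_algebra \<Rightarrow> 'x list \<Rightarrow> ('x list \<Rightarrow>\<^sub>0 int)" where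
  "bar_dif A w =
     (\<Sum>i<length w. frag_cmul (- psign (theta A (take i w)))
        (frag_extend (\<lambda>x. frag_of (take i w @ x # drop (i + 1) w)) (dif A (w ! i))))
   + (\<Sum>i<length w - 1. frag_cmul (psign (theta A (take (i + 1) w)))
        (frag_extend (\<lambda>x. frag_of (take i w @ x # drop (i + 2) w)) (mul A (w ! i) (w ! (i + 1)))))"

definition bar :: "'x based_algebra \<Rightarrow> 'x list based_coalgebra" where
  "bar A =
    \<lparr>bas = lists (bas A - {unt A}),
     deg = bar_deg A,
     dif = bar_dif A,
     cop = (\<lambda>w. \<Sum>j\<le>length w. frag_of (take j w, drop j w)),
     gl = []\<rparr>"

text \<open>Cobar construction: \<open>s\<^sup>-\<^sup>1c\<^sub>1 \<cdots> s\<^sup>-\<^sup>1c\<^sub>k\<close> is the list \<open>[c\<^sub>1,\<dots>,c\<^sub>k]\<close>.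
  Discarding the terms that contain \<open>gl\<close> turns the coproduct into the reduced one.\<close>

definition cobar_gen_dif :: "'c based_coalgebra \<Rightarrow> 'c \<Rightarrow> ('c list \<Rightarrow>\<^sub>0 int)" where
  "cobar_gen_dif C c =
     - frag_extend (\<lambda>c'. frag_of [c']) (dif C c)
     + frag_extend (\<lambda>(c1, c2). if c1 = gl C \<or> c2 = gl C then 0
                      else frag_cmul (psign (deg C c1)) (frag_of [c1, c2])) (cop C c)"

primrec cobar_dif :: "'c based_coalgebra \<Rightarrow> 'c list \<Rightarrow> ('c list \<Rightarrow>\<^sub>0 int)" where
  "cobar_dif C [] = 0"
| "cobar_dif C (c # w) =
     frag_extend (\<lambda>v. frag_of (v @ w)) (cobar_gen_dif C c)
     + frag_cmul (psign (deg C c + 1)) (frag_extend (\<lambda>v. frag_of (c # v)) (cobar_dif C w))"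

definition cobar :: "'c based_coalgebra \<Rightarrow> 'c list based_algebra" where
  "cobar C =
    \<lparr>bas = lists (bas C - {gl C}),
     deg = (\<lambda>w. \<Sum>c\<leftarrow>w. deg C c + 1),
     dif = cobar_dif C,
     mul = (\<lambda>v w. frag_of (v @ w)),
     unt = []\<rparr>"

text \<open>The counit of the cobar-bar adjunction.\<close>

primrec counit :: "'x based_algebra \<Rightarrow> 'x list list \<Rightarrow> ('x \<Rightarrow>\<^sub>0 int)" where
  "counit A [] = frag_of (unt A)"
| "counit A (w # ws) = (if length w = 1 then frag_extend (mul A (hd w)) (counit A ws) else 0)"

text \<open>Free right module \<open>A \<otimes> C\<close> with \<open>(w \<otimes> c) \<cdot> w' = (-1)\<^bsup>|w'||c|\<^esup> w w' \<otimes> c\<close> and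
  differential the right module derivation determined by \<open>D1 c = D(1 \<otimes> c)\<close>.\<close>

definition right_mult ::
  "('w, 'y) based_algebra_scheme \<Rightarrow> ('c, 'z) based_scheme \<Rightarrow>
   ('w \<times> 'c \<Rightarrow>\<^sub>0 int) \<Rightarrow> ('w \<Rightarrow>\<^sub>0 int) \<Rightarrow> ('w \<times> 'c \<Rightarrow>\<^sub>0 int)" where
  "right_mult A C x y = frag_extend (\<lambda>(w, c). frag_extend (\<lambda>w'.
      frag_cmul (psign (deg A w' * deg C c)) (frag_extend (\<lambda>v. frag_of (v, c)) (mul A w w'))) y) x"

definition free_module ::
  "('w, 'y) based_algebra_scheme \<Rightarrow> ('c, 'z) based_scheme \<Rightarrow> ('c \<Rightarrow> ('w \<times> 'c \<Rightarrow>\<^sub>0 int)) \<Rightarrow>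
   ('w \<times> 'c) based" where
  "free_module A C D1 =
    \<lparr>bas = bas A \<times> bas C,
     deg = (\<lambda>(w, c). deg A w + deg C c),
     dif = (\<lambda>(w, c). frag_cmul (psign (deg A w * deg C c))
              (right_mult A C (D1 c) (frag_of w)
               + frag_cmul (psign (deg C c)) (right_mult A C (frag_of (unt A, c)) (dif A w))))\<rparr>"

definition tensor_id :: "('w \<Rightarrow> ('v \<Rightarrow>\<^sub>0 int)) \<Rightarrow> ('w \<times> 'c \<Rightarrow>\<^sub>0 int) \<Rightarrow> ('v \<times> 'c \<Rightarrow>\<^sub>0 int)" where
  "tensor_id f = frag_extend (\<lambda>(w, c). frag_extend (\<lambda>v. frag_of (v, c)) (f w))"


section \<open>Simplicial sets and normalized cochains\<close>

record 's sset =
  simp :: "nat \<Rightarrow> 's set"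
  face :: "nat \<Rightarrow> nat \<Rightarrow> 's \<Rightarrow> 's"
  degen :: "nat \<Rightarrow> nat \<Rightarrow> 's \<Rightarrow> 's"

definition nondeg :: "'s sset \<Rightarrow> nat \<Rightarrow> 's set" where
  "nondeg K m = simp K m - {degen K k i s | k i s. m = Suc k \<and> i \<le> k \<and> s \<in> simp K k}"

primrec front_face :: "'s sset \<Rightarrow> nat \<Rightarrow> nat \<Rightarrow> 's \<Rightarrow> 's" where
  "front_face K p 0 s = s"
| "front_face K p (Suc q) s = front_face K p q (face K (p + Suc q) (p + Suc q) s)"

primrec back_face :: "'s sset \<Rightarrow> nat \<Rightarrow> nat \<Rightarrow> 's \<Rightarrow> 's" where
  "back_face K 0 q s = s"
| "back_face K (Suc p) q s = back_face K p q (face K (Suc p + q) 0 s)"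

text \<open>Normalized cochains of a reduced simplicial set of finite type, with basis
  \<open>(p, s)\<close> dual to the nondegenerate simplices; the product is the cup product given by
  the Alexander-Whitney coproduct. The unit is the cochain dual to the only vertex.\<close>

definition cochain_algebra :: "'s sset \<Rightarrow> (nat \<times> 's) based_algebra" where
  "cochain_algebra K =
    \<lparr>bas = {(p, s). s \<in> nondeg K p},
     deg = fst,
     dif = (\<lambda>(p, s). \<Sum>t\<in>nondeg K (p + 1). \<Sum>i\<le>p + 1.
              (if face K (p + 1) i t = s then frag_cmul (psign i) (frag_of (p + 1, t)) else 0)),
     mul = (\<lambda>(p, s) (q, t). \<Sum>r\<in>nondeg K (p + q).
              (if front_face K p q r = s \<and> back_face K p q r = t then frag_of (p + q, r) else 0)),
     unt = (0, THE v. v \<in> simp K 0)\<rparr>"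

text \<open>The simplicial sphere \<open>\<Delta>[N]/\<partial>\<Delta>[N]\<close>: an \<open>m\<close>-simplex is either the (degenerate)
  basepoint \<open>None\<close> or a monotone surjection \<open>[m] \<rightarrow> [N]\<close>, listed by its values.\<close>

definition sphere_sset :: "nat \<Rightarrow> nat list option sset" where
  "sphere_sset N =
    \<lparr>simp = (\<lambda>m. insert None (Some ` {xs. length xs = m + 1 \<and> sorted xs \<and> set xs = {0..N}})),
     face = (\<lambda>m i s. case s of None \<Rightarrow> None
              | Some xs \<Rightarrow> (let ys = take i xs @ drop (i + 1) xs
                           in if set ys = {0..N} then Some ys else None)),
     degen = (\<lambda>m i s. map_option (\<lambda>xs. take (i + 1) xs @ drop i xs) s)\<rparr>"

type_synonym letter = "nat \<times> nat list option"

definition sphere_cochains :: "nat \<Rightarrow> letter based_algebra" where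
  "sphere_cochains n = cochain_algebra (sphere_sset (2 * n + 1))"

text \<open>The generator \<open>z\<close> of degree \<open>2n+1\<close>, dual to the nondegenerate \<open>(2n+1)\<close>-simplex.\<close>

definition sphere_gen :: "nat \<Rightarrow> letter" where
  "sphere_gen n = (2 * n + 1, Some [0..<2 * n + 2])"

text \<open>The product of the divided power algebra \<open>\<Gamma>(sz)\<close>: all words are of the form
  \<open>sz(m) = sz|\<dots>|sz\<close>, so concatenation is \<open>sz(a), sz(b) \<mapsto> sz(a + b)\<close>.\<close>

definition sphere_star :: "letter list \<Rightarrow> letter list \<Rightarrow> (letter list \<Rightarrow>\<^sub>0 int)" where
  "sphere_star u v =
     frag_cmul (int ((length u + length v) choose length u)) (frag_of (u @ v))"


section \<open>The path and free loop models\<close>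

text \<open>Below \<open>star\<close> is the product on the bar construction. \<open>left_act A star a b xs\<close> is
  \<open>(s\<^sup>-\<^sup>1(a \<otimes> b) \<otimes> 1)(1 \<otimes> sx\<^sub>1|\<dots>|sx\<^sub>m)\<close>.\<close>

function left_act ::
  "'x based_algebra \<Rightarrow> ('x list \<Rightarrow> 'x list \<Rightarrow> ('x list \<Rightarrow>\<^sub>0 int)) \<Rightarrow> 'x list \<Rightarrow> 'x list \<Rightarrow> 'x list \<Rightarrow>
   (('x list \<times> 'x list) list \<times> 'x list \<Rightarrow>\<^sub>0 int)" where
  "left_act A star a b xs =
     frag_of ([(a, b)], xs)
     + frag_cmul (psign (bar_deg A b * theta A xs))
         (frag_extend (\<lambda>b'. frag_of ([(a, b')], [])) (star xs b)
          - frag_extend (\<lambda>a'. frag_of ([(a', b)], [])) (star a xs))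
     + (\<Sum>j\<in>{1..<length xs}.
          - frag_cmul (psign (bar_deg A b * theta A (take j xs)))
              (frag_extend (\<lambda>a'. left_act A star a' b (drop j xs)) (star a (take j xs)))
          + frag_cmul (psign ((bar_deg A b + theta A (take j xs))
                               * (theta A xs - theta A (take j xs))))
              (frag_extend (\<lambda>b'. frag_of ([(a, b')], take j xs)) (star (drop j xs) b)))"
  by pat_completeness auto
termination
  by (relation "Wellfounded.measure (\<lambda>(A, star, a, b, xs). length xs)") auto

declare left_act.simps [simp del]

definition path_dif ::
  "'x based_algebra \<Rightarrow> ('x list \<Rightarrow> 'x list \<Rightarrow> ('x list \<Rightarrow>\<^sub>0 int)) \<Rightarrow> 'x list \<Rightarrow>
   (('x list \<times> 'x list) list \<times> 'x list \<Rightarrow>\<^sub>0 int)" where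
  "path_dif A star xs =
     frag_extend (\<lambda>c. frag_of ([], c)) (bar_dif A xs)
     + frag_of ([(xs, [])], []) - frag_of ([([], xs)], [])
     + (\<Sum>j\<in>{1..<length xs}.
          left_act A star (take j xs) [] (drop j xs)
          - frag_cmul (psign (theta A (take j xs) * (theta A xs - theta A (take j xs))))
              (frag_of ([([], drop j xs)], take j xs)))"

definition path_model where
  "path_model A star =
     free_module (cobar (tensor_coalgebra (bar A) (bar A))) (bar A) (path_dif A star)"

primrec cobar_star ::
  "('x list \<Rightarrow> 'x list \<Rightarrow> ('x list \<Rightarrow>\<^sub>0 int)) \<Rightarrow> ('x list \<times> 'x list) list \<Rightarrow> ('x list list \<Rightarrow>\<^sub>0 int)" where
  "cobar_star star [] = frag_of []"
| "cobar_star star (p # w) =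
     frag_extend (\<lambda>u. frag_extend (\<lambda>v. frag_of (u # v)) (cobar_star star w)) (star (fst p) (snd p))"

definition loop_dif where
  "loop_dif A star c = tensor_id (cobar_star star) (path_dif A star c)"

definition loop_model where
  "loop_model A star = free_module (cobar (bar A)) (bar A) (loop_dif A star)"

definition thin_model where
  "thin_model A star =
     free_module A (bar A) (\<lambda>c. tensor_id (counit A) (loop_dif A star c))"


section \<open>Cubical cochains\<close>

text \<open>Coordinates are numbered from \<open>0\<close>; points of \<open>I\<^sup>m\<close> are extensional functions
  on \<open>{..<m}\<close>, and singular cubes are extensional functions on \<open>I\<^sup>m\<close>. Cochains vanish on
  degenerate cubes and carry the dimension as an explicit argument.\<close>

type_synonym 'y cube = "(nat \<Rightarrow> real) \<Rightarrow> 'y"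
type_synonym 'y cochain = "nat \<Rightarrow> 'y cube \<Rightarrow> int"

definition std_cube :: "nat \<Rightarrow> (nat \<Rightarrow> real) topology" where
  "std_cube m = product_topology (\<lambda>i. top_of_set {0..1}) {..<m}"

definition singular_cube :: "nat \<Rightarrow> 'y topology \<Rightarrow> 'y cube \<Rightarrow> bool" where
  "singular_cube m Y T \<longleftrightarrow>
     continuous_map (std_cube m) Y T \<and> T \<in> extensional (topspace (std_cube m))"

definition degenerate_cube :: "nat \<Rightarrow> 'y cube \<Rightarrow> bool" where
  "degenerate_cube m T \<longleftrightarrow>
     (\<exists>i<m. \<forall>t\<in>topspace (std_cube m). \<forall>t'\<in>topspace (std_cube m).
        (\<forall>j. j \<noteq> i \<longrightarrow> t j = t' j) \<longrightarrow> T t = T t')"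

text \<open>\<open>subcube m L e T\<close> is \<open>T|\<^bsub>t\<^sub>j = e, j \<notin> L\<^esub>\<close>, a cube of dimension \<open>card L\<close> whose
  coordinates are those in \<open>L\<close>, renumbered in increasing order.\<close>

definition subcube :: "nat \<Rightarrow> nat set \<Rightarrow> real \<Rightarrow> 'y cube \<Rightarrow> 'y cube" where
  "subcube m L e T = (\<lambda>t\<in>topspace (std_cube (card L)).
      T (\<lambda>j\<in>{..<m}. if j \<in> L then t (card (L \<inter> {..<j})) else e))"

definition cube_boundary :: "nat \<Rightarrow> 'y cube \<Rightarrow> ('y cube \<Rightarrow>\<^sub>0 int)" where
  "cube_boundary m T = (\<Sum>i<m. frag_cmul (psign (i + 1))
      (frag_of (subcube m ({..<m} - {i}) 1 T) - frag_of (subcube m ({..<m} - {i}) 0 T)))"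

definition evaluate :: "('y cube \<Rightarrow> int) \<Rightarrow> ('y cube \<Rightarrow>\<^sub>0 int) \<Rightarrow> int" where
  "evaluate f c = (\<Sum>T\<in>Poly_Mapping.keys c. Poly_Mapping.lookup c T * f T)"

definition cube_codiff :: "'y topology \<Rightarrow> 'y cochain \<Rightarrow> 'y cochain" where
  "cube_codiff Y f = (\<lambda>m T. case m of 0 \<Rightarrow> 0
     | Suc k \<Rightarrow> if singular_cube m Y T then evaluate (f k) (cube_boundary m T) else 0)"

definition CU :: "'y topology \<Rightarrow> 'y cochain cochain_complex" where
  "CU Y = \<lparr>comp = (\<lambda>p. {f. \<forall>m T. f m T \<noteq> 0 \<longrightarrow>
                          m = p \<and> singular_cube m Y T \<and> \<not> degenerate_cube m T}),
           diff = cube_codiff Y\<rparr>"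

definition shuffle_sign :: "nat \<Rightarrow> nat set \<Rightarrow> int" where
  "shuffle_sign m L = psign (card {(i, j). i \<in> L \<and> j \<in> {..<m} - L \<and> j < i})"

definition cube_cup :: "'y topology \<Rightarrow> 'y cochain \<Rightarrow> 'y cochain \<Rightarrow> 'y cochain" where
  "cube_cup Y f g = (\<lambda>m T. if singular_cube m Y T
     then \<Sum>L\<in>Pow {..<m}. shuffle_sign m L * f (card L) (subcube m L 0 T)
                              * g (m - card L) (subcube m ({..<m} - L) 1 T)
     else 0)"

definition cube_one :: "'y topology \<Rightarrow> 'y cochain" where
  "cube_one Y = (\<lambda>m T. if m = 0 \<and> singular_cube 0 Y T then 1 else 0)"

definition pullback :: "'y topology \<Rightarrow> ('y \<Rightarrow> 'z) \<Rightarrow> 'z cochain \<Rightarrow> 'y cochain" where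
  "pullback Y h f = (\<lambda>m T. if singular_cube m Y T
     then f m (restrict (h \<circ> T) (topspace (std_cube m))) else 0)"

definition scale :: "int \<Rightarrow> 'y cochain \<Rightarrow> 'y cochain" where
  "scale k f = (\<lambda>m T. k * f m T)"

definition lin_ext :: "('b \<Rightarrow> 'y cochain) \<Rightarrow> ('b \<Rightarrow>\<^sub>0 int) \<Rightarrow> 'y cochain" where
  "lin_ext g x = (\<Sum>b\<in>Poly_Mapping.keys x. scale (Poly_Mapping.lookup x b) (g b))"


section \<open>Path and loop spaces\<close>

definition mapping_space :: "'a topology \<Rightarrow> 'b topology \<Rightarrow> ('a \<Rightarrow> 'b) topology" where
  "mapping_space A B = topology_generated_by
     {{f \<in> extensional (topspace A). continuous_map A B f \<and> f ` C \<subseteq> U} | C U.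
        compactin A C \<and> openin B U}"

definition unit_interval :: "real topology" where
  "unit_interval = top_of_set {0..1}"

definition circle :: "complex topology" where
  "circle = top_of_set (sphere 0 1)"

definition path_space :: "'y topology \<Rightarrow> (real \<Rightarrow> 'y) topology" where
  "path_space X = mapping_space unit_interval X"

definition loop_space :: "'y topology \<Rightarrow> (complex \<Rightarrow> 'y) topology" where
  "loop_space X = mapping_space circle X"

text \<open>The inclusion \<open>j\<close> of loops into paths, the evaluation \<open>e\<close> at the basepoint of the
  circle, the endpoint map \<open>p\<close> and the constant path map \<open>i\<close>.\<close>

definition loop_to_path :: "(complex \<Rightarrow> 'y) \<Rightarrow> (real \<Rightarrow> 'y)" where
  "loop_to_path l = (\<lambda>u\<in>{0..1}. l (cis (2 * pi * u)))"

definition loop_eval :: "(complex \<Rightarrow> 'y) \<Rightarrow> 'y" where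
  "loop_eval l = l 1"

definition endpoints :: "(real \<Rightarrow> 'y) \<Rightarrow> 'y \<times> 'y" where
  "endpoints l = (l 0, l 1)"

definition const_path :: "'y \<Rightarrow> (real \<Rightarrow> 'y)" where
  "const_path x = (\<lambda>u\<in>{0..1}. x)"

definition contract_cube :: "nat \<Rightarrow> (real \<Rightarrow> 'y) cube \<Rightarrow> (real \<Rightarrow> 'y) cube" where
  "contract_cube m T = (\<lambda>t\<in>topspace (std_cube (m + 1)). \<lambda>u\<in>{0..1}.
      T (\<lambda>i\<in>{..<m}. t (i + 1)) (t 0 * u))"

definition J_op :: "'y topology \<Rightarrow> (real \<Rightarrow> 'y) cochain \<Rightarrow> (real \<Rightarrow> 'y) cochain" where
  "J_op X f = (\<lambda>m T. if singular_cube m (path_space X) T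
     then - f (m + 1) (contract_cube m T) else 0)"


section \<open>The maps out of the models\<close>

text \<open>\<open>is_path_map\<close> states the recursion that determines the map out of the path model.
  The argument of \<open>J_op\<close> has to lie in the kernel of restriction to constant paths.\<close>

definition is_path_map where
  "is_path_map A star X \<alpha> \<beta> \<longleftrightarrow>
     \<beta> (frag_of ([], [])) = cube_one (path_space X) \<and>
     (\<forall>c\<in>bas (bar A). bar_deg A c > 0 \<longrightarrow>
        pullback X const_path (\<beta> (path_dif A star c)) = 0 \<and>
        \<beta> (frag_of ([], c)) = J_op X (\<beta> (path_dif A star c))) \<and>
     (\<forall>p. \<forall>x\<in>comp (complex_of (path_model A star)) p.
        \<beta> x = lin_ext (\<lambda>(w, c).
          scale (psign (deg (cobar (tensor_coalgebra (bar A) (bar A))) w * bar_deg A c))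
            (cube_cup (path_space X) (\<beta> (frag_of ([], c)))
               (pullback (path_space X) endpoints (\<alpha> (frag_of w))))) x)"

definition loop_map where
  "loop_map A star X \<beta> \<gamma> = lin_ext (\<lambda>(w, c).
     scale (psign (deg (cobar (bar A)) w * bar_deg A c))
       (cube_cup (loop_space X)
          (if bar_deg A c = 0 then cube_one (loop_space X)
           else pullback (loop_space X) loop_to_path (J_op X (\<beta> (path_dif A star c))))
          (pullback (loop_space X) loop_eval (\<gamma> (frag_of w)))))"

definition is_thin_section where
  "is_thin_section A star \<sigma> \<longleftrightarrow>
     cochain_map (complex_of (thin_model A star)) (complex_of (loop_model A star)) \<sigma> \<and>
     (\<forall>p. \<forall>x\<in>comp (complex_of (thin_model A star)) p. tensor_id (counit A) (\<sigma> x) = x) \<and>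
     (\<forall>c\<in>bas (bar A). length c \<le> 2 \<longrightarrow>
        \<sigma> (frag_of (unt A, c)) = frag_of ([], c) \<and>
        (\<forall>x\<in>bas A - {unt A}. \<sigma> (frag_of (x, c)) = frag_of ([[x]], c)))"

text \<open>The choices \<open>\<alpha>, \<gamma>, \<beta>, \<sigma>\<close> entering a thin free loop model, together with the fact
  that the maps out of the models are quasi-isomorphisms.\<close>

definition thin_loop_data where
  "thin_loop_data A star X \<alpha> \<gamma> \<beta> \<sigma> \<longleftrightarrow>
     (let B2 = cobar (tensor_coalgebra (bar A) (bar A)); B1 = cobar (bar A) in
      quasi_iso (complex_of B2) (CU (prod_topology X X)) \<alpha> \<and>
      coh_algebra_map (complex_of B2) (mult_of B2) (frag_of (unt B2))
        (CU (prod_topology X X)) (cube_cup (prod_topology X X)) (cube_one (prod_topology X X)) \<alpha> \<and>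
      quasi_iso (complex_of B1) (CU X) \<gamma> \<and>
      coh_algebra_map (complex_of B1) (mult_of B1) (frag_of (unt B1))
        (CU X) (cube_cup X) (cube_one X) \<gamma> \<and>
      (\<forall>p. \<forall>x\<in>comp (complex_of B2) p.
         pullback X (\<lambda>x. (x, x)) (\<alpha> x) = \<gamma> (frag_extend (cobar_star star) x)) \<and>
      (\<forall>p. \<forall>x\<in>comp (complex_of B1) p. frag_extend (counit A) x = 0 \<longrightarrow> \<gamma> x = 0) \<and>
      (\<forall>p. \<forall>x\<in>comp (complex_of B1) p.
         \<alpha> (frag_extend (\<lambda>w. frag_of (map (\<lambda>c. (c, [])) w)) x)
           = pullback (prod_topology X X) fst (\<gamma> x) \<and>
         \<alpha> (frag_extend (\<lambda>w. frag_of (map (\<lambda>c. ([], c)) w)) x)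
           = pullback (prod_topology X X) snd (\<gamma> x)) \<and>
      is_path_map A star X \<alpha> \<beta> \<and>
      is_thin_section A star \<sigma> \<and>
      quasi_iso (complex_of (path_model A star)) (CU (path_space X)) \<beta> \<and>
      quasi_iso (complex_of (loop_model A star)) (CU (loop_space X)) (loop_map A star X \<beta> \<gamma>) \<and>
      quasi_iso (complex_of (thin_model A star)) (complex_of (loop_model A star)) \<sigma>)"

definition Upsilon where
  "Upsilon A star X \<gamma> \<beta> \<sigma> = (\<lambda>x. loop_map A star X \<beta> \<gamma> (\<sigma> x))"


section \<open>Homotopy orbit complexes\<close>

definition rotate_loop :: "complex \<Rightarrow> (complex \<Rightarrow> 'y) \<Rightarrow> (complex \<Rightarrow> 'y)" where
  "rotate_loop w l = (\<lambda>u\<in>sphere 0 1. l (w * u))"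

definition act_cube :: "nat \<Rightarrow> complex cube \<Rightarrow> nat \<Rightarrow> (complex \<Rightarrow> 'y) cube \<Rightarrow> (complex \<Rightarrow> 'y) cube" where
  "act_cube a U m V = (\<lambda>t\<in>topspace (std_cube (a + m)).
      rotate_loop (U (\<lambda>i\<in>{..<a}. t i)) (V (\<lambda>i\<in>{..<m}. t (a + i))))"

inductive rot_family :: "nat \<Rightarrow> ((nat \<Rightarrow> real) \<Rightarrow> real) \<Rightarrow> bool" where
  "rot_family 0 (\<lambda>t. t 0)"
| "rot_family l g \<Longrightarrow> rot_family m h \<Longrightarrow>
     rot_family (l + m + 1) (\<lambda>t. t 0 * (g (\<lambda>i. t (i + 1)) + h (\<lambda>i. t (2 * l + 2 + i))))"

definition rot_chain :: "nat \<Rightarrow> (complex cube \<Rightarrow>\<^sub>0 int)" where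
  "rot_chain k = (\<Sum>f\<in>{f. rot_family k f}.
      frag_of (\<lambda>t\<in>topspace (std_cube (2 * k + 1)). cis (2 * pi * f t)))"

definition omega_op ::
  "'y topology \<Rightarrow> nat \<Rightarrow> (complex \<Rightarrow> 'y) cochain \<Rightarrow> (complex \<Rightarrow> 'y) cochain" where
  "omega_op X k f = (\<lambda>m V. if singular_cube m (loop_space X) V
     then evaluate (f (2 * k + 1 + m))
            (frag_extend (\<lambda>U. frag_of (act_cube (2 * k + 1) U m V)) (rot_chain k))
     else 0)"

text \<open>An element \<open>\<Sum>\<^sub>k \<upsilon>\<^sup>k \<otimes> F k\<close> of \<open>\<Lambda>\<upsilon> \<otimes> CU\<^sup>*\<L>X\<close> is represented by its
  coefficient sequence \<open>F\<close>; in each degree only finitely many coefficients are nonzero.\<close>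

definition orbit_cochains :: "'y topology \<Rightarrow> (nat \<Rightarrow> (complex \<Rightarrow> 'y) cochain) cochain_complex" where
  "orbit_cochains X =
    \<lparr>comp = (\<lambda>p. {F. \<forall>k. F k \<in> (if 2 * k \<le> p then comp (CU (loop_space X)) (p - 2 * k) else {0})}),
     diff = (\<lambda>F r. cube_codiff (loop_space X) (F r)
                   + (\<Sum>(m, k)\<in>{(m, k). m + k + 1 = r}. omega_op X k (F m)))\<rparr>"

text \<open>The operator \<open>S\<close>; the sign is the Koszul sign of moving \<open>sx\<^sub>j|\<dots>|sx\<^sub>m\<close> to the
  front of \<open>sy\<close> and \<open>sx\<^sub>1|\<dots>|sx\<^bsub>j-1\<^esub>\<close>.\<close>

definition S_op :: "'x based_algebra \<Rightarrow> 'x \<times> 'x list \<Rightarrow> ('x \<times> 'x list \<Rightarrow>\<^sub>0 int)" where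
  "S_op A = (\<lambda>(y, c). if y = unt A then 0 else
     (\<Sum>j\<le>length c. frag_cmul (psign (theta A (drop j c) * theta A (y # take j c)))
        (frag_of (unt A, drop j c @ y # take j c))))"

text \<open>The basis element \<open>\<upsilon>\<^sup>k \<otimes> y \<otimes> c\<close> is the triple \<open>(k, y, c)\<close>.\<close>

definition orbit_model ::
  "'x based_algebra \<Rightarrow> ('x list \<Rightarrow> 'x list \<Rightarrow> ('x list \<Rightarrow>\<^sub>0 int)) \<Rightarrow> (nat \<times> 'x \<times> 'x list) based" where
  "orbit_model A star =
    \<lparr>bas = UNIV \<times> bas (thin_model A star),
     deg = (\<lambda>(k, b). 2 * k + deg (thin_model A star) b),
     dif = (\<lambda>(k, b). frag_extend (\<lambda>b'. frag_of (k, b')) (dif (thin_model A star) b)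
                     + frag_extend (\<lambda>b'. frag_of (k + 1, b')) (S_op A b))\<rparr>"

definition orbit_model_proj :: "(nat \<times> 'b \<Rightarrow>\<^sub>0 int) \<Rightarrow> ('b \<Rightarrow>\<^sub>0 int)" where
  "orbit_model_proj = frag_extend (\<lambda>(k, b). if k = 0 then frag_of b else 0)"

definition orbit_cochains_proj :: "(nat \<Rightarrow> 'f) \<Rightarrow> 'f" where
  "orbit_cochains_proj F = F 0"

definition upsilon_power :: "'y topology \<Rightarrow> nat \<Rightarrow> (nat \<Rightarrow> (complex \<Rightarrow> 'y) cochain)" where
  "upsilon_power X k = (\<lambda>r. if r = k then cube_one (loop_space X) else 0)"


section \<open>The model of the sphere\<close>

text \<open>The facts below identify the objects attached to the simplicial sphere: it has two
  nondegenerate simplices, its cochain algebra is \<open>\<Lambda>z\<close>, the differential of the thin model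
  vanishes, and \<open>S(z \<otimes> sz(m)) = (m+1) 1 \<otimes> sz(m+1)\<close>.\<close>

lemma sorted_adjacent_eq: "sorted (xs::nat list) \<Longrightarrow> \<not> distinct xs \<Longrightarrow> \<exists>i. Suc i < length xs \<and> xs ! i = xs ! Suc i"
proof (induction xs)
  case (Cons x xs)
  show ?case
  proof (cases "distinct xs")
    case True
    then have "x \<in> set xs" using Cons by auto
    then obtain y ys where xs: "xs = y # ys" by (cases xs) auto
    then have "x = y" using Cons.prems(1) \<open>x \<in> set xs\<close> by (auto intro: antisym)
    then show ?thesis using xs by (intro exI[of _ 0]) auto
  next
    case False
    then obtain i where "Suc i < length xs \<and> xs ! i = xs ! Suc i" using Cons by auto
    then show ?thesis by (intro exI[of _ "Suc i"]) auto
  qed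
qed auto

lemma degen_decompose:
  assumes "Suc i < length xs" "xs ! i = xs ! Suc i"
  defines "ys \<equiv> take (i+1) xs @ drop (i+2) xs"
  shows "xs = take (i+1) ys @ drop i ys" "length ys = length xs - 1" "set ys = set xs"
    "sorted xs \<Longrightarrow> sorted ys"
proof -
  have d: "drop i xs = xs ! i # xs ! i # drop (i+2) xs"
    using assms by (metis Cons_nth_drop_Suc Suc_lessD add_2_eq_Suc')
  have x: "xs = take i xs @ xs ! i # xs ! i # drop (i+2) xs"
    by (metis append_take_drop_id d)
  have y: "ys = take i xs @ xs ! i # drop (i+2) xs"
    using assms(1) by (simp add: ys_def take_Suc_conv_app_nth)
  have l: "length (take i xs) = i" using assms by simp
  show "xs = take (i+1) ys @ drop i ys"
    by (subst x, simp add: y l min_absorb2[OF less_imp_le[OF Suc_lessD[OF assms(1)]]])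
  show "length ys = length xs - 1" using assms by (simp add: y)
  show "set ys = set xs" using arg_cong[OF x, of set] by (simp add: y)
  assume "sorted xs"
  then have "sorted (take i xs @ xs ! i # xs ! i # drop (i+2) xs)" using x by simp
  then show "sorted ys" unfolding y by (auto simp: sorted_append)
qed

lemma nondeg_sphere:
  assumes "N > 0"
  shows "nondeg (sphere_sset N) p =
    (if p = 0 then {None} else if p = N then {Some [0..<N + 1]} else {})"
proof -
  have dist: "xs = [0..<N+1]" if "sorted xs" "set xs = {0..N}" "distinct xs" for xs
    using that by (metis Suc_eq_plus1 atLeastLessThanSuc_atLeastAtMost distinct_upt set_upt sorted_distinct_set_unique sorted_upt)
  have nondist: "\<not> distinct (take (i+1) ys @ drop i ys)" if "i < length ys" for i and ys :: "nat list"
  proof -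
    have "ys ! i \<in> set (take (i+1) ys)" using that by (auto simp: take_Suc_conv_app_nth)
    moreover have "ys ! i \<in> set (drop i ys)" using that by (metis Cons_nth_drop_Suc list.set_intros(1))
    ultimately show ?thesis by auto
  qed
  have len0: "\<not> (length xs = 1 \<and> set xs = {0..N})" for xs
  proof
    assume "length xs = 1 \<and> set xs = {0..N}"
    then have "card {0..N} \<le> 1" by (metis card_length)
    then show False using assms by simp
  qed
  show ?thesis
  proof (cases p)
    case 0
    then show ?thesis using len0 by (auto simp: nondeg_def sphere_sset_def)
  next
    case (Suc k)
    have none: "None \<notin> nondeg (sphere_sset N) p"
      using Suc by (force simp: nondeg_def sphere_sset_def)
    have some: "Some xs \<in> nondeg (sphere_sset N) p \<longleftrightarrow> p = N \<and> xs = [0..<N+1]" for xs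
    proof
      assume a: "Some xs \<in> nondeg (sphere_sset N) p"
      then have s: "length xs = p + 1" "sorted xs" "set xs = {0..N}"
        by (auto simp: nondeg_def sphere_sset_def)
      have "distinct xs"
      proof (rule ccontr)
        assume "\<not> distinct xs"
        then obtain i where i: "Suc i < length xs" "xs ! i = xs ! Suc i" using sorted_adjacent_eq s by blast
        define ys where "ys = take (i+1) xs @ drop (i+2) xs"
        note dd = degen_decompose[OF i, folded ys_def]
        have "Some ys \<in> simp (sphere_sset N) k" using dd s Suc
          by (auto simp: sphere_sset_def)
        moreover have "Some xs = degen (sphere_sset N) k i (Some ys)"
          using dd(1) by (simp add: sphere_sset_def)
        moreover have "i \<le> k" using i s Suc by simp
        ultimately show False using a Suc unfolding nondeg_def by blast
      qed
      then have "xs = [0..<N+1]" using dist s by blast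
      then show "p = N \<and> xs = [0..<N+1]" using s by simp
    next
      assume a: "p = N \<and> xs = [0..<N+1]"
      have "Some xs \<in> simp (sphere_sset N) p" using a by (auto simp: sphere_sset_def simp del: upt_Suc)
      moreover have "Some xs \<noteq> degen (sphere_sset N) k i s" if "s \<in> simp (sphere_sset N) k" "i \<le> k" for i s
      proof (cases s)
        case None then show ?thesis by (simp add: sphere_sset_def)
      next
        case (Some ys)
        then have "i < length ys" using that by (auto simp: sphere_sset_def)
        from nondist[OF this] have "[0..<N+1] \<noteq> take (i+1) ys @ drop i ys" by (metis distinct_upt)
        then show ?thesis using Some a by (simp add: sphere_sset_def del: upt_Suc)
      qed
      ultimately show "Some xs \<in> nondeg (sphere_sset N) p"
        using Suc unfolding nondeg_def by blast
    qed
    show ?thesis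
    proof (rule Set.set_eqI)
      fix s show "s \<in> nondeg (sphere_sset N) p \<longleftrightarrow> s \<in> (if p = 0 then {None} else if p = N then {Some [0..<N + 1]} else {})"
        using none some Suc by (cases s) auto
    qed
  qed
qed

lemma sphere_cochains_unt: "n>0 \<Longrightarrow> unt (sphere_cochains n) = (0, None)"
proof -
  assume n: "n>0"
  have "simp (sphere_sset (2*n+1)) 0 = {None}"
  proof -
    have "\<not> (length xs = 1 \<and> set xs = {0..2*n+1})" for xs
    proof
      assume "length xs = 1 \<and> set xs = {0..2*n+1}"
      then have "card {0..2*n+1} \<le> 1" by (metis card_length)
      then show False by simp
    qed
    then show ?thesis by (auto simp: sphere_sset_def)
  qed
  then show ?thesis by (simp add: sphere_cochains_def cochain_algebra_def)
qed

lemma sphere_cochains_bas: "bas (sphere_cochains n) = {(0, None), sphere_gen n}"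
  by (auto simp: sphere_cochains_def cochain_algebra_def nondeg_sphere sphere_gen_def simp del: upt_Suc split: if_splits)

lemma sphere_cochains_deg: "deg (sphere_cochains n) = fst"
  by (simp add: sphere_cochains_def cochain_algebra_def)

lemma sphere_cochains_dif: "n > 0 \<Longrightarrow> dif (sphere_cochains n) (sphere_gen n) = 0 \<and> dif (sphere_cochains n) (0,None) = 0"
  by (auto simp: sphere_cochains_def cochain_algebra_def nondeg_sphere sphere_gen_def simp del: upt_Suc)

lemma front_face_None: "front_face (sphere_sset N) p q None = None" 
  by (induction q) (auto simp: sphere_sset_def)
lemma back_face_None: "back_face (sphere_sset N) p q None = None" 
  by (induction p) (auto simp: sphere_sset_def)


lemma sphere_cochains_mul:
  assumes "n > 0"
  shows "mul (sphere_cochains n) (0,None) (0,None) = frag_of (0,None)"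
   "mul (sphere_cochains n) (0,None) (sphere_gen n) = frag_of (sphere_gen n)"
   "mul (sphere_cochains n) (sphere_gen n) (0,None) = frag_of (sphere_gen n)"
   "mul (sphere_cochains n) (sphere_gen n) (sphere_gen n) = 0"
proof -
  let ?N = "2*n+1" let ?K = "sphere_sset ?N" let ?x = "Some [0..<?N+1]"
  have "set (take ?N [0..<?N+1] @ drop (?N+1) [0..<?N+1]) \<noteq> {0..?N}"
  proof
    assume a: "set (take ?N [0..<?N+1] @ drop (?N+1) [0..<?N+1]) = {0..?N}"
    have "set (take ?N [0..<?N+1] @ drop (?N+1) [0..<?N+1]) = {0..<?N}" by (simp add: take_upt drop_upt del: upt_Suc)
    then show False using a by auto
  qed
  then have f1: "face ?K m ?N ?x = None" for m by (simp add: sphere_sset_def Let_def del: upt_Suc)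
  have "set (take 0 [0..<?N+1] @ drop 1 [0..<?N+1]) \<noteq> {0..?N}" 
  proof
    assume a: "set (take 0 [0..<?N+1] @ drop 1 [0..<?N+1]) = {0..?N}"
    have "set (take 0 [0..<?N+1] @ drop 1 [0..<?N+1]) = {1..<?N+1}" by (simp add: take_upt drop_upt del: upt_Suc)
    then show False using a by (metis atLeastAtMost_iff atLeastLessThan_iff le0 not_one_le_zero)
  qed
  then have f2: "face ?K m 0 ?x = None" for m by (simp add: sphere_sset_def Let_def del: upt_Suc)
  have ff: "front_face ?K 0 ?N ?x = None" using f1 front_face_None by (simp del: upt_Suc)
  have bf: "back_face ?K ?N 0 ?x = None" using f2 back_face_None by (simp del: upt_Suc)
  show "mul (sphere_cochains n) (0,None) (0,None) = frag_of (0,None)"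
    by (simp add: sphere_cochains_def cochain_algebra_def nondeg_sphere)
  show "mul (sphere_cochains n) (0,None) (sphere_gen n) = frag_of (sphere_gen n)"
    using ff by (simp add: sphere_cochains_def cochain_algebra_def nondeg_sphere sphere_gen_def del: upt_Suc front_face.simps)
  show "mul (sphere_cochains n) (sphere_gen n) (0,None) = frag_of (sphere_gen n)"
    using bf by (simp add: sphere_cochains_def cochain_algebra_def nondeg_sphere sphere_gen_def del: upt_Suc back_face.simps)
  show "mul (sphere_cochains n) (sphere_gen n) (sphere_gen n) = 0"
    by (simp add: sphere_cochains_def cochain_algebra_def nondeg_sphere sphere_gen_def del: upt_Suc front_face.simps back_face.simps)
qed

abbreviation "sz n m \<equiv> replicate m (sphere_gen n)"

lemma degrees_sz: "bar_deg (sphere_cochains n) (sz n m) = 2*n*m" "theta (sphere_cochains n) (sz n m) = (2*n+2)*m"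
  by (auto simp: bar_deg_def theta_def sphere_cochains_deg sphere_gen_def sum_list_replicate)

lemma psign_even [simp]: "even k \<Longrightarrow> psign k = 1" by (simp add: psign_def)

lemma S_op_sphere: "n>0 \<Longrightarrow> S_op (sphere_cochains n) (sphere_gen n, sz n m) = frag_cmul (int (m+1)) (frag_of (unt (sphere_cochains n), sz n (m+1)))"
proof -
  assume n: "n>0"
  have "(sphere_gen n # take j (sz n m)) = sz n (Suc (min j m))" for j by (simp add: min.commute)
  moreover have "sz n a @ sz n (Suc b) = sz n (Suc (a+b))" for a b by (metis add_Suc_right replicate_add)
  moreover have "even (theta (sphere_cochains n) (sz n k))" for k by (simp add: degrees_sz)
  ultimately have *: "(frag_cmul (psign (theta (sphere_cochains n) (drop j (sz n m)) * theta (sphere_cochains n) (sphere_gen n # take j (sz n m))))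
        (frag_of (unt (sphere_cochains n), drop j (sz n m) @ sphere_gen n # take j (sz n m)))) =
     frag_of (unt (sphere_cochains n), sz n (m+1))" if "j \<le> m" for j
    using that by (simp del: replicate_Suc take_replicate add: drop_replicate take_replicate[symmetric])
  have nz: "sphere_gen n \<noteq> unt (sphere_cochains n)" using n by (simp add: sphere_cochains_unt sphere_gen_def)
  have sm: "(\<Sum>j\<le>k. x) = frag_cmul (int (Suc k)) x" for x :: "'z \<Rightarrow>\<^sub>0 int" and k
  proof (induction k)
    case (Suc k)
    have "frag_cmul (int (Suc (Suc k))) x = frag_cmul (int (Suc k)) x + frag_cmul 1 x"
      by (subst frag_cmul_distrib[symmetric]) simp
    then show ?case using Suc by simp
  qed simp
  have "S_op (sphere_cochains n) (sphere_gen n, sz n m) = (\<Sum>j\<le>m. frag_of (unt (sphere_cochains n), sz n (m+1)))"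
    unfolding S_op_def using nz by (simp add: * del: take_replicate drop_replicate replicate_Suc)
  then show ?thesis unfolding sm by simp
qed

lemma tensor_id_add: "tensor_id f (x+y) = tensor_id f x + tensor_id f y" by (simp add: tensor_id_def frag_extend_add)
lemma tensor_id_diff: "tensor_id f (x-y) = tensor_id f x - tensor_id f y" by (simp add: tensor_id_def frag_extend_diff)
lemma tensor_id_minus: "tensor_id f (-y) = - tensor_id f y" by (simp add: tensor_id_def frag_extend_minus)
lemma tensor_id_cmul: "tensor_id f (frag_cmul k y) = frag_cmul k (tensor_id f y)" by (simp add: tensor_id_def frag_extend_cmul)
lemma tensor_id_sum: "tensor_id f (sum g I) = (\<Sum>i\<in>I. tensor_id f (g i))" by (induction I rule: infinite_finite_induct) (auto simp: tensor_id_add, simp_all add: tensor_id_def)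

lemma sphere_star_sz: "sphere_star (sz n a) (sz n b) = frag_cmul (int ((a+b) choose a)) (frag_of (sz n (a+b)))"
  by (simp add: sphere_star_def replicate_add)

lemma tensor_id_pair: "tensor_id (cobar_star sphere_star) (frag_of ([(sz n a, sz n b)], c)) = frag_cmul (int ((a+b) choose a)) (frag_of ([sz n (a+b)], c))"
  by (simp add: tensor_id_def sphere_star_sz frag_extend_cmul)

lemma choose_trinomial: "int ((b + c) choose b) * int ((a+(b + c)) choose a) = int ((a+b) choose a) * int ((a+b + c) choose c)"
proof -
  have "(b + c choose b) * (a+(b + c) choose a) = (a+b choose a) * (a+b + c choose c)"
    using choose_mult[of a "a+b" "a+b + c"] 
    by (metis (no_types, lifting) add.assoc add.commute add_diff_cancel_left' binomial_symmetric le_add1 mult.commute)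
  then show ?thesis by (metis of_nat_mult)
qed

lemma left_act_sphere: "n>0 \<Longrightarrow> tensor_id (cobar_star sphere_star) (left_act (sphere_cochains n) sphere_star (sz n a) (sz n b) (sz n c))
   = frag_cmul (int ((a+b) choose a)) (frag_of ([sz n (a+b)], sz n c))"
proof (induction c arbitrary: a b rule: less_induct)
  case (less c)
  let ?M = "\<lambda>j. frag_cmul (int ((a+b) choose a) * int ((a+b+j) choose j)) (frag_of ([sz n (a+b+j)], sz n (c-j)))"
  have t: "tensor_id (cobar_star sphere_star) (frag_extend (\<lambda>a'. left_act (sphere_cochains n) sphere_star a' (sz n b) (drop j (sz n c))) (sphere_star (sz n a) (take j (sz n c)))) 
      = ?M j" if "j \<in> {1..<c}" for j
  proof -
    have "tensor_id (cobar_star sphere_star) (frag_extend (\<lambda>a'. left_act (sphere_cochains n) sphere_star a' (sz n b) (drop j (sz n c))) (sphere_star (sz n a) (take j (sz n c)))) 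
     = frag_cmul (int ((a+j) choose a)) (frag_cmul (int ((a+j+b) choose (a+j))) (frag_of ([sz n (a+j+b)], sz n (c-j))))"
      using that less by (simp add: sphere_star_sz frag_extend_cmul tensor_id_cmul min_absorb2 drop_replicate)
    moreover have "int ((a+j) choose a) * int ((a+j+b) choose (a+j)) = int ((a+b) choose a) * int ((a+b+j) choose j)"
      using choose_trinomial[of j b a] choose_trinomial[of b j a] by (metis (no_types, opaque_lifting) add.assoc add.commute binomial_symmetric add_diff_cancel_left' le_add1 mult.commute)
    ultimately show ?thesis by (simp add: ac_simps)
  qed
  have u: "tensor_id (cobar_star sphere_star) (frag_extend (\<lambda>b'. frag_of ([(sz n a, b')], take j (sz n c))) (sphere_star (drop j (sz n c)) (sz n b)))
     = ?M (c - j)" if "j \<in> {1..<c}" for j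
  proof -
    have "tensor_id (cobar_star sphere_star) (frag_extend (\<lambda>b'. frag_of ([(sz n a, b')], take j (sz n c))) (sphere_star (drop j (sz n c)) (sz n b)))
      = frag_cmul (int ((c-j+b) choose (c-j)) * int ((a+(c-j+b)) choose a)) (frag_of ([sz n (a+(c-j+b))], sz n j))"
      using that by (simp add: sphere_star_sz frag_extend_cmul tensor_id_cmul min_absorb2 drop_replicate tensor_id_pair)
    moreover have "int ((c-j+b) choose (c-j)) * int ((a+(c-j+b)) choose a) = int ((a+b) choose a) * int ((a+b+(c-j)) choose (c-j))"
      using choose_trinomial[of b "c-j" a] by (metis (no_types, opaque_lifting) add.commute binomial_symmetric add_diff_cancel_left' le_add1)
    ultimately show ?thesis using that by (simp add: ac_simps)
  qed
  have 0: "tensor_id (cobar_star sphere_star) (frag_extend (\<lambda>b'. frag_of ([(sz n a, b')], [])) (sphere_star (sz n c) (sz n b)))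
     = tensor_id (cobar_star sphere_star) (frag_extend (\<lambda>a'. frag_of ([(a', sz n b)], [])) (sphere_star (sz n a) (sz n c)))"
  proof -
    have "int ((c+b) choose c) * int ((a+(c+b)) choose a) = int ((a + c) choose a) * int ((a + c+b) choose (a + c))"
      using choose_trinomial[of c b a] by (metis (no_types, opaque_lifting) add.commute binomial_symmetric add_diff_cancel_left' le_add1)
    then show ?thesis
      by (simp add: sphere_star_sz frag_extend_cmul tensor_id_cmul tensor_id_pair ac_simps)
  qed
  have ev: "even (bar_deg (sphere_cochains n) (sz n b))" "even (theta (sphere_cochains n) (sz n k))" for k by (simp_all add: degrees_sz)
  have "(\<Sum>j\<in>{1..<c}. - ?M j + ?M (c - j)) = 0"
  proof -
    have "(\<Sum>j\<in>{1..<c}. ?M (c - j)) = (\<Sum>j\<in>{1..<c}. ?M j)"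
      by (rule sum.reindex_bij_witness[of _ "\<lambda>j. c - j" "\<lambda>j. c - j"]) auto
    then show ?thesis unfolding sum.distrib sum_negf by simp
  qed
  then have s0: "(\<Sum>j\<in>{1..<c}. tensor_id (cobar_star sphere_star) (
          - frag_cmul (psign (bar_deg (sphere_cochains n) (sz n b) * theta (sphere_cochains n) (take j (sz n c))))
              (frag_extend (\<lambda>a'. left_act (sphere_cochains n) sphere_star a' (sz n b) (drop j (sz n c))) (sphere_star (sz n a) (take j (sz n c))))
          + frag_cmul (psign ((bar_deg (sphere_cochains n) (sz n b) + theta (sphere_cochains n) (take j (sz n c)))
                               * (theta (sphere_cochains n) (sz n c) - theta (sphere_cochains n) (take j (sz n c)))))
              (frag_extend (\<lambda>b'. frag_of ([(sz n a, b')], take j (sz n c))) (sphere_star (drop j (sz n c)) (sz n b))))) = 0"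
    (is "(\<Sum>j\<in>_. ?T j) = 0")
  proof -
    have "?T j = - ?M j + ?M (c - j)" if "j \<in> {1..<c}" for j
    proof -
      have p: "psign (bar_deg (sphere_cochains n) (sz n b) * k) = 1" for k using ev by simp
      have "even (theta (sphere_cochains n) (take j (sz n c)))" using ev by simp
      then have q: "psign ((bar_deg (sphere_cochains n) (sz n b) + theta (sphere_cochains n) (take j (sz n c))) * k) = 1" for k 
        using ev by (intro psign_even) (simp del: take_replicate)
      show ?thesis unfolding tensor_id_add tensor_id_minus p q frag_cmul_one using t[OF that] u[OF that] by simp
    qed
    then have "(\<Sum>j\<in>{1..<c}. ?T j) = (\<Sum>j\<in>{1..<c}. - ?M j + ?M (c - j))" by (rule sum.cong[OF refl])
    then show ?thesis using \<open>(\<Sum>j\<in>{1..<c}. - ?M j + ?M (c - j)) = 0\<close> by argo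
  qed
  show ?case
    by (subst left_act.simps, unfold length_replicate tensor_id_add tensor_id_sum s0[unfolded tensor_id_add]) (simp add: tensor_id_add tensor_id_cmul tensor_id_diff 0 tensor_id_pair ev)
qed

lemma bar_dif_sphere: assumes n: "n>0" shows "bar_dif (sphere_cochains n) (sz n m) = 0"
  using sphere_cochains_mul(4)[OF n] sphere_cochains_dif[OF n] by (simp add: bar_dif_def)

lemma loop_dif_zero: assumes n: "n>0" shows "loop_dif (sphere_cochains n) sphere_star (sz n m) = 0"
proof -
  let ?M = "\<lambda>j. frag_of ([sz n j], sz n (m - j))"
  have ev: "even (theta (sphere_cochains n) (sz n k))" for k by (simp add: degrees_sz)
  have "(\<Sum>j\<in>{1..<m}. ?M j - ?M (m - j)) = 0"
  proof -
    have "(\<Sum>j\<in>{1..<m}. ?M (m - j)) = (\<Sum>j\<in>{1..<m}. ?M j)"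
      by (rule sum.reindex_bij_witness[of _ "\<lambda>j. m - j" "\<lambda>j. m - j"]) auto
    then show ?thesis unfolding sum_subtractf by simp
  qed
  moreover have "tensor_id (cobar_star sphere_star) (left_act (sphere_cochains n) sphere_star (take j (sz n m)) [] (drop j (sz n m))
          - frag_cmul (psign (theta (sphere_cochains n) (take j (sz n m)) * (theta (sphere_cochains n) (sz n m) - theta (sphere_cochains n) (take j (sz n m)))))
              (frag_of ([([], drop j (sz n m))], take j (sz n m)))) = ?M j - ?M (m - j)" (is "?T j = _") if "j \<in> {1..<m}" for j
  proof -
    have t: "take j (sz n m) = sz n j" "drop j (sz n m) = sz n (m - j)" using that by (auto simp: min_absorb2 min_def)
    have p: "psign (theta (sphere_cochains n) (sz n j) * k) = 1" for k using ev by simp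
    show ?thesis unfolding t p tensor_id_diff using left_act_sphere[OF n, of j 0 "m-j"] tensor_id_pair[of 0 n "m-j" "sz n j"] that
      by simp
  qed
  then have "(\<Sum>j\<in>{1..<m}. ?T j) = (\<Sum>j\<in>{1..<m}. ?M j - ?M (m - j))" by (rule sum.cong[OF refl])
  ultimately have "(\<Sum>j\<in>{1..<m}. ?T j) = 0" by argo
  then show ?thesis
    unfolding loop_dif_def path_dif_def tensor_id_add tensor_id_diff[of _ "_ + _"] tensor_id_sum 
    using tensor_id_pair[of m n 0 "[]"] tensor_id_pair[of 0 n m "[]"] by (simp add: bar_dif_sphere[OF n] tensor_id_diff tensor_id_add) (simp add: tensor_id_def sphere_star_def)
qed

lemma thin_dif_zero: assumes n: "n>0" and b: "b \<in> bas (thin_model (sphere_cochains n) sphere_star)"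
 shows "dif (thin_model (sphere_cochains n) sphere_star) b = 0"
proof -
  obtain y c where bb: "b = (y,c)" "y \<in> bas (sphere_cochains n)" "c \<in> bas (bar (sphere_cochains n))"
    using b by (cases b) (auto simp: thin_model_def free_module_def)
  have "set c \<subseteq> {sphere_gen n}" using bb(3) sphere_cochains_unt[OF n] sphere_cochains_bas[of n] by (auto simp: bar_def)
  then have "c = sz n (length c)" by (intro replicate_eqI) auto
  then have l: "loop_dif (sphere_cochains n) sphere_star c = 0" using loop_dif_zero[OF n] by metis
  have "dif (sphere_cochains n) y = 0" using bb sphere_cochains_dif[OF n] sphere_cochains_bas by auto
  then show ?thesis using l by (simp add: bb thin_model_def free_module_def right_mult_def tensor_id_def)
qed

end

theory Submission
 imports Defs "HOL-Algebra.Exponent"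
begin

text \<open>
 The thin model gives classes \<open>a\<^sub>m\<close> and \<open>b\<^sub>m = a\<^sub>m e\<^sup>*c\<close>, freely spanning the cohomology of the free loop space of \<open>X\<close>, the sphere of dimension \<open>2n+1\<close>.
 On \<open>X \<times> X\<close> the cochains \<open>G\<^sub>s = \<Sum>r\<le>s. (-1)^(r+1) \<alpha>[sz(r)|sz(s-r)]\<close> vanish on the diagonal and satisfy \<open>dG = - G G\<close>, and
 \<open>a\<^sub>m\<close> is minus the integral of \<open>G\<^sub>m\<close> along the loop. A homotopy from the diagonal to interleaved cubes
 produces a second solution of the equation linearised at \<open>G\<close>, besides \<open>s G\<^sub>s\<close>, with the same first term; comparing the two,
 \<open>a\<^sub>i a\<^sub>j \<sim> (i+j choose i) a\<^sub>i\<^sub>+\<^sub>j\<close> and hence \<open>\<omega>\<^sub>0 b\<^sub>m \<sim> (m+1) a\<^sub>m\<^sub>+\<^sub>1\<close>.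

 The chains \<open>T\<^sub>k\<close> are primitive, so the orbit cochains form a differential graded algebra. The \<open>N\<close> for which \<open>N a\<^sub>m\<close> lifts to a
 cocycle \<open>A\<close> with \<open>m \<upsilon> A\<close> exact form an ideal that contains \<open>m\<close>; products of lifts for smaller \<open>m\<close> show that it is not
 contained in \<open>p\<int>\<close> for any prime divisor \<open>p\<close> of \<open>m\<close>. So there are \<open>A\<^sub>m\<close>, \<open>B\<^sub>m\<close> over \<open>a\<^sub>m\<close>, \<open>b\<^sub>m\<close> with \<open>D A\<^sub>m = 0\<close> and \<open>D B\<^sub>m = (m+1) \<upsilon> A\<^sub>m\<^sub>+\<^sub>1\<close>, which
 defines the map; it is a quasi-isomorphism because it is one modulo \<open>\<upsilon>\<close>.\<close>

text \<open>Two obstacles shape the argument, both integral. The data determine the loop classes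
  only through the recursion for the path model, so \<open>G\<close> is found by inverting that
  recursion binomially; its equation is then the vanishing of the squared differential of the path
  model, and every later relation is proved for cochains. Both \<open>s G\<close> and the second
  solution are tangent vectors at \<open>G\<close>: the first is the derivative of rescaling by
  weight, the second transports \<open>G 1\<close> along \<open>G\<close>. They differ by a gauge
  term, which integration along the loop does not see. Free cohomology of the loop space then
  permits division.

  The orbit complex does have torsion. An extension of \<open>a m\<close> to a cocycle always
  exists, because odd cocycles are exact, but it is ambiguous by multiples of \<upsilon>, and
  \<open>m\<close> \<upsilon> times it need not be exact. The ambiguity lies in lower degrees, where
  everything except the powers of \<upsilon> is annihilated by \<upsilon> times a common multiple of
  \<open>1, ..., m - 1\<close>. Evaluation at a constant loop removes the powers of \<upsilon>. The
  hard case is \<open>m\<close> a power of \<open>p\<close>, where all proper binomial coefficients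
  are divisible by \<open>p\<close>.\<close>

abbreviation "codiff \<equiv> cube_codiff"
abbreviation "cup \<equiv> cube_cup"
abbreviation "singular \<equiv> singular_cube"
abbreviation "omega \<equiv> omega_op"
abbreviation "loops \<equiv> loop_space"
abbreviation "keys \<equiv> Poly_Mapping.keys"
abbreviation "lookup \<equiv> Poly_Mapping.lookup"

section \<open>Face words and singular cubes\<close>

text \<open>Each entry describes one coordinate of a face: \<open>None\<close> leaves it free,
  \<open>Some b\<close> fixes it at an end. With faces as lists, the sums over subsets of
  coordinates in the cubical boundary and coproduct become recursions, and their identities become
  inductions.\<close>

type_synonym face_word = "bool option list"

definition nfree :: "face_word => nat" where "nfree w = length (filter (%x. x = None) w)"
definition sg :: "face_word => int" where "sg w = (- 1) ^ nfree w"

abbreviation "free m \<equiv> replicate m None"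

lemma nfree_simps [simp]:
 "nfree [] = 0" "nfree (None # w) = Suc (nfree w)" "nfree (Some b # w) = nfree w"
 "nfree (v @ w) = nfree v + nfree w" "nfree (free m) = m"
 by (auto simp: nfree_def)

lemma sg_simps [simp]:
 "sg [] = 1" "sg (None # w) = - sg w" "sg (Some b # w) = sg w" "sg (v @ w) = sg v * sg w"
 "sg w * sg w = 1" "sg w * (sg w * x) = x"
 by (auto simp: sg_def power_add simp flip: power_mult_distrib mult.assoc)

text \<open>Here \<open>F\<close> plays the role of a functional on the faces of a cube. Coordinates
  carry the sign \<open>(-1)^i\<close> counted from one, whence the minus of the first coordinate
  and the change of sign after each free one.\<close>

fun bdry :: "face_word => (face_word => int) => int" where
 "bdry [] F = 0"
| "bdry (None # w) F = - (F (Some True # w) - F (Some False # w)) - bdry w (%u. F (None # u))"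
| "bdry (Some b # w) F = bdry w (%u. F (Some b # u))"

text \<open>The cubical (Serre) coproduct, with the front face in the first argument. In the second
  summand the coordinate belongs to the complement of the front set, and \<open>sg u\<close> is its
  contribution to the shuffle sign.\<close>

fun diag :: "face_word => (face_word => face_word => int) => int" where
 "diag [] F = F [] []"
| "diag (None # w) F =
   diag w (%u v. F (None # u) (Some True # v) + sg u * F (Some False # u) (None # v))"
| "diag (Some b # w) F = diag w (%u v. F (Some b # u) (Some b # v))"

text \<open>The cubical cup-one operation, a homotopy between the coproduct and its transpose. Where
  both words become free in the same coordinate, all later coordinates follow the coproduct.\<close>

fun cup_one :: "face_word => (face_word => face_word => int) => int" where
 "cup_one [] F = 0"
| "cup_one (None # w) F = diag w (%u v. sg u * F (None # u) (None # v))
   - cup_one w (%u v. sg u * F (Some True # u) (None # v) + F (None # u) (Some False # v))"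
| "cup_one (Some b # w) F = cup_one w (%u v. F (Some b # u) (Some b # v))"

lemma boundary_lin:
 "bdry w (%u. F u + G u) = bdry w F + bdry w G"
 "bdry w (%u. F u - G u) = bdry w F - bdry w G"
 "bdry w (%u. - F u) = - bdry w F"
 "bdry w (%u. k * F u) = k * bdry w F"
 "bdry w (%u. F u * k) = bdry w F * k"
 "bdry w (%u. 0) = 0"
proof -
 show add: "bdry w (%u. F u + G u) = bdry w F + bdry w G" for F G
  by (induction w F arbitrary: G rule: bdry.induct) simp_all
 show cm: "bdry w (%u. k * F u) = k * bdry w F" for k F
  by (induction w F rule: bdry.induct) (simp_all add: algebra_simps)
 show "bdry w (%u. F u * k) = bdry w F * k" using cm[of k F] by (simp add: mult.commute)
 show "bdry w (%u. - F u) = - bdry w F" using cm[of "-1" F] by simp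
 show "bdry w (%u. F u - G u) = bdry w F - bdry w G" using add[of F "%u. - G u"] cm[of "-1" G] by simp
 show "bdry w (%u. 0) = 0" using cm[of 0 "%u. 0"] by simp
qed

lemma diagonal_lin:
 "diag w (%u v. F u v + G u v) = diag w F + diag w G"
 "diag w (%u v. F u v - G u v) = diag w F - diag w G"
 "diag w (%u v. - F u v) = - diag w F"
 "diag w (%u v. k * F u v) = k * diag w F"
 "diag w (%u v. F u v * k) = diag w F * k"
 "diag w (%u v. 0) = 0"
proof -
 show add: "diag w (%u v. F u v + G u v) = diag w F + diag w G" for F G
 proof (induction w F arbitrary: G rule: diag.induct)
  case (2 w F)
  show ?case unfolding diag.simps 2[symmetric] by (rule arg_cong[where f="diag w"]) (auto simp: algebra_simps fun_eq_iff)
 qed auto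
 show cm: "diag w (%u v. k * F u v) = k * diag w F" for k F
 proof (induction w F rule: diag.induct)
  case (2 w F)
  show ?case unfolding diag.simps 2[symmetric] by (rule arg_cong[where f="diag w"]) (auto simp: algebra_simps fun_eq_iff)
 qed auto
 show "diag w (%u v. F u v * k) = diag w F * k" using cm[of k F] by (simp add: mult.commute)
 show "diag w (%u v. - F u v) = - diag w F" using cm[of "-1" F] by simp
 show "diag w (%u v. F u v - G u v) = diag w F - diag w G" using add[of F "%u v. - G u v"] cm[of "-1" G] by simp
 show "diag w (%u v. 0) = 0" using cm[of 0 "%u v. 0"] by simp
qed

lemma cup_one_lin:
 "cup_one w (%u v. F u v + G u v) = cup_one w F + cup_one w G"
 "cup_one w (%u v. F u v - G u v) = cup_one w F - cup_one w G"
 "cup_one w (%u v. - F u v) = - cup_one w F"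
 "cup_one w (%u v. k * F u v) = k * cup_one w F"
 "cup_one w (%u v. F u v * k) = cup_one w F * k"
 "cup_one w (%u v. 0) = 0"
proof -
 show add: "cup_one w (%u v. F u v + G u v) = cup_one w F + cup_one w G" for F G
 proof (induction w F arbitrary: G rule: cup_one.induct)
  case (2 w F)
  have "cup_one w (%u v. sg u * (F (Some True # u) (None # v) + G (Some True # u) (None # v)) + (F (None # u) (Some False # v) + G (None # u) (Some False # v)))
   = cup_one w (%u v. (sg u * F (Some True # u) (None # v) + F (None # u) (Some False # v)) + (sg u * G (Some True # u) (None # v) + G (None # u) (Some False # v)))"
   by (rule arg_cong[where f="cup_one w"]) (auto simp: algebra_simps fun_eq_iff)
  then show ?case unfolding cup_one.simps 2 by (simp add: algebra_simps diagonal_lin)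
 qed auto
 show cm: "cup_one w (%u v. k * F u v) = k * cup_one w F" for k F
 proof (induction w F rule: cup_one.induct)
  case (2 w F)
  have "cup_one w (%u v. sg u * (k * F (Some True # u) (None # v)) + (k * F (None # u) (Some False # v)))
   = cup_one w (%u v. k * (sg u * F (Some True # u) (None # v) + F (None # u) (Some False # v)))"
   by (rule arg_cong[where f="cup_one w"]) (auto simp: algebra_simps fun_eq_iff)
  then show ?case unfolding cup_one.simps 2 by (simp add: algebra_simps diagonal_lin mult.left_commute)
 qed auto
 show "cup_one w (%u v. F u v * k) = cup_one w F * k" using cm[of k F] by (simp add: mult.commute)
 show "cup_one w (%u v. - F u v) = - cup_one w F" using cm[of "-1" F] by simp
 show "cup_one w (%u v. F u v - G u v) = cup_one w F - cup_one w G" using add[of F "%u v. - G u v"] cm[of "-1" G] by simp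
 show "cup_one w (%u v. 0) = 0" using cm[of 0 "%u v. 0"] by simp
qed

lemmas word_lin = boundary_lin diagonal_lin cup_one_lin

lemma boundary_boundary: "bdry w (%u. bdry u F) = 0"
 by (induction w F rule: bdry.induct) (simp_all add: word_lin)

lemma boundary_sg: "bdry w (%u. sg u * F u) = - (sg w * bdry w F)"
 by (induction w F rule: bdry.induct) (simp_all add: word_lin algebra_simps)

lemma sg_mult_diagonal: "sg w * diag w F = diag w (%u v. sg u * (sg v * F u v))"
 by (induction w F rule: diag.induct) (simp_all add: word_lin algebra_simps)

lemma boundary_diagonal:
 "bdry w (%x. diag x F) =
  diag w (%u v. bdry u (%u'. F u' v) + sg u * bdry v (%v'. F u v'))"
 by (induction w F rule: diag.induct) (simp_all add: word_lin algebra_simps boundary_sg)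

lemma diagonal_assoc:
 "diag w (%x v. diag x (%u u'. F u u' v)) = diag w (%u y. diag y (%u' v. F u u' v))"
proof (induction w arbitrary: F)
 case (Cons x w)
 then show ?case by (cases x) (simp_all add: word_lin algebra_simps sg_mult_diagonal)
qed simp

abbreviation ksg :: "face_word => face_word => int" where "ksg u v \<equiv> (- 1) ^ (nfree u * nfree v)"

lemma ksg_simps:
 "(- 1 :: int) ^ (nfree u + nfree u * nfree v) = sg u * ksg u v"
 "(- 1 :: int) ^ (nfree v + nfree u * nfree v) = sg v * ksg u v"
 by (auto simp: sg_def power_add)

text \<open>Commutativity of the coproduct up to homotopy. It will be needed for two factors of odd
  degree, where \<open>ksg\<close> is \<open>-1\<close> and the right-hand side turns into an
  anticommutator.\<close>

lemma boundary_cup_one: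
 "cup_one w (%u v. bdry u (%u'. F u' v) + sg u * bdry v (%v'. F u v')) + bdry w (%x. cup_one x F)
  = diag w F - diag w (%u v. ksg u v * F v u)"
proof (induction w arbitrary: F)
 case (Cons x w)
 show ?case
 proof (cases x)
  case None
  show ?thesis
   using Cons[of "%u v. sg u * F (Some True # u) (None # v)"] Cons[of "%u v. F (None # u) (Some False # v)"]
   by (simp add: None word_lin algebra_simps ksg_simps boundary_diagonal boundary_sg)
 next
  case (Some b)
  show ?thesis using Cons[of "%u v. F (Some b # u) (Some b # v)"] by (simp add: Some)
 qed
qed simp

abbreviation "pts m \<equiv> topspace (std_cube m)"

lemma pts_iff: "t \<in> pts m \<longleftrightarrow> t \<in> extensional {..<m} & (\<forall>i<m. 0 \<le> t i & t i \<le> 1)"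
 by (auto simp: std_cube_def PiE_def Pi_def)

lemma pts_eqI: "t \<in> pts m ==> t' \<in> pts m ==> (!!i. i < m ==> t i = t' i) ==> t = t'"
 unfolding pts_iff by (auto intro: extensionalityI)

lemma continuous_map_std_cube:
 "continuous_map Y (std_cube m) f \<longleftrightarrow>
  f ` topspace Y \<subseteq> extensional {..<m} & (\<forall>i<m. continuous_map Y (top_of_set {0..1}) (%y. f y i))"
 by (auto simp: std_cube_def continuous_map_componentwise)

lemma continuous_map_coordinate: "i < m ==> continuous_map (std_cube m) (top_of_set {0..1}) (%t. t i)"
 using continuous_map_std_cube[of "std_cube m" m id] by simp

fun ins :: "face_word => (nat => real) => (nat => real)" where
 "ins [] t = (%_. undefined)"
| "ins (None # w) t = case_nat (t 0) (ins w (%i. t (Suc i)))"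
| "ins (Some b # w) t = case_nat (of_bool b) (ins w t)"

lemma ins_nth: "ins w t j = (if j < length w then case w ! j of None => t (nfree (take j w)) | Some b => of_bool b else undefined)"
proof (induction w t arbitrary: j rule: ins.induct)
 case (2 w t)
 then show ?case by (cases j) (auto split: option.splits)
next
 case (3 b w t)
 then show ?case by (cases j) (auto split: option.splits)
qed auto

lemma nfree_take_less: "j < length w ==> w ! j = None ==> nfree (take j w) < nfree w"
proof (induction w arbitrary: j)
 case (Cons x w)
 then show ?case by (cases x; cases j) auto
qed simp

lemma continuous_map_ins: "continuous_map (std_cube (nfree w)) (std_cube (length w)) (ins w)"
 unfolding continuous_map_std_cube
proof safe
 fix i assume "i < length w"
 then show "continuous_map (std_cube (nfree w)) (top_of_set {0..1}) (%y. ins w y i)"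
  by (cases "w ! i") (auto simp: ins_nth nfree_take_less continuous_map_coordinate)
qed (auto simp: ins_nth extensional_def)

lemma ins_pts: "t \<in> pts (nfree w) ==> ins w t \<in> pts (length w)"
 using continuous_map_ins by (metis continuous_map_image_subset_topspace image_subset_iff)

definition fc :: "face_word => 'y cube => 'y cube" where
 "fc w T = (\<lambda>t\<in>pts (nfree w). T (ins w t))"

text \<open>A face of a face: the entries of the second word fill the free positions of the
  first.\<close>

fun subst_word :: "face_word => face_word => face_word" where
 "subst_word (None # w) (x # u) = x # subst_word w u"
| "subst_word (Some b # w) u = Some b # subst_word w u"
| "subst_word _ _ = []"

lemma subst_word_simps [simp]:
 assumes "length u = nfree w"
 shows "length (subst_word w u) = length w" "nfree (subst_word w u) = nfree u" "sg (subst_word w u) = sg u"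
  "ins (subst_word w u) t = ins w (ins u t)"
proof -
 have "length (subst_word w u) = length w & nfree (subst_word w u) = nfree u & (\<forall>t. ins (subst_word w u) t = ins w (ins u t))"
  using assms
 proof (induction w u rule: subst_word.induct)
  case (1 w x u)
  then show ?case by (cases x) auto
 qed auto
 then show "length (subst_word w u) = length w" "nfree (subst_word w u) = nfree u" "sg (subst_word w u) = sg u"
  "ins (subst_word w u) t = ins w (ins u t)" by (auto simp: sg_def)
qed

lemma fc_fc: "length u = nfree w ==> fc u (fc w T) = fc (subst_word w u) T"
 using ins_pts[of _ u] by (auto simp: fc_def fun_eq_iff restrict_def)

lemma subst_word_replicate [simp]: "length u = m ==> subst_word (free m) u = u"
 by (induction m arbitrary: u) (auto simp: length_Suc_conv)

lemma ins_replicate: "t \<in> pts m ==> ins (free m) t = t"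
 using ins_pts[of t "free m"] by (intro pts_eqI) (auto simp: ins_nth simp del: replicate.simps)

lemma fc_replicate: "singular m Y T ==> fc (free m) T = T"
 by (auto simp: fc_def singular_cube_def fun_eq_iff ins_replicate extensional_def)

lemma singular_fc: "singular (length w) Y T ==> singular (nfree w) Y (fc w T)"
 unfolding singular_cube_def fc_def
 using continuous_map_compose[OF continuous_map_ins, of w Y T]
 by (auto simp: o_def elim: continuous_map_eq)

lemma boundary_cong: "(!!u. length u = length w ==> F u = G u) ==> bdry w F = bdry w G"
 by (induction w F arbitrary: G rule: bdry.induct) auto

lemma diagonal_cong: "(!!u v. length u = length w ==> length v = length w ==> F u v = G u v) ==> diag w F = diag w G"
proof (induction w F arbitrary: G rule: diag.induct)
 case (2 w F) show ?case unfolding diag.simps by (rule 2(1)) (auto simp: 2(2))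
qed auto

lemma cup_one_cong: "(!!u v. length u = length w ==> length v = length w ==> F u v = G u v) ==> cup_one w F = cup_one w G"
proof (induction w F arbitrary: G rule: cup_one.induct)
 case (2 w F) show ?case unfolding cup_one.simps by (intro arg_cong2[where f=minus] 2(1) diagonal_cong) (auto simp: 2(2))
qed auto

lemma boundary_subst: "length x = nfree w ==> bdry x (%u. F (subst_word w u)) = bdry (subst_word w x) F"
proof (induction w x arbitrary: F rule: subst_word.induct)
 case (1 w x u)
 then show ?case by (cases x) auto
qed auto

lemma diagonal_subst:
 "length x = nfree w ==> diag x (%u v. F (subst_word w u) (subst_word w v)) = diag (subst_word w x) F"
proof (induction w x arbitrary: F rule: subst_word.induct)
 case (1 w x u)
 show ?case
 proof (cases x)
  case None
  have "diag u (%ua v. F (None # subst_word w ua) (Some True # subst_word w v) + sg ua * F (Some False # subst_word w ua) (None # subst_word w v))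
    = diag u (%ua v. F (None # subst_word w ua) (Some True # subst_word w v) + sg (subst_word w ua) * F (Some False # subst_word w ua) (None # subst_word w v))"
   using 1(2) by (intro diagonal_cong) auto
  also have "... = diag (subst_word w u) (%u v. F (None # u) (Some True # v) + sg u * F (Some False # u) (None # v))"
   using 1(2) by (subst 1(1)[symmetric]) auto
  finally show ?thesis using None by simp
 qed (use 1 in auto)
qed auto

lemma cup_one_subst:
 "length x = nfree w ==> cup_one x (%u v. F (subst_word w u) (subst_word w v)) = cup_one (subst_word w x) F"
proof (induction w x arbitrary: F rule: subst_word.induct)
 case (1 w x u)
 show ?case
 proof (cases x)
  case None
  have "cup_one u (%ua v. sg ua * F (Some True # subst_word w ua) (None # subst_word w v) + F (None # subst_word w ua) (Some False # subst_word w v))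
    = cup_one u (%ua v. sg (subst_word w ua) * F (Some True # subst_word w ua) (None # subst_word w v) + F (None # subst_word w ua) (Some False # subst_word w v))"
   using 1(2) by (intro cup_one_cong) auto
  also have "... = cup_one (subst_word w u) (%u v. sg u * F (Some True # u) (None # v) + F (None # u) (Some False # v))"
   using 1(2) by (subst 1(1)[symmetric]) auto
  moreover have "diag u (%ua v. sg ua * F (None # subst_word w ua) (None # subst_word w v)) =
   diag u (%ua v. sg (subst_word w ua) * F (None # subst_word w ua) (None # subst_word w v))"
   using 1(2) by (intro diagonal_cong) auto
  ultimately show ?thesis using None 1(2) diagonal_subst[of u w "%u v. sg u * F (None # u) (None # v)"] by simp
 qed (use 1 in auto)
qed auto

section \<open>Sums over subsets of coordinates as recursions on face words\<close>

definition coord_word :: "nat => nat set => bool => face_word" where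
 "coord_word m L b = map (%j. if j \<in> L then None else Some b) [0..<m]"

lemma nfree_take_coord_word: "j \<le> m ==> nfree (take j (coord_word m L b)) = card (L \<inter> {..<j})"
proof (induction j)
 case (Suc j)
 have "take (Suc j) (coord_word m L b) = take j (coord_word m L b) @ [if j \<in> L then None else Some b]"
  using Suc.prems by (simp add: coord_word_def take_Suc_conv_app_nth)
 moreover have "L \<inter> {..<Suc j} = (if j \<in> L then insert j (L \<inter> {..<j}) else L \<inter> {..<j})"
  by (auto simp: less_Suc_eq)
 ultimately show ?case using Suc by simp
qed (auto simp: coord_word_def)

lemma nfree_coord_word: "L \<subseteq> {..<m} ==> nfree (coord_word m L b) = card L"
 using nfree_take_coord_word[of m m L b] by (simp add: coord_word_def Int_absorb2)

lemma subcube_eq_fc: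
 assumes L: "L \<subseteq> {..<m}"
 shows "subcube m L (of_bool b) T = fc (coord_word m L b) T"
proof -
 have "(\<lambda>j\<in>{..<m}. if j \<in> L then t (card (L \<inter> {..<j})) else of_bool b) = ins (coord_word m L b) t" for t
 proof
  fix j
  have "nfree (take j (coord_word m L b)) = card (L \<inter> {..<j})" if "j < m" using nfree_take_coord_word that by simp
  then show "(\<lambda>j\<in>{..<m}. if j \<in> L then t (card (L \<inter> {..<j})) else of_bool b) j = ins (coord_word m L b) t j"
   by (auto simp: ins_nth coord_word_def)
 qed
 then show ?thesis unfolding subcube_def fc_def nfree_coord_word[OF L] by simp
qed

lemma coord_word_Suc:
 "coord_word (Suc m) (Suc ` L) b = Some b # coord_word m L b"
 "coord_word (Suc m) (insert 0 (Suc ` L)) b = None # coord_word m L b"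
 by (auto simp: coord_word_def upt_conv_Cons map_Suc_upt[symmetric] image_iff simp del: upt_Suc)

lemma Pow_lessThan_Suc: "Pow {..<Suc m} = (%L. Suc ` L) ` Pow {..<m} \<union> (%L. insert 0 (Suc ` L)) ` Pow {..<m}"
proof -
 have "L \<in> (%L. Suc ` L) ` Pow {..<m} \<union> (%L. insert 0 (Suc ` L)) ` Pow {..<m}" if "L \<subseteq> {..<Suc m}" for L
 proof -
  define L' where "L' = {i. Suc i \<in> L}"
  have "L' \<subseteq> {..<m}" using that by (auto simp: L'_def)
  moreover have "L = (if 0 \<in> L then insert 0 (Suc ` L') else Suc ` L')"
   by (auto simp: L'_def image_iff) (metis not0_implies_Suc)+
  ultimately show ?thesis by (auto split: if_splits)
 qed
 then show ?thesis by (auto simp: Pow_def)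
qed

text \<open>A new first coordinate outside \<open>L\<close> forms an inversion with every element of
  \<open>L\<close>; inside \<open>L\<close> it forms none.\<close>

lemma shuffle_sign_Suc:
 assumes "L \<subseteq> {..<m}"
 shows "shuffle_sign (Suc m) (Suc ` L) = (- 1) ^ card L * shuffle_sign m L"
  "shuffle_sign (Suc m) (insert 0 (Suc ` L)) = shuffle_sign m L"
proof -
 let ?I = "%m L. {(i, j). i \<in> L & j \<in> {..<m} - L & j < i}"
 have fin: "finite L" using assms finite_subset by blast
 have finI: "finite (?I m L)" by (rule finite_subset[of _ "L \<times> {..<m}"]) (use fin in auto)
 have e: "?I (Suc m) (Suc ` L) = (%i. (Suc i, 0)) ` L \<union> map_prod Suc Suc ` ?I m L"
 proof (rule Set.set_eqI)
  fix x :: "nat \<times> nat"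
  obtain a b where x: "x = (a, b)" by (cases x)
  show "x \<in> ?I (Suc m) (Suc ` L) \<longleftrightarrow> x \<in> (%i. (Suc i, 0)) ` L \<union> map_prod Suc Suc ` ?I m L"
   unfolding x by (cases a; cases b) (auto simp: image_iff)
 qed
 have c1: "card ((%i. (Suc i, 0::nat)) ` L) = card L" by (rule card_image) (auto simp: inj_on_def)
 have c2: "card (map_prod Suc Suc ` ?I m L) = card (?I m L)" by (rule card_image) (auto simp: inj_on_def)
 have "card (?I (Suc m) (Suc ` L)) = card L + card (?I m L)"
  unfolding e by (subst card_Un_disjoint) (use fin finI c1 c2 in auto)
 then show "shuffle_sign (Suc m) (Suc ` L) = (- 1) ^ card L * shuffle_sign m L"
  by (simp add: shuffle_sign_def psign_def power_add)
 have "?I (Suc m) (insert 0 (Suc ` L)) = map_prod Suc Suc ` ?I m L"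
 proof (rule Set.set_eqI)
  fix x :: "nat \<times> nat"
  obtain a b where x: "x = (a, b)" by (cases x)
  show "x \<in> ?I (Suc m) (insert 0 (Suc ` L)) \<longleftrightarrow> x \<in> map_prod Suc Suc ` ?I m L"
   unfolding x by (cases a; cases b) (auto simp: image_iff)
 qed
 then show "shuffle_sign (Suc m) (insert 0 (Suc ` L)) = shuffle_sign m L"
  using c2 by (simp add: shuffle_sign_def)
qed

lemma diagonal_sum:
 "(\<Sum>L\<in>Pow {..<m}. shuffle_sign m L * F (coord_word m L False) (coord_word m ({..<m} - L) True)) = diag (free m) F"
proof (induction m arbitrary: F)
 case 0 show ?case by (simp add: coord_word_def shuffle_sign_def psign_def)
next
 case (Suc m)
 let ?h = "%L. shuffle_sign (Suc m) L * F (coord_word (Suc m) L False) (coord_word (Suc m) ({..<Suc m} - L) True)"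
 have inj: "inj_on (%L. Suc ` L) A" "inj_on (%L. insert 0 (Suc ` L)) A" for A
  by (auto simp: inj_on_def image_iff set_eq_iff)
 have compl: "{..<Suc m} - Suc ` L = insert 0 (Suc ` ({..<m} - L))" "{..<Suc m} - insert 0 (Suc ` L) = Suc ` ({..<m} - L)" for L
  by (auto simp: lessThan_Suc_eq_insert_0)
 have "sum ?h (Pow {..<Suc m}) = (\<Sum>L\<in>Pow {..<m}. ?h (Suc ` L)) + (\<Sum>L\<in>Pow {..<m}. ?h (insert 0 (Suc ` L)))"
  unfolding Pow_lessThan_Suc
  by (subst sum.union_disjoint) (auto simp: sum.reindex[OF inj(1)] sum.reindex[OF inj(2)])
 also have "... = (\<Sum>L\<in>Pow {..<m}. shuffle_sign m L * (F (None # coord_word m L False) (Some True # coord_word m ({..<m} - L) True)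
   + sg (coord_word m L False) * F (Some False # coord_word m L False) (None # coord_word m ({..<m} - L) True)))"
  unfolding sum.distrib[symmetric] compl coord_word_Suc
  by (rule sum.cong) (auto simp: shuffle_sign_Suc sg_def nfree_coord_word algebra_simps)
 also have "... = diag (free (Suc m)) F" by (subst Suc) simp
 finally show ?case .
qed

lemma boundary_sum:
 "(\<Sum>i<m. psign (i + 1) * (F (coord_word m ({..<m} - {i}) True) - F (coord_word m ({..<m} - {i}) False))) = bdry (free m) F"
proof (induction m arbitrary: F)
 case (Suc m)
 have c: "{..<Suc m} - {0} = Suc ` {..<m}" "i < m ==> {..<Suc m} - {Suc i} = insert 0 (Suc ` ({..<m} - {i}))" for i
  by (auto simp: lessThan_Suc_eq_insert_0)
 have a: "coord_word m {..<m} b = free m" for b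
  by (rule nth_equalityI) (auto simp: coord_word_def)
 show ?case unfolding sum.lessThan_Suc_shift
  using Suc[of "%u. F (None # u)"] by (simp add: c coord_word_Suc a psign_def sum_negf)
qed simp

lemma evaluate_superset: "finite S ==> keys x \<subseteq> S ==> evaluate f x = (\<Sum>T\<in>S. lookup x T * f T)"
 unfolding evaluate_def by (intro sum.mono_neutral_left) (auto simp: in_keys_iff)

lemma evaluate_cmul [simp]: "evaluate f (frag_cmul k x) = k * evaluate f x"
 using evaluate_superset[of "keys x" "frag_cmul k x" f] keys_cmul[of k x] by (simp add: evaluate_def sum_distrib_left mult.assoc)

lemma evaluate_simps [simp]:
 "evaluate f 0 = 0" "evaluate f (frag_of T) = f T" "evaluate f (x + y) = evaluate f x + evaluate f y"
 using Poly_Mapping.keys_add[of x y] evaluate_superset[of "keys x \<union> keys y" _ f]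
 by (auto simp: evaluate_def[of _ 0] evaluate_def[of _ "frag_of T"] sum.distrib lookup_add algebra_simps)

lemma evaluate_minus [simp]: "evaluate f (- x) = - evaluate f x" "evaluate f (x - y) = evaluate f x - evaluate f y"
 using evaluate_cmul[of f "-1" x] evaluate_cmul[of f "-1" y] evaluate_simps(3)[of f x "- y"] by simp_all

lemma evaluate_sum: "evaluate f (sum g I) = (\<Sum>i\<in>I. evaluate f (g i))"
 by (induction I rule: infinite_finite_induct) auto

lemma subst_word_id [simp]: "subst_word w (free (nfree w)) = w"
proof (induction w)
 case (Cons x w)
 then show ?case by (cases x) auto
qed simp

text \<open>A cochain seen as a functional on the faces of one fixed cube. The operations on
  cochains turn into \<open>bdry\<close>, \<open>diag\<close> and \<open>cup_one\<close> of such
  functionals, so identities of cochains follow from identities of words.\<close>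

definition ev :: "'y cochain => 'y cube => face_word => int" where
 "ev f T w = f (nfree w) (fc w T)"

lemma ev_fc: "length u = nfree w ==> ev f (fc w T) u = ev f T (subst_word w u)"
 by (simp add: ev_def fc_fc)

lemma ev_lin [simp]: "ev (f + g) T w = ev f T w + ev g T w" "ev (f - g) T w = ev f T w - ev g T w"
 "ev (- f) T w = - ev f T w" "ev 0 T w = 0"
 by (auto simp: ev_def)

lemma cube_codiff_eq: "singular m Y T ==> codiff Y f m T = bdry (free m) (ev f T)"
proof (cases m)
 case (Suc k)
 assume T: "singular m Y T"
 have "codiff Y f m T = (\<Sum>i<m. psign (i + 1) * (f k (subcube m ({..<m} - {i}) 1 T) - f k (subcube m ({..<m} - {i}) 0 T)))"
  using T Suc by (simp add: cube_codiff_def cube_boundary_def evaluate_sum)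
 also have "... = (\<Sum>i<m. psign (i + 1) * (ev f T (coord_word m ({..<m} - {i}) True) - ev f T (coord_word m ({..<m} - {i}) False)))"
  using Suc subcube_eq_fc[of _ m True T] subcube_eq_fc[of _ m False T]
  by (intro sum.cong refl) (auto simp: ev_def nfree_coord_word card_Diff_singleton)
 finally show ?thesis by (simp only: boundary_sum)
qed (simp add: cube_codiff_def)

lemma ev_codiff:
 assumes "singular (length w) Y T"
 shows "ev (codiff Y f) T w = bdry w (ev f T)"
proof -
 from assms have "ev (codiff Y f) T w = bdry (free (nfree w)) (ev f (fc w T))"
  using singular_fc[of w Y T] by (simp only: ev_def[of "codiff Y f"] cube_codiff_eq)
 also have "... = bdry (free (nfree w)) (%u. ev f T (subst_word w u))"
  by (rule boundary_cong) (simp add: ev_fc)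
 finally show ?thesis by (simp add: boundary_subst)
qed

lemma cube_cup_eq:
 assumes T: "singular m Y T"
 shows "cup Y f g m T = diag (free m) (%u v. ev f T u * ev g T v)"
proof -
 have "cup Y f g m T = (\<Sum>L\<in>Pow {..<m}. shuffle_sign m L * (ev f T (coord_word m L False) * ev g T (coord_word m ({..<m} - L) True)))"
  unfolding cube_cup_def using T subcube_eq_fc[of _ m True T] subcube_eq_fc[of _ m False T]
  by (auto intro!: sum.cong simp: ev_def nfree_coord_word card_Diff_subset finite_subset[of _ "{..<m}"])
 then show ?thesis using diagonal_sum[of m "%u v. ev f T u * ev g T v"] by simp
qed

lemma ev_cup:
 assumes "singular (length w) Y T"
 shows "ev (cup Y f g) T w = diag w (%u v. ev f T u * ev g T v)"
proof -
 from assms have "ev (cup Y f g) T w = diag (free (nfree w)) (%u v. ev f (fc w T) u * ev g (fc w T) v)"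
  using singular_fc[of w Y T] by (simp only: ev_def[of "cup Y f g"] cube_cup_eq)
 also have "... = diag (free (nfree w)) (%u v. ev f T (subst_word w u) * ev g T (subst_word w v))"
  by (rule diagonal_cong) (simp add: ev_fc)
 finally show ?thesis by (simp add: diagonal_subst[of _ _ "%u v. ev f T u * ev g T v"])
qed

definition cup1 :: "'y topology => 'y cochain => 'y cochain => 'y cochain" where
 "cup1 Y f g = (%m T. if singular m Y T then cup_one (free m) (%u v. ev f T u * ev g T v) else 0)"

lemma ev_cup1:
 assumes "singular (length w) Y T"
 shows "ev (cup1 Y f g) T w = cup_one w (%u v. ev f T u * ev g T v)"
proof -
 from assms have "ev (cup1 Y f g) T w = cup_one (free (nfree w)) (%u v. ev f (fc w T) u * ev g (fc w T) v)"
  using singular_fc[of w Y T] by (simp only: ev_def[of "cup1 Y f g"]) (simp add: cup1_def)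
 also have "... = cup_one (free (nfree w)) (%u v. ev f T (subst_word w u) * ev g T (subst_word w v))"
  by (rule cup_one_cong) (simp add: ev_fc)
 finally show ?thesis by (simp add: cup_one_subst[of _ _ "%u v. ev f T u * ev g T v"])
qed

lemma apply_eq_ev: "singular m Y T ==> f m T = ev f T (free m)"
 by (simp add: ev_def fc_replicate)

section \<open>Degenerate cubes and normalised cochains\<close>

definition indep :: "nat => 'y cube => nat => bool" where
 "indep m T i \<longleftrightarrow> (\<forall>t\<in>pts m. \<forall>t'\<in>pts m. (\<forall>j. j ~= i --> t j = t' j) --> T t = T t')"

lemma degenerate_iff: "degenerate_cube m T \<longleftrightarrow> (\<exists>i<m. indep m T i)"
 by (simp add: degenerate_cube_def indep_def)

lemma nfree_take_neq:
 assumes "i < length u" "j < length u" "u ! i = None" "u ! j = None" "i ~= j"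
 shows "nfree (take i u) ~= nfree (take j u)"
proof -
 have *: "nfree (take a u) < nfree (take b u)" if "a < b" "b < length u" "u ! a = None" for a b
  using nfree_take_less[of a "take b u"] that by (simp add: min_def)
 show ?thesis using *[of i j] *[of j i] assms by (cases "i < j") auto
qed

lemma degenerate_cube_fc:
 assumes "indep (length u) T i" "i < length u" "u ! i = None"
 shows "degenerate_cube (nfree u) (fc u T)"
 unfolding degenerate_iff
proof (intro exI conjI)
 show "nfree (take i u) < nfree u" using assms nfree_take_less by blast
 show "indep (nfree u) (fc u T) (nfree (take i u))"
  unfolding indep_def
 proof (intro ballI impI)
  fix t t' assume t: "t \<in> pts (nfree u)" "t' \<in> pts (nfree u)" "\<forall>j. j ~= nfree (take i u) --> t j = t' j"
  have "ins u t j = ins u t' j" if "j ~= i" for j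
   using that t(3) nfree_take_neq[of j u i] assms(2,3) by (auto simp: ins_nth split: option.splits)
  then have "T (ins u t) = T (ins u t')"
   using assms(1) ins_pts[OF t(1)] ins_pts[OF t(2)] unfolding indep_def by blast
  then show "fc u T t = fc u T t'" using t by (simp add: fc_def)
 qed
qed

lemma fc_indep_update:
 assumes "indep (length u) T i" "i < length u" "u ! i = Some b"
 shows "nfree (u[i := Some b']) = nfree u" "fc (u[i := Some b']) T = fc u T"
proof -
 have upd: "nfree (x[i := Some b']) = nfree x" if "i < length x --> x ! i = Some b" for x
  using that
 proof (induction x arbitrary: i)
  case (Cons y x)
  then show ?case by (cases i; cases y) auto
 qed simp
 then show n: "nfree (u[i := Some b']) = nfree u" using assms by blast
 have "ins (u[i := Some b']) t j = ins u t j" if "j ~= i" for t j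
  unfolding ins_nth take_update_swap using that upd[of "take j u"] assms(3) by (simp split: option.split)
 then have "T (ins (u[i := Some b']) t) = T (ins u t)" if "t \<in> pts (nfree u)" for t
  using assms(1)[unfolded indep_def, rule_format, of "ins (u[i := Some b']) t" "ins u t"]
   ins_pts[OF that] ins_pts[of t "u[i := Some b']"] that n by simp
 then show "fc (u[i := Some b']) T = fc u T" by (auto simp: fc_def n restrict_def)
qed

text \<open>A set of degrees instead of a single one: sign rules depend only on the parity of its
  elements, and the empty set covers operations that lower the degree below zero.\<close>

definition cochains :: "'y topology => nat set => 'y cochain set" where
 "cochains Y S = {f. \<forall>m T. f m T ~= 0 --> m \<in> S & singular m Y T & \<not> degenerate_cube m T}"

lemma comp_CU: "comp (CU Y) p = cochains Y {p}" by (auto simp: CU_def cochains_def)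
lemma diff_CU: "diff (CU Y) = codiff Y" by (simp add: CU_def)

lemma cochains_mono: "f \<in> cochains Y S ==> S \<subseteq> S' ==> f \<in> cochains Y S'" by (auto simp: cochains_def)

lemma cochains_lin [simp]:
 fixes Y :: "'y topology" shows
 "0 \<in> cochains Y S" "f \<in> cochains Y S ==> g \<in> cochains Y S ==> f + g \<in> cochains Y S"
 "f \<in> cochains Y S ==> g \<in> cochains Y S ==> f - g \<in> cochains Y S" "f \<in> cochains Y S ==> - f \<in> cochains Y S"
proof -
 have *: "m \<in> S & singular m Y T & \<not> degenerate_cube m T"
  if "f \<in> cochains Y S" "g \<in> cochains Y S" "f m T ~= 0 \<or> g m T ~= 0" for f g :: "'y cochain" and m T
  using that unfolding cochains_def by blast
 have "f m T ~= 0 \<or> g m T ~= 0" if "(f + g) m T ~= 0" for f g :: "'y cochain" and m T using that by auto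
 then show "f \<in> cochains Y S ==> g \<in> cochains Y S ==> f + g \<in> cochains Y S"
  unfolding cochains_def[of Y S] mem_Collect_eq by (meson *[unfolded cochains_def])
 have "f m T ~= 0 \<or> g m T ~= 0" if "(f - g) m T ~= 0" for f g :: "'y cochain" and m T using that by auto
 then show "f \<in> cochains Y S ==> g \<in> cochains Y S ==> f - g \<in> cochains Y S"
  unfolding cochains_def[of Y S] mem_Collect_eq by (meson *[unfolded cochains_def])
qed (auto simp: cochains_def)

lemma cochains_sum: "(!!i. i \<in> I ==> f i \<in> cochains Y S) ==> sum f I \<in> cochains Y S"
 by (induction I rule: infinite_finite_induct) auto

lemma cochains_zero: "f \<in> cochains Y S ==> \<not> singular m Y T \<or> degenerate_cube m T \<or> m \<notin> S ==> f m T = 0"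
 by (auto simp: cochains_def)

lemma ev_indep: "f \<in> cochains Y S ==> indep (length u) T i ==> i < length u ==> u ! i = None ==> ev f T u = 0"
 using degenerate_cube_fc[of u T i] by (auto simp: ev_def intro: cochains_zero)

text \<open>Faces that keep the idle coordinate free are degenerate, and the two faces that fix it
  agree and enter with opposite signs.\<close>

lemma boundary_zero:
 assumes "i < length w" "w ! i = None"
  "!!u. length u = length w ==> u ! i = None ==> F u = 0"
  "!!u. length u = length w ==> F (u[i := Some True]) = F (u[i := Some False])"
 shows "bdry w F = 0"
 using assms
proof (induction w F arbitrary: i rule: bdry.induct)
 case (2 w F)
 show ?case
 proof (cases i)
  case 0
  have "bdry w (%u. F (None # u)) = bdry w (%u. 0)" using 2(4) 0 by (intro boundary_cong) auto
  then show ?thesis using 2(5)[of "None # w"] 0 by (simp add: word_lin)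
 next
  case (Suc k)
  have "bdry w (%u. F (None # u)) = 0"
   by (rule 2(1)[of k]) (use 2(2-3) 2(4)[of "None # _"] 2(5)[of "None # _"] Suc in auto)
  then show ?thesis using 2(4)[of "Some _ # w"] 2(3) Suc by simp
 qed
next
 case (3 b w F)
 then obtain k where k: "i = Suc k" by (cases i) auto
 have "bdry w (%u. F (Some b # u)) = 0"
  by (rule 3(1)[of k]) (use 3(2-3) 3(4)[of "Some b # _"] 3(5)[of "Some b # _"] k in auto)
 then show ?case by simp
qed auto

text \<open>In each term of the coproduct one of the two faces is free in the given
  coordinate.\<close>

lemma diagonal_zero:
 assumes "i < length w" "w ! i = None"
  "!!u v. length u = length w ==> length v = length w ==> u ! i = None \<or> v ! i = None ==> F u v = 0"
 shows "diag w F = 0"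
 using assms
proof (induction w F arbitrary: i rule: diag.induct)
 case (2 w F)
 show ?case
 proof (cases i)
  case 0
  have "diag w (%u v. F (None # u) (Some True # v) + sg u * F (Some False # u) (None # v)) = diag w (%u v. 0)"
   using 2(4) 0 by (intro diagonal_cong) auto
  then show ?thesis by (simp add: word_lin)
 next
  case (Suc k)
  show ?thesis unfolding diag.simps by (rule 2(1)[of k]) (use 2 Suc in auto)
 qed
next
 case (3 b w F)
 then obtain k where k: "i = Suc k" by (cases i) auto
 show ?case unfolding diag.simps by (rule 3(1)[of k]) (use 3 k in auto)
qed auto

lemma cube_codiff_in [simp]: "f \<in> cochains Y S ==> codiff Y f \<in> cochains Y (Suc ` S)"
 unfolding cochains_def[of Y "Suc ` S"]
proof safe
 fix m T assume f: "f \<in> cochains Y S" and nz: "codiff Y f m T ~= 0"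
 show T: "singular m Y T" using nz by (auto simp: cube_codiff_def split: nat.splits if_splits)
 have "codiff Y f m T = 0" if "m \<notin> Suc ` S"
 proof (cases m)
  case (Suc k)
  then have "f k = (%_. 0)" using that f by (auto simp: fun_eq_iff cochains_def)
  then show ?thesis using Suc by (simp add: cube_codiff_def evaluate_def)
 qed (simp add: cube_codiff_def)
 then show "m \<in> Suc ` S" using nz by blast
 assume "degenerate_cube m T"
 then obtain i where i: "i < m" "indep m T i" by (auto simp: degenerate_iff)
 have "bdry (free m) (ev f T) = 0"
 proof (rule boundary_zero[of i])
  fix u :: face_word assume u: "length u = length (free m :: face_word)"
  show "ev f T u = 0" if "u ! i = None" using that u i ev_indep[OF f] by simp
  show "ev f T (u[i := Some True]) = ev f T (u[i := Some False])"
   using fc_indep_update[of "u[i := Some True]" T i True False] u i by (simp add: ev_def)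
 qed (use i in auto)
 then show False using nz T by (simp add: cube_codiff_eq)
qed

lemma nfree_diagonal:
 assumes "!!u v. length u = length w ==> length v = length w ==> nfree u + nfree v = nfree w ==> F u v = G u v"
 shows "diag w F = diag w G"
 using assms
proof (induction w F arbitrary: G rule: diag.induct)
 case (2 w F) show ?case unfolding diag.simps by (rule 2(1)) (auto simp: 2(2))
qed auto

lemma cube_cup_in:
 assumes "f \<in> cochains Y S" "g \<in> cochains Y S'"
 shows "cup Y f g \<in> cochains Y {a + b | a b. a \<in> S & b \<in> S'}"
 unfolding cochains_def
proof (intro CollectI allI impI conjI notI)
 fix m T assume nz: "cup Y f g m T ~= 0"
 show T: "singular m Y T" using nz by (auto simp: cube_cup_def split: if_splits)
 show "\<exists>a b. m = a + b & a \<in> S & b \<in> S'"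
 proof (rule ccontr)
  assume n: "\<not> ?thesis"
  have "diag (free m) (%u v. ev f T u * ev g T v) = diag (free m) (%u v. 0)"
  proof (rule nfree_diagonal)
   fix u v :: face_word assume "nfree u + nfree v = nfree (free m)"
   then have "nfree u \<notin> S \<or> nfree v \<notin> S'" using n by fastforce
   then show "ev f T u * ev g T v = 0" using assms by (auto simp: ev_def cochains_zero)
  qed
  then show False using nz T by (simp add: cube_cup_eq word_lin)
 qed
 assume "degenerate_cube m T"
 then obtain i where i: "i < m" "indep m T i" by (auto simp: degenerate_iff)
 have "diag (free m) (%u v. ev f T u * ev g T v) = 0"
  by (rule diagonal_zero[of i]) (use i ev_indep[OF assms(1)] ev_indep[OF assms(2)] in auto)
 then show False using nz T by (simp add: cube_cup_eq)
qed

lemma cochain_eqI: "(!!m T. f m T = g m T) ==> f = (g :: 'y cochain)"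
 by (intro ext)

lemma codiff_lin [simp]:
 "codiff Y (f + g) = codiff Y f + codiff Y g" "codiff Y (f - g) = codiff Y f - codiff Y g"
 "codiff Y (- f) = - codiff Y f" "codiff Y 0 = 0"
 "codiff Y (scale k f) = scale k (codiff Y f)"
 by (auto simp: fun_eq_iff cube_codiff_def evaluate_def scale_def algebra_simps sum.distrib sum_subtractf sum_negf sum_distrib_left split: nat.splits)

lemma cup_lin [simp]:
 "cup Y (f + g) h = cup Y f h + cup Y g h" "cup Y (f - g) h = cup Y f h - cup Y g h"
 "cup Y (- f) h = - cup Y f h" "cup Y 0 h = 0" "cup Y (scale k f) h = scale k (cup Y f h)"
 "cup Y h (f + g) = cup Y h f + cup Y h g" "cup Y h (f - g) = cup Y h f - cup Y h g"
 "cup Y h (- f) = - cup Y h f" "cup Y h 0 = 0" "cup Y h (scale k f) = scale k (cup Y h f)"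
 by (auto simp: fun_eq_iff cube_cup_def scale_def algebra_simps sum.distrib sum_subtractf sum_negf sum_distrib_left)

lemma nonsingular: "\<not> singular m Y T ==> codiff Y f m T = 0" "\<not> singular m Y T ==> cup Y f g m T = 0"
 by (auto simp: cube_codiff_def cube_cup_def split: nat.splits)

lemma codiff_codiff [simp]: "codiff Y (codiff Y f) = 0"
proof (intro cochain_eqI)
 fix m T show "codiff Y (codiff Y f) m T = 0 m T"
 proof (cases "singular m Y T")
  case True
  then have "bdry (free m) (ev (codiff Y f) T) = bdry (free m) (%u. bdry u (ev f T))"
   by (intro boundary_cong) (simp add: ev_codiff)
  then show ?thesis using True by (simp add: cube_codiff_eq boundary_boundary)
 qed (simp add: nonsingular)
qed

text \<open>The Koszul sign of an odd operation passing a cochain whose degrees all have the same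
  parity.\<close>

definition sgn_if :: "bool => 'a::ab_group_add => 'a" where "sgn_if b x = (if b then x else - x)"

lemma sg_ev: "f \<in> cochains Y S ==> (!!m. m \<in> S ==> even m = b) ==> sg u * ev f T u = sgn_if b (ev f T u)"
 by (cases "nfree u \<in> S") (auto simp: ev_def sg_def sgn_if_def cochains_zero)

lemma leibniz:
 assumes "f \<in> cochains Y S" "!!m. m \<in> S ==> even m = b"
 shows "codiff Y (cup Y f g) = cup Y (codiff Y f) g + sgn_if b (cup Y f (codiff Y g))"
proof (intro cochain_eqI)
 fix m T show "codiff Y (cup Y f g) m T = (cup Y (codiff Y f) g + sgn_if b (cup Y f (codiff Y g))) m T"
 proof (cases "singular m Y T")
  case True
  have "codiff Y (cup Y f g) m T = bdry (free m) (%x. diag x (%u v. ev f T u * ev g T v))"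
   unfolding cube_codiff_eq[OF True] using True by (intro boundary_cong) (simp add: ev_cup)
  also have "... = diag (free m) (%u v. bdry u (%u'. ev f T u' * ev g T v) + sg u * bdry v (%v'. ev f T u * ev g T v'))"
   by (rule boundary_diagonal)
  also have "... = diag (free m) (%u v. ev (codiff Y f) T u * ev g T v + sgn_if b 1 * (ev f T u * ev (codiff Y g) T v))"
   using True sg_ev[OF assms] by (intro diagonal_cong) (auto simp: ev_codiff word_lin mult.assoc[symmetric] sgn_if_def)
  also have "... = (cup Y (codiff Y f) g + sgn_if b (cup Y f (codiff Y g))) m T"
   using True by (simp add: word_lin cube_cup_eq sgn_if_def)
  finally show ?thesis .
 qed (simp add: nonsingular sgn_if_def)
qed

lemma cup_assoc: "cup Y (cup Y f g) h = cup Y f (cup Y g h)"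
proof (intro cochain_eqI)
 fix m T show "cup Y (cup Y f g) h m T = cup Y f (cup Y g h) m T"
 proof (cases "singular m Y T")
  case True
  have "cup Y (cup Y f g) h m T = diag (free m) (%x v. diag x (%u u'. ev f T u * ev g T u' * ev h T v))"
   unfolding cube_cup_eq[OF True] using True by (intro diagonal_cong) (simp add: ev_cup word_lin)
  also have "... = diag (free m) (%u y. diag y (%u' v. ev f T u * ev g T u' * ev h T v))"
   by (rule diagonal_assoc)
  also have "... = cup Y f (cup Y g h) m T"
   unfolding cube_cup_eq[OF True] using True by (intro diagonal_cong) (simp add: ev_cup word_lin mult.assoc)
  finally show ?thesis .
 qed (simp add: nonsingular)
qed

lemma codiff_cup1:
 assumes "f \<in> cochains Y S" "!!m. m \<in> S ==> odd m" "g \<in> cochains Y S'" "!!m. m \<in> S' ==> odd m"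
 shows "cup1 Y (codiff Y f) g - cup1 Y f (codiff Y g) + codiff Y (cup1 Y f g) = cup Y f g + cup Y g f"
proof (intro cochain_eqI)
 fix m T show "(cup1 Y (codiff Y f) g - cup1 Y f (codiff Y g) + codiff Y (cup1 Y f g)) m T = (cup Y f g + cup Y g f) m T"
 proof (cases "singular m Y T")
  case True
  have s: "sg u * ev f T u = - ev f T u" for u using sg_ev[OF assms(1), of False] assms(2) by (simp add: sgn_if_def)
  have k: "ksg u v * (ev f T v * ev g T u) = - (ev f T v * ev g T u)" for u v
   using assms by (cases "nfree v \<in> S"; cases "nfree u \<in> S'") (auto simp: ev_def cochains_zero)
  have "cup_one (free m) (%u v. ev (codiff Y f) T u * ev g T v - ev f T u * ev (codiff Y g) T v)
   + bdry (free m) (ev (cup1 Y f g) T)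
   = cup_one (free m) (%u v. bdry u (%u'. ev f T u' * ev g T v) + sg u * bdry v (%v'. ev f T u * ev g T v'))
   + bdry (free m) (%x. cup_one x (%u v. ev f T u * ev g T v))"
   using True by (intro arg_cong2[where f="(+)"] cup_one_cong boundary_cong) (simp_all add: ev_cup1 ev_codiff word_lin mult.assoc[symmetric] s)
  also have "... = diag (free m) (%u v. ev f T u * ev g T v) - diag (free m) (%u v. ksg u v * (ev f T v * ev g T u))"
   by (rule boundary_cup_one)
  also have "... = (cup Y f g + cup Y g f) m T"
   using True by (simp add: k word_lin cube_cup_eq mult.commute)
  finally show ?thesis using True by (simp add: cube_codiff_eq cup1_def word_lin)
 qed (simp add: nonsingular cup1_def)
qed

lemma cube_one_in: "cube_one Y \<in> cochains Y {0}"
 by (auto simp: cochains_def cube_one_def degenerate_cube_def split: if_splits)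

lemma ev_one: "singular (length w) Y T ==> ev (cube_one Y) T w = of_bool (nfree w = 0)"
 using singular_fc[of w Y T] by (cases "nfree w = 0") (auto simp: ev_def cube_one_def)

lemma diagonal_unit:
 "diag w (%u v. of_bool (nfree u = 0) * F v) = F w" "diag w (%u v. F u * of_bool (nfree v = 0)) = F w"
proof -
 show "diag w (%u v. F u * of_bool (nfree v = 0)) = F w"
  by (induction w "%u v::face_word. F u * of_bool (nfree v = 0)" arbitrary: F rule: diag.induct) (auto simp: word_lin)
 have *: "sg u * (of_bool (nfree u = 0) * x) = of_bool (nfree u = 0) * x" for u x by (auto simp: sg_def)
 show "diag w (%u v. of_bool (nfree u = 0) * F v) = F w"
  by (induction w "%u v::face_word. of_bool (nfree u = 0) * F v" arbitrary: F rule: diag.induct) (auto simp: word_lin *)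
qed

lemma cup_one_unit:
 assumes "f \<in> cochains Y S"
 shows "cup Y (cube_one Y) f = f" "cup Y f (cube_one Y) = f"
proof -
 have "cup Y (cube_one Y) f m T = f m T & cup Y f (cube_one Y) m T = f m T" for m T
 proof (cases "singular m Y T")
  case True
  have "diag (free m) (%u v. ev (cube_one Y) T u * ev f T v) = diag (free m) (%u v. of_bool (nfree u = 0) * ev f T v)"
   "diag (free m) (%u v. ev f T u * ev (cube_one Y) T v) = diag (free m) (%u v. ev f T u * of_bool (nfree v = 0))"
   using True by (intro diagonal_cong; simp add: ev_one)+
  then show ?thesis using True unfolding cube_cup_eq[OF True] by (simp only: diagonal_unit apply_eq_ev[OF True])
 next
  case False
  then show ?thesis using cochains_zero[OF assms] by (simp add: nonsingular)
 qed
 then show "cup Y (cube_one Y) f = f" "cup Y f (cube_one Y) = f" by (auto intro: cochain_eqI)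
qed

lemma codiff_one [simp]: "codiff Y (cube_one Y) = 0"
proof (intro cochain_eqI)
 fix m T show "codiff Y (cube_one Y) m T = 0 m T"
 proof (cases "singular m Y T")
  case True
  have "bdry w (%u. of_bool (nfree u = 0)) = 0" for w :: face_word
   by (induction w "%u::face_word. of_bool (nfree u = 0) :: int" rule: bdry.induct) (auto simp: word_lin)
  moreover have "bdry (free m) (ev (cube_one Y) T) = bdry (free m) (%u. of_bool (nfree u = 0))"
   using True by (intro boundary_cong) (simp add: ev_one)
  ultimately show ?thesis using True by (simp add: cube_codiff_eq)
 qed (simp add: nonsingular)
qed

section \<open>Pullback of cochains\<close>

definition push :: "nat => ('y => 'z) => 'y cube => 'z cube" where
 "push m h T = restrict (h \<circ> T) (pts m)"

text \<open>Cochains see a map only through singular cubes. For maps into or out of path and loop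
  spaces this condition is checked on the adjoint maps of cubes.\<close>

definition cube_map :: "'y topology => 'z topology => ('y => 'z) => bool" where
 "cube_map Y Z h \<longleftrightarrow> (\<forall>m T. singular m Y T --> singular m Z (push m h T))"

lemma cube_mapI:
 assumes h: "continuous_map Y Z h"
 shows "cube_map Y Z h"
proof -
 have "continuous_map (std_cube m) Z (push m h T)" if "continuous_map (std_cube m) Y T" for m T
  by (rule continuous_map_eq[OF continuous_map_compose[OF that h]]) (simp add: push_def)
 then show ?thesis unfolding cube_map_def singular_cube_def push_def by auto
qed

lemma pullback_apply: "singular m Y T ==> pullback Y h f m T = f m (push m h T)"
 by (simp add: pullback_def push_def)

lemma fc_push: "fc w (push (length w) h T) = push (nfree w) h (fc w T)"
 using ins_pts[of _ w] by (auto simp: fc_def push_def fun_eq_iff)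

lemma ev_pullback: "singular (length w) Y T ==> ev (pullback Y h f) T w = ev f (push (length w) h T) w"
 using singular_fc[of w Y T] by (simp add: ev_def pullback_apply fc_push)

lemma pullback_lin [simp]:
 "pullback Y h (f + g) = pullback Y h f + pullback Y h g" "pullback Y h (f - g) = pullback Y h f - pullback Y h g"
 "pullback Y h (- f) = - pullback Y h f" "pullback Y h 0 = 0" "pullback Y h (scale k f) = scale k (pullback Y h f)"
 by (auto simp: fun_eq_iff pullback_def scale_def)

lemma pullback_nonsingular: "\<not> singular m Y T ==> pullback Y h f m T = 0"
 by (simp add: pullback_def)

lemma pullback_codiff: "cube_map Y Z h ==> pullback Y h (codiff Z f) = codiff Y (pullback Y h f)"
proof (intro cochain_eqI)
 fix m T assume h: "cube_map Y Z h"
 show "pullback Y h (codiff Z f) m T = codiff Y (pullback Y h f) m T"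
 proof (cases "singular m Y T")
  case True
  have "bdry (free m) (ev (pullback Y h f) T) = bdry (free m) (ev f (push m h T))"
   using True by (intro boundary_cong) (simp add: ev_pullback)
  then show ?thesis using True h by (simp add: pullback_apply cube_codiff_eq cube_map_def)
 qed (simp add: nonsingular pullback_nonsingular)
qed

lemma pullback_cup: "cube_map Y Z h ==> pullback Y h (cup Z f g) = cup Y (pullback Y h f) (pullback Y h g)"
proof (intro cochain_eqI)
 fix m T assume h: "cube_map Y Z h"
 show "pullback Y h (cup Z f g) m T = cup Y (pullback Y h f) (pullback Y h g) m T"
 proof (cases "singular m Y T")
  case True
  have "diag (free m) (%u v. ev (pullback Y h f) T u * ev (pullback Y h g) T v)
   = diag (free m) (%u v. ev f (push m h T) u * ev g (push m h T) v)"
   using True by (intro diagonal_cong) (simp add: ev_pullback)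
  then show ?thesis using True h by (simp add: pullback_apply cube_cup_eq cube_map_def)
 qed (simp add: nonsingular pullback_nonsingular)
qed

lemma degenerate_push: "degenerate_cube m T ==> degenerate_cube m (push m h T)"
 unfolding degenerate_cube_def push_def by (simp, metis)

lemma pullback_in: "f \<in> cochains Z S ==> pullback Y h f \<in> cochains Y S"
 unfolding cochains_def[of Y] using degenerate_push cochains_zero
 by (auto simp: pullback_def push_def[symmetric] split: if_splits; blast)

lemma pullback_one: "cube_map Y Z h ==> pullback Y h (cube_one Z) = cube_one Y"
 by (auto simp: fun_eq_iff pullback_def push_def[symmetric] cube_one_def cube_map_def)

lemma pullback_pullback: "cube_map Y Z h ==> pullback Y h (pullback Z k f) = pullback Y (k \<circ> h) f"
proof -
 have "push m k (push m h T) = push m (k \<circ> h) T" for m T by (auto simp: push_def fun_eq_iff)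
 then show "cube_map Y Z h ==> ?thesis"
  by (intro cochain_eqI) (auto simp: pullback_def push_def[symmetric] cube_map_def)
qed

lemma pullback_id: "f \<in> cochains Y S ==> (!!y. y \<in> topspace Y ==> h y = y) ==> pullback Y h f = f"
proof (intro cochain_eqI)
 fix m T assume f: "f \<in> cochains Y S" and h: "!!y. y \<in> topspace Y ==> h y = y"
 show "pullback Y h f m T = f m T"
 proof (cases "singular m Y T")
  case True
  then have "push m h T = T"
   using h continuous_map_image_subset_topspace[of "std_cube m" Y T]
   by (auto simp: push_def singular_cube_def fun_eq_iff extensional_def image_subset_iff)
  then show ?thesis using True by (simp add: pullback_apply)
 qed (use cochains_zero[OF f] in \<open>auto simp: pullback_nonsingular\<close>)
qed

section \<open>Mapping spaces and integration along loops\<close>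

lemma topspace_mapping_space: "topspace (mapping_space A B) = {f \<in> extensional (topspace A). continuous_map A B f}"
proof -
 let ?B = "{{f \<in> extensional (topspace A). continuous_map A B f & f ` C \<subseteq> U} | C U. compactin A C & openin B U}"
 have "{f \<in> extensional (topspace A). continuous_map A B f} = {f \<in> extensional (topspace A). continuous_map A B f & f ` {} \<subseteq> {}}"
  by simp
 then have "{f \<in> extensional (topspace A). continuous_map A B f} \<in> ?B"
  by (intro CollectI exI[of _ "{}"]) simp
 moreover have "\<Union> ?B \<subseteq> {f \<in> extensional (topspace A). continuous_map A B f}" by blast
 ultimately show ?thesis unfolding mapping_space_def topology_generated_by_topspace by blast
qed

lemma openin_mapping_space:
 "compactin A C ==> openin B U ==> openin (mapping_space A B) {f \<in> extensional (topspace A). continuous_map A B f & f ` C \<subseteq> U}"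
 unfolding mapping_space_def by (rule topology_generated_by_Basis) auto

text \<open>A point of \<open>S\<close> has the compact neighbourhoods
  \<open>cball u (e/2) \<inter> S\<close>, and a subbasic open set of the mapping space controls a
  function on all of such a neighbourhood at once.\<close>

lemma continuous_map_uncurry:
 fixes S :: "'a::heine_borel set"
 assumes S: "compact S" and V: "continuous_map Y (mapping_space (top_of_set S) B) V"
 shows "continuous_map (prod_topology Y (top_of_set S)) B (%(y, u). V y u)"
proof -
 have Vy: "continuous_map (top_of_set S) B (V y)" if "y \<in> topspace Y" for y
  using continuous_map_image_subset_topspace[OF V] that by (auto simp: topspace_mapping_space)
 show ?thesis
  unfolding continuous_map_def
 proof (intro conjI allI impI)
  show "(%(y, u). V y u) \<in> topspace (prod_topology Y (top_of_set S)) \<rightarrow> topspace B"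
   using Vy unfolding continuous_map_def by auto
  fix U assume U: "openin B U"
  let ?W = "{x \<in> topspace (prod_topology Y (top_of_set S)). (case x of (y, u) => V y u) \<in> U}"
  show "openin (prod_topology Y (top_of_set S)) ?W"
  proof (subst openin_subopen, safe)
   fix y u assume yu: "(y, u) \<in> topspace (prod_topology Y (top_of_set S))" "V y u \<in> U"
   then have y: "y \<in> topspace Y" and u: "u \<in> S" by auto
   have "openin (top_of_set S) {u \<in> S. V y u \<in> U}"
    using Vy[OF y] U by (auto simp: continuous_map_def)
   then obtain e where e: "e > 0" "ball u e \<inter> S \<subseteq> {u \<in> S. V y u \<in> U}"
    using u yu(2) unfolding openin_contains_ball by auto
   let ?C = "cball u (e/2) \<inter> S"
   have "compact ?C" using S by (simp add: compact_Int)
   then have C: "compactin (top_of_set S) ?C" by (simp add: compactin_subtopology)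
   have CV: "V y ` ?C \<subseteq> U" using e by (auto simp: subset_iff)
   let ?O = "{y \<in> topspace Y. V y \<in> {f \<in> extensional (topspace (top_of_set S)). continuous_map (top_of_set S) B f & f ` ?C \<subseteq> U}}"
   have "openin Y ?O" using V openin_mapping_space[OF C U] unfolding continuous_map_def by blast
   moreover have "openin (top_of_set S) (ball u (e/2) \<inter> S)" by (simp add: openin_open_Int Int_commute)
   ultimately have "openin (prod_topology Y (top_of_set S)) (?O \<times> (ball u (e/2) \<inter> S))"
    by (simp add: openin_prod_Times_iff)
   moreover have "(y, u) \<in> ?O \<times> (ball u (e/2) \<inter> S)"
    using y u e CV continuous_map_image_subset_topspace[OF V] by (auto simp: topspace_mapping_space)
   moreover have "?O \<times> (ball u (e/2) \<inter> S) \<subseteq> ?W" by auto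
   ultimately show "\<exists>T. openin (prod_topology Y (top_of_set S)) T & (y, u) \<in> T & T \<subseteq> ?W" by blast
  qed
 qed
qed

text \<open>By the tube lemma the condition of mapping a compact set into an open set is open in the
  parameter.\<close>

lemma continuous_map_curry:
 assumes g: "continuous_map (prod_topology Y A) B (%(y, u). g y u)"
 shows "continuous_map Y (mapping_space A B) (%y. restrict (g y) (topspace A))"
proof -
 have gy: "continuous_map A B (restrict (g y) (topspace A))" if "y \<in> topspace Y" for y
 proof -
  have "continuous_map A (prod_topology Y A) (%u. (y, u))" using that by (simp add: continuous_map_pairwise o_def)
  from continuous_map_compose[OF this g] show ?thesis by (rule continuous_map_eq) auto
 qed
 show ?thesis
  unfolding mapping_space_def
 proof (rule continuous_on_generated_topo)
  fix W assume "W \<in> {{f \<in> extensional (topspace A). continuous_map A B f & f ` C \<subseteq> U} | C U. compactin A C & openin B U}"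
  then obtain C U where C: "compactin A C" and U: "openin B U"
   and W: "W = {f \<in> extensional (topspace A). continuous_map A B f & f ` C \<subseteq> U}" by blast
  have CA: "C \<subseteq> topspace A" using C compactin_subset_topspace by blast
  let ?P = "{x \<in> topspace (prod_topology Y A). (case x of (y, u) => g y u) \<in> U}"
  have P: "openin (prod_topology Y A) ?P" using g U by (auto simp: continuous_map_def)
  have eq: "(%y. restrict (g y) (topspace A)) -` W \<inter> topspace Y = {y \<in> topspace Y. g y ` C \<subseteq> U}"
   unfolding W using gy CA by (auto simp: subset_iff image_iff)
  have "openin Y {y \<in> topspace Y. g y ` C \<subseteq> U}"
  proof (subst openin_subopen, safe)
   fix y assume y: "y \<in> topspace Y" "g y ` C \<subseteq> U"
   then have "{y} \<times> C \<subseteq> ?P" using CA by auto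
   from tube_lemma_right[OF P C y(1) this]
   obtain O' V' where "openin Y O'" "y \<in> O'" "C \<subseteq> V'" "O' \<times> V' \<subseteq> ?P" by blast
   then show "\<exists>T. openin Y T & y \<in> T & T \<subseteq> {y \<in> topspace Y. g y ` C \<subseteq> U}"
    using openin_subset[of Y O'] by (intro exI[of _ O']) fastforce
  qed
  then show "openin Y ((%y. restrict (g y) (topspace A)) -` W \<inter> topspace Y)" using eq by simp
 next
  have "(%y. restrict (g y) (topspace A)) ` topspace Y \<subseteq> topspace (mapping_space A B)"
   using gy by (auto simp: topspace_mapping_space)
  then show "(%y. restrict (g y) (topspace A)) ` topspace Y
   \<subseteq> \<Union> {{f \<in> extensional (topspace A). continuous_map A B f & f ` C \<subseteq> U} | C U. compactin A C & openin B U}"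
   by (simp only: mapping_space_def topology_generated_by_topspace)
 qed
qed

lemma singular_cube_curry:
 fixes S :: "'a::heine_borel set"
 assumes "compact S"
 shows "singular m (mapping_space (top_of_set S) B) V \<longleftrightarrow>
   V \<in> extensional (pts m) & (\<forall>t\<in>pts m. V t \<in> extensional S) &
   continuous_map (prod_topology (std_cube m) (top_of_set S)) B (%(t, u). V t u)" (is "?L \<longleftrightarrow> ?R")
proof
 assume L: ?L
 then have V: "continuous_map (std_cube m) (mapping_space (top_of_set S) B) V" by (simp add: singular_cube_def)
 have "V t \<in> extensional S" if "t \<in> pts m" for t
  using continuous_map_image_subset_topspace[OF V] that by (auto simp: topspace_mapping_space)
 then show ?R using L continuous_map_uncurry[OF assms V] by (simp add: singular_cube_def)
next
 assume R: ?R
 have "continuous_map (std_cube m) (mapping_space (top_of_set S) B) V"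
  by (rule continuous_map_eq[OF continuous_map_curry[of _ "top_of_set S" B V]]) (use R in \<open>simp_all add: extensional_restrict\<close>)
 then show ?L using R by (simp add: singular_cube_def)
qed

lemma singular_path_cube:
 "singular m (path_space X) V \<longleftrightarrow> V \<in> extensional (pts m) & (\<forall>t\<in>pts m. V t \<in> extensional {0..1}) &
   continuous_map (prod_topology (std_cube m) (top_of_set {0..1})) X (%(t, u). V t u)"
 unfolding path_space_def unit_interval_def by (rule singular_cube_curry) simp

lemma singular_loop_cube:
 "singular m (loops X) V \<longleftrightarrow> V \<in> extensional (pts m) & (\<forall>t\<in>pts m. V t \<in> extensional (sphere 0 1)) &
   continuous_map (prod_topology (std_cube m) (top_of_set (sphere 0 1))) X (%(t, u). V t u)"
 unfolding loop_space_def circle_def by (rule singular_cube_curry) simp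

lemma continuous_map_path_cube:
 assumes "singular m (path_space X) V" "continuous_map Y (std_cube m) h" "continuous_map Y (top_of_set {0..1}) k"
 shows "continuous_map Y X (%y. V (h y) (k y))"
 using continuous_map_compose[of Y "prod_topology (std_cube m) (top_of_set {0..1})" "%y. (h y, k y)" X "%(t, u). V t u"] assms
 by (simp add: singular_path_cube continuous_map_pairwise o_def)

lemma continuous_map_loop_cube:
 assumes "singular m (loops X) V" "continuous_map Y (std_cube m) h" "continuous_map Y (top_of_set (sphere 0 1)) k"
 shows "continuous_map Y X (%y. V (h y) (k y))"
 using continuous_map_compose[of Y "prod_topology (std_cube m) (top_of_set (sphere 0 1))" "%y. (h y, k y)" X "%(t, u). V t u"] assms
 by (simp add: singular_loop_cube continuous_map_pairwise o_def)

lemma tail_pts: "t \<in> pts (Suc m) ==> (%i. t (Suc i)) \<in> pts m"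
 by (auto simp: pts_iff extensional_def)

lemma restrict_tail: "t \<in> pts (Suc m) ==> (\<lambda>i\<in>{..<m}. t (Suc i)) = (%i. t (Suc i))"
 by (auto simp: pts_iff extensional_def fun_eq_iff)

lemma continuous_map_tail: "continuous_map (std_cube (Suc m)) (std_cube m) (%t i. t (Suc i))"
 unfolding continuous_map_std_cube by (simp add: continuous_map_coordinate pts_iff extensional_def image_subset_iff)

lemma continuous_map_interval_mult:
 "continuous_map Y (top_of_set {0..1}) f ==> continuous_map Y (top_of_set {0..1}) g ==>
  continuous_map Y (top_of_set {0..1}) (%y. f y * g y :: real)"
 unfolding continuous_map_in_subtopology Pi_iff
 by (auto intro!: continuous_map_real_mult mult_le_one mult_nonneg_nonneg)

lemma continuous_map_cis:
 "continuous_map Y euclideanreal f ==> continuous_map Y (top_of_set (sphere 0 1)) (%y. cis (2 * pi * f y))"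
proof -
 assume f: "continuous_map Y euclideanreal f"
 have "continuous_map euclideanreal euclidean (%x. cis (2 * pi * x))"
  unfolding continuous_map_iff_continuous2 by (intro continuous_intros)
 from continuous_map_compose[OF f this] show ?thesis
  unfolding continuous_map_in_subtopology by (auto simp: o_def)
qed

lemma continuous_map_interval_real: "continuous_map Y (top_of_set {0..1}) f ==> continuous_map Y euclideanreal f"
 by (simp add: continuous_map_in_subtopology)

lemma singular_contract_cube:
 assumes "singular m (path_space X) T"
 shows "singular (Suc m) (path_space X) (contract_cube m T)"
proof -
 let ?Y = "prod_topology (std_cube (Suc m)) (top_of_set {0..1::real})"
 have "continuous_map ?Y X (%y. T (%i. fst y (Suc i)) (fst y 0 * snd y))"
  by (intro continuous_map_path_cube[OF assms] continuous_map_interval_mult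
    continuous_map_compose[OF continuous_map_fst continuous_map_tail, unfolded o_def]
    continuous_map_compose[OF continuous_map_fst continuous_map_coordinate, unfolded o_def] continuous_map_snd) simp
 then have "continuous_map ?Y X (%(t, u). contract_cube m T t u)"
  by (rule continuous_map_eq) (auto simp: contract_cube_def restrict_tail)
 then show ?thesis by (auto simp: singular_path_cube contract_cube_def)
qed

lemma contract_cube_apply:
 "t \<in> pts (Suc m) ==> contract_cube m T t = (\<lambda>u\<in>{0..1}. T (%i. t (Suc i)) (t 0 * u))"
 by (simp add: contract_cube_def restrict_tail)

text \<open>The geometry behind \<open>J_op\<close>: the new coordinate scales the path parameter,
  so that one end gives the original paths and the other end constant ones.\<close>

lemma fc_contract_cube:
 assumes "length u = m"
 shows "fc (None # u) (contract_cube m T) = contract_cube (nfree u) (fc u T)"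
  "fc (Some False # u) (contract_cube m T) = (\<lambda>t\<in>pts (nfree u). const_path (fc u T t 0))"
  "singular m (path_space X) T ==> fc (Some True # u) (contract_cube m T) = fc u T"
proof -
 have i: "ins (x # u) t \<in> pts (Suc m)" if "t \<in> pts (nfree (x # u))" for x t
  using ins_pts[OF that] assms by simp
 show "fc (None # u) (contract_cube m T) = contract_cube (nfree u) (fc u T)"
 proof
  fix t show "fc (None # u) (contract_cube m T) t = contract_cube (nfree u) (fc u T) t"
  proof (cases "t \<in> pts (Suc (nfree u))")
   case True
   then show ?thesis using i[of t None] tail_pts[OF True] by (simp add: fc_def contract_cube_apply)
  qed (simp add: fc_def contract_cube_def)
 qed
 show "fc (Some False # u) (contract_cube m T) = (\<lambda>t\<in>pts (nfree u). const_path (fc u T t 0))"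
  using i[of _ "Some False"] by (auto simp: fc_def contract_cube_apply const_path_def fun_eq_iff)
 assume "singular m (path_space X) T"
 then have T: "T t \<in> extensional {0..1}" if "t \<in> pts m" for t using that by (simp add: singular_path_cube)
 show "fc (Some True # u) (contract_cube m T) = fc u T"
  using i[of _ "Some True"] ins_pts[of _ u] T assms by (auto simp: fc_def contract_cube_apply fun_eq_iff extensional_def)
qed

section \<open>Integration along the loop parameter\<close>

definition ecube :: "nat => (complex => 'y) cube => ('y \<times> 'y) cube" where
 "ecube m V = (\<lambda>t\<in>pts (Suc m). (V (%i. t (Suc i)) 1, V (%i. t (Suc i)) (cis (2 * pi * t 0))))"

lemma singular_ecube:
 assumes V: "singular m (loops X) V"
 shows "singular (Suc m) (prod_topology X X) (ecube m V)"
proof -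
 have "continuous_map (std_cube (Suc m)) (prod_topology X X) (%t. (V (%i. t (Suc i)) 1, V (%i. t (Suc i)) (cis (2 * pi * t 0))))"
  unfolding continuous_map_pairwise o_def fst_conv snd_conv
  by (intro conjI continuous_map_loop_cube[OF V] continuous_map_tail continuous_map_cis
    continuous_map_interval_real continuous_map_coordinate) (auto simp: continuous_map_in_subtopology)
 then have "continuous_map (std_cube (Suc m)) (prod_topology X X) (ecube m V)"
  by (rule continuous_map_eq) (simp add: ecube_def)
 then show ?thesis by (simp add: singular_cube_def ecube_def)
qed

lemma fc_ecube:
 assumes "length u = m"
 shows "fc (None # u) (ecube m V) = ecube (nfree u) (fc u V)"
  "fc (Some b # u) (ecube m V) = (\<lambda>t\<in>pts (nfree u). (fc u V t 1, fc u V t 1))"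
proof -
 have i: "ins (x # u) t \<in> pts (Suc m)" if "t \<in> pts (nfree (x # u))" for x t
  using ins_pts[OF that] assms by simp
 show "fc (None # u) (ecube m V) = ecube (nfree u) (fc u V)"
 proof
  fix t show "fc (None # u) (ecube m V) t = ecube (nfree u) (fc u V) t"
  proof (cases "t \<in> pts (Suc (nfree u))")
   case True
   then show ?thesis using i[of t None] tail_pts[OF True] by (simp add: fc_def ecube_def)
  qed (simp add: fc_def ecube_def)
 qed
 show "fc (Some b # u) (ecube m V) = (\<lambda>t\<in>pts (nfree u). (fc u V t 1, fc u V t 1))"
  using i[of _ "Some b"] by (cases b) (auto simp: fc_def ecube_def fun_eq_iff)
qed

text \<open>Loops close up, so both faces of \<open>ecube\<close> in the loop parameter consist of
  pairs of equal points; cochains of this kind do not see them.\<close>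

definition diag_vanish :: "('y \<times> 'y) cochain => bool" where
 "diag_vanish f \<longleftrightarrow> (\<forall>m T. (\<forall>t\<in>pts m. fst (T t) = snd (T t)) --> f m T = 0)"

lemma vanishes_on_diagonalI:
 fixes X :: "'y topology"
 assumes "f \<in> cochains (prod_topology X X) S" "pullback X (%x. (x, x)) f = 0"
 shows "diag_vanish f"
 unfolding diag_vanish_def
proof (intro allI impI)
 fix m and T :: "('y \<times> 'y) cube" assume d: "\<forall>t\<in>pts m. fst (T t) = snd (T t)"
 show "f m T = 0"
 proof (cases "singular m (prod_topology X X) T")
  case True
  let ?S = "push m fst T"
  have S: "singular m X ?S"
   using cube_mapI[OF continuous_map_fst] True unfolding cube_map_def by blast
  have "push m (%x. (x, x)) ?S = T"
   using True d by (auto simp: push_def fun_eq_iff singular_cube_def extensional_def prod_eq_iff)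
  then show ?thesis using assms(2) S pullback_apply[OF S, of "%x. (x, x)" f] by (simp add: zero_fun_def)
 qed (use cochains_zero[OF assms(1)] in blast)
qed

definition lint :: "'y topology => ('y \<times> 'y) cochain => (complex => 'y) cochain" where
 "lint X f = (%m V. if singular m (loops X) V then f (Suc m) (ecube m V) else 0)"

lemma ev_loop_integral:
 "singular (length w) (loops X) V ==> ev (lint X f) V w = ev f (ecube (length w) V) (None # w)"
 using singular_fc[of w "loops X" V] by (simp add: ev_def lint_def fc_ecube)

lemma ev_ecube_zero: "diag_vanish f ==> length u = m ==> ev f (ecube m V) (Some b # u) = 0"
 by (simp add: ev_def fc_ecube diag_vanish_def)

lemma loop_integral_lin [simp]:
 "lint X (f + g) = lint X f + lint X g" "lint X (f - g) = lint X f - lint X g"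
 "lint X (- f) = - lint X f" "lint X 0 = 0" "lint X (scale k f) = scale k (lint X f)"
 by (auto simp: fun_eq_iff lint_def scale_def)

lemma indep_shift:
 assumes "indep m V i" "!!t t'. t \<in> pts (Suc m) ==> t' \<in> pts (Suc m) ==> t 0 = t' 0 ==>
   V (%i. t (Suc i)) = V (%i. t' (Suc i)) ==> W t = W t'"
 shows "indep (Suc m) W (Suc i)"
 unfolding indep_def
proof (intro ballI impI)
 fix t t' assume t: "t \<in> pts (Suc m)" "t' \<in> pts (Suc m)" "\<forall>j. j ~= Suc i --> t j = t' j"
 have "V (%i. t (Suc i)) = V (%i. t' (Suc i))"
  using assms(1)[unfolded indep_def, rule_format, OF tail_pts[OF t(1)] tail_pts[OF t(2)]] t(3) by simp
 then show "W t = W t'" using assms(2)[OF t(1,2)] t(3) by blast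
qed

lemma loop_integral_in:
 assumes "f \<in> cochains (prod_topology X X) S"
 shows "lint X f \<in> cochains (loops X) {m. Suc m \<in> S}"
 unfolding cochains_def
proof (intro CollectI allI impI conjI notI)
 fix m V assume nz: "lint X f m V ~= 0"
 then show V: "singular m (loops X) V" by (simp add: lint_def split: if_splits)
 then have nz': "f (Suc m) (ecube m V) ~= 0" using nz by (simp add: lint_def)
 then show "Suc m \<in> S" using cochains_zero[OF assms] by blast
 assume "degenerate_cube m V"
 then obtain i where i: "i < m" "indep m V i" by (auto simp: degenerate_iff)
 have "indep (Suc m) (ecube m V) (Suc i)" by (rule indep_shift[OF i(2)]) (simp only: ecube_def restrict_apply' if_True)
 then have "degenerate_cube (Suc m) (ecube m V)" using i by (auto simp: degenerate_iff)
 then show False using nz' cochains_zero[OF assms] by blast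
qed

text \<open>The two faces in the loop parameter lie in the diagonal and contribute nothing. The
  other faces are shifted by one coordinate, whence the sign.\<close>

lemma loop_integral_codiff:
 assumes "diag_vanish f"
 shows "lint X (codiff (prod_topology X X) f) = - codiff (loops X) (lint X f)"
proof (intro cochain_eqI)
 fix m V show "lint X (codiff (prod_topology X X) f) m V = (- codiff (loops X) (lint X f)) m V"
 proof (cases "singular m (loops X) V")
  case True
  have "bdry (free m) (ev (lint X f) V) = bdry (free m) (%u. ev f (ecube m V) (None # u))"
   using True by (intro boundary_cong) (simp add: ev_loop_integral)
  then show ?thesis
   using True by (simp add: lint_def[of _ "codiff _ f"] cube_codiff_eq singular_ecube ev_ecube_zero[OF assms])
 qed (simp add: nonsingular lint_def)
qed

text \<open>The coproduct gives the loop parameter to one factor and fixes it at an end in the other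
  factor, which is then evaluated inside the diagonal.\<close>

lemma loop_integral_cup:
 assumes "diag_vanish f" "diag_vanish g"
 shows "lint X (cup (prod_topology X X) f g) = 0"
proof (intro cochain_eqI)
 fix m V show "lint X (cup (prod_topology X X) f g) m V = 0 m V"
 proof (cases "singular m (loops X) V")
  case True
  have "diag (free m) (%u v. ev f (ecube m V) (None # u) * ev g (ecube m V) (Some True # v)
    + sg u * (ev f (ecube m V) (Some False # u) * ev g (ecube m V) (None # v))) = diag (free m) (%u v. 0)"
   using assms by (intro diagonal_cong) (simp add: ev_ecube_zero)
  then show ?thesis using True by (simp add: lint_def cube_cup_eq singular_ecube word_lin)
 qed (simp add: lint_def)
qed

section \<open>The operators \<open>\<omega>\<^sub>k\<close>\<close>

text \<open>Index set for the functions that make up \<open>rot_chain\<close>: \<open>Leaf\<close>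
  is the coordinate function, and a node multiplies the sum of its two subtrees, in disjoint
  variables, by a new first coordinate.\<close>

datatype tree = Leaf | Node tree tree

fun tsize :: "tree => nat" where
 "tsize Leaf = 0" | "tsize (Node g h) = tsize g + tsize h + 1"

type_synonym lift = "(nat => real) => real"

definition cone :: "lift => lift" where "cone q = (%t. t 0 * q (%i. t (Suc i)))"
definition ljoin :: "nat => lift => lift => lift" where "ljoin a g h = (%t. g t + h (%i. t (a + i)))"

fun tfun :: "tree => lift" where
 "tfun Leaf = (%t. t 0)"
| "tfun (Node g h) = cone (ljoin (2 * tsize g + 1) (tfun g) (tfun h))"

abbreviation "tdim x \<equiv> 2 * tsize x + 1"
abbreviation "tjoin g h \<equiv> ljoin (tdim g) (tfun g) (tfun h)"

lemma rot_family_iff: "rot_family k f \<longleftrightarrow> (\<exists>x. tsize x = k & f = tfun x)"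
proof
 assume "rot_family k f"
 then show "\<exists>x. tsize x = k & f = tfun x"
 proof induction
  case 1
  show ?case by (rule exI[of _ Leaf]) simp
 next
  case (2 l g m h)
  then obtain x y where "tsize x = l" "g = tfun x" "tsize y = m" "h = tfun y" by blast
  then show ?case by (intro exI[of _ "Node x y"]) (simp add: cone_def ljoin_def)
 qed
next
 assume "\<exists>x. tsize x = k & f = tfun x"
 then obtain x where x: "tsize x = k" "f = tfun x" by blast
 have "rot_family (tsize x) (tfun x)"
 proof (induction x)
  case (Node g h)
  from rot_family.intros(2)[OF Node] show ?case by (simp add: cone_def ljoin_def)
 qed (simp add: rot_family.intros)
 then show "rot_family k f" using x by simp
qed

lemma tree_fun_zero: "t 0 = 0 ==> tfun x t = 0"
 by (cases x) (auto simp: cone_def)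

text \<open>The chain is a sum over a set of functions; for a sum over trees, no two trees may give
  the same one. Setting the first coordinate of the left block to zero removes the left subtree and
  isolates the right one.\<close>

lemma inj_tree_fun: "tfun x = tfun y ==> x = y"
proof (induction x arbitrary: y)
 case Leaf
 show ?case
 proof (cases y)
  case (Node g h)
  have "tfun y (%i. if i = 0 then 1 else 0) = 0"
   unfolding Node by (simp add: cone_def ljoin_def tree_fun_zero)
  moreover have "tfun Leaf (%i. if i = 0 then 1 else 0) = 1" by simp
  ultimately have False using Leaf by (metis zero_neq_one)
  then show ?thesis ..
 qed simp
next
 case (Node g h)
 show ?case
 proof (cases y)
  case Leaf
  have "tfun (Node g h) (%i. if i = 0 then 1 else 0) = 0"
   by (simp add: cone_def ljoin_def tree_fun_zero)
  then show ?thesis using Node.prems Leaf by simp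
 next
  case y: (Node g' h')
  have e: "tfun g s + tfun h (%i. s (Suc (2 * tsize g) + i)) = tfun g' s + tfun h' (%i. s (Suc (2 * tsize g') + i))" for s
   using fun_cong[OF Node.prems, of "case_nat 1 s"] unfolding y by (simp add: cone_def ljoin_def)
  have hh: "tfun h (%i. s (Suc (2 * tsize g) + i)) = tfun h' (%i. s (Suc (2 * tsize g') + i))" for s
   using e[of "s(0 := 0)"] by (simp add: tree_fun_zero)
  have "tfun g = tfun g'" using e hh by (auto simp: fun_eq_iff)
  then have g: "g = g'" by (rule Node.IH(1))
  have "tfun h s = tfun h' s" for s
   using hh[of "%i. s (i - Suc (2 * tsize g))"] g by simp
  then have "h = h'" by (intro Node.IH(2)) (auto simp: fun_eq_iff)
  then show ?thesis using y g by simp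
 qed
qed

definition trees :: "nat => tree set" where "trees k = {x. tsize x = k}"

lemma finite_trees_le: "finite {x. tsize x \<le> k}"
proof (induction k)
 case 0
 have "{x. tsize x \<le> 0} = {Leaf}"
 proof -
  have "tsize x \<le> 0 ==> x = Leaf" for x by (cases x) auto
  then show ?thesis by auto
 qed
 then show ?case by simp
next
 case (Suc k)
 have "x \<in> insert Leaf ((%(g, h). Node g h) ` ({x. tsize x \<le> k} \<times> {x. tsize x \<le> k}))" if "tsize x \<le> Suc k" for x
  using that by (cases x) auto
 then have "{x. tsize x \<le> Suc k} \<subseteq> insert Leaf ((%(g, h). Node g h) ` ({x. tsize x \<le> k} \<times> {x. tsize x \<le> k}))" by blast
 then show ?case using Suc by (meson finite_SigmaI finite_imageI finite_insert finite_subset)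
qed

lemma finite_trees [simp]: "finite (trees k)"
 by (rule finite_subset[OF _ finite_trees_le[of k]]) (auto simp: trees_def)

lemma trees_0: "trees 0 = {Leaf}"
proof -
 have "tsize x = 0 ==> x = Leaf" for x by (cases x) auto
 then show ?thesis by (auto simp: trees_def)
qed

definition tree_pairs :: "nat => (tree \<times> tree) set" where "tree_pairs k = {(g, h). tsize g + tsize h = k}"

lemma sum_tree_pairs:
 "sum F (tree_pairs k) = (\<Sum>g | tsize g \<le> k. \<Sum>h\<in>trees (k - tsize g). F (g, h))"
 "sum F (tree_pairs k) = (\<Sum>h | tsize h \<le> k. \<Sum>g\<in>trees (k - tsize h). F (g, h))"
proof -
 have "tree_pairs k = Sigma {g. tsize g \<le> k} (%g. trees (k - tsize g))"
  by (auto simp: tree_pairs_def trees_def)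
 then show "sum F (tree_pairs k) = (\<Sum>g | tsize g \<le> k. \<Sum>h\<in>trees (k - tsize g). F (g, h))"
  by (simp add: sum.Sigma finite_trees_le)
 have "sum F (tree_pairs k) = sum (%(h, g). F (g, h)) (Sigma {h. tsize h \<le> k} (%h. trees (k - tsize h)))"
  by (rule sum.reindex_bij_witness[of _ prod.swap prod.swap]) (auto simp: tree_pairs_def trees_def)
 then show "sum F (tree_pairs k) = (\<Sum>h | tsize h \<le> k. \<Sum>g\<in>trees (k - tsize h). F (g, h))"
  by (simp add: sum.Sigma finite_trees_le)
qed

lemma finite_tree_pairs [simp]: "finite (tree_pairs k)"
 by (rule finite_subset[of _ "{x. tsize x \<le> k} \<times> {x. tsize x \<le> k}"]) (auto simp: tree_pairs_def finite_trees_le)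

lemma sum_tree_cases:
 fixes X Y :: "tree => int"
 shows "(\<Sum>h | tsize h \<le> k. if k - tsize h = 0 then X h else - Y h) = (\<Sum>h\<in>trees k. X h) - (\<Sum>h | tsize h < k. Y h)"
proof -
 have e: "{h. tsize h \<le> k} = trees k \<union> {h. tsize h < k}" "trees k \<inter> {h. tsize h < k} = {}" by (auto simp: trees_def)
 have f: "finite {h. tsize h < k}" by (rule finite_subset[OF _ finite_trees_le[of k]]) auto
 have "(\<Sum>h\<in>trees k. if k - tsize h = 0 then X h else - Y h) = (\<Sum>h\<in>trees k. X h)"
  by (rule sum.cong) (auto simp: trees_def)
 moreover have "(\<Sum>h | tsize h < k. if k - tsize h = 0 then X h else - Y h) = - (\<Sum>h | tsize h < k. Y h)"
  unfolding sum_negf[symmetric] by (rule sum.cong) auto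
 ultimately show ?thesis unfolding e(1) by (simp add: sum.union_disjoint e(2) f)
qed

lemma sum_trees_Suc: "sum F (trees (Suc k)) = (\<Sum>(g, h)\<in>tree_pairs k. F (Node g h))"
proof -
 have "\<exists>g h. x = Node g h & tsize g + tsize h = k" if "tsize x = Suc k" for x using that by (cases x) auto
 then have "trees (Suc k) = (%(g, h). Node g h) ` tree_pairs k"
  by (fastforce simp: trees_def tree_pairs_def image_iff)
 moreover have "inj_on (%(g, h). Node g h) (tree_pairs k)" by (auto simp: inj_on_def)
 ultimately show ?thesis by (simp add: sum.reindex o_def case_prod_unfold)
qed

lemma sum_tree_pairs_swap: "(\<Sum>(g, h)\<in>tree_pairs k. F g h) = (\<Sum>(g, h)\<in>tree_pairs k. F h g)"
 by (rule sum.reindex_bij_witness[of _ prod.swap prod.swap]) (auto simp: tree_pairs_def)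

section \<open>Faces of lifts; coproduct and boundary of the sum over trees\<close>

definition dep :: "nat => lift => bool" where
 "dep a q \<longleftrightarrow> (\<forall>t t'. (\<forall>i<a. t i = t' i) --> q t = q t')"

text \<open>An idle coordinate of a lift makes the rotated cube degenerate, so functionals that come
  from cochains vanish on such lifts.\<close>

definition idg :: "nat => lift => bool" where
 "idg a q \<longleftrightarrow> (\<exists>i<a. \<forall>t t'. (\<forall>j. j ~= i --> t j = t' j) --> q t = q t')"

definition lface :: "face_word => lift => lift" where "lface u q = (%t. q (ins u t))"

lemma dep_tree_fun: "dep (tdim x) (tfun x)"
proof (induction x)
 case (Node g h)
 show ?case unfolding dep_def
 proof (intro allI impI)
  fix t t' :: "nat => real" assume t: "\<forall>i<2 * tsize (Node g h) + 1. t i = t' i"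
  have "tfun g (%i. t (Suc i)) = tfun g (%i. t' (Suc i))"
   by (rule Node(1)[unfolded dep_def, rule_format]) (use t in auto)
  moreover have "tfun h (%i. t (Suc (Suc (2 * tsize g + i)))) = tfun h (%i. t' (Suc (Suc (2 * tsize g + i))))"
   by (rule Node(2)[unfolded dep_def, rule_format]) (use t in auto)
  ultimately show "tfun (Node g h) t = tfun (Node g h) t'" using t by (simp add: cone_def ljoin_def)
 qed
qed (simp add: dep_def)

lemma dep_lface: "dep (length u) q ==> dep (nfree u) (lface u q)"
 unfolding dep_def lface_def
proof (intro allI impI)
 fix t t' :: "nat => real"
 assume q: "\<forall>t t'. (\<forall>i<length u. t i = t' i) --> q t = q t'" and t: "\<forall>i<nfree u. t i = t' i"
 show "q (ins u t) = q (ins u t')"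
  by (rule q[rule_format]) (auto simp: ins_nth t nfree_take_less split: option.splits)
qed

lemma lface_cone:
 "lface (None # u) (cone q) = cone (lface u q)" "lface (Some b # u) (cone q) = (%t. of_bool b * lface u q t)"
 by (auto simp: lface_def cone_def)

lemma ins_append: "ins (u @ v) t i = (if i < length u then ins u t i else ins v (%j. t (nfree u + j)) (i - length u))"
 by (auto simp: ins_nth nth_append split: option.split)

lemma lface_ljoin:
 assumes "dep (length u) g"
 shows "lface (u @ v) (ljoin (length u) g h) = ljoin (nfree u) (lface u g) (lface v h)"
proof
 fix t
 have "g (ins (u @ v) t) = g (ins u t)"
  by (rule assms[unfolded dep_def, rule_format]) (simp add: ins_append)
 then show "lface (u @ v) (ljoin (length u) g h) t = ljoin (nfree u) (lface u g) (lface v h) t"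
  by (simp add: lface_def ljoin_def ins_append)
qed

lemma lface_replicate: "dep m q ==> lface (free m) q = q"
proof
 fix t assume q: "dep m q"
 show "lface (free m) q t = q t"
  unfolding lface_def by (rule q[unfolded dep_def, rule_format]) (simp add: ins_nth min_def)
qed

lemma idg_cone: "idg a q ==> idg (Suc a) (cone q)"
 unfolding idg_def
proof (elim exE conjE)
 fix i assume i: "i < a" and q: "\<forall>t t'. (\<forall>j. j ~= i --> t j = t' j) --> q t = q t'"
 show "\<exists>i<Suc a. \<forall>t t'. (\<forall>j. j ~= i --> t j = t' j) --> cone q t = cone q t'"
 proof (intro exI[of _ "Suc i"] conjI allI impI)
  fix t t' :: "nat => real" assume t: "\<forall>j. j ~= Suc i --> t j = t' j"
  have "q (%i. t (Suc i)) = q (%i. t' (Suc i))" by (rule q[rule_format]) (use t in auto)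
  then show "cone q t = cone q t'" using t by (simp add: cone_def)
 qed (use i in simp)
qed

lemma idg_ljoin_left: "idg a q ==> idg (a + b) (ljoin a q h)"
 unfolding idg_def
proof (elim exE conjE)
 fix i assume i: "i < a" and q: "\<forall>t t'. (\<forall>j. j ~= i --> t j = t' j) --> q t = q t'"
 show "\<exists>i<a + b. \<forall>t t'. (\<forall>j. j ~= i --> t j = t' j) --> ljoin a q h t = ljoin a q h t'"
 proof (intro exI[of _ i] conjI allI impI)
  fix t t' :: "nat => real" assume t: "\<forall>j. j ~= i --> t j = t' j"
  have "q t = q t'" by (rule q[rule_format]) (use t in auto)
  then show "ljoin a q h t = ljoin a q h t'" using t i by (simp add: ljoin_def)
 qed (use i in simp)
qed

lemma idg_ljoin_right: "dep a g ==> idg b q ==> idg (a + b) (ljoin a g q)"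
 unfolding idg_def
proof (elim exE conjE)
 fix i assume g: "dep a g" and i: "i < b" and q: "\<forall>t t'. (\<forall>j. j ~= i --> t j = t' j) --> q t = q t'"
 show "\<exists>i<a + b. \<forall>t t'. (\<forall>j. j ~= i --> t j = t' j) --> ljoin a g q t = ljoin a g q t'"
 proof (intro exI[of _ "a + i"] conjI allI impI)
  fix t t' :: "nat => real" assume t: "\<forall>j. j ~= a + i --> t j = t' j"
  have "q (%i. t (a + i)) = q (%i. t' (a + i))" by (rule q[rule_format]) (use t in auto)
  moreover have "g t = g t'" by (rule g[unfolded dep_def, rule_format]) (use t in auto)
  ultimately show "ljoin a g q t = ljoin a g q t'" by (simp add: ljoin_def)
 qed (use i in simp)
qed

lemma idg_const: "0 < a ==> idg a (%t. c)" by (auto simp: idg_def)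

lemma ljoin_simps: "ljoin 0 (%t. c) h = (%t. c + h t)" "ljoin a g (%t. c) = (%t. g t + c)"
 "ljoin (a + b) (ljoin a f g) h = ljoin a f (ljoin b g h)"
 by (auto simp: ljoin_def add.assoc)

lemma boundary_append: "bdry (w @ w') F = bdry w (%u. F (u @ w')) + sg w * bdry w' (%u. F (w @ u))"
 by (induction w F rule: bdry.induct) (auto simp: word_lin algebra_simps)

text \<open>The sign comes from moving the front part of the second block past the back part of the
  first.\<close>

lemma diagonal_append:
 "diag (w @ w') F = diag w (%u v. diag w' (%u' v'. ksg v u' * F (u @ u') (v @ v')))"
proof (induction w arbitrary: F)
 case (Cons x w)
 have k: "(- 1 :: int) ^ (nfree u' + nfree v * nfree u') = sg u' * ksg v u'" for u' v :: face_word
  by (simp add: sg_def power_add)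
 show ?case by (cases x) (simp_all add: Cons word_lin algebra_simps k)
qed simp

lemma diagonal_sum_swap: "(\<Sum>h\<in>H. diag w (%u v. F h u v)) = diag w (%u v. \<Sum>h\<in>H. F h u v)"
 by (induction H rule: infinite_finite_induct) (auto simp: word_lin)

lemma boundary_sum_swap: "(\<Sum>h\<in>H. bdry w (%u. F h u)) = bdry w (%u. \<Sum>h\<in>H. F h u)"
 by (induction H rule: infinite_finite_induct) (auto simp: word_lin)

abbreviation full :: "tree => face_word" where "full x \<equiv> free (tdim x)"

abbreviation "dtree x F \<equiv> diag (full x) (%u v. F (nfree u) (lface u (tfun x)) (nfree v) (lface v (tfun x)))"
abbreviation "btree x F \<equiv> bdry (full x) (%u. F (nfree u) (lface u (tfun x)))"

lemma full_Node: "full (Node g h) = None # full g @ full h"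
 by (simp flip: replicate_add replicate_Suc)

lemma full_N: "lface (full g @ full h) (tjoin g h) = tjoin g h"
proof -
 have "length (full g) = tdim g" "nfree (full g) = tdim g" by simp_all
 then show ?thesis
  using lface_ljoin[of "full g" "tfun g" "full h" "tfun h"] lface_replicate[OF dep_tree_fun] dep_tree_fun[of g]
  by metis
qed

text \<open>The mixed terms of the node of \<open>g\<close>
 and \<open>h\<close> cancel against those of the node of \<open>h\<close> and \<open>g\<close>, because the cubes have odd
 dimension.\<close>

lemma diagonal_trees:
 assumes "!!a q b r. idg a q \<or> idg b r ==> \<Psi> a q b r = 0" and "!!a q b r. \<Psi> a q b (%t. r t + 1) = \<Psi> a q b r"
 shows "(\<Sum>x\<in>trees k. dtree x \<Psi>)
  = (\<Sum>x\<in>trees k. \<Psi> (tdim x) (tfun x) 0 (%_. 0) + \<Psi> 0 (%_. 0) (tdim x) (tfun x))"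
 using assms
proof (induction k arbitrary: \<Psi> rule: less_induct)
 case (less k)
 note z = less.prems(1) and i = less.prems(2)
 show ?case
 proof (cases k)
  case 0
  have "lface [None] (%t. t 0) = (%t. t 0)" "lface [Some True] (%t. t 0) = (%t. 0 + 1)" "lface [Some False] (%t. t 0) = (%t. 0)"
   by (auto simp: lface_def)
  then show ?thesis using i[of 1 "%t. t 0" 0 "%t. 0"] 0 by (simp add: trees_0)
 next
  case (Suc k')
  let ?N = "%g h. tjoin g h"
  let ?d = "%x. tdim x"
  \<comment> \<open>The faces \<open>u1\<close> and \<open>v1\<close> of the left subtree are
    absorbed into the functional, so that the induction hypothesis can be applied to the right
    subtree. This is the reason for allowing arbitrary functionals.\<close>
  define \<Theta> where "\<Theta> g u1 v1 a q b r = (- 1) ^ (nfree v1 * a) *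
   \<Psi> (Suc (nfree u1 + a)) (cone (ljoin (nfree u1) (lface u1 (tfun g)) q)) (nfree v1 + b) (ljoin (nfree v1) (lface v1 (tfun g)) r)"
   for g :: tree and u1 v1 :: face_word and a b :: nat and q r :: lift
  have step: "dtree (Node g h) \<Psi>
    = diag (full g) (%u1 v1. dtree h (\<Theta> g u1 v1))
    + \<Psi> 0 (%_. 0) (?d (Node g h)) (tfun (Node g h))" (is "?L = ?R + ?S") for g h
  proof -
   \<comment> \<open>With the root coordinate at 0 the lift is constantly zero, and degenerate
     unless no coordinate is left.\<close>
   have 1: "sg u * \<Psi> (nfree u) (lface (Some False # u) (cone (?N g h))) b r = of_bool (nfree u = 0) * \<Psi> 0 (%_. 0) b r" for u b r
    by (cases "nfree u = 0") (auto simp: lface_cone sg_def z idg_const)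
   have "?L = diag (full g @ full h) (%u v. \<Psi> (Suc (nfree u)) (cone (lface u (?N g h))) (nfree v) (lface v (?N g h)))
     + diag (full g @ full h) (%u v. of_bool (nfree u = 0) * \<Psi> 0 (%_. 0) (Suc (nfree v)) (cone (lface v (?N g h))))"
    unfolding full_Node diag.simps diagonal_lin tfun.simps nfree_simps 1 by (simp add: lface_cone)
   also have "diag (full g @ full h) (%u v. of_bool (nfree u = 0) * \<Psi> 0 (%_. 0) (Suc (nfree v)) (cone (lface v (?N g h)))) = ?S"
    unfolding diagonal_unit(1)[of "full g @ full h" "%v. \<Psi> 0 (%_. 0) (Suc (nfree v)) (cone (lface v (?N g h)))"] full_N
    by (simp add: algebra_simps)
   also have "diag (full g @ full h) (%u v. \<Psi> (Suc (nfree u)) (cone (lface u (?N g h))) (nfree v) (lface v (?N g h))) = ?R"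
    unfolding diagonal_append
   proof (intro diagonal_cong)
    fix u1 v1 u2 v2 :: face_word assume l: "length u1 = length (full g)" "length v1 = length (full g)"
    have "lface (u1 @ u2) (?N g h) = ljoin (nfree u1) (lface u1 (tfun g)) (lface u2 (tfun h))" for u2
     using lface_ljoin[of u1 "tfun g" u2 "tfun h"] dep_tree_fun[of g] l by (simp del: replicate.simps)
    moreover have "lface (v1 @ v2) (?N g h) = ljoin (nfree v1) (lface v1 (tfun g)) (lface v2 (tfun h))" for v2
     using lface_ljoin[of v1 "tfun g" v2 "tfun h"] dep_tree_fun[of g] l by (simp del: replicate.simps)
    ultimately show "ksg v1 u2 * \<Psi> (Suc (nfree (u1 @ u2))) (cone (lface (u1 @ u2) (?N g h))) (nfree (v1 @ v2)) (lface (v1 @ v2) (?N g h))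
     = \<Theta> g u1 v1 (nfree u2) (lface u2 (tfun h)) (nfree v2) (lface v2 (tfun h))"
     by (simp only: \<Theta>_def nfree_simps)
   qed
   finally show ?thesis .
  qed
  have \<Theta>0: "\<Theta> g u v a q b r = 0" if "idg a q \<or> idg b r" "length u = length (full g)" "length v = length (full g)" for g u v a q b r
  proof -
   have "dep (nfree u) (lface u (tfun g))" "dep (nfree v) (lface v (tfun g))"
    using dep_lface dep_tree_fun[of g] that by simp_all
   then have "idg (Suc (nfree u + a)) (cone (ljoin (nfree u) (lface u (tfun g)) q)) \<or> idg (nfree v + b) (ljoin (nfree v) (lface v (tfun g)) r)"
    using that(1) idg_ljoin_right idg_cone by blast
   then show ?thesis by (simp add: \<Theta>_def z)
  qed
  have \<Theta>1: "\<Theta> g u v a q b (%t. r t + 1) = \<Theta> g u v a q b r" for g u v a q b r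
  proof -
   have "ljoin c l (%t. r t + 1) = (%t. ljoin c l r t + 1)" for c l by (simp add: ljoin_def add.assoc)
   then show ?thesis by (simp add: \<Theta>_def i)
  qed
  \<comment> \<open>Now the right subtree lies wholly in the front or wholly in the back, and is
    absorbed in turn. The sign \<open>(-1) ^ b\<close> is what remains of the Koszul sign because
    the dimension of \<open>h\<close> is odd.\<close>
  define \<Omega> where "\<Omega> h a q b r = (- 1) ^ b * \<Psi> (Suc (a + ?d h)) (cone (ljoin a q (tfun h))) b (ljoin b r (%_. 0))
    + \<Psi> (Suc a) (cone (ljoin a q (%_. 0))) (b + ?d h) (ljoin b r (tfun h))" for h a q b r
  have in_h: "(\<Sum>h\<in>trees (k' - tsize g). diag (full g) (%u1 v1. dtree h (\<Theta> g u1 v1)))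
    = (\<Sum>h\<in>trees (k' - tsize g). dtree g (\<Omega> h))" for g
   unfolding diagonal_sum_swap
  proof (rule diagonal_cong)
   fix u v :: face_word assume l: "length u = length (full g)" "length v = length (full g)"
   have "(\<Sum>h\<in>trees (k' - tsize g). dtree h (\<Theta> g u v))
    = (\<Sum>h\<in>trees (k' - tsize g). \<Theta> g u v (?d h) (tfun h) 0 (%_. 0) + \<Theta> g u v 0 (%_. 0) (?d h) (tfun h))"
   proof (rule less.IH)
    show "k' - tsize g < k" using Suc by simp
    show "\<Theta> g u v a q b r = 0" if "idg a q \<or> idg b r" for a q b r using that l by (rule \<Theta>0)
    show "\<Theta> g u v a q b (%t. r t + 1) = \<Theta> g u v a q b r" for a q b r by (rule \<Theta>1)
   qed
   also have "... = (\<Sum>h\<in>trees (k' - tsize g). \<Omega> h (nfree u) (lface u (tfun g)) (nfree v) (lface v (tfun g)))"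
   proof (rule sum.cong[OF refl])
    fix h
    have "(- 1 :: int) ^ (m * (tdim h)) = (- 1) ^ m" for m by (simp add: minus_one_power_iff)
    then show "\<Theta> g u v (?d h) (tfun h) 0 (%_. 0) + \<Theta> g u v 0 (%_. 0) (?d h) (tfun h) =
     \<Omega> h (nfree u) (lface u (tfun g)) (nfree v) (lface v (tfun g))"
     unfolding \<Omega>_def \<Theta>_def by simp
   qed
   finally show "(\<Sum>h\<in>trees (k' - tsize g). dtree h (\<Theta> g u v))
    = (\<Sum>h\<in>trees (k' - tsize g). \<Omega> h (nfree u) (lface u (tfun g)) (nfree v) (lface v (tfun g)))" .
  qed
  have \<Omega>0: "\<Omega> h a q b r = 0" if "idg a q \<or> idg b r" for h a q b r
  proof -
   have "idg (Suc (a + c)) (cone (ljoin a q l))" "idg (Suc a) (cone (ljoin a q l))" if "idg a q" for c l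
    using idg_cone[OF idg_ljoin_left[OF that, of _ l], of c] idg_cone[OF idg_ljoin_left[OF that, of _ l], of 0] by simp_all
   moreover have "idg (b + c) (ljoin b r l)" "idg b (ljoin b r l)" if "idg b r" for c l
    using idg_ljoin_left[OF that, of c l] idg_ljoin_left[OF that, of 0 l] by simp_all
   ultimately have "idg (Suc (a + ?d h)) (cone (ljoin a q (tfun h))) \<or> idg b (ljoin b r (%_. 0))"
    "idg (Suc a) (cone (ljoin a q (%_. 0))) \<or> idg (b + ?d h) (ljoin b r (tfun h))" using that by blast+
   then show ?thesis unfolding \<Omega>_def by (simp only: z mult_zero_right add_0_right)
  qed
  have \<Omega>1: "\<Omega> h a q b (%t. r t + 1) = \<Omega> h a q b r" for h a q b r
  proof -
   have "ljoin c (%t. r t + 1) l = (%t. ljoin c r l t + 1)" for c l by (simp add: ljoin_def algebra_simps)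
   then show ?thesis by (simp add: \<Omega>_def i)
  qed
  have "(\<Sum>(g, h)\<in>tree_pairs k'. diag (full g) (%u1 v1. dtree h (\<Theta> g u1 v1)))
   = (\<Sum>h | tsize h \<le> k'. \<Sum>g\<in>trees (k' - tsize h). dtree g (\<Omega> h))"
   unfolding sum_tree_pairs(1) case_prod_conv in_h
   unfolding sum_tree_pairs(2)[of "%(g, h). dtree g (\<Omega> h)", unfolded case_prod_conv, symmetric]
   by (simp only: sum_tree_pairs(1) case_prod_conv)
  also have "... = (\<Sum>h | tsize h \<le> k'. \<Sum>g\<in>trees (k' - tsize h). \<Omega> h (?d g) (tfun g) 0 (%_. 0) + \<Omega> h 0 (%_. 0) (?d g) (tfun g))"
  proof (rule sum.cong[OF refl], rule less.IH)
   fix h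
   show "k' - tsize h < k" using Suc by simp
   show "\<Omega> h a q b r = 0" if "idg a q \<or> idg b r" for a q b r using that by (rule \<Omega>0)
   show "\<Omega> h a q b (%t. r t + 1) = \<Omega> h a q b r" for a q b r by (rule \<Omega>1)
  qed
  also have "... = (\<Sum>(g, h)\<in>tree_pairs k'. \<Omega> h (?d g) (tfun g) 0 (%_. 0) + \<Omega> h 0 (%_. 0) (?d g) (tfun g))"
   by (simp only: sum_tree_pairs(2) case_prod_conv)
  \<comment> \<open>With both subtrees in the back, the front is the cone of zero on one coordinate,
    which is degenerate; the other three distributions remain.\<close>
  also have "... = (\<Sum>(g, h)\<in>tree_pairs k'. \<Psi> (?d (Node g h)) (tfun (Node g h)) 0 (%_. 0))
   + ((\<Sum>(g, h)\<in>tree_pairs k'. \<Psi> (Suc (?d g)) (cone (tfun g)) (?d h) (tfun h))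
    - (\<Sum>(g, h)\<in>tree_pairs k'. \<Psi> (Suc (?d h)) (cone (tfun h)) (?d g) (tfun g)))"
   unfolding sum.distrib[symmetric] sum_subtractf[symmetric]
  proof (intro sum.cong refl, clarify)
   fix g h
   have c0: "cone (%_. 0) = (%_. 0)" by (simp add: cone_def)
   have "\<Psi> 1 (%_. 0) b r = 0" for b r by (simp add: z idg_const)
   then show "\<Omega> h (?d g) (tfun g) 0 (%_. 0) + \<Omega> h 0 (%_. 0) (?d g) (tfun g) =
     \<Psi> (?d (Node g h)) (tfun (Node g h)) 0 (%_. 0)
     + (\<Psi> (Suc (?d g)) (cone (tfun g)) (?d h) (tfun h) - \<Psi> (Suc (?d h)) (cone (tfun h)) (?d g) (tfun g))"
    by (simp add: \<Omega>_def ljoin_simps c0)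
  qed
  also have "... = (\<Sum>(g, h)\<in>tree_pairs k'. \<Psi> (?d (Node g h)) (tfun (Node g h)) 0 (%_. 0))"
   by (subst (3) sum_tree_pairs_swap) simp
  finally show ?thesis unfolding Suc sum_trees_Suc step by (simp add: sum.distrib case_prod_unfold)
 qed
qed

text \<open>The contributions of the inner edges cancel by associativity.\<close>

lemma boundary_trees:
 assumes "!!a q. idg a q ==> \<Psi> a q = 0"
 shows "(\<Sum>x\<in>trees k. btree x \<Psi>)
  = (if k = 0 then \<Psi> 0 (%_. 0) - \<Psi> 0 (%_. 1)
    else - (\<Sum>(g, h)\<in>tree_pairs (k - 1). \<Psi> (2 * k) (tjoin g h)))"
 using assms
proof (induction k arbitrary: \<Psi> rule: less_induct)
 case (less k)
 note z = less.prems
 show ?case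
 proof (cases k)
  case 0
  have "lface [Some True] (%t. t 0) = (%t. 1)" "lface [Some False] (%t. t 0) = (%t. 0)"
   by (auto simp: lface_def)
  then show ?thesis using 0 by (simp add: trees_0)
 next
  case (Suc k')
  let ?N = "%g h. tjoin g h"
  let ?d = "%x. tdim x"
  \<comment> \<open>Faces taken inside the left subtree, seen through the surrounding node;
    \<open>\<Lambda>'\<close> does the same for the right subtree. The odd dimension of the left
    subtree gives the two families opposite signs.\<close>
  define \<Lambda> where "\<Lambda> h a q = \<Psi> (Suc (a + ?d h)) (cone (ljoin a q (tfun h)))" for h a q
  define \<Lambda>' where "\<Lambda>' g a q = \<Psi> (Suc (?d g + a)) (cone (ljoin (?d g) (tfun g) q))" for g a q
  have step: "btree (Node g h) \<Psi>
    = - \<Psi> (2 * k) (?N g h) - btree g (\<Lambda> h)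
     + btree h (\<Lambda>' g)" if "tsize g + tsize h = k'" for g h
  proof -
   have e: "nfree (full g @ full h) = 2 * k" using that Suc by simp
   have k: "2 * k > 0" using Suc by simp
   have 1: "bdry (full g) (%u. \<Psi> (Suc (nfree (u @ full h))) (cone (lface (u @ full h) (?N g h)))) = btree g (\<Lambda> h)"
   proof (rule boundary_cong)
    fix u :: face_word assume l: "length u = length (full g)"
    have "lface (u @ full h) (?N g h) = ljoin (nfree u) (lface u (tfun g)) (tfun h)"
     using lface_ljoin[of u "tfun g" "full h" "tfun h"] dep_tree_fun[of g] lface_replicate[OF dep_tree_fun, of h] l by (simp del: replicate.simps)
    then show "\<Psi> (Suc (nfree (u @ full h))) (cone (lface (u @ full h) (?N g h))) = \<Lambda> h (nfree u) (lface u (tfun g))"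
     by (simp only: \<Lambda>_def nfree_simps)
   qed
   have 2: "bdry (full h) (%u. \<Psi> (Suc (nfree (full g @ u))) (cone (lface (full g @ u) (?N g h)))) = btree h (\<Lambda>' g)"
   proof (rule boundary_cong)
    fix u :: face_word
    have "lface (full g @ u) (?N g h) = ljoin (?d g) (tfun g) (lface u (tfun h))"
     using lface_ljoin[of "full g" "tfun g" u "tfun h"] dep_tree_fun[of g] lface_replicate[OF dep_tree_fun, of g] by (simp del: replicate.simps)
    then show "\<Psi> (Suc (nfree (full g @ u))) (cone (lface (full g @ u) (?N g h))) = \<Lambda>' g (nfree u) (lface u (tfun h))"
     by (simp only: \<Lambda>'_def nfree_simps)
   qed
   have "btree (Node g h) \<Psi>
    = - (\<Psi> (2 * k) (lface (full g @ full h) (?N g h)) - \<Psi> (2 * k) (%_. 0)) - bdry (full g @ full h) (%u. \<Psi> (Suc (nfree u)) (cone (lface u (?N g h))))"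
    unfolding full_Node bdry.simps tfun.simps nfree_simps(2,3) e lface_cone by simp
   also have "... = - \<Psi> (2 * k) (?N g h) - bdry (full g @ full h) (%u. \<Psi> (Suc (nfree u)) (cone (lface u (?N g h))))"
    using z[OF idg_const[OF k]] full_N by simp
   finally show ?thesis unfolding boundary_append 1 2 by (simp add: sg_def)
  qed
  have \<Lambda>0: "idg a q ==> \<Lambda> h a q = 0" "idg a q ==> \<Lambda>' g a q = 0" for h g a q
   using z[OF idg_cone[OF idg_ljoin_left[of a q "?d h" "tfun h"]]] z[OF idg_cone[OF idg_ljoin_right[OF dep_tree_fun, of a q g]]]
   by (simp_all only: \<Lambda>_def \<Lambda>'_def)
  have AB: "(\<Sum>h | tsize h \<le> k'. \<Sum>g\<in>trees (k' - tsize h). btree g (L h))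
   = (\<Sum>h\<in>trees k'. L h 0 (%_. 0) - L h 0 (%_. 1))
    - (\<Sum>h | tsize h < k'. \<Sum>(f, g)\<in>tree_pairs (k' - tsize h - 1). L h (2 * (k' - tsize h)) (?N f g))"
   if "!!h a q. idg a q ==> L h a q = 0" for L :: "tree => nat => lift => int"
  proof -
   have ih: "(\<Sum>g\<in>trees (k' - tsize h). btree g (L h))
    = (if k' - tsize h = 0 then L h 0 (%_. 0) - L h 0 (%_. 1) else - (\<Sum>(f, g)\<in>tree_pairs (k' - tsize h - 1). L h (2 * (k' - tsize h)) (?N f g)))" for h
    by (rule less.IH[OF _ that]) (use Suc in simp)
   show ?thesis unfolding ih by (rule sum_tree_cases)
  qed
  note A = trans[OF sum_tree_pairs(2)[of "%(g, h). btree g (\<Lambda> h)" k', unfolded case_prod_conv] AB[of \<Lambda>, OF \<Lambda>0(1)]]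
  note B = trans[OF sum_tree_pairs(1)[of "%(g, h). btree h (\<Lambda>' g)" k', unfolded case_prod_conv] AB[of \<Lambda>', OF \<Lambda>0(2)]]
  have C: "(\<Sum>h\<in>trees k'. \<Lambda> h 0 (%_. 0) - \<Lambda> h 0 (%_. 1)) = (\<Sum>g\<in>trees k'. \<Lambda>' g 0 (%_. 0) - \<Lambda>' g 0 (%_. 1))"
   by (simp add: \<Lambda>_def \<Lambda>'_def ljoin_simps add.commute)
  \<comment> \<open>Both sums run over triples of trees, bracketed from the left and from the right,
    and \<open>ljoin\<close> is associative.\<close>
  have D: "(\<Sum>h | tsize h < k'. \<Sum>(f, g)\<in>tree_pairs (k' - tsize h - 1). \<Lambda> h (2 * (k' - tsize h)) (?N f g))
   = (\<Sum>f | tsize f < k'. \<Sum>(g, h)\<in>tree_pairs (k' - tsize f - 1). \<Lambda>' f (2 * (k' - tsize f)) (?N g h))"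
  proof -
   have fin: "finite {h. tsize h < k'}" by (rule finite_subset[OF _ finite_trees_le[of k']]) auto
   have d: "2 * (k' - tsize h) = ?d (fst x) + ?d (snd x)" if "tsize h < k'" "x \<in> tree_pairs (k' - tsize h - 1)" for h x
    using that by (cases x) (auto simp: tree_pairs_def)
   have "(\<Sum>h | tsize h < k'. \<Sum>x\<in>tree_pairs (k' - tsize h - 1). \<Lambda> h (2 * (k' - tsize h)) (?N (fst x) (snd x)))
    = (\<Sum>h | tsize h < k'. \<Sum>x\<in>tree_pairs (k' - tsize h - 1). \<Lambda> h (?d (fst x) + ?d (snd x)) (?N (fst x) (snd x)))"
    by (intro sum.cong refl) (simp only: mem_Collect_eq d)
   also have "... = (\<Sum>h | tsize h < k'. \<Sum>x\<in>tree_pairs (k' - tsize h - 1). \<Lambda>' h (?d (fst x) + ?d (snd x)) (?N (fst x) (snd x)))"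
    unfolding sum.Sigma[OF fin ballI[OF finite_tree_pairs]] case_prod_unfold
    by (rule sum.reindex_bij_witness[of _ "%(f, (g, h)). (h, (f, g))" "%(h, (f, g)). (f, (g, h))"])
     (auto simp: tree_pairs_def \<Lambda>_def \<Lambda>'_def ljoin_simps[symmetric] algebra_simps)
   also have "... = (\<Sum>h | tsize h < k'. \<Sum>x\<in>tree_pairs (k' - tsize h - 1). \<Lambda>' h (2 * (k' - tsize h)) (?N (fst x) (snd x)))"
    by (intro sum.cong refl) (simp only: mem_Collect_eq d)
   finally show ?thesis by (simp only: case_prod_unfold)
  qed
  have "(\<Sum>(g, h)\<in>tree_pairs k'. btree (Node g h) \<Psi>)
   = (\<Sum>(g, h)\<in>tree_pairs k'. - \<Psi> (2 * k) (?N g h) - btree g (\<Lambda> h)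
     + btree h (\<Lambda>' g))"
  proof (intro sum.cong refl)
   fix x assume "x \<in> tree_pairs k'"
   then show "(case x of (g, h) => btree (Node g h) \<Psi>) =
    (case x of (g, h) => - \<Psi> (2 * k) (?N g h) - btree g (\<Lambda> h)
     + btree h (\<Lambda>' g))"
    using step by (cases x) (simp only: tree_pairs_def mem_Collect_eq case_prod_conv)
  qed
  also have "... = - (\<Sum>(g, h)\<in>tree_pairs k'. \<Psi> (2 * k) (?N g h))"
   using A B C D by (simp only: case_prod_unfold sum.distrib sum_subtractf sum_negf)
  finally show ?thesis using Suc by (simp only: sum_trees_Suc) simp
 qed
qed

section \<open>Rotation of cubes of loops\<close>

definition ract :: "nat => lift => nat => (complex => 'y) cube => (complex => 'y) cube" where
 "ract a q m V = (\<lambda>t\<in>pts (a + m). \<lambda>u\<in>sphere 0 1. V (%i. t (a + i)) (cis (2 * pi * q t) * u))"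

abbreviation "tract x \<equiv> ract (tdim x) (tfun x)"

lemma shift_pts: "t \<in> pts (a + m) ==> (%i. t (a + i)) \<in> pts m"
 by (auto simp: pts_iff extensional_def)

lemma act_cube_eq:
 assumes "dep a q"
 shows "act_cube a (\<lambda>t\<in>pts a. cis (2 * pi * q t)) m V = ract a q m V"
proof
 fix t show "act_cube a (\<lambda>t\<in>pts a. cis (2 * pi * q t)) m V t = ract a q m V t"
 proof (cases "t \<in> pts (a + m)")
  case True
  then have "(\<lambda>i\<in>{..<a}. t i) \<in> pts a" "(\<lambda>i\<in>{..<m}. t (a + i)) = (%i. t (a + i))"
   by (auto simp: pts_iff extensional_def fun_eq_iff)
  moreover have "q (\<lambda>i\<in>{..<a}. t i) = q t" by (rule assms[unfolded dep_def, rule_format]) simp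
  ultimately show ?thesis using True by (simp add: act_cube_def ract_def rotate_loop_def)
 qed (simp add: act_cube_def ract_def)
qed

lemma sum_tree_pairs_index: "sum F (tree_pairs k) = (\<Sum>i\<le>k. \<Sum>g\<in>trees i. \<Sum>h\<in>trees (k - i). F (g, h))"
proof -
 have "sum F (tree_pairs k) = (\<Sum>x\<in>(\<Union>i\<le>k. trees i \<times> trees (k - i)). F x)"
  by (rule sum.cong) (auto simp: tree_pairs_def trees_def)
 also have "... = (\<Sum>i\<le>k. \<Sum>x\<in>trees i \<times> trees (k - i). F x)"
  by (rule sum.UNION_disjoint) (simp, simp, auto simp: trees_def)
 finally show ?thesis by (simp add: sum.cartesian_product)
qed

lemma omega_op_eq:
 "omega X k f m V = (if singular m (loops X) V
   then \<Sum>x\<in>trees k. f (tdim x + m) (tract x m V) else 0)"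
proof (cases "singular m (loops X) V")
 case True
 have "{f. rot_family k f} = tfun ` trees k" by (auto simp: rot_family_iff trees_def)
 moreover have "inj_on tfun (trees k)" by (auto intro: inj_onI inj_tree_fun)
 ultimately have "rot_chain k = (\<Sum>x\<in>trees k. frag_of (\<lambda>t\<in>pts (2 * k + 1). cis (2 * pi * tfun x t)))"
  by (simp add: rot_chain_def sum.reindex)
 then have "omega X k f m V = (\<Sum>x\<in>trees k. f (2 * k + 1 + m) (act_cube (2 * k + 1) (\<lambda>t\<in>pts (2 * k + 1). cis (2 * pi * tfun x t)) m V))"
  using True by (simp add: omega_op_def frag_extend_sum evaluate_sum del: Suc_eq_plus1)
 also have "... = (\<Sum>x\<in>trees k. f (tdim x + m) (tract x m V))"
 proof (rule sum.cong[OF refl])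
  fix x assume "x \<in> trees k"
  then have k: "k = tsize x" by (simp add: trees_def)
  show "f (2 * k + 1 + m) (act_cube (2 * k + 1) (\<lambda>t\<in>pts (2 * k + 1). cis (2 * pi * tfun x t)) m V) = f (tdim x + m) (tract x m V)"
   unfolding k act_cube_eq[OF dep_tree_fun] ..
 qed
 finally show ?thesis using True by simp
qed (simp add: omega_op_def)

lemma continuous_map_tree_fun:
 "(!!i. i < tdim x ==> continuous_map Y euclideanreal (%y. s y i)) ==> continuous_map Y euclideanreal (%y. tfun x (s y))"
proof (induction x arbitrary: s)
 case (Node g h)
 show ?case unfolding tfun.simps cone_def ljoin_def
  by (intro continuous_map_real_mult continuous_map_add Node) auto
qed simp

lemma continuous_map_shift: "continuous_map (std_cube (a + m)) (std_cube m) (%t i. t (a + i))"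
 unfolding continuous_map_std_cube by (simp add: continuous_map_coordinate pts_iff extensional_def image_subset_iff)

lemma continuous_map_circle_mult:
 assumes "continuous_map Y (top_of_set (sphere 0 1)) f" "continuous_map Y (top_of_set (sphere 0 1)) g"
 shows "continuous_map Y (top_of_set (sphere 0 1)) (%y. f y * g y :: complex)"
proof -
 have "continuous_map Y euclidean (%y. f y * g y)"
  using assms unfolding continuous_map_in_subtopology by (simp add: continuous_map_atin tendsto_mult)
 then show ?thesis using assms unfolding continuous_map_in_subtopology Pi_iff by (auto simp: norm_mult)
qed

lemma singular_ract:
 assumes V: "singular m (loops X) V"
 shows "singular (tdim x + m) (loops X) (tract x m V)"
proof -
 let ?a = "tdim x"
 let ?Y = "prod_topology (std_cube (?a + m)) (top_of_set (sphere 0 1 :: complex set))"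
 have c: "continuous_map ?Y euclideanreal (%y. fst y i)" if "i < ?a" for i
  using continuous_map_compose[OF continuous_map_fst continuous_map_interval_real[OF continuous_map_coordinate, of i "?a + m"]] that
  by (simp add: o_def)
 have "continuous_map ?Y X (%y. V (%i. fst y (?a + i)) (cis (2 * pi * tfun x (fst y)) * snd y))"
  by (intro continuous_map_loop_cube[OF V] continuous_map_circle_mult continuous_map_cis continuous_map_tree_fun c continuous_map_snd
    continuous_map_compose[OF continuous_map_fst continuous_map_shift, unfolded o_def])
 then have "continuous_map ?Y X (%(t, u). ract ?a (tfun x) m V t u)"
  by (rule continuous_map_eq) (auto simp: ract_def)
 then show ?thesis by (auto simp: singular_loop_cube ract_def)
qed

lemma fc_ract:
 assumes "dep (length u) q"
 shows "fc (u @ v) (ract (length u) q (length v) V) = ract (nfree u) (lface u q) (nfree v) (fc v V)"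
proof
 fix t show "fc (u @ v) (ract (length u) q (length v) V) t = ract (nfree u) (lface u q) (nfree v) (fc v V) t"
 proof (cases "t \<in> pts (nfree u + nfree v)")
  case True
  have 1: "ins (u @ v) t \<in> pts (length u + length v)" using ins_pts[of t "u @ v"] True by simp
  have 2: "(%i. ins (u @ v) t (length u + i)) = ins v (%i. t (nfree u + i))"
   by (simp add: ins_append fun_eq_iff)
  have 3: "q (ins (u @ v) t) = lface u q t"
   unfolding lface_def by (rule assms[unfolded dep_def, rule_format]) (simp add: ins_append)
  show ?thesis using True 1 shift_pts[OF True] by (simp add: fc_def[of "u @ v"] ract_def 2 3) (simp add: fc_def)
 qed (simp add: fc_def ract_def)
qed

lemma ev_ract:
 "length v = m ==> length u = tdim x ==>
  ev f (tract x m V) (u @ v) = f (nfree u + nfree v) (ract (nfree u) (lface u (tfun x)) (nfree v) (fc v V))"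
 using fc_ract[of u "tfun x" v V] dep_tree_fun[of x] by (simp add: ev_def)

lemma degenerate_ract_lift:
 assumes "idg a q"
 shows "degenerate_cube (a + m) (ract a q m V)"
proof -
 from assms obtain i where i: "i < a" and q: "!!t t'. (!!j. j ~= i ==> t j = t' j) ==> q t = q t'"
  unfolding idg_def by blast
 have "indep (a + m) (ract a q m V) i"
  unfolding indep_def
 proof (intro ballI impI)
  fix t t' assume t: "t \<in> pts (a + m)" "t' \<in> pts (a + m)" "\<forall>j. j ~= i --> t j = t' j"
  have "q t = q t'" using q t(3) by blast
  moreover have "(%j. t (a + j)) = (%j. t' (a + j))" using t(3) i by auto
  ultimately show "ract a q m V t = ract a q m V t'" using t by (simp add: ract_def)
 qed
 then show ?thesis using i unfolding degenerate_iff by (intro exI[of _ i]) simp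
qed

lemma degenerate_ract:
 assumes q: "dep a q" and "degenerate_cube m V"
 shows "degenerate_cube (a + m) (ract a q m V)"
proof -
 from assms obtain i where i: "i < m" "indep m V i" by (auto simp: degenerate_iff)
 have "indep (a + m) (ract a q m V) (a + i)"
  unfolding indep_def
 proof (intro ballI impI)
  fix t t' assume t: "t \<in> pts (a + m)" "t' \<in> pts (a + m)" "\<forall>j. j ~= a + i --> t j = t' j"
  have "q t = q t'" by (rule q[unfolded dep_def, rule_format]) (use t in auto)
  moreover have "V (%j. t (a + j)) = V (%j. t' (a + j))"
   using i(2)[unfolded indep_def, rule_format, OF shift_pts[OF t(1)] shift_pts[OF t(2)]] t(3) by simp
  ultimately show "ract a q m V t = ract a q m V t'" using t by (simp add: ract_def)
 qed
 then show ?thesis using i unfolding degenerate_iff by (intro exI[of _ "a + i"]) simp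
qed

lemma cis_add_one: "cis (2 * pi * (x + 1)) = cis (2 * pi * x)"
 by (simp add: distrib_left flip: cis_mult)

text \<open>Full turns act trivially, and successive rotations add their angles over concatenated
  parameters, which is what \<open>ljoin\<close> records.\<close>

lemma ract_simps:
 "ract a (%t. q t + 1) m V = ract a q m V"
 "singular m (loops X) V ==> ract 0 (%_. 0) m V = V" "ract 0 (%_. 1) m V = ract 0 (%_. 0) m V"
 "ract b p (a + m) (ract a q m V) = ract (b + a) (ljoin b p q) m V"
proof -
 show "ract a (%t. q t + 1) m V = ract a q m V" unfolding ract_def cis_add_one ..
 show "ract 0 (%_. 1) m V = ract 0 (%_. 0) m V" using cis_add_one[of 0] by (simp add: ract_def)
 show "singular m (loops X) V ==> ract 0 (%_. 0) m V = V"
  by (auto simp: ract_def singular_loop_cube fun_eq_iff extensional_def)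
 show "ract b p (a + m) (ract a q m V) = ract (b + a) (ljoin b p q) m V"
 proof
  fix t show "ract b p (a + m) (ract a q m V) t = ract (b + a) (ljoin b p q) m V t"
  proof (cases "t \<in> pts (b + a + m)")
   case True
   have c: "cis (2 * pi * q (%i. t (b + i))) * (cis (2 * pi * p t) * u) = cis (2 * pi * (p t + q (%i. t (b + i)))) * u" for u
    by (simp add: distrib_left mult_ac flip: cis_mult)
   have "(%i. t (b + i)) \<in> pts (a + m)" using shift_pts[of t b "a + m"] True by (simp add: add.assoc)
   then show ?thesis using True by (auto simp: ract_def add.assoc norm_mult c ljoin_def fun_eq_iff)
  qed (simp add: ract_def add.assoc)
 qed
qed

lemma omega_lin [simp]:
 "omega X k (f + g) = omega X k f + omega X k g" "omega X k (f - g) = omega X k f - omega X k g"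
 "omega X k (- f) = - omega X k f" "omega X k 0 = 0" "omega X k (scale c f) = scale c (omega X k f)"
 by (auto simp: fun_eq_iff omega_op_eq scale_def sum.distrib sum_subtractf sum_negf sum_distrib_left)

lemma omega_in:
 assumes "f \<in> cochains (loops X) S"
 shows "omega X k f \<in> cochains (loops X) {m. 2 * k + 1 + m \<in> S}"
 unfolding cochains_def
proof (intro CollectI allI impI conjI notI)
 fix m V assume nz: "omega X k f m V ~= 0"
 then show V: "singular m (loops X) V" by (simp add: omega_op_eq split: if_splits)
 then obtain x where x: "x \<in> trees k" "f (tdim x + m) (tract x m V) ~= 0"
  using nz by (force simp: omega_op_eq elim!: sum.not_neutral_contains_not_neutral)
 then show "2 * k + 1 + m \<in> S" using cochains_zero[OF assms] by (auto simp: trees_def)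
 assume "degenerate_cube m V"
 then show False using x(2) cochains_zero[OF assms] degenerate_ract[OF dep_tree_fun] by blast
qed

lemma ev_omega:
 "singular (length w) (loops X) V ==>
  ev (omega X k f) V w = (\<Sum>x\<in>trees k. f (tdim x + nfree w) (tract x (nfree w) (fc w V)))"
 using singular_fc[of w "loops X" V] by (simp add: ev_def omega_op_eq)

lemma sum_apply2: "(\<Sum>i\<in>I. f i) m T = (\<Sum>i\<in>I. f i m T :: int)"
 by (induction I rule: infinite_finite_induct) auto

text \<open>The root faces in \<open>boundary_trees\<close> are joins of two trees, hence composites
  of two operations; this is what lets the orbit differential square to zero. For
  \<open>k = 0\<close> the two ends of the circle coincide and the boundary term disappears.\<close>

lemma omega_codiff:
 assumes f: "f \<in> cochains (loops X) S"
 shows "codiff (loops X) (omega X k f) + omega X k (codiff (loops X) f)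
  = - (\<Sum>i<k. omega X i (omega X (k - 1 - i) f))" (is "?l = ?r")
proof (intro cochain_eqI)
 fix m V show "?l m V = ?r m V"
 proof (cases "singular m (loops X) V")
  case V: True
  let ?w = "free m :: face_word"
  define \<Psi> where "\<Psi> a q = f (a + m) (ract a q m V)" for a q
  have "omega X k (codiff (loops X) f) m V = (\<Sum>x\<in>trees k. bdry (full x @ ?w) (ev f (tract x m V)))"
   using V by (simp only: omega_op_eq cube_codiff_eq[OF singular_ract[OF V]] replicate_add if_True)
  also have "... = (\<Sum>x\<in>trees k. bdry (full x) (%u. \<Psi> (nfree u) (lface u (tfun x)))
    - bdry ?w (%v. f (tdim x + nfree v) (tract x (nfree v) (fc v V))))"
  proof (rule sum.cong[OF refl])
   fix x
   have "bdry (full x) (%u. ev f (tract x m V) (u @ ?w)) = bdry (full x) (%u. \<Psi> (nfree u) (lface u (tfun x)))"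
    using V by (intro boundary_cong, subst ev_ract) (auto simp: \<Psi>_def fc_replicate)
   moreover have "bdry ?w (%v. ev f (tract x m V) (full x @ v)) = bdry ?w (%v. f (tdim x + nfree v) (tract x (nfree v) (fc v V)))"
   proof (rule boundary_cong)
    fix v :: face_word assume "length v = length ?w"
    then have "ev f (tract x m V) (full x @ v) = f (nfree (full x) + nfree v) (ract (nfree (full x)) (lface (full x) (tfun x)) (nfree v) (fc v V))"
     by (intro ev_ract) (simp_all del: replicate.simps)
    then show "ev f (tract x m V) (full x @ v) = f (tdim x + nfree v) (tract x (nfree v) (fc v V))"
     unfolding lface_replicate[OF dep_tree_fun] nfree_simps .
   qed
   ultimately show "bdry (full x @ ?w) (ev f (tract x m V)) = bdry (full x) (%u. \<Psi> (nfree u) (lface u (tfun x)))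
    - bdry ?w (%v. f (tdim x + nfree v) (tract x (nfree v) (fc v V)))"
    unfolding boundary_append by (simp add: sg_def)
  qed
  also have "... = (\<Sum>x\<in>trees k. bdry (full x) (%u. \<Psi> (nfree u) (lface u (tfun x)))) - bdry ?w (ev (omega X k f) V)"
  proof -
   have "bdry ?w (ev (omega X k f) V) = bdry ?w (%v. \<Sum>x\<in>trees k. f (tdim x + nfree v) (tract x (nfree v) (fc v V)))"
    using V by (intro boundary_cong) (simp add: ev_omega)
   then show ?thesis by (simp only: sum_subtractf boundary_sum_swap)
  qed
  also have "(\<Sum>x\<in>trees k. bdry (full x) (%u. \<Psi> (nfree u) (lface u (tfun x)))) =
   (if k = 0 then \<Psi> 0 (%_. 0) - \<Psi> 0 (%_. 1)
    else - (\<Sum>(g, h)\<in>tree_pairs (k - 1). \<Psi> (2 * k) (tjoin g h)))"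
  proof (rule boundary_trees)
   show "\<Psi> a q = 0" if "idg a q" for a q
    unfolding \<Psi>_def using degenerate_ract_lift[OF that] cochains_zero[OF f] by blast
  qed
  also have "... = - (\<Sum>i<k. omega X i (omega X (k - 1 - i) f)) m V"
  proof (cases k)
   case 0
   then show ?thesis by (simp add: \<Psi>_def ract_simps)
  next
   case (Suc k')
   have "(\<Sum>(g, h)\<in>tree_pairs k'. \<Psi> (2 * k) (tjoin g h))
    = (\<Sum>(g, h)\<in>tree_pairs k'. \<Psi> (2 * k) (tjoin h g))"
    by (rule sum_tree_pairs_swap)
   also have "... = (\<Sum>i\<le>k'. \<Sum>g\<in>trees i. \<Sum>h\<in>trees (k' - i). \<Psi> (2 * k) (tjoin h g))"
    by (simp only: sum_tree_pairs_index case_prod_conv)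
   also have "... = (\<Sum>i\<le>k'. omega X i (omega X (k - 1 - i) f) m V)"
   proof (rule sum.cong[OF refl])
    fix i assume i: "i \<in> {..k'}"
    have "omega X i (omega X (k - 1 - i) f) m V = (\<Sum>g\<in>trees i. \<Sum>h\<in>trees (k' - i). f (tdim h + (tdim g + m)) (tract h (tdim g + m) (tract g m V)))"
     using V Suc by (simp only: omega_op_eq singular_ract[OF V] if_True diff_Suc_1)
    also have "... = (\<Sum>g\<in>trees i. \<Sum>h\<in>trees (k' - i). \<Psi> (2 * k) (tjoin h g))"
    proof (intro sum.cong refl)
     fix g h assume "g \<in> trees i" "h \<in> trees (k' - i)"
     then have "2 * k = tdim h + (tdim g)" using i Suc by (auto simp: trees_def)
     then show "f (tdim h + (tdim g + m)) (tract h (tdim g + m) (tract g m V))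
      = \<Psi> (2 * k) (tjoin h g)"
      by (simp only: \<Psi>_def ract_simps(4)) (simp only: add.assoc)
    qed
    finally show "(\<Sum>g\<in>trees i. \<Sum>h\<in>trees (k' - i). \<Psi> (2 * k) (tjoin h g)) = omega X i (omega X (k - 1 - i) f) m V" ..
   qed
   finally show ?thesis using Suc by (simp add: lessThan_Suc_atMost sum_apply2)
  qed
  finally show ?thesis using V by (simp add: cube_codiff_eq)
 qed (simp add: nonsingular omega_op_eq sum_apply2)
qed

text \<open>By \<open>diagonal_trees\<close> only those terms survive in which the whole rotating
  chain acts on one of the factors, so that each operation is an odd derivation.\<close>

lemma omega_cup:
 assumes f: "f \<in> cochains (loops X) S" and g: "g \<in> cochains (loops X) S'" and b: "!!m. m \<in> S ==> even m = b"
 shows "omega X k (cup (loops X) f g) =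
  cup (loops X) (omega X k f) g + sgn_if b (cup (loops X) f (omega X k g))" (is "?l = ?r")
proof (intro cochain_eqI)
 fix m V show "?l m V = ?r m V"
 proof (cases "singular m (loops X) V")
  case V: True
  let ?w = "free m :: face_word"
  define \<Psi> where "\<Psi> a q c r = diag ?w (%u v. (- 1) ^ (c * nfree u) * (f (a + nfree u) (ract a q (nfree u) (fc u V)) * g (c + nfree v) (ract c r (nfree v) (fc v V))))"
   for a q c r
  have sf: "ract 0 (%_. 0) (nfree u) (fc u V) = fc u V" if "length u = m" for u
   using that V singular_fc[of u "loops X" V] by (simp add: ract_simps)
  have "?l m V = (\<Sum>x\<in>trees k. diag (full x @ ?w) (%u v. ev f (tract x m V) u * ev g (tract x m V) v))"
   using V by (simp only: omega_op_eq cube_cup_eq[OF singular_ract[OF V]] replicate_add if_True)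
  also have "... = (\<Sum>x\<in>trees k. diag (full x) (%u v. \<Psi> (nfree u) (lface u (tfun x)) (nfree v) (lface v (tfun x))))"
   unfolding diagonal_append
  proof (intro sum.cong refl diagonal_cong)
   fix x and u v :: face_word assume l: "length u = length (full x)" "length v = length (full x)"
   show "diag ?w (%u' v'. ksg v u' * (ev f (tract x m V) (u @ u') * ev g (tract x m V) (v @ v')))
    = \<Psi> (nfree u) (lface u (tfun x)) (nfree v) (lface v (tfun x))"
    unfolding \<Psi>_def using l by (intro diagonal_cong) (subst (1 2) ev_ract, simp_all)
  qed
  also have "... = (\<Sum>x\<in>trees k. \<Psi> (tdim x) (tfun x) 0 (%_. 0) + \<Psi> 0 (%_. 0) (tdim x) (tfun x))"
  proof (rule diagonal_trees)
   show "\<Psi> a q c (%t. r t + 1) = \<Psi> a q c r" for a q c r by (simp only: \<Psi>_def ract_simps(1))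
   fix a q c r assume "idg a q \<or> idg c r"
   then have "f (a + nfree u) (ract a q (nfree u) (fc u V)) * g (c + nfree v) (ract c r (nfree v) (fc v V)) = 0" for u v
    using degenerate_ract_lift cochains_zero[OF f] cochains_zero[OF g] by (metis mult_eq_0_iff)
   then show "\<Psi> a q c r = 0" unfolding \<Psi>_def by (simp only: mult_zero_right diagonal_lin)
  qed
  also have "... = diag ?w (%u v. ev (omega X k f) V u * ev g V v) + diag ?w (%u v. sg u * (ev f V u * ev (omega X k g) V v))"
  proof -
   have "(\<Sum>x\<in>trees k. \<Psi> (tdim x) (tfun x) 0 (%_. 0)) = diag ?w (%u v. ev (omega X k f) V u * ev g V v)"
    unfolding \<Psi>_def diagonal_sum_swap
    by (rule diagonal_cong) (use V in \<open>simp add: ev_omega sf sum_distrib_right ev_def[of g]\<close>)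
   moreover have "(\<Sum>x\<in>trees k. \<Psi> 0 (%_. 0) (tdim x) (tfun x)) = diag ?w (%u v. sg u * (ev f V u * ev (omega X k g) V v))"
    unfolding \<Psi>_def diagonal_sum_swap
   proof (rule diagonal_cong)
    fix u v :: face_word assume l: "length u = length ?w" "length v = length ?w"
    have "(- 1 :: int) ^ ((tdim x) * nfree u) = sg u" for x by (simp add: sg_def minus_one_power_iff)
    then show "(\<Sum>x\<in>trees k. (- 1) ^ ((tdim x) * nfree u) * (f (0 + nfree u) (ract 0 (%_. 0) (nfree u) (fc u V)) *
      g (tdim x + nfree v) (tract x (nfree v) (fc v V)))) = sg u * (ev f V u * ev (omega X k g) V v)"
     using V l by (simp add: ev_omega sf sum_distrib_left ev_def[of f])
   qed
   ultimately show ?thesis by (simp only: sum.distrib)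
  qed
  also have "diag ?w (%u v. sg u * (ev f V u * ev (omega X k g) V v)) = sgn_if b (cup (loops X) f (omega X k g)) m V"
   using V sg_ev[OF f b] by (simp add: mult.assoc[symmetric] cube_cup_eq) (simp add: sgn_if_def word_lin cube_cup_eq)
  finally show ?thesis using V by (simp add: cube_cup_eq)
 qed (simp add: nonsingular omega_op_eq sgn_if_def)
qed

section \<open>Reparametrised cubes of pairs\<close>

text \<open>A letter describes how a coordinate of a cube of pairs is reparametrised: \<open>Dg\<close> is
 \<open>(t, t)\<close>, \<open>Ha\<close> is \<open>(t, 1)\<close>, \<open>Hb\<close> is \<open>(0, t)\<close>, \<open>Qd\<close> with two parameters is \<open>(s t, t)\<close>,
 \<open>Du\<close> is \<open>(0, 0)\<close> with an idle parameter, and \<open>Fx a b\<close> is constant.\<close>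

datatype letter_state = Dg | Ha | Hb | Qd | Du | Fx bool bool

type_synonym state_word = "letter_state list"

fun nparam :: "state_word => nat" where
 "nparam [] = 0" | "nparam (Qd # x) = Suc (Suc (nparam x))" | "nparam (Fx a b # x) = nparam x" | "nparam (_ # x) = Suc (nparam x)"

fun p1 :: "state_word => (nat => real) => (nat => real)" where
 "p1 [] t = (%_. undefined)"
| "p1 (Dg # x) t = case_nat (t 0) (p1 x (%i. t (Suc i)))"
| "p1 (Ha # x) t = case_nat (t 0) (p1 x (%i. t (Suc i)))"
| "p1 (Hb # x) t = case_nat 0 (p1 x (%i. t (Suc i)))"
| "p1 (Qd # x) t = case_nat (t 0 * t 1) (p1 x (%i. t (Suc (Suc i))))"
| "p1 (Du # x) t = case_nat 0 (p1 x (%i. t (Suc i)))"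
| "p1 (Fx a b # x) t = case_nat (of_bool a) (p1 x t)"

fun p2 :: "state_word => (nat => real) => (nat => real)" where
 "p2 [] t = (%_. undefined)"
| "p2 (Dg # x) t = case_nat (t 0) (p2 x (%i. t (Suc i)))"
| "p2 (Ha # x) t = case_nat 1 (p2 x (%i. t (Suc i)))"
| "p2 (Hb # x) t = case_nat (t 0) (p2 x (%i. t (Suc i)))"
| "p2 (Qd # x) t = case_nat (t 1) (p2 x (%i. t (Suc (Suc i))))"
| "p2 (Du # x) t = case_nat 0 (p2 x (%i. t (Suc i)))"
| "p2 (Fx a b # x) t = case_nat (of_bool b) (p2 x t)"

lemma p_undefined: "length x \<le> j ==> p1 x t j = undefined" "length x \<le> j ==> p2 x t j = undefined"
proof -
 show "length x \<le> j ==> p1 x t j = undefined" by (induction x t arbitrary: j rule: p1.induct) (auto split: nat.splits)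
 show "length x \<le> j ==> p2 x t j = undefined" by (induction x t arbitrary: j rule: p2.induct) (auto split: nat.splits)
qed

lemma continuous_map_case_nat:
 "continuous_map Y Z (%y. a y) ==> (!!j. j < n ==> continuous_map Y Z (%y. p y j)) ==> j < Suc n ==>
  continuous_map Y Z (%y. case_nat (a y) (p y) j)"
 by (cases j) auto

lemma continuous_map_p:
 assumes "!!i. i < nparam x ==> continuous_map Y (top_of_set {0..1}) (%y. s y i)" "j < length x"
 shows "continuous_map Y (top_of_set {0..1}) (%y. p1 x (s y) j) & continuous_map Y (top_of_set {0..1}) (%y. p2 x (s y) j)"
 using assms
proof (induction x arbitrary: s j)
 case (Cons l x)
 have c: "continuous_map Y (top_of_set {0..1}) (%y. of_bool b :: real)" for b by simp
 show ?case
 proof (cases l)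
  case Qd
  have IH: "continuous_map Y (top_of_set {0..1}) (%y. p1 x (%i. s y (Suc (Suc i))) j) & continuous_map Y (top_of_set {0..1}) (%y. p2 x (%i. s y (Suc (Suc i))) j)"
   if "j < length x" for j using that Cons.prems(1) Qd by (intro Cons.IH) auto
  show ?thesis unfolding Qd p1.simps p2.simps using IH Cons.prems Qd
   by (intro conjI continuous_map_case_nat[where n="length x"] continuous_map_interval_mult) auto
 next
  case (Fx a b)
  have IH: "continuous_map Y (top_of_set {0..1}) (%y. p1 x (s y) j) & continuous_map Y (top_of_set {0..1}) (%y. p2 x (s y) j)"
   if "j < length x" for j using that Cons.prems(1) Fx by (intro Cons.IH) auto
  show ?thesis unfolding Fx p1.simps p2.simps using IH Cons.prems c
   by (intro conjI continuous_map_case_nat[where n="length x"]) auto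
 qed (use Cons.prems Cons.IH[of "%y i. s y (Suc i)"] c[of True] c[of False] in \<open>auto intro!: continuous_map_case_nat[where n="length x"]\<close>)
qed simp

lemma continuous_map_p_std:
 "continuous_map (std_cube (nparam x)) (std_cube (length x)) (p1 x)" "continuous_map (std_cube (nparam x)) (std_cube (length x)) (p2 x)"
 unfolding continuous_map_std_cube using continuous_map_p[of x "std_cube (nparam x)" "%t. t"]
 by (auto simp: continuous_map_coordinate extensional_def p_undefined)

lemma p_pts: "t \<in> pts (nparam x) ==> p1 x t \<in> pts (length x)" "t \<in> pts (nparam x) ==> p2 x t \<in> pts (length x)"
 using continuous_map_p_std[of x] continuous_map_image_subset_topspace by blast+

definition rp :: "state_word => ('y \<times> 'y) cube => ('y \<times> 'y) cube" where
 "rp x T = (\<lambda>t\<in>pts (nparam x). (fst (T (p1 x t)), snd (T (p2 x t))))"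

lemma singular_rp:
 assumes "singular (length x) (prod_topology Z Z) T"
 shows "singular (nparam x) (prod_topology Z Z) (rp x T)"
proof -
 have T: "continuous_map (std_cube (length x)) Z (fst \<circ> T)" "continuous_map (std_cube (length x)) Z (snd \<circ> T)"
  using assms by (auto simp: singular_cube_def continuous_map_pairwise)
 have "continuous_map (std_cube (nparam x)) (prod_topology Z Z) (%t. (fst (T (p1 x t)), snd (T (p2 x t))))"
  using continuous_map_compose[OF continuous_map_p_std(1) T(1)] continuous_map_compose[OF continuous_map_p_std(2) T(2)]
  by (simp add: continuous_map_pairwise o_def)
 then have "continuous_map (std_cube (nparam x)) (prod_topology Z Z) (rp x T)"
  by (rule continuous_map_eq) (simp add: rp_def)
 then show ?thesis by (simp add: singular_cube_def rp_def)
qed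

text \<open>The face at 0 of the second parameter of \<open>Qd\<close> freezes both components at 0
  while the first parameter stays on without effect; this is the letter \<open>Du\<close>.\<close>

fun app :: "state_word => face_word => state_word" where
 "app (Dg # x) (a # u) = (case a of None => Dg | Some b => Fx b b) # app x u"
| "app (Ha # x) (a # u) = (case a of None => Ha | Some b => Fx b True) # app x u"
| "app (Hb # x) (a # u) = (case a of None => Hb | Some b => Fx False b) # app x u"
| "app (Du # x) (a # u) = (case a of None => Du | Some b => Fx False False) # app x u"
| "app (Qd # x) (a # c # u) = (case a of
   None => (case c of None => Qd | Some b => if b then Ha else Du)
  | Some b => (case c of None => if b then Dg else Hb | Some d => Fx (b & d) d)) # app x u"
| "app (Fx a b # x) u = Fx a b # app x u"
| "app _ _ = []"

lemma app_simps:
 assumes "length u = nparam x"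
 shows "length (app x u) = length x" "nparam (app x u) = nfree u"
  "p1 x (ins u t) = p1 (app x u) t" "p2 x (ins u t) = p2 (app x u) t"
proof -
 have "length (app x u) = length x & nparam (app x u) = nfree u & (\<forall>t. p1 x (ins u t) = p1 (app x u) t) & (\<forall>t. p2 x (ins u t) = p2 (app x u) t)"
  using assms by (induction x u rule: app.induct) (auto split: option.splits)
 then show "length (app x u) = length x" "nparam (app x u) = nfree u"
  "p1 x (ins u t) = p1 (app x u) t" "p2 x (ins u t) = p2 (app x u) t" by auto
qed

lemma app_replicate [simp]: "app x (free (nparam x)) = x"
 by (induction x rule: nparam.induct) auto

lemma fc_rp: "length u = nparam x ==> fc u (rp x T) = rp (app x u) T"
 using ins_pts[of _ u] by (auto simp: fc_def rp_def app_simps fun_eq_iff)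

text \<open>The cubical boundary in terms of letters. The idle face of \<open>Qd\<close> is left out
  because it is degenerate, and the default value 0 is met only at the empty word or at
  \<open>Du\<close>, which the lemmas exclude.\<close>

fun sboundary :: "state_word => (state_word => int) => int" where
 "sboundary (Dg # x) F = - (F (Fx True True # x) - F (Fx False False # x)) - sboundary x (%y. F (Dg # y))"
| "sboundary (Ha # x) F = - (F (Fx True True # x) - F (Fx False True # x)) - sboundary x (%y. F (Ha # y))"
| "sboundary (Hb # x) F = - (F (Fx False True # x) - F (Fx False False # x)) - sboundary x (%y. F (Hb # y))"
| "sboundary (Qd # x) F = F (Ha # x) + F (Hb # x) - F (Dg # x) + sboundary x (%y. F (Qd # y))"
| "sboundary (Fx a b # x) F = sboundary x (%y. F (Fx a b # y))"
| "sboundary _ F = 0"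

lemma sboundary_lin:
 "sboundary x (%u. F u + G u) = sboundary x F + sboundary x G"
proof (induction x arbitrary: F G)
 case (Cons l x)
 then show ?case by (cases l) simp_all
qed simp

lemma boundary_app:
 assumes "Du \<notin> set x" "!!y. Du \<in> set y ==> F y = 0"
 shows "bdry (free (nparam x)) (%u. F (app x u)) = sboundary x F"
 using assms by (induction x F rule: sboundary.induct) (simp_all add: word_lin)

text \<open>The homotopy chain separates the coordinates one after another: those before
  \<open>Qd\<close> already move only one component each, as \<open>Ha\<close> or \<open>Hb\<close>,
  and those after it still move both components together.\<close>

fun hsum :: "face_word => (state_word => int) => int" where
 "hsum [] F = 0"
| "hsum (None # w) F =
   F (Qd # map (%a. case a of None => Dg | Some b => Fx b b) w) - hsum w (%x. F (Ha # x) + F (Hb # x))"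
| "hsum (Some b # w) F = hsum w (%x. F (Fx b b # x))"

fun edge_sum :: "face_word => (state_word => int) => int" where
 "edge_sum [] F = F []"
| "edge_sum (None # w) F = edge_sum w (%x. F (Ha # x) + F (Hb # x))"
| "edge_sum (Some b # w) F = edge_sum w (%x. F (Fx b b # x))"

abbreviation diag_word :: "face_word => state_word" where
 "diag_word \<equiv> map (%a. case a of None => Dg | Some b => Fx b b)"

lemma sboundary_diag_word: "sboundary (diag_word w) F = bdry w (%u. F (diag_word u))"
proof (induction w arbitrary: F)
 case (Cons a w)
 then show ?case by (cases a) auto
qed simp

lemma homotopy_sum_lin:
 "hsum w (%x. F x + G x) = hsum w F + hsum w G"
 "hsum w (%x. - F x) = - hsum w F"
 "hsum w (%x. 0) = 0"
 "hsum w (%x. F x - G x) = hsum w F - hsum w G"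
proof -
 show a: "hsum w (%x. F x + G x) = hsum w F + hsum w G" for F G
 proof (induction w F arbitrary: G rule: hsum.induct)
  case (2 w F)
  from 2[of "%x. G (Ha # x) + G (Hb # x)"] show ?case by (simp add: algebra_simps)
 qed simp_all
 show n: "hsum w (%x. - F x) = - hsum w F" for F
 proof (induction w F rule: hsum.induct)
  case (2 w F)
  then show ?case by (simp add: algebra_simps)
 qed simp_all
 show "hsum w (%x. 0) = 0" using a[of "%x. 0" "%x. 0"] by simp
 show "hsum w (%x. F x - G x) = hsum w F - hsum w G"
  using a[of F "%x. - G x"] n[of G] by simp
qed

lemma nparam_diag_word: "nparam (diag_word w) = nfree w"
proof (induction w)
 case (Cons a w)
 then show ?case by (cases a) auto
qed simp

definition proper_state :: "face_word => state_word => bool" where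
 "proper_state w x \<longleftrightarrow> length x = length w & Du \<notin> set x & nparam x = Suc (nfree w) & (\<forall>i<length w. w ! i = None --> (\<nexists>a b. x ! i = Fx a b))"

lemma proper_state_Cons:
 "proper_state w x ==> proper_state (None # w) (Ha # x)" "proper_state w x ==> proper_state (None # w) (Hb # x)"
 "proper_state w x ==> proper_state (Some b # w) (Fx b b # x)" "proper_state (None # w) (Qd # diag_word w)"
proof -
 show "proper_state w x ==> proper_state (None # w) (Ha # x)" "proper_state w x ==> proper_state (None # w) (Hb # x)"
  "proper_state w x ==> proper_state (Some b # w) (Fx b b # x)"
  by (auto simp: proper_state_def nth_Cons split: nat.splits)
 show "proper_state (None # w) (Qd # diag_word w)"
  by (auto simp: proper_state_def nth_Cons nparam_diag_word split: nat.splits option.splits)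
qed

lemma homotopy_sum_cong:
 "(!!x. proper_state w x ==> F x = G x) ==> hsum w F = hsum w G"
proof (induction w F arbitrary: G rule: hsum.induct)
 case (2 w F)
 have "hsum w (%x. F (Ha # x) + F (Hb # x)) = hsum w (%x. G (Ha # x) + G (Hb # x))"
  using 2(2) proper_state_Cons by (intro 2(1)) auto
 then show ?case using 2(2)[OF proper_state_Cons(4)] by simp
qed (auto simp: proper_state_Cons)

lemma edge_sum_zero:
 "(!!x. length x = m ==> set x \<subseteq> {Ha, Hb} ==> F x = 0) ==> edge_sum (free m) F = 0"
 by (induction m arbitrary: F) auto

text \<open>The inner faces of \<open>Qd\<close> at one position cancel against those at the next,
  and only the two extreme stages remain: all coordinates separated, and none.\<close>

lemma boundary_homotopy_sum:
 "bdry w (%u. hsum u F) + hsum w (%x. sboundary x F) = edge_sum w F - F (diag_word w)"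
proof (induction w arbitrary: F)
 case (Cons a w)
 show ?case
 proof (cases a)
  case None
  have "hsum w (%x. sboundary (Ha # x) F + sboundary (Hb # x) F) = - hsum w (%x. F (Fx True True # x)) + hsum w (%x. F (Fx False False # x))
    - hsum w (%x. sboundary x (%y. F (Ha # y) + F (Hb # y)))"
   by (simp flip: homotopy_sum_lin add: sboundary_lin algebra_simps)
  then show ?thesis
   using Cons[of "%x. F (Ha # x) + F (Hb # x)"] None by (simp add: word_lin sboundary_diag_word)
 next
  case (Some b)
  then show ?thesis using Cons[of "%x. F (Fx b b # x)"] by simp
 qed
qed simp

fun subst_state :: "face_word => state_word => state_word" where
 "subst_state (None # w) (l # x) = l # subst_state w x"
| "subst_state (Some b # w) x = Fx b b # subst_state w x"
| "subst_state _ _ = []"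

lemma subst_state_simps:
 assumes "length x = nfree w"
 shows "length (subst_state w x) = length w" "nparam (subst_state w x) = nparam x"
  "p1 (subst_state w x) t = ins w (p1 x t)" "p2 (subst_state w x) t = ins w (p2 x t)"
proof -
 have "length (subst_state w x) = length w & nparam (subst_state w x) = nparam x & (\<forall>t. p1 (subst_state w x) t = ins w (p1 x t)) & (\<forall>t. p2 (subst_state w x) t = ins w (p2 x t))"
  using assms
 proof (induction w x rule: subst_state.induct)
  case (1 w l x)
  then show ?case by (cases l) auto
 qed auto
 then show "length (subst_state w x) = length w" "nparam (subst_state w x) = nparam x"
  "p1 (subst_state w x) t = ins w (p1 x t)" "p2 (subst_state w x) t = ins w (p2 x t)" by auto
qed

lemma rp_fc: "length x = nfree w ==> rp x (fc w T) = rp (subst_state w x) T"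
 using p_pts[of _ x] by (auto simp: rp_def fc_def subst_state_simps fun_eq_iff)

lemma subst_diag_word: "subst_state w (replicate (nfree w) Dg) = diag_word w"
proof (induction w)
 case (Cons a w)
 then show ?case by (cases a) auto
qed simp

lemma homotopy_sum_subst: "hsum (free (nfree w)) (%x. F (subst_state w x)) = hsum w F"
proof (induction w arbitrary: F)
 case (Cons a w)
 show ?case
 proof (cases a)
  case None
  show ?thesis using Cons[of "%x. F (Ha # x) + F (Hb # x)"] None subst_diag_word[of w] by (simp add: map_replicate_const)
 next
  case (Some b)
  then show ?thesis using Cons[of "%x. F (Fx b b # x)"] by simp
 qed
qed simp

text \<open>A uniform description of one letter by the number \<open>d\<close> of parameters that it
  consumes and its two coordinate functions; it spares the next lemmas a case distinction over
  letters.\<close>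

lemma p_Cons:
 "\<exists>d a b. nparam (l # x) = d + nparam x & (\<forall>t. p1 (l # x) t = case_nat (a t) (p1 x (%i. t (d + i)))) &
   (\<forall>t. p2 (l # x) t = case_nat (b t) (p2 x (%i. t (d + i)))) &
   (\<forall>t t'. (\<forall>i<d. t i = t' i) --> a t = a t' & b t = b t') & (l = Ha --> (\<forall>t t'. b t = b t')) &
   (l = Hb --> (\<forall>t t'. a t = a t')) & (l = Du --> (\<forall>t t'. a t = a t' & b t = b t')) & ((\<nexists>a b. l = Fx a b) --> d > 0)"
proof (cases l)
 case Dg
 then show ?thesis by (intro exI[of _ 1] exI[of _ "%t. t 0"]) auto
next
 case Ha
 then show ?thesis by (intro exI[of _ 1] exI[of _ "%t. t 0"] exI[of _ "%t. 1"]) auto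
next
 case Hb
 then show ?thesis by (intro exI[of _ 1] exI[of _ "%t. 0"] exI[of _ "%t. t 0"]) auto
next
 case Qd
 then show ?thesis by (intro exI[of _ 2] exI[of _ "%t. t 0 * t 1"] exI[of _ "%t. t 1"]) auto
next
 case Du
 then show ?thesis by (intro exI[of _ 1] exI[of _ "%t. 0"]) auto
next
 case (Fx c e)
 then show ?thesis by (intro exI[of _ 0] exI[of _ "%t. of_bool c"] exI[of _ "%t. of_bool e"]) auto
qed

lemma case_nat_eqI: "(j = 0 ==> a = a') ==> (!!k. j = Suc k ==> f k = f' k) ==> case_nat a f j = case_nat a' f' j"
 by (cases j) auto

lemma param_position:
 "k < nparam x ==> \<exists>i<length x. \<forall>t t'. (\<forall>j. j ~= k --> t j = t' j) --> (\<forall>j. j ~= i --> p1 x t j = p1 x t' j & p2 x t j = p2 x t' j)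
   & (x ! i = Ha --> p2 x t = p2 x t') & (x ! i = Hb --> p1 x t = p1 x t') & (x ! i = Du --> p1 x t = p1 x t' & p2 x t = p2 x t')"
proof (induction x arbitrary: k)
 case (Cons l x)
 obtain d a b where d: "nparam (l # x) = d + nparam x" and p: "!!t. p1 (l # x) t = case_nat (a t) (p1 x (%i. t (d + i)))"
   "!!t. p2 (l # x) t = case_nat (b t) (p2 x (%i. t (d + i)))"
  and ab: "!!t t'. (\<forall>i<d. t i = t' i) ==> a t = a t' & b t = b t'" and h: "l = Ha ==> (\<forall>t t'. b t = b t')"
   "l = Hb ==> (\<forall>t t'. a t = a t')" "l = Du ==> (\<forall>t t'. a t = a t' & b t = b t')"
  using p_Cons[of l x] by blast
 show ?case
 proof (cases "k < d")
  case True
  show ?thesis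
  proof (intro exI[of _ 0] conjI allI impI)
   fix t t' :: "nat => real" assume t: "\<forall>j. j ~= k --> t j = t' j"
   have e: "(%i. t (d + i)) = (%i. t' (d + i))" using t True by auto
   show "p1 (l # x) t j = p1 (l # x) t' j" "p2 (l # x) t j = p2 (l # x) t' j" if "j ~= 0" for j
    unfolding p e by (rule case_nat_eqI; use that in simp)+
   show "p2 (l # x) t = p2 (l # x) t'" if "(l # x) ! 0 = Ha" using h(1) that unfolding p e by simp metis
   show "p1 (l # x) t = p1 (l # x) t'" if "(l # x) ! 0 = Hb" using h(2) that unfolding p e by simp metis
   show "p1 (l # x) t = p1 (l # x) t'" "p2 (l # x) t = p2 (l # x) t'" if "(l # x) ! 0 = Du" using h(3) that unfolding p e by (simp, metis)+
  qed simp
 next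
  case False
  then obtain k' where k: "k = d + k'" "k' < nparam x" using Cons.prems d by (metis add_less_cancel_left le_Suc_ex not_le)
  from Cons.IH[OF k(2)] obtain i where i: "i < length x" and
   Q: "!!t t'. (\<forall>j. j ~= k' --> t j = t' j) ==> (\<forall>j. j ~= i --> p1 x t j = p1 x t' j & p2 x t j = p2 x t' j)
   & (x ! i = Ha --> p2 x t = p2 x t') & (x ! i = Hb --> p1 x t = p1 x t') & (x ! i = Du --> p1 x t = p1 x t' & p2 x t = p2 x t')"
   by blast
  show ?thesis
  proof (intro exI[of _ "Suc i"] conjI allI impI)
   fix t t' :: "nat => real" assume t: "\<forall>j. j ~= k --> t j = t' j"
   have a: "a t = a t'" "b t = b t'" using ab[of t t'] t False by auto
   have t': "\<forall>j. j ~= k' --> t (d + j) = t' (d + j)" using t k by simp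
   note Q = Q[of "%i. t (d + i)" "%i. t' (d + i)", OF t']
   show "p1 (l # x) t j = p1 (l # x) t' j" "p2 (l # x) t j = p2 (l # x) t' j" if "j ~= Suc i" for j
    unfolding p a using Q that by (auto intro!: case_nat_eqI)
   show "p2 (l # x) t = p2 (l # x) t'" if "(l # x) ! Suc i = Ha" using Q that unfolding p a by simp
   show "p1 (l # x) t = p1 (l # x) t'" if "(l # x) ! Suc i = Hb" using Q that unfolding p a by simp
   show "p1 (l # x) t = p1 (l # x) t'" "p2 (l # x) t = p2 (l # x) t'" if "(l # x) ! Suc i = Du" using Q that unfolding p a by simp_all
  qed (use i in simp)
 qed
qed simp

lemma position_param:
 "i < length x ==> \<not> (\<exists>a b. x ! i = Fx a b) ==> \<exists>k<nparam x. \<forall>t t'. (\<forall>j. j ~= k --> t j = t' j) -->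
   (\<forall>j. j ~= i --> p1 x t j = p1 x t' j & p2 x t j = p2 x t' j)"
proof (induction x arbitrary: i)
 case (Cons l x)
 obtain d a b where d: "nparam (l # x) = d + nparam x" and p: "!!t. p1 (l # x) t = case_nat (a t) (p1 x (%i. t (d + i)))"
   "!!t. p2 (l # x) t = case_nat (b t) (p2 x (%i. t (d + i)))"
  and ab: "!!t t'. (\<forall>i<d. t i = t' i) ==> a t = a t' & b t = b t'" and f: "(\<nexists>a b. l = Fx a b) ==> d > 0"
  using p_Cons[of l x] by blast
 show ?case
 proof (cases i)
  case 0
  then have "d > 0" using f Cons.prems by simp
  show ?thesis
  proof (intro exI[of _ 0] conjI allI impI)
   fix t t' :: "nat => real" and j assume t: "\<forall>j. j ~= 0 --> t j = t' j" and j: "j ~= i"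
   have e: "(%i. t (d + i)) = (%i. t' (d + i))" using t \<open>d > 0\<close> by auto
   show "p1 (l # x) t j = p1 (l # x) t' j" "p2 (l # x) t j = p2 (l # x) t' j"
    unfolding p e by (rule case_nat_eqI; use j 0 in simp)+
  qed (use d \<open>d > 0\<close> in simp)
 next
  case (Suc i')
  have "i' < length x" "\<not> (\<exists>a b. x ! i' = Fx a b)" using Cons.prems Suc by auto
  from Cons.IH[OF this] obtain k where k: "k < nparam x" and
   Q: "!!t t'. (\<forall>j. j ~= k --> t j = t' j) ==> (\<forall>j. j ~= i' --> p1 x t j = p1 x t' j & p2 x t j = p2 x t' j)" by blast
  show ?thesis
  proof (intro exI[of _ "d + k"] conjI allI impI)
   fix t t' :: "nat => real" and j assume t: "\<forall>j. j ~= d + k --> t j = t' j" and j: "j ~= i"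
   have a: "a t = a t'" "b t = b t'" using ab[of t t'] t by auto
   have t': "\<forall>j. j ~= k --> t (d + j) = t' (d + j)" using t by simp
   note Q = Q[of "%i. t (d + i)" "%i. t' (d + i)", OF t']
   show "p1 (l # x) t j = p1 (l # x) t' j" "p2 (l # x) t j = p2 (l # x) t' j"
    unfolding p a using Q j Suc by (auto intro!: case_nat_eqI)
  qed (use k d in simp)
 qed
qed simp

lemma idle_param:
 "Du \<in> set x ==> \<exists>k<nparam x. \<forall>t t'. (\<forall>j. j ~= k --> t j = t' j) --> p1 x t = p1 x t' & p2 x t = p2 x t'"
proof (induction x)
 case (Cons l x)
 show ?case
 proof (cases "l = Du")
  case True
  show ?thesis
  proof (intro exI[of _ 0] conjI allI impI)
   fix t t' :: "nat => real" assume "\<forall>j. j ~= 0 --> t j = t' j"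
   then have "(%i. t (Suc i)) = (%i. t' (Suc i))" by auto
   then show "p1 (l # x) t = p1 (l # x) t'" "p2 (l # x) t = p2 (l # x) t'" using True by simp_all
  qed (simp add: True)
 next
  case False
  then have "Du \<in> set x" using Cons.prems by auto
  from Cons.IH[OF this] obtain k where k: "k < nparam x" and Q: "!!t t'. (\<forall>j. j ~= k --> t j = t' j) ==> p1 x t = p1 x t' & p2 x t = p2 x t'" by blast
  obtain d a b where d: "nparam (l # x) = d + nparam x" and p: "!!t. p1 (l # x) t = case_nat (a t) (p1 x (%i. t (d + i)))"
    "!!t. p2 (l # x) t = case_nat (b t) (p2 x (%i. t (d + i)))"
   and ab: "!!t t'. (\<forall>i<d. t i = t' i) ==> a t = a t' & b t = b t'"
   using p_Cons[of l x] by blast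
  show ?thesis
  proof (intro exI[of _ "d + k"] conjI allI impI)
   fix t t' :: "nat => real" assume t: "\<forall>j. j ~= d + k --> t j = t' j"
   have e: "a t = a t'" "b t = b t'" using ab[of t t'] t by auto
   have t': "\<forall>j. j ~= k --> t (d + j) = t' (d + j)" using t by simp
   show "p1 (l # x) t = p1 (l # x) t'" "p2 (l # x) t = p2 (l # x) t'"
    unfolding p e using Q[of "%i. t (d + i)" "%i. t' (d + i)", OF t'] by simp_all
  qed (use k d in simp)
 qed
qed simp

section \<open>The homotopy operator on cochains of pairs\<close>

definition hop :: "'y topology => ('y \<times> 'y) cochain => ('y \<times> 'y) cochain" where
 "hop Z f = (%m T. if singular m (prod_topology Z Z) T
   then hsum (free m) (%x. f (nparam x) (rp x T)) else 0)"

lemma hop_lin [simp]: "hop Z (f + g) = hop Z f + hop Z g" "hop Z (- f) = - hop Z f" "hop Z 0 = 0"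
 by (auto simp: fun_eq_iff hop_def homotopy_sum_lin)

lemma ev_hop:
 assumes "singular (length w) (prod_topology Z Z) T"
 shows "ev (hop Z f) T w = hsum w (%x. f (nparam x) (rp x T))"
proof -
 have "ev (hop Z f) T w = hsum (free (nfree w)) (%x. f (nparam x) (rp x (fc w T)))"
  using singular_fc[OF assms] by (simp add: ev_def hop_def)
 also have "... = hsum (free (nfree w)) (%x. f (nparam (subst_state w x)) (rp (subst_state w x) T))"
  by (rule homotopy_sum_cong) (simp add: proper_state_def rp_fc subst_state_simps)
 finally show ?thesis by (simp add: homotopy_sum_subst[of w "%x. f (nparam x) (rp x T)"])
qed

lemma ev_rp: "length u = nparam x ==> ev f (rp x T) u = f (nparam (app x u)) (rp (app x u) T)"
 by (simp add: ev_def fc_rp app_simps)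

lemma nparam_replicate: "nparam (replicate m Dg) = m"
 by (induction m) auto

lemma p_replicate: "t \<in> pts m ==> p1 (replicate m Dg) t = t & p2 (replicate m Dg) t = t"
proof (induction m arbitrary: t)
 case 0 then show ?case by (auto simp: pts_iff extensional_def)
next
 case (Suc m)
 from Suc.IH[OF tail_pts[OF Suc.prems]] show ?case by (auto simp: fun_eq_iff split: nat.splits)
qed

lemma rp_diag: "rp (replicate m Dg) T = restrict T (pts m)"
 using p_replicate by (auto simp: rp_def nparam_replicate)

lemma fc_eq_rp: "fc w T = rp (diag_word w) T"
proof -
 have "nparam (diag_word w) = nfree w & (\<forall>t. p1 (diag_word w) t = ins w t) & (\<forall>t. p2 (diag_word w) t = ins w t)"
 proof (induction w)
  case (Cons a w)
  then show ?case by (cases a) auto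
 qed simp
 then show ?thesis by (simp add: fc_def rp_def)
qed

lemma degenerate_rp_idle:
 assumes "Du \<in> set x"
 shows "degenerate_cube (nparam x) (rp x T)"
proof -
 from assms obtain k where k: "k < nparam x" and Q: "!!t t'. (\<forall>j. j ~= k --> t j = t' j) ==> p1 x t = p1 x t' & p2 x t = p2 x t'"
  using idle_param by blast
 have "indep (nparam x) (rp x T) k" unfolding indep_def
 proof (intro ballI impI)
  fix t t' assume "t \<in> pts (nparam x)" "t' \<in> pts (nparam x)" "\<forall>j. j ~= k --> t j = t' j"
  then show "rp x T t = rp x T t'" using Q[of t t'] by (simp add: rp_def)
 qed
 then show ?thesis using k unfolding degenerate_iff by blast
qed

lemma degenerate_rp:
 assumes "indep (length x) T i" "i < length x" "\<nexists>a b. x ! i = Fx a b"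
 shows "degenerate_cube (nparam x) (rp x T)"
proof -
 obtain k where k: "k < nparam x" and Q: "!!t t'. (\<forall>j. j ~= k --> t j = t' j) ==> (\<forall>j. j ~= i --> p1 x t j = p1 x t' j & p2 x t j = p2 x t' j)"
  using position_param[OF assms(2,3)] by blast
 have "indep (nparam x) (rp x T) k" unfolding indep_def
 proof (intro ballI impI)
  fix t t' assume t: "t \<in> pts (nparam x)" "t' \<in> pts (nparam x)" "\<forall>j. j ~= k --> t j = t' j"
  have "T (p1 x t) = T (p1 x t')" "T (p2 x t) = T (p2 x t')"
   using assms(1)[unfolded indep_def, rule_format, OF p_pts(1)[OF t(1)] p_pts(1)[OF t(2)]]
    assms(1)[unfolded indep_def, rule_format, OF p_pts(2)[OF t(1)] p_pts(2)[OF t(2)]] Q[OF t(3)] by blast+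
  then show "rp x T t = rp x T t'" using t by (simp add: rp_def)
 qed
 then show ?thesis using k unfolding degenerate_iff by blast
qed

lemma codiff_rp:
 assumes "f \<in> cochains (prod_topology Z Z) S" "singular (length x) (prod_topology Z Z) T" "Du \<notin> set x"
 shows "codiff (prod_topology Z Z) f (nparam x) (rp x T) = sboundary x (%y. f (nparam y) (rp y T))"
proof -
 have "bdry (free (nparam x)) (ev f (rp x T)) = bdry (free (nparam x)) (%u. f (nparam (app x u)) (rp (app x u) T))"
  by (rule boundary_cong) (simp add: ev_rp)
 also have "... = sboundary x (%y. f (nparam y) (rp y T))"
  by (rule boundary_app[OF assms(3), of "%y. f (nparam y) (rp y T)"]) (use degenerate_rp_idle cochains_zero[OF assms(1)] in blast)
 finally show ?thesis using cube_codiff_eq[OF singular_rp[OF assms(2)]] by simp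
qed

lemma cup_rp:
 "singular (length x) (prod_topology Z Z) T ==> cup (prod_topology Z Z) f g (nparam x) (rp x T) =
  diag (free (nparam x)) (%u v. f (nparam (app x u)) (rp (app x u) T) * g (nparam (app x v)) (rp (app x v) T))"
 unfolding cube_cup_eq[OF singular_rp] by (rule diagonal_cong) (simp add: ev_rp)

text \<open>Vanishing on a family of cubes that is closed under reparametrisation passes to cup
  products and to \<open>hop\<close>. Three families will be used: interleaved cubes, and cubes with
  one component in a given set.\<close>

definition stable_cubes :: "(nat => ('y \<times> 'y) cube => bool) => bool" where
 "stable_cubes P \<longleftrightarrow> (\<forall>x T. P (length x) T --> P (nparam x) (rp x T))"

definition vanishes_on :: "(nat => 'z cube => bool) => 'z cochain => bool" where
 "vanishes_on P f \<longleftrightarrow> (\<forall>m T. P m T --> f m T = 0)"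

lemma vanishes_on_lin: "vanishes_on P f ==> vanishes_on P g ==> vanishes_on P (f + g)" "vanishes_on P 0"
 by (auto simp: vanishes_on_def)

lemma vanishes_on_hop: "stable_cubes P ==> vanishes_on P f ==> vanishes_on P (hop Z f)"
 unfolding vanishes_on_def
proof (intro allI impI)
 fix m T assume P: "stable_cubes P" and f: "\<forall>m T. P m T --> f m T = 0" and T: "P m T"
 have "hsum (free m) (%x. f (nparam x) (rp x T)) = hsum (free m) (%x. 0)"
 proof (rule homotopy_sum_cong)
  fix x assume "proper_state (free m) x"
  then have "P (length x) T" using T by (simp add: proper_state_def)
  then show "f (nparam x) (rp x T) = 0" using P f by (simp add: stable_cubes_def)
 qed
 then show "hop Z f m T = 0" by (simp add: hop_def homotopy_sum_lin)
qed

lemma vanishes_on_ev: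
 assumes a: "stable_cubes P" "vanishes_on P f" "P (length w) T"
 shows "ev f T w = 0"
proof -
 have "P (length (diag_word w)) T" using a(3) by simp
 then show ?thesis using a nparam_diag_word[of w] unfolding ev_def fc_eq_rp stable_cubes_def vanishes_on_def by metis
qed

lemma vanishes_on_cup:
 assumes "stable_cubes P" "vanishes_on P f \<or> vanishes_on P g"
 shows "vanishes_on P (cup Y f g)"
 unfolding vanishes_on_def
proof (intro allI impI)
 fix m T assume T: "P m T"
 show "cup Y f g m T = 0"
 proof (cases "singular m Y T")
  case True
  have "diag (free m) (%u v. ev f T u * ev g T v) = diag (free m) (%u v. 0)"
   using assms T vanishes_on_ev[OF assms(1)] by (intro diagonal_cong) auto
  then show ?thesis using True by (simp add: cube_cup_eq word_lin)
 qed (simp add: nonsingular)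
qed

text \<open>No coordinate moves both components, as in a product of a cube in the first factor with
  a cube in the second. The separated end of the homotopy consists of such cubes.\<close>

definition interleaved :: "nat => ('y \<times> 'y) cube => bool" where
 "interleaved m T \<longleftrightarrow> (\<forall>i<m. indep m (fst \<circ> T) i \<or> indep m (snd \<circ> T) i)"

lemma interleaved_rp:
 assumes "!!i. i < length x ==> x ! i = Ha \<or> x ! i = Hb \<or> indep (length x) (fst \<circ> T) i \<or> indep (length x) (snd \<circ> T) i"
 shows "interleaved (nparam x) (rp x T)"
 unfolding interleaved_def
proof (intro allI impI)
 fix k assume "k < nparam x"
 from param_position[OF this] obtain i where i: "i < length x" and
  Q: "!!t t'. (\<forall>j. j ~= k --> t j = t' j) ==> (\<forall>j. j ~= i --> p1 x t j = p1 x t' j & p2 x t j = p2 x t' j)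
   & (x ! i = Ha --> p2 x t = p2 x t') & (x ! i = Hb --> p1 x t = p1 x t')" by blast
 have 1: "indep (nparam x) (fst \<circ> rp x T) k"
  if "x ! i = Hb \<or> indep (length x) (fst \<circ> T) i"
  unfolding indep_def
 proof (intro ballI impI)
  fix t t' assume t: "t \<in> pts (nparam x)" "t' \<in> pts (nparam x)" "\<forall>j. j ~= k --> t j = t' j"
  have "(fst \<circ> T) (p1 x t) = (fst \<circ> T) (p1 x t')"
   using that
  proof
   assume "indep (length x) (fst \<circ> T) i"
   from this[unfolded indep_def, rule_format, OF p_pts(1)[OF t(1)] p_pts(1)[OF t(2)]] show ?thesis using Q[OF t(3)] by blast
  qed (use Q[OF t(3)] in simp)
  then show "(fst \<circ> rp x T) t = (fst \<circ> rp x T) t'" using t by (simp add: rp_def)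
 qed
 have 2: "indep (nparam x) (snd \<circ> rp x T) k"
  if "x ! i = Ha \<or> indep (length x) (snd \<circ> T) i"
  unfolding indep_def
 proof (intro ballI impI)
  fix t t' assume t: "t \<in> pts (nparam x)" "t' \<in> pts (nparam x)" "\<forall>j. j ~= k --> t j = t' j"
  have "(snd \<circ> T) (p2 x t) = (snd \<circ> T) (p2 x t')"
   using that
  proof
   assume "indep (length x) (snd \<circ> T) i"
   from this[unfolded indep_def, rule_format, OF p_pts(2)[OF t(1)] p_pts(2)[OF t(2)]] show ?thesis using Q[OF t(3)] by blast
  qed (use Q[OF t(3)] in simp)
  then show "(snd \<circ> rp x T) t = (snd \<circ> rp x T) t'" using t by (simp add: rp_def)
 qed
 show "indep (nparam x) (fst \<circ> rp x T) k \<or> indep (nparam x) (snd \<circ> rp x T) k" using assms[OF i] 1 2 by blast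
qed

lemma stable_interleaved: "stable_cubes interleaved"
 unfolding stable_cubes_def
proof (intro allI impI)
 fix x :: state_word and T :: "('y \<times> 'y) cube" assume "interleaved (length x) T"
 then show "interleaved (nparam x) (rp x T)" by (intro interleaved_rp) (auto simp: interleaved_def)
qed

lemma stable_components:
 "stable_cubes (%m T. \<forall>t\<in>pts m. fst (T t) \<in> D)" "stable_cubes (%m T. \<forall>t\<in>pts m. snd (T t) \<in> D)"
 using p_pts by (auto simp: stable_cubes_def rp_def)

text \<open>The separated end of the homotopy is interleaved and drops out, so \<open>hop\<close>
  contracts, up to sign, the cochains that vanish on interleaved cubes.\<close>

lemma hop_homotopy:
 assumes f: "f \<in> cochains (prod_topology Z Z) S" and v: "vanishes_on interleaved f"
 shows "codiff (prod_topology Z Z) (hop Z f) + hop Z (codiff (prod_topology Z Z) f) = - f"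
proof (intro cochain_eqI)
 let ?Y = "prod_topology Z Z"
 fix m T show "(codiff ?Y (hop Z f) + hop Z (codiff ?Y f)) m T = (- f) m T"
 proof (cases "singular m ?Y T")
  case True
  let ?F = "%x. f (nparam x) (rp x T)"
  have "bdry (free m) (ev (hop Z f) T) = bdry (free m) (%w. hsum w ?F)"
   using True by (intro boundary_cong) (simp add: ev_hop)
  moreover have "hsum (free m) (%x. codiff ?Y f (nparam x) (rp x T)) = hsum (free m) (%x. sboundary x ?F)"
   using True by (intro homotopy_sum_cong codiff_rp[OF f]) (auto simp: proper_state_def)
  moreover have "edge_sum (free m) ?F = 0"
  proof (rule edge_sum_zero)
   fix x assume x: "length x = m" "set x \<subseteq> {Ha, Hb}"
   have "interleaved (nparam x) (rp x T)" using x nth_mem by (intro interleaved_rp) fastforce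
   then show "?F x = 0" using v by (simp add: vanishes_on_def)
  qed
  moreover have "?F (diag_word (free m)) = f m T"
  proof -
   have "nparam (replicate m Dg) = m" by (induction m) auto
   then show ?thesis using True by (simp add: rp_diag singular_cube_def extensional_restrict)
  qed
  ultimately show ?thesis
   using True boundary_homotopy_sum[of "free m" ?F] by (simp add: cube_codiff_eq hop_def)
 next
  case False
  then show ?thesis using cochains_zero[OF f] by (simp add: nonsingular hop_def)
 qed
qed

lemma hop_in:
 fixes Z :: "'y topology"
 assumes f: "f \<in> cochains (prod_topology Z Z) S"
 shows "hop Z f \<in> cochains (prod_topology Z Z) {m. Suc m \<in> S}"
 unfolding cochains_def
proof (intro CollectI allI impI conjI notI)
 fix m and T :: "('y \<times> 'y) cube" assume nz: "hop Z f m T ~= 0"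
 then show T: "singular m (prod_topology Z Z) T" by (simp add: hop_def split: if_splits)
 have z: "\<exists>x. proper_state (free m) x & f (nparam x) (rp x T) ~= 0"
 proof (rule ccontr)
  assume "\<not> ?thesis"
  then have "hsum (free m) (%x. f (nparam x) (rp x T)) = hsum (free m) (%x. 0)"
   by (intro homotopy_sum_cong) auto
  then show False using nz by (simp add: hop_def homotopy_sum_lin split: if_splits)
 qed
 then obtain x where x: "proper_state (free m) x" "f (nparam x) (rp x T) ~= 0" by blast
 show "Suc m \<in> S" using x cochains_zero[OF f] by (fastforce simp: proper_state_def)
 assume "degenerate_cube m T"
 then obtain i where i: "i < m" "indep m T i" by (auto simp: degenerate_iff)
 then have "degenerate_cube (nparam x) (rp x T)" using x(1) by (intro degenerate_rp[of x T i]) (auto simp: proper_state_def)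
 then show False using x(2) cochains_zero[OF f] by blast
qed

text \<open>Every term of \<open>cup_one\<close> has a coordinate that is free in both
  words.\<close>

lemma cup_one_zero:
 assumes "!!u v i. length u = length w ==> length v = length w ==> i < length w ==> u ! i = None ==> v ! i = None ==> F u v = 0"
 shows "cup_one w F = 0"
 using assms
proof (induction w F rule: cup_one.induct)
 case (2 w F)
 have "diag w (%u v. sg u * F (None # u) (None # v)) = diag w (%u v. 0)"
  using 2(2)[of "None # _" "None # _" 0] by (intro diagonal_cong) simp
 moreover have "cup_one w (%u v. sg u * F (Some True # u) (None # v) + F (None # u) (Some False # v)) = 0"
 proof (rule 2(1))
  fix u v :: face_word and i assume *: "length u = length w" "length v = length w" "i < length w" "u ! i = None" "v ! i = None"
  show "sg u * F (Some True # u) (None # v) + F (None # u) (Some False # v) = 0"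
   using 2(2)[of "Some True # u" "None # v" "Suc i"] 2(2)[of "None # u" "Some False # v" "Suc i"] * by simp
 qed
 ultimately show ?case by (simp add: word_lin)
next
 case (3 b w F)
 have "cup_one w (%u v. F (Some b # u) (Some b # v)) = 0"
  by (rule 3(1)) (use 3(2)[of "Some b # _" "Some b # _" "Suc _"] in simp)
 then show ?case by simp
qed auto

text \<open>On an interleaved cube each term of the cup-one product has a coordinate free on both
  sides, of which one of the two factors is independent. The cup-one product therefore vanishes
  there, and odd classes from the two factors anticommute exactly, not merely up to
  homotopy.\<close>

lemma interleaved_commute:
 fixes Z :: "'a topology"
 assumes f: "f \<in> cochains Z S" "!!m. m \<in> S ==> odd m" and g: "g \<in> cochains Z S'" "!!m. m \<in> S' ==> odd m" "codiff Z g = 0"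
 defines "Y \<equiv> prod_topology Z Z"
 shows "vanishes_on interleaved (cup Y (pullback Y snd f) (pullback Y fst g) + cup Y (pullback Y fst g) (pullback Y snd f))"
proof -
 have h: "cube_map Y Z fst" "cube_map Y Z snd" unfolding Y_def by (intro cube_mapI continuous_map_fst continuous_map_snd)+
 have c1: "vanishes_on interleaved (cup1 Y (pullback Y snd f') (pullback Y fst g))" if f': "f' \<in> cochains Z S''" for f' S''
  unfolding vanishes_on_def
 proof (intro allI impI)
  fix m and T :: "('a \<times> 'a) cube" assume T: "interleaved m T"
  show "cup1 Y (pullback Y snd f') (pullback Y fst g) m T = 0"
  proof (cases "singular m Y T")
   case True
   have "cup_one (free m) (%u v. ev (pullback Y snd f') T u * ev (pullback Y fst g) T v) = 0"
   proof (rule cup_one_zero)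
    fix u v :: face_word and i assume *: "length u = length (free m :: face_word)" "length v = length (free m :: face_word)"
     "i < length (free m :: face_word)" "u ! i = None" "v ! i = None"
    have p: "indep m (push m h T) i" if "indep m (h \<circ> T) i" for h :: "'a \<times> 'a => 'a"
     unfolding indep_def
    proof (intro ballI impI)
     fix t t' assume t: "t \<in> pts m" "t' \<in> pts m" "\<forall>j. j ~= i --> t j = t' j"
     from that[unfolded indep_def, rule_format, OF t(1,2)] have "(h \<circ> T) t = (h \<circ> T) t'" using t(3) by blast
     then show "push m h T t = push m h T t'" using t(1,2) by (simp add: push_def)
    qed
    have i: "i < m" using * by simp
    have "ev f' (push m snd T) u = 0 \<or> ev g (push m fst T) v = 0"
    proof (cases "indep m (fst \<circ> T) i")
     case True
     have "length v = m" using * by simp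
     then have "indep (length v) (push m fst T) i" "i < length v" using p[OF True] i by blast+
     from ev_indep[OF g(1) this *(5)] show ?thesis ..
    next
     case False
     then have "indep m (snd \<circ> T) i" using T i unfolding interleaved_def by blast
     note q = p[OF this]
     have "length u = m" using * by simp
     then have "indep (length u) (push m snd T) i" "i < length u" using q i by blast+
     from ev_indep[OF f' this *(4)] show ?thesis ..
    qed
    then show "ev (pullback Y snd f') T u * ev (pullback Y fst g) T v = 0"
     using True * by (auto simp: ev_pullback)
   qed
   then show ?thesis using True by (simp add: cup1_def)
  qed (simp add: cup1_def)
 qed
 have "vanishes_on interleaved (codiff Y k)" if "vanishes_on interleaved k" for k
  unfolding vanishes_on_def
 proof (intro allI impI)
  fix m and T :: "('a \<times> 'a) cube" assume T: "interleaved m T"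
  show "codiff Y k m T = 0"
  proof (cases "singular m Y T")
   case True
   have "bdry (free m) (ev k T) = bdry (free m) (%u. 0)"
    using vanishes_on_ev[OF stable_interleaved that] T by (intro boundary_cong) simp
   then show ?thesis using True by (simp add: cube_codiff_eq word_lin)
  qed (simp add: nonsingular)
 qed
 note this[OF c1[OF f(1)]] c1[OF cube_codiff_in[OF f(1)]]
 moreover have "cup1 Y (pullback Y snd (codiff Z f)) (pullback Y fst g) - cup1 Y (pullback Y snd f) 0 + codiff Y (cup1 Y (pullback Y snd f) (pullback Y fst g))
  = cup Y (pullback Y snd f) (pullback Y fst g) + cup Y (pullback Y fst g) (pullback Y snd f)"
  using codiff_cup1[OF pullback_in[OF f(1)] f(2) pullback_in[OF g(1)] g(2), of Y snd fst]
   pullback_codiff[OF h(2), of f] pullback_codiff[OF h(1), of g] g(3) by simp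
 moreover have "cup1 Y k 0 = 0" for k :: "('a \<times> 'a) cochain" by (auto simp: fun_eq_iff cup1_def cup_one_lin)
 ultimately show ?thesis using vanishes_on_lin(1) by fastforce
qed

section \<open>Solutions of the Maurer-Cartan equation\<close>

text \<open>Sequences are treated as formal power series in a weight, with this as their product.
  The Maurer-Cartan equation and its linearisation become equations between such series.\<close>

definition conv :: "'y topology => (nat => 'y cochain) => (nat => 'y cochain) => nat => 'y cochain" where
 "conv Y F G s = (\<Sum>i\<le>s. cup Y (F i) (G (s - i)))"

abbreviation seqd :: "'y topology => (nat => 'y cochain) => nat => 'y cochain" where
 "seqd Y F \<equiv> (%s. codiff Y (F s))"

lemmas sum_eqs = sum.infinite sum.empty sum.insert simp_thms

lemma codiff_sum: "codiff Y (sum f I) = (\<Sum>i\<in>I. codiff Y (f i))"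
 by (induction I rule: infinite_finite_induct) (simp_all only: sum_eqs codiff_lin)

lemma cup_sum: "cup Y (sum f I) h = (\<Sum>i\<in>I. cup Y (f i) h)" "cup Y h (sum f I) = (\<Sum>i\<in>I. cup Y h (f i))"
 by (induction I rule: infinite_finite_induct) auto

lemma pullback_sum: "pullback Y h (sum f I) = (\<Sum>i\<in>I. pullback Y h (f i))"
 by (induction I rule: infinite_finite_induct) (simp_all only: sum_eqs pullback_lin)

lemma conv_lin [simp]:
 "conv Y (F + G) H = conv Y F H + conv Y G H" "conv Y (F - G) H = conv Y F H - conv Y G H" "conv Y (- F) H = - conv Y F H"
 "conv Y H (F + G) = conv Y H F + conv Y H G" "conv Y H (F - G) = conv Y H F - conv Y H G" "conv Y H (- F) = - conv Y H F"
 by (auto simp: conv_def sum.distrib sum_subtractf sum_negf)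

lemma conv_assoc: "conv Y (conv Y F G) H = conv Y F (conv Y G H)"
proof
 fix s
 have "conv Y (conv Y F G) H s = (\<Sum>i\<le>s. \<Sum>j\<le>i. cup Y (F j) (cup Y (G (i - j)) (H (s - i))))"
  by (simp add: conv_def cup_sum cup_assoc)
 also have "... = (\<Sum>(i, j)\<in>(SIGMA i:{..s}. {..i}). cup Y (F j) (cup Y (G (i - j)) (H (s - i))))"
  by (simp add: sum.Sigma)
 also have "... = (\<Sum>(j, i)\<in>(SIGMA j:{..s}. {..s - j}). cup Y (F j) (cup Y (G i) (H (s - j - i))))"
  by (rule sum.reindex_bij_witness[of _ "%(j, i). (j + i, j)" "%(i, j). (j, i - j)"]) auto
 also have "... = conv Y F (conv Y G H) s"
  by (simp add: conv_def cup_sum sum.Sigma)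
 finally show "conv Y (conv Y F G) H s = conv Y F (conv Y G H) s" .
qed

lemma seqd_lin:
 "seqd Y (F + G) = seqd Y F + seqd Y G" "seqd Y (F - G) = seqd Y F - seqd Y G" "seqd Y (- F) = - seqd Y F"
 by auto

lemma seqd_conv:
 assumes "!!s. F s \<in> cochains Y (S s)" "!!s m. m \<in> S s ==> even m = b"
 shows "seqd Y (conv Y F G) = conv Y (seqd Y F) G + (%s. sgn_if b (conv Y F (seqd Y G) s))"
proof
 fix s
 have "sgn_if b (sum f I) = (\<Sum>i\<in>I. sgn_if b (f i :: 'a cochain))" for f and I :: "nat set"
  by (simp add: sgn_if_def sum_negf)
 then show "seqd Y (conv Y F G) s = (conv Y (seqd Y F) G + (%s. sgn_if b (conv Y F (seqd Y G) s))) s"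
  by (simp add: conv_def codiff_sum leibniz[OF assms] sum.distrib)
qed

lemma conv_in:
 assumes "!!i. F i \<in> cochains Y {a * i + p}" "!!i. G i \<in> cochains Y {a * i + q}"
 shows "conv Y F G s \<in> cochains Y {a * s + (p + q)}"
 unfolding conv_def
proof (rule cochains_sum)
 fix i assume "i \<in> {..s}"
 then obtain j where j: "s = i + j" by (auto dest: le_Suc_ex)
 have "cup Y (F i) (G (s - i)) \<in> cochains Y {u + v |u v. u \<in> {a * i + p} & v \<in> {a * j + q}}"
  using cube_cup_in[OF assms(1)[of i] assms(2)[of j]] j by simp
 then show "cup Y (F i) (G (s - i)) \<in> cochains Y {a * s + (p + q)}"
  by (rule cochains_mono) (auto simp: j algebra_simps)
qed

lemma conv_zero: "(!!i. i \<le> s ==> F i = 0 \<or> G (s - i) = 0) ==> conv Y F G s = 0"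
 unfolding conv_def by (rule sum.neutral) fastforce

text \<open>A series that starts with \<open>G 1\<close> on the first factor and is continued by
  integrating, with \<open>hop\<close>, its bracket with \<open>G\<close> on the second factor.
  Entry \<open>k\<close> has weight \<open>k + 1\<close>.\<close>

function secondary :: "'z topology => (nat => 'z cochain) => nat => ('z \<times> 'z) cochain" where
 "secondary Z G k = (let Y = prod_topology Z Z in if k = 0 then pullback Y fst (G 1) else
   hop Z (\<Sum>i<k. cup Y (pullback Y snd (G (k - i))) (secondary Z G i) + cup Y (secondary Z G i) (pullback Y snd (G (k - i)))))"
 by pat_completeness auto
termination by (relation "Wellfounded.measure (%(Z, G, k). k)") auto

declare secondary.simps [simp del]

section \<open>Transport of the first term along a solution\<close>

locale maurer_cartan =
 fixes Z :: "'z topology" and G :: "nat => 'z cochain" and n :: nat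
 assumes G_in: "!!s. G s \<in> cochains Z {2 * n * s + 1}" and G_zero: "G 0 = 0"
  and codiff_G: "!!s. codiff Z (G s) = - conv Z G G s"
begin

definition "Y = prod_topology Z Z"
definition "Gs = (%s. pullback Y snd (G s))"
definition "W = secondary Z G"
definition "bracket F = conv Y Gs F + conv Y F Gs"

lemma cube_map_fst: "cube_map Y Z fst" and cube_map_snd: "cube_map Y Z snd"
 unfolding Y_def by (intro cube_mapI continuous_map_fst continuous_map_snd)+

lemma Gs_zero: "Gs 0 = 0" by (simp add: Gs_def G_zero)

lemma Gs_in: "Gs s \<in> cochains Y {2 * n * s + 1}"
 unfolding Gs_def by (rule pullback_in[OF G_in])

lemma codiff_G1: "codiff Z (G 1) = 0"
 by (simp add: codiff_G conv_def G_zero)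

lemma seqd_Gs: "seqd Y Gs = - conv Y Gs Gs"
proof
 fix s show "seqd Y Gs s = (- conv Y Gs Gs) s"
  by (simp add: Gs_def conv_def pullback_codiff[OF cube_map_snd, symmetric] codiff_G pullback_sum pullback_cup[OF cube_map_snd])
qed

text \<open>As \<open>Gs 0 = 0\<close>, the bracket in weight \<open>k\<close> involves
  \<open>F\<close> only below \<open>k\<close>; this is what makes the recursion well
  founded.\<close>

lemma bracket_split: "bracket F k = (\<Sum>i<k. cup Y (Gs (k - i)) (F i) + cup Y (F i) (Gs (k - i)))"
proof -
 have "conv Y Gs F k = (\<Sum>i\<le>k. cup Y (Gs (k - i)) (F i))"
  unfolding conv_def by (rule sum.reindex_bij_witness[of _ "%i. k - i" "%i. k - i"]) auto
 then show ?thesis unfolding bracket_def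
  by (simp add: conv_def lessThan_Suc_atMost[symmetric] Gs_zero sum.distrib)
qed

lemma W_zero: "W 0 = pullback Y fst (G 1)"
 by (simp add: W_def secondary.simps[of _ _ 0] Y_def Let_def)

lemma W_Suc: "k > 0 ==> W k = hop Z (bracket W k)"
 by (simp add: W_def secondary.simps[of _ _ k] bracket_split Gs_def Y_def Let_def)

lemma bracket_in:
 assumes "!!i. i < k ==> F i \<in> cochains Y {2 * n * Suc i + 1}"
 shows "bracket F k \<in> cochains Y {2 * n * Suc k + 2}"
 unfolding bracket_split
proof (rule cochains_sum)
 fix i assume i: "i \<in> {..<k}"
 then obtain j where j: "k = i + j" using less_imp_add_positive by blast
 have *: "cup Y f g \<in> cochains Y {2 * n * Suc k + 2}"
  if "f \<in> cochains Y {a}" "g \<in> cochains Y {b}" "a + b = 2 * n * Suc k + 2" for f g a b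
  by (rule cochains_mono[OF cube_cup_in[OF that(1,2)]]) (use that in auto)
 show "cup Y (Gs (k - i)) (F i) + cup Y (F i) (Gs (k - i)) \<in> cochains Y {2 * n * Suc k + 2}"
  using i by (intro cochains_lin *[OF Gs_in assms] *[OF assms Gs_in]) (auto simp: j algebra_simps)
qed

lemma W_in: "W k \<in> cochains Y {2 * n * Suc k + 1}"
proof (induction k rule: less_induct)
 case (less k)
 show ?case
 proof (cases "k = 0")
  case True
  then show ?thesis using pullback_in[OF G_in[of 1]] by (simp add: W_zero)
 next
  case False
  have "hop Z (bracket W k) \<in> cochains Y {m. Suc m \<in> {2 * n * Suc k + 2}}"
   unfolding Y_def by (rule hop_in, fold Y_def) (rule bracket_in[OF less])
  then show ?thesis using False by (simp add: W_Suc)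
 qed
qed

text \<open>The three claims support each other. The bracket vanishes on interleaved cubes because
  the earlier \<open>W i\<close> do, or, for \<open>W 0\<close>, by exact anticommutativity; it is
  closed because the equation holds below \<open>k\<close>; then \<open>hop\<close> integrates
  it.\<close>

lemma W_structure:
 "vanishes_on interleaved (bracket W k) & (k > 0 --> vanishes_on interleaved (W k)) & codiff Y (W k) + bracket W k = 0"
proof (induction k rule: less_induct)
 case (less k)
 have v: "vanishes_on interleaved (bracket W k)"
 proof -
  have "vanishes_on interleaved (cup Y (Gs (k - i)) (W i) + cup Y (W i) (Gs (k - i)))" if "i < k" for i
  proof (cases "i = 0")
   case True
   have "vanishes_on interleaved (cup Y (pullback Y snd (G k)) (pullback Y fst (G 1)) + cup Y (pullback Y fst (G 1)) (pullback Y snd (G k)))"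
    unfolding Y_def by (rule interleaved_commute[OF G_in[of k] _ G_in[of 1]]) (use codiff_G1 in auto)
   then show ?thesis using True by (simp add: W_zero Gs_def)
  next
   case False
   then show ?thesis using less[OF that] by (intro vanishes_on_lin vanishes_on_cup stable_interleaved) auto
  qed
  then have "vanishes_on interleaved (\<Sum>i\<in>I. cup Y (Gs (k - i)) (W i) + cup Y (W i) (Gs (k - i)))" if "I \<subseteq> {..<k}" for I
   using that by (induction I rule: infinite_finite_induct) (simp_all add: vanishes_on_lin)
  then show ?thesis unfolding bracket_split by simp
 qed
 show ?case
 proof (cases "k = 0")
  case True
  have "codiff Y (W 0) = 0" unfolding W_zero using pullback_codiff[OF cube_map_fst, of "G 1"] codiff_G1 by simp
  moreover have "bracket W 0 = 0" by (simp only: bracket_split lessThan_0 sum.empty)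
  ultimately show ?thesis using True v by (metis add_0 less_irrefl)
 next
  case False
  \<comment> \<open>The defect of the equation. The differential of the bracket is expressed by
    \<open>R\<close>, as in a Bianchi identity, and with \<open>Gs 0 = 0\<close> only the vanishing
    entries below \<open>k\<close> enter.\<close>
  define R where "R = seqd Y W + bracket W"
  have R: "R i = 0" if "i < k" for i using less[OF that] unfolding R_def plus_fun_apply by blast
  have dW: "seqd Y W = R - bracket W" by (simp add: R_def)
  have "seqd Y (bracket W) = conv Y R Gs - conv Y Gs R"
  proof -
   have 1: "seqd Y (conv Y Gs W) = conv Y (seqd Y Gs) W - conv Y Gs (seqd Y W)"
    using seqd_conv[OF Gs_in, where b=False and G=W] by (auto simp: sgn_if_def fun_eq_iff)
   have 2: "seqd Y (conv Y W Gs) = conv Y (seqd Y W) Gs - conv Y W (seqd Y Gs)"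
    using seqd_conv[OF W_in, where b=False and G=Gs] by (auto simp: sgn_if_def fun_eq_iff)
   have "seqd Y (bracket W) = seqd Y (conv Y Gs W) + seqd Y (conv Y W Gs)" unfolding bracket_def by (rule seqd_lin)
   then show ?thesis unfolding 1 2 dW seqd_Gs conv_lin unfolding bracket_def conv_lin conv_assoc by (simp add: algebra_simps)
  qed
  then have "codiff Y (bracket W k) = conv Y R Gs k - conv Y Gs R k" by (metis (no_types, lifting) minus_apply)
  moreover have "conv Y R Gs k = 0" using R by (intro conv_zero) (metis Gs_zero diff_self_eq_0 le_neq_implies_less)
  moreover have "conv Y Gs R k = 0"
  proof (rule conv_zero)
   fix i assume "i \<le> k"
   then show "Gs i = 0 \<or> R (k - i) = 0" using R[of "k - i"] Gs_zero False by (cases "i = 0") auto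
  qed
  ultimately have "codiff Y (bracket W k) = 0" by simp
  moreover have "codiff Y (hop Z (bracket W k)) + hop Z (codiff Y (bracket W k)) = - bracket W k"
   using hop_homotopy[OF bracket_in[OF W_in, unfolded Y_def] v] by (simp add: Y_def)
  ultimately have "codiff Y (W k) + bracket W k = 0" using False by (simp add: W_Suc)
  then show ?thesis using v vanishes_on_hop[OF stable_interleaved v] False by (simp add: W_Suc)
 qed
qed

lemma codiff_W: "codiff Y (W k) = - bracket W k"
 using W_structure[of k] by (simp add: eq_neg_iff_add_eq_0)

lemma W_vanishes_fst:
 assumes "!!s. vanishes_on (%m T. \<forall>t\<in>pts m. T t \<in> D) (G s)"
 shows "vanishes_on (%m T. \<forall>t\<in>pts m. fst (T t) \<in> D) (W k)"
proof (induction k rule: less_induct)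
 case (less k)
 let ?P = "%m (T :: ('z \<times> 'z) cube). \<forall>t\<in>pts m. fst (T t) \<in> D"
 show ?case
 proof (cases "k = 0")
  case True
  have "pullback Y fst (G 1) m T = 0" if "?P m T" for m T
  proof -
   have "\<forall>t\<in>pts m. push m fst T t \<in> D" using that by (simp add: push_def)
   then have "G 1 m (push m fst T) = 0" using assms[of 1] unfolding vanishes_on_def by blast
   then show ?thesis by (cases "singular m Y T") (simp_all add: pullback_apply pullback_nonsingular)
  qed
  then show ?thesis using True by (simp add: W_zero vanishes_on_def)
 next
  case False
  have "vanishes_on ?P (\<Sum>i\<in>I. cup Y (Gs (k - i)) (W i) + cup Y (W i) (Gs (k - i)))" if "I \<subseteq> {..<k}" for I
   using that less by (induction I rule: infinite_finite_induct) (auto intro!: vanishes_on_lin vanishes_on_cup stable_components)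
  then show ?thesis using False unfolding W_Suc[OF False[unfolded neq0_conv]] bracket_split by (intro vanishes_on_hop stable_components) blast
 qed
qed

lemma Gs_vanishes_snd:
 assumes "!!s. vanishes_on (%m T. \<forall>t\<in>pts m. T t \<in> D) (G s)"
 shows "vanishes_on (%m T. \<forall>t\<in>pts m. snd (T t) \<in> D) (Gs k)"
 unfolding vanishes_on_def
proof (intro allI impI)
 fix m and T :: "('z \<times> 'z) cube" assume "\<forall>t\<in>pts m. snd (T t) \<in> D"
 then have "\<forall>t\<in>pts m. push m snd T t \<in> D" by (simp add: push_def)
 then have "G k m (push m snd T) = 0" using assms[of k] unfolding vanishes_on_def by blast
 then show "Gs k m T = 0" unfolding Gs_def by (cases "singular m Y T") (simp_all add: pullback_apply pullback_nonsingular)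
qed

text \<open>For \<open>k > 0\<close> each term of the bracket contains a factor \<open>Gs\<close>.
  The entry \<open>W 0\<close> depends on the first component alone, whence the restriction.\<close>

lemma W_vanishes_snd:
 assumes "!!s. vanishes_on (%m T. \<forall>t\<in>pts m. T t \<in> D) (G s)" "k > 0"
 shows "vanishes_on (%m T. \<forall>t\<in>pts m. snd (T t) \<in> D) (W k)"
proof -
 have "vanishes_on (%m T. \<forall>t\<in>pts m. snd (T t) \<in> D) (\<Sum>i\<in>I. cup Y (Gs (k - i)) (W i) + cup Y (W i) (Gs (k - i)))" for I
  using Gs_vanishes_snd[OF assms(1)] by (induction I rule: infinite_finite_induct) (auto intro!: vanishes_on_lin vanishes_on_cup stable_components)
 then show ?thesis unfolding W_Suc[OF assms(2)] bracket_split by (intro vanishes_on_hop stable_components) blast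
qed

end

section \<open>The second solution and its loop integral\<close>

locale diagonal_maurer_cartan = maurer_cartan "prod_topology X X" G n for X :: "'y topology" and G n +
 assumes G_diagonal: "!!s. diag_vanish (G s)"
begin

abbreviation "XX \<equiv> prod_topology X X"
abbreviation "LX \<equiv> loops X"

abbreviation "dg \<equiv> (%z :: 'y \<times> 'y. (z, z))"
abbreviation "D \<equiv> {z :: 'y \<times> 'y. fst z = snd z}"

text \<open>The shift by one lets \<open>w s\<close> have the degree of \<open>G s\<close>, with
  first term \<open>G 1\<close>. On the diagonal of the square, both copies of \<open>G\<close>
  become the same series.\<close>

definition "w s = (case s of 0 => 0 | Suc k => pullback XX dg (W k))"

lemma cube_map_dg: "cube_map XX Y dg"
 unfolding Y_def by (intro cube_mapI) (simp add: continuous_map_pairwise o_def)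

lemma pullback_dg_Gs: "pullback XX dg (Gs k) = G k"
proof -
 have "pullback XX dg (Gs k) = pullback XX (snd \<circ> dg) (G k)"
  unfolding Gs_def by (rule pullback_pullback[OF cube_map_dg])
 also have "... = G k" by (rule pullback_id[OF G_in]) simp
 finally show ?thesis .
qed

lemma w_one: "w 1 = G 1"
proof -
 have "w 1 = pullback XX (fst \<circ> dg) (G 1)"
  unfolding w_def by (simp add: W_zero pullback_pullback[OF cube_map_dg])
 also have "... = G 1" by (rule pullback_id[OF G_in]) simp
 finally show ?thesis .
qed

lemma w_in: "w s \<in> cochains XX {2 * n * s + 1}"
 using pullback_in[OF W_in] by (cases s) (auto simp: w_def)

lemma vanishes_on_G: "vanishes_on (%m T. \<forall>t\<in>pts m. T t \<in> D) (G s)"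
 using G_diagonal by (simp add: vanishes_on_def diag_vanish_def)

lemma w_diagonal: "diag_vanish (w s)"
proof (cases s)
 case (Suc k)
 have "w s m T = 0" if "\<forall>t\<in>pts m. fst (T t) = snd (T t)" for m T
 proof (cases "singular m XX T")
  case True
  have "W k m (push m dg T) = 0"
   using W_vanishes_fst[OF vanishes_on_G, of k] that by (simp add: vanishes_on_def push_def)
  then show ?thesis using True Suc by (simp add: w_def pullback_apply)
 qed (simp add: w_def pullback_nonsingular Suc)
 then show ?thesis by (simp add: diag_vanish_def)
qed (simp add: w_def diag_vanish_def)

lemma codiff_w: "codiff XX (w s) = - (conv XX G w s + conv XX w G s)"
proof (cases s)
 case 0
 have "conv XX G w 0 = 0" "conv XX w G 0 = 0"
  by (intro conv_zero; simp add: G_zero)+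
 then show ?thesis using 0 by (simp add: w_def)
next
 case (Suc k)
 let ?P = "pullback XX dg"
 have 1: "conv XX G w (Suc k) = (\<Sum>i<k. cup XX (G (k - i)) (?P (W i)))"
 proof -
  have "conv XX G w (Suc k) = (\<Sum>j\<le>Suc k. cup XX (G (Suc k - j)) (w j))"
   unfolding conv_def by (rule sum.reindex_bij_witness[of _ "%i. Suc k - i" "%i. Suc k - i"]) auto
  also have "... = (\<Sum>i<Suc k. cup XX (G (k - i)) (?P (W i)))"
   by (simp add: sum.atMost_Suc_shift w_def lessThan_Suc_atMost del: sum.atMost_Suc)
  finally show ?thesis by (simp add: G_zero)
 qed
 have 2: "conv XX w G (Suc k) = (\<Sum>i<k. cup XX (?P (W i)) (G (k - i)))"
 proof -
  have "conv XX w G (Suc k) = (\<Sum>i<Suc k. cup XX (?P (W i)) (G (k - i)))"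
   by (simp add: conv_def sum.atMost_Suc_shift w_def lessThan_Suc_atMost del: sum.atMost_Suc)
  then show ?thesis by (simp add: G_zero)
 qed
 have "codiff XX (w (Suc k)) = - ?P (bracket W k)"
  by (simp add: w_def pullback_codiff[OF cube_map_dg, symmetric] codiff_W)
 also have "?P (bracket W k) = conv XX G w (Suc k) + conv XX w G (Suc k)"
  unfolding bracket_split pullback_sum 1 2 by (simp add: pullback_cup[OF cube_map_dg] pullback_dg_Gs sum.distrib)
 finally show ?thesis unfolding Suc .
qed

abbreviation dcube :: "nat => (complex => 'y) cube => (('y \<times> 'y) \<times> ('y \<times> 'y)) cube" where
 "dcube m V \<equiv> push (Suc m) dg (ecube m V)"

text \<open>The letter \<open>Qd\<close> in the loop direction compares the loop at the two times
  \<open>s t\<close> and \<open>t\<close>. This square is the cochain homotopy between the loop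
  integral of \<open>w\<close> and a product of two loop integrals.\<close>

definition N :: "nat => (complex => 'y) cochain" where
 "N k = (%m V. if singular m LX V then W k (Suc (Suc m)) (rp (Qd # replicate m Dg) (dcube m V)) else 0)"

lemma singular_dcube: "singular m LX V ==> singular (Suc m) Y (dcube m V)"
 using singular_ecube cube_map_dg unfolding cube_map_def by blast

lemma ev_N:
 assumes "singular (length u) LX V"
 shows "ev (N k) V u = W k (nparam (Qd # diag_word u)) (rp (Qd # diag_word u) (dcube (length u) V))"
proof -
 have "dcube (nfree u) (fc u V) = fc (None # u) (dcube (length u) V)"
  using fc_push[of "None # u" dg "ecube (length u) V"] by (simp add: fc_ecube)
 then have "rp (Qd # replicate (nfree u) Dg) (dcube (nfree u) (fc u V)) = rp (Qd # diag_word u) (dcube (length u) V)"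
  using rp_fc[of "Qd # replicate (nfree u) Dg" "None # u" "dcube (length u) V"] by (simp add: subst_diag_word)
 then show ?thesis using singular_fc[OF assms] by (simp add: ev_def N_def nparam_diag_word)
qed

lemma N_in: "N k \<in> cochains LX {m. Suc (Suc m) = 2 * n * Suc k + 1}"
 unfolding cochains_def
proof (intro CollectI allI impI conjI notI)
 fix m V assume nz: "N k m V ~= 0"
 then show "singular m LX V" by (simp add: N_def split: if_splits)
 have nz': "W k (Suc (Suc m)) (rp (Qd # replicate m Dg) (dcube m V)) ~= 0" using nz by (simp add: N_def split: if_splits)
 then show "Suc (Suc m) = 2 * n * Suc k + 1" using cochains_zero[OF W_in] by blast
 assume "degenerate_cube m V"
 then obtain i where i: "i < m" "indep m V i" by (auto simp: degenerate_iff)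
 have "indep (Suc m) (dcube m V) (Suc i)"
 proof (rule indep_shift[OF i(2)])
  fix t t' assume t: "t \<in> pts (Suc m)" "t' \<in> pts (Suc m)" "t 0 = t' 0" "V (%i. t (Suc i)) = V (%i. t' (Suc i))"
  then show "dcube m V t = dcube m V t'" by (simp add: push_def ecube_def)
 qed
 then have "degenerate_cube (nparam (Qd # replicate m Dg)) (rp (Qd # replicate m Dg) (dcube m V))"
  using i by (intro degenerate_rp[of _ _ "Suc i"]) auto
 then show False using nz' cochains_zero[OF W_in] by (simp add: nparam_replicate)
qed

text \<open>The equation \<open>codiff_W\<close> is evaluated on the cube with \<open>Qd\<close> in
  the loop direction. Its diagonal face gives the integral of \<open>w\<close>, the faces in the
  other coordinates give the differential of \<open>N\<close>, and on the bracket side only one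
  distribution of the two times avoids the diagonal.\<close>

lemma loop_integral_w:
 assumes "k > 0"
 shows "lint X (w (Suc k)) = codiff LX (N k) - cup LX (lint X (G k)) (lint X (G 1))"
proof (intro cochain_eqI)
 fix m V
 let ?L = "loops X" and ?A = "app (replicate m Dg)"
 show "lint X (w (Suc k)) m V = (codiff ?L (N k) - cup ?L (lint X (G k)) (lint X (G 1))) m V"
 proof (cases "singular m ?L V")
  case True
  define T where "T = dcube m V"
  define x where "x = Qd # replicate m Dg"
  have T: "singular (length x) Y T" using singular_dcube[OF True] by (simp add: T_def x_def)
  let ?F = "%f y. f (nparam y) (rp y T)"
  have comp: "fst (T t) = ecube m V t" "snd (T t) = ecube m V t" if "t \<in> pts (Suc m)" for t
   using that by (simp_all add: T_def push_def)
  have E: "ecube m V t \<in> D" if "t \<in> pts (Suc m)" "t 0 = 0 \<or> t 0 = 1" for t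
   using that by (auto simp: ecube_def simp flip: cis_2pi)
  \<comment> \<open>These leading letters hold the first component at one of the two ends of the
    loop, hence in the diagonal of \<open>X\<close>; the next fact is the same for the second
    component.\<close>
  have one: "fst (rp (l # y) T t) \<in> D" if "l \<in> {Hb, Fx True True, Fx False False}" "length y = m" "t \<in> pts (nparam (l # y))" for l y t
   using p_pts(1)[OF that(3)] that comp E by (auto simp: rp_def simp del: p1.simps) (auto simp: rp_def)
  have two: "snd (rp (l # y) T t) \<in> D" if "l \<in> {Ha, Fx True True, Fx False False}" "length y = m" "t \<in> pts (nparam (l # y))" for l y t
   using p_pts(2)[OF that(3)] that comp E by (auto simp: rp_def simp del: p2.simps) (auto simp: rp_def)
  have W1: "?F (W i) (l # y) = 0" if "l \<in> {Hb, Fx True True, Fx False False}" "length y = m" for l y i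
   using W_vanishes_fst[OF vanishes_on_G, of i] one[OF that] unfolding vanishes_on_def by blast
  have W2: "?F (W i) (l # y) = 0" if "l \<in> {Ha, Fx True True, Fx False False}" "length y = m" "i > 0" for l y i
   using W_vanishes_snd[OF vanishes_on_G that(3)] two[OF that(1,2)] unfolding vanishes_on_def by blast
  have G2: "?F (Gs i) (l # y) = 0" if "l \<in> {Ha, Fx True True, Fx False False}" "length y = m" for l y i
   using Gs_vanishes_snd[OF vanishes_on_G, of i] two[OF that(1,2)] unfolding vanishes_on_def by blast
  have idle: "?F (W i) (Du # y) = 0" "?F (Gs i) (Du # y) = 0" for i y
   using degenerate_rp_idle[of "Du # y" T] cochains_zero[OF W_in] cochains_zero[OF Gs_in] by simp_all
  have a: "length (?A u) = m" "nparam (?A u) = nfree u" if "length u = m" for u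
   using that app_simps[of u "replicate m Dg"] by (simp_all add: nparam_replicate)
  have W1': "W i (Suc (nfree u)) (rp (Hb # ?A u) T) = 0" "W i (nfree u) (rp (Fx b b # ?A u) T) = 0"
   if "length u = m" for u i b
   using W1[of Hb "?A u" i] W1[of "Fx b b" "?A u" i] that by (cases b; simp add: a)+
  have W2': "W i (Suc (nfree u)) (rp (Ha # ?A u) T) = 0" if "length u = m" "i > 0" for u i
   using W2[of Ha "?A u" i] that by (simp add: a)
  have G2': "Gs i (Suc (nfree u)) (rp (Ha # ?A u) T) = 0" "Gs i (nfree u) (rp (Fx b b # ?A u) T) = 0"
   if "length u = m" for u i b
   using G2[of Ha "?A u" i] G2[of "Fx b b" "?A u" i] that by (cases b; simp add: a)+
  have idle': "W i (Suc (nfree u)) (rp (Du # ?A u) T) = 0" "Gs i (Suc (nfree u)) (rp (Du # ?A u) T) = 0"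
   if "length u = m" for u i
   using idle[of i "?A u"] that by (simp_all add: a)
  \<comment> \<open>The four ways in which the coproduct can distribute the two parameters of
    \<open>Qd\<close>. The surviving one pairs \<open>Hb\<close>, at the times
    \<open>(0, t)\<close>, with \<open>Ha\<close>, at the times \<open>(s, 1)\<close>.\<close>
  have cup: "cup Y f g (Suc (Suc m)) (rp x T) = diag (free m) (%u v.
    ?F f (Qd # ?A u) * ?F g (Fx True True # ?A v)
    + sg u * ?F f (Du # ?A u) * ?F g (Dg # ?A v)
    - sg u * ?F f (Hb # ?A u) * ?F g (Ha # ?A v)
    + ?F f (Fx False False # ?A u) * ?F g (Qd # ?A v))" for f g
  proof -
   have "cup Y f g (Suc (Suc m)) (rp x T) = diag (free (nparam x)) (%u v. ?F f (app x u) * ?F g (app x v))"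
    using cup_rp[of x "prod_topology X X" T f g] T by (simp add: x_def nparam_replicate Y_def)
   also have "... = diag (free m) (%u v.
     ?F f (Qd # ?A u) * ?F g (Fx True True # ?A v)
     + sg u * ?F f (Du # ?A u) * ?F g (Dg # ?A v)
     - sg u * ?F f (Hb # ?A u) * ?F g (Ha # ?A v)
     + ?F f (Fx False False # ?A u) * ?F g (Qd # ?A v))"
    by (simp add: x_def nparam_replicate sg_def) (rule diagonal_cong, simp add: algebra_simps)
   finally show ?thesis .
  qed
  have cupW: "cup Y (W i) (Gs j) (Suc (Suc m)) (rp x T) = 0" for i j
  proof -
   have "cup Y (W i) (Gs j) (Suc (Suc m)) (rp x T) = diag (free m) (%u v. 0)"
    unfolding cup by (rule diagonal_cong) (simp add: a W1' G2' idle')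
   then show ?thesis by (simp add: word_lin)
  qed
  have cupG: "cup Y (Gs j) (W i) (Suc (Suc m)) (rp x T) = 0" if "i > 0" for i j
  proof -
   have "cup Y (Gs j) (W i) (Suc (Suc m)) (rp x T) = diag (free m) (%u v. 0)"
    unfolding cup by (rule diagonal_cong) (simp add: a W1' W2' G2' idle' that)
   then show ?thesis by (simp add: word_lin)
  qed
  have push_rp: "push (nparam y) snd (rp y T) = (\<lambda>t\<in>pts (nparam y). ecube m V (p2 y t))"
    "push (nparam y) fst (rp y T) = (\<lambda>t\<in>pts (nparam y). ecube m V (p1 y t))" if "length y = Suc m" for y
   using p_pts[of _ y] that by (auto simp: push_def rp_def comp)
  have p: "p1 (?A u) t = ins u t" "p2 (?A u) t = ins u t" if "length u = m" "t \<in> pts (nfree u)" for u t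
   using app_simps(3,4)[of u "replicate m Dg" t] p_replicate[OF ins_pts[OF that(2)]] that by (simp_all add: nparam_replicate)
  have e: "(\<lambda>t\<in>pts (Suc (nfree u)). ecube m V (case_nat (t 0) (ins u (%i. t (Suc i))))) = ecube (nfree u) (fc u V)" if "length u = m" for u
  proof -
   have "fc (None # u) (ecube m V) = (\<lambda>t\<in>pts (Suc (nfree u)). ecube m V (case_nat (t 0) (ins u (%i. t (Suc i)))))"
    by (simp add: fc_def)
   from this[symmetric] fc_ecube(1)[OF that, of V] show ?thesis by (rule trans)
  qed
  have Gh: "?F (Gs k) (Hb # ?A u) = ev (lint X (G k)) V u" if u: "length u = m" for u
  proof -
   have "push (Suc (nfree u)) snd (rp (Hb # ?A u) T) = ecube (nfree u) (fc u V)"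
    unfolding e[OF u, symmetric] using push_rp(1)[of "Hb # ?A u"] p(2)[OF u tail_pts]
    by (simp add: a[OF u] cong: restrict_cong)
   moreover have "singular (Suc (nfree u)) Y (rp (Hb # ?A u) T)"
    using singular_rp[of "Hb # ?A u" "prod_topology X X" T] T by (simp add: Y_def x_def a[OF u])
   ultimately show ?thesis using True u singular_fc[of u "loops X" V]
    by (simp add: Gs_def pullback_apply a[OF u] ev_def lint_def)
  qed
  have Wh: "?F (W 0) (Ha # ?A u) = ev (lint X (G 1)) V u" if u: "length u = m" for u
  proof -
   have "push (Suc (nfree u)) fst (rp (Ha # ?A u) T) = ecube (nfree u) (fc u V)"
    unfolding e[OF u, symmetric] using push_rp(2)[of "Ha # ?A u"] p(1)[OF u tail_pts]
    by (simp add: a[OF u] cong: restrict_cong)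
   moreover have "singular (Suc (nfree u)) Y (rp (Ha # ?A u) T)"
    using singular_rp[of "Ha # ?A u" "prod_topology X X" T] T by (simp add: Y_def x_def a[OF u])
   ultimately show ?thesis using True u singular_fc[of u "loops X" V]
    by (simp add: W_zero pullback_apply a[OF u] ev_def lint_def)
  qed
  have main: "cup Y (Gs k) (W 0) (Suc (Suc m)) (rp x T) = - cup ?L (lint X (G k)) (lint X (G 1)) m V"
  proof -
   have s: "sg u * ev (lint X (G k)) V u = ev (lint X (G k)) V u" for u
    using sg_ev[OF loop_integral_in[OF G_in], where b=True] by (simp add: sgn_if_def)
   have "cup Y (Gs k) (W 0) (Suc (Suc m)) (rp x T) = diag (free m) (%u v. - (ev (lint X (G k)) V u * ev (lint X (G 1)) V v))"
    unfolding cup by (rule diagonal_cong) (use Gh Wh s in \<open>simp add: a W1' G2' idle'\<close>)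
   then show ?thesis using True by (simp add: word_lin cube_cup_eq)
  qed
  have "codiff Y (W k) (Suc (Suc m)) (rp x T) = sboundary x (?F (W k))"
   using codiff_rp[OF W_in[unfolded Y_def] T[unfolded Y_def]] by (simp add: x_def nparam_replicate Y_def)
  also have "... = ?F (W k) (Ha # replicate m Dg) + ?F (W k) (Hb # replicate m Dg) - ?F (W k) (Dg # replicate m Dg)
    + sboundary (replicate m Dg) (%y. ?F (W k) (Qd # y))" by (simp add: x_def)
  also have "?F (W k) (Dg # replicate m Dg) = lint X (w (Suc k)) m V"
  proof -
   have "rp (Dg # replicate m Dg) T = T" using rp_diag[of "Suc m" T] T
    by (simp add: singular_cube_def extensional_restrict x_def)
   then show ?thesis using True singular_ecube[OF True] by (simp add: lint_def w_def pullback_apply T_def nparam_replicate)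
  qed
  also have "sboundary (replicate m Dg) (%y. ?F (W k) (Qd # y)) = codiff ?L (N k) m V"
  proof -
   have "bdry (free m) (ev (N k) V) = bdry (free m) (%u. ?F (W k) (Qd # diag_word u))"
    using True by (intro boundary_cong) (simp add: ev_N T_def)
   then show ?thesis using True sboundary_diag_word[of "free m" "%y. ?F (W k) (Qd # y)"]
    by (simp add: cube_codiff_eq map_replicate_const)
  qed
  finally have "codiff Y (W k) (Suc (Suc m)) (rp x T) = - lint X (w (Suc k)) m V + codiff ?L (N k) m V"
   using W1[of Hb "replicate m Dg"] W2[of Ha "replicate m Dg"] assms by simp
  moreover have "bracket W k (Suc (Suc m)) (rp x T) = - cup ?L (lint X (G k)) (lint X (G 1)) m V"
  proof -
   have "bracket W k (Suc (Suc m)) (rp x T) = (\<Sum>i<k. cup Y (Gs (k - i)) (W i) (Suc (Suc m)) (rp x T) + cup Y (W i) (Gs (k - i)) (Suc (Suc m)) (rp x T))"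
    by (simp add: bracket_split sum_apply2)
   also have "... = (\<Sum>i\<in>{0}. cup Y (Gs (k - i)) (W i) (Suc (Suc m)) (rp x T))"
    using assms by (intro sum.mono_neutral_cong_right) (auto simp: cupW cupG)
   finally show ?thesis using main by simp
  qed
  ultimately show ?thesis using codiff_W[of k] by simp
 qed (simp add: lint_def nonsingular)
qed

end

lemma scale_in: "f \<in> cochains Y S ==> scale k f \<in> cochains Y S"
 unfolding cochains_def mem_Collect_eq scale_def by (metis mult_zero_right)

lemma cube_map_diagonal: "cube_map X (prod_topology X X) (%x. (x, x))"
 by (intro cube_mapI) (simp add: continuous_map_pairwise o_def)

lemma pullback_diagonal_zero:
 assumes "diag_vanish f"
 shows "pullback X (%x. (x, x)) f = 0"
proof (intro cochain_eqI)
 fix m T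
 have "f m (push m (%x. (x, x)) T) = 0" using assms by (simp add: diag_vanish_def push_def)
 then show "pullback X (%x. (x, x)) f m T = 0 m T"
  by (cases "singular m X T") (simp_all add: pullback_apply pullback_nonsingular)
qed

lemma loop_integral_sum: "lint X (sum f I) = (\<Sum>i\<in>I. lint X (f i))"
 by (induction I rule: infinite_finite_induct) (simp_all only: sum_eqs loop_integral_lin)

section \<open>Comparison of the two solutions\<close>

context diagonal_maurer_cartan
begin

definition "U s = scale (int s) (G s) - w s"

lemma U_in: "U s \<in> cochains XX {2 * n * s + 1}"
 unfolding U_def by (intro cochains_lin w_in scale_in G_in)

lemma U_diagonal: "diag_vanish (U s)"
 using G_diagonal[of s] w_diagonal[of s] by (simp add: diag_vanish_def U_def scale_def)

lemma U_zero: "U 0 = 0" "U 1 = 0"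
proof -
 show "U 0 = 0" by (intro cochain_eqI) (simp add: U_def scale_def w_def)
 show "U 1 = 0" unfolding U_def w_one by (intro cochain_eqI) (simp add: scale_def)
qed

text \<open>Multiplication by the weight is a derivation of \<open>conv\<close>, so
  \<open>s G s\<close> solves the linearised equation; the difference of two solutions is again
  one.\<close>

lemma codiff_U: "seqd XX U = - (conv XX G U + conv XX U G)"
proof
 fix s
 let ?H = "%s. scale (int s) (G s)"
 have "conv XX G ?H s + conv XX ?H G s = scale (int s) (conv XX G G s)"
 proof (intro cochain_eqI)
  fix m T
  have "cup XX (?H i) (G (s - i)) m T + cup XX (G i) (?H (s - i)) m T = int s * cup XX (G i) (G (s - i)) m T" if "i \<le> s" for i
  proof -
   have "cup XX (?H i) (G (s - i)) m T + cup XX (G i) (?H (s - i)) m T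
    = (int i + int (s - i)) * cup XX (G i) (G (s - i)) m T"
    unfolding cup_lin unfolding scale_def by (simp only: distrib_right)
   then show ?thesis using that by simp
  qed
  then show "(conv XX G ?H s + conv XX ?H G s) m T = scale (int s) (conv XX G G s) m T"
   by (simp only: plus_fun_apply conv_def sum_apply2 scale_def[of _ "sum _ _"] sum.distrib[symmetric] sum_distrib_left add.commute) (simp add: add.commute)
 qed
 then have 1: "codiff XX (?H s) = - (conv XX G ?H s + conv XX ?H G s)"
  by (simp add: codiff_G) (simp add: scale_def fun_eq_iff)
 have "U = ?H - w" by (auto simp: U_def)
 then have 2: "conv XX G U s + conv XX U G s = (conv XX G ?H s + conv XX ?H G s) - (conv XX G w s + conv XX w G s)"
  by simp
 have "codiff XX (U s) = codiff XX (?H s) - codiff XX (w s)" by (simp only: U_def codiff_lin)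
 also have "... = - (conv XX G ?H s + conv XX ?H G s) - - (conv XX G w s + conv XX w G s)" by (simp only: 1 codiff_w)
 also have "... = - (conv XX G U s + conv XX U G s)" unfolding 2 by (rule minus_diff_minus)
 finally show "seqd XX U s = (- (conv XX G U + conv XX U G)) s" by (simp only: uminus_apply plus_fun_apply)
qed

context
 assumes n: "n > 0"
  and H1: "!!s f. s \<ge> 2 ==> f \<in> cochains XX {2 * n * s + 1} ==> codiff XX f = 0 ==> \<exists>g\<in>cochains XX {2 * n * s}. f = codiff XX g"
  and H2: "!!s f. s \<ge> 1 ==> f \<in> cochains X {2 * n * s} ==> codiff X f = 0 ==> \<exists>g\<in>cochains X {2 * n * s - 1}. f = codiff X g"
begin

text \<open>Obstruction theory in the weight. The first defect is closed because all lower ones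
  vanish, hence exact by \<open>H1\<close>. Its primitive is closed on the diagonal, hence exact
  there by \<open>H2\<close>, and subtracting a coboundary pulled back along the first projection
  makes it vanish on the diagonal.\<close>

lemma U_exact:
 assumes m: "m \<ge> (1::nat)"
 shows "\<exists>x. (\<forall>s. x s \<in> cochains XX {2 * n * s}) & (\<forall>s. diag_vanish (x s)) &
      (\<forall>s\<le>m. U s = codiff XX (x s) + conv XX G x s - conv XX x G s)"
 using m
proof (induction m rule: nat_induct_at_least)
 case base
 have c: "conv XX G (%_. 0) s = 0" "conv XX (%_. 0) G s = 0" for s by (intro conv_zero; simp)+
 show ?case
 proof (intro exI[of _ "%_. 0"] conjI allI impI)
  fix s
  show "0 \<in> cochains XX {2 * n * s}" by (rule cochains_lin)
  show "diag_vanish (0 :: ('y \<times> 'y) cochain)" by (simp add: diag_vanish_def)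
  assume "s \<le> 1"
  then have "U s = 0" using U_zero by (metis le_neq_implies_less less_one)
  then show "U s = codiff XX 0 + conv XX G (%_. 0) s - conv XX (%_. 0) G s"
   by (simp only: c codiff_lin add_0 diff_self)
 qed
next
 case (Suc m)
 then obtain x where x: "!!s. x s \<in> cochains XX {2 * n * s}" "!!s. diag_vanish (x s)"
  and xU: "!!s. s \<le> m ==> U s = codiff XX (x s) + conv XX G x s - conv XX x G s" by blast
 define y where "y = x(Suc m := 0)"
 have y: "y s \<in> cochains XX {2 * n * s}" "diag_vanish (y s)" for s
  using x[of s] by (auto simp: y_def diag_vanish_def)
 have conv_upd: "conv XX G (x(Suc m := f)) s = conv XX G x s" "conv XX (x(Suc m := f)) G s = conv XX x G s" if "s \<le> Suc m" for s f
 proof -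
  have "cup XX (G i) ((x(Suc m := f)) (s - i)) = cup XX (G i) (x (s - i))" if "i \<le> s" for i
   using \<open>s \<le> Suc m\<close> that G_zero by (cases "i = 0") auto
  then show "conv XX G (x(Suc m := f)) s = conv XX G x s" unfolding conv_def by (intro sum.cong) auto
  have "cup XX ((x(Suc m := f)) i) (G (s - i)) = cup XX (x i) (G (s - i))" if "i \<le> s" for i
   using \<open>s \<le> Suc m\<close> that G_zero by (cases "i = s") auto
  then show "conv XX (x(Suc m := f)) G s = conv XX x G s" unfolding conv_def by (intro sum.cong) auto
 qed
 \<comment> \<open>The defect before entry \<open>m + 1\<close> of \<open>x\<close> is chosen. Since
   \<open>G 0 = 0\<close>, that entry does not enter the convolutions up to this weight, and can be
   chosen afterwards.\<close>
 define E where "E = U - seqd XX y - conv XX G y + conv XX y G"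
 have E0: "E s = 0" if "s \<le> m" for s
 proof -
  have "E s = U s - codiff XX (x s) - conv XX G x s + conv XX x G s"
   unfolding E_def minus_apply plus_fun_apply using conv_upd[of s 0] that by (simp add: y_def)
  then show ?thesis using xU[OF that] by (simp add: algebra_simps)
 qed
 have dE: "seqd XX E = - conv XX G E - conv XX E G"
 proof -
  have U: "U = E + seqd XX y + conv XX G y - conv XX y G" by (simp add: E_def)
  have 1: "seqd XX (conv XX G y) = conv XX (seqd XX G) y - conv XX G (seqd XX y)"
   using seqd_conv[OF G_in, where b=False and G=y] by (auto simp: sgn_if_def fun_eq_iff)
  have 2: "seqd XX (conv XX y G) = conv XX (seqd XX y) G + conv XX y (seqd XX G)"
   using seqd_conv[OF y(1), where b=True and G=G] by (auto simp: sgn_if_def fun_eq_iff)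
  have 3: "seqd XX G = - conv XX G G" using codiff_G by auto
  have 4: "seqd XX (seqd XX y) = 0" by auto
  have "seqd XX E = seqd XX U - seqd XX (seqd XX y) - seqd XX (conv XX G y) + seqd XX (conv XX y G)"
   unfolding E_def by (simp only: seqd_lin)
  also have "... = - (conv XX G U + conv XX U G) - conv XX (- conv XX G G) y + conv XX G (seqd XX y) + conv XX (seqd XX y) G + conv XX y (- conv XX G G)"
   unfolding 1 2 3 4 codiff_U by (simp add: algebra_simps)
  also have "... = - conv XX G E - conv XX E G"
   unfolding U conv_lin conv_assoc by (simp add: algebra_simps)
  finally show ?thesis .
 qed
 have "E (Suc m) \<in> cochains XX {2 * n * Suc m + 1} & diag_vanish (E (Suc m)) & (\<exists>g\<in>cochains XX {2 * n * Suc m}. E (Suc m) = codiff XX g)"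
 proof -
  have e: "E (Suc m) = U (Suc m) - conv XX G y (Suc m) + conv XX y G (Suc m)"
   unfolding E_def minus_apply plus_fun_apply by (simp add: y_def)
  have in1: "conv XX G y (Suc m) \<in> cochains XX {2 * n * Suc m + (1 + 0)}" "conv XX y G (Suc m) \<in> cochains XX {2 * n * Suc m + (0 + 1)}"
   using y(1) G_in by (intro conv_in; simp)+
  then have i: "E (Suc m) \<in> cochains XX {2 * n * Suc m + 1}" unfolding e using U_in[of "Suc m"] in1 by (intro cochains_lin) simp_all
  have v: "diag_vanish (cup XX f g)" if "diag_vanish f" for f g
  proof -
   have z: "ev f T u = 0" if "\<forall>t\<in>pts m. fst (T t) = snd (T t)" "length u = m" for T u m
   proof -
    have "\<forall>t\<in>pts (nfree u). fst (fc u T t) = snd (fc u T t)" using that ins_pts[of _ u] by (simp add: fc_def)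
    then show ?thesis using \<open>diag_vanish f\<close> by (simp add: ev_def diag_vanish_def)
   qed
   then have "cup XX f g m T = 0" if "\<forall>t\<in>pts m. fst (T t) = snd (T t)" for m T
   proof (cases "singular m XX T")
    case True
    have "diag (free m) (%u v. ev f T u * ev g T v) = diag (free m) (%u v. 0)"
     using z that by (intro diagonal_cong) simp
    then show ?thesis using True by (simp add: cube_cup_eq word_lin)
   qed (simp add: nonsingular)
   then show ?thesis by (simp add: diag_vanish_def)
  qed
  have vs: "diag_vanish (conv XX F H s)" if "!!i. diag_vanish (F i)" for F H s
   using v[OF that] by (simp add: diag_vanish_def conv_def sum_apply2)
  have vd: "diag_vanish (E (Suc m))"
   using U_diagonal[of "Suc m"] vs[OF G_diagonal, where H=y and s="Suc m"] vs[OF y(2), where H=G and s="Suc m"] unfolding e by (simp add: diag_vanish_def)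
  have "\<exists>g\<in>cochains XX {2 * n * Suc m}. E (Suc m) = codiff XX g"
  proof -
   have "codiff XX (E (Suc m)) = - conv XX G E (Suc m) - conv XX E G (Suc m)" using fun_cong[OF dE, of "Suc m"] by simp
   moreover have "conv XX G E (Suc m) = 0" "conv XX E G (Suc m) = 0"
   proof -
    show "conv XX G E (Suc m) = 0"
    proof (rule conv_zero)
     fix i assume "i \<le> Suc m"
     then show "G i = 0 \<or> E (Suc m - i) = 0" using E0[of "Suc m - i"] G_zero by (cases "i = 0") auto
    qed
    show "conv XX E G (Suc m) = 0"
    proof (rule conv_zero)
     fix i assume "i \<le> Suc m"
     then show "E i = 0 \<or> G (Suc m - i) = 0" using E0[of i] G_zero by (cases "i = Suc m") auto
    qed
   qed
   ultimately have "codiff XX (E (Suc m)) = 0" by simp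
   then show ?thesis using H1[OF _ i] Suc.hyps by simp
  qed
  then show ?thesis using i vd by blast
 qed
 then obtain g where g: "g \<in> cochains XX {2 * n * Suc m}" "E (Suc m) = codiff XX g" and vE: "diag_vanish (E (Suc m))" by blast
 have "codiff X (pullback X (%x. (x, x)) g) = 0"
  unfolding pullback_codiff[OF cube_map_diagonal, symmetric] g(2)[symmetric] by (rule pullback_diagonal_zero[OF vE])
 then obtain u where u: "u \<in> cochains X {2 * n * Suc m - 1}" "pullback X (%x. (x, x)) g = codiff X u"
  using H2[OF _ pullback_in[OF g(1)]] by auto
 define h where "h = g - codiff XX (pullback XX fst u)"
 have fm: "cube_map XX X fst" by (intro cube_mapI continuous_map_fst)
 have du: "codiff X u \<in> cochains X {2 * n * Suc m}" using cube_codiff_in[OF u(1)] n by simp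
 have h: "h \<in> cochains XX {2 * n * Suc m}"
  unfolding h_def using g(1) pullback_in[OF du] by (intro cochains_lin) (simp_all add: pullback_codiff[OF fm, symmetric])
 have "pullback X (%x. (x, x)) (pullback XX fst (codiff X u)) = codiff X u"
  unfolding pullback_pullback[OF cube_map_diagonal] by (rule pullback_id[OF du]) simp
 then have "pullback X (%x. (x, x)) h = 0"
  by (simp add: h_def u(2) pullback_codiff[OF fm, symmetric])
 then have hv: "diag_vanish h" using vanishes_on_diagonalI[OF h] by blast
 have dh: "codiff XX h = E (Suc m)" by (simp add: h_def g(2))
 show ?case
 proof (intro exI[of _ "x(Suc m := h)"] conjI allI impI)
  fix s
  show "(x(Suc m := h)) s \<in> cochains XX {2 * n * s}" "diag_vanish ((x(Suc m := h)) s)" using x h hv by auto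
  assume s: "s \<le> Suc m"
  show "U s = codiff XX ((x(Suc m := h)) s) + conv XX G (x(Suc m := h)) s - conv XX (x(Suc m := h)) G s"
  proof (cases "s = Suc m")
   case True
   have "E (Suc m) = U (Suc m) - conv XX G x (Suc m) + conv XX x G (Suc m)"
    unfolding E_def minus_apply plus_fun_apply using conv_upd[of "Suc m" 0] by (simp add: y_def)
   then show ?thesis using True conv_upd[OF s] dh by (simp add: algebra_simps)
  next
   case False
   then show ?thesis using s xU[of s] conv_upd[OF s] by simp
  qed
 qed
qed

text \<open>The gauge terms are products of cochains that vanish on the diagonal, so that their loop
  integrals are zero and only a coboundary separates the integrals of the two solutions.\<close>

lemma loop_integral_relation:
 assumes k: "k > 0"
 shows "\<exists>y\<in>cochains LX {2 * n * Suc k - 1}. scale (int (Suc k)) (lint X (G (Suc k))) =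
  - cup LX (lint X (G k)) (lint X (G 1)) + codiff LX y"
proof -
 have "Suc k \<ge> 1" by simp
 from U_exact[OF this] obtain x where x: "!!s. x s \<in> cochains XX {2 * n * s}" "!!s. diag_vanish (x s)"
  "U (Suc k) = codiff XX (x (Suc k)) + conv XX G x (Suc k) - conv XX x G (Suc k)" by blast
 have z: "lint X (conv XX F H s) = 0" if "!!i. diag_vanish (F i)" "!!i. diag_vanish (H i)" for F H s
 proof -
  show ?thesis unfolding conv_def loop_integral_sum using loop_integral_cup[OF that] by (simp only: sum.neutral_const)
 qed
 have "lint X (U (Suc k)) = - codiff LX (lint X (x (Suc k)))"
  unfolding x(3) loop_integral_lin z[OF G_diagonal x(2)] z[OF x(2) G_diagonal] loop_integral_codiff[OF x(2)] by simp
 moreover have "lint X (U (Suc k)) = scale (int (Suc k)) (lint X (G (Suc k))) - lint X (w (Suc k))"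
  by (simp only: U_def loop_integral_lin)
 moreover note loop_integral_w[OF k]
 ultimately have "scale (int (Suc k)) (lint X (G (Suc k))) =
  - cup LX (lint X (G k)) (lint X (G 1)) + codiff LX (N k - lint X (x (Suc k)))"
  unfolding codiff_lin by (simp add: algebra_simps)
 moreover have "N k - lint X (x (Suc k)) \<in> cochains LX {2 * n * Suc k - 1}"
  using n by (intro cochains_lin cochains_mono[OF N_in] cochains_mono[OF loop_integral_in[OF x(1)]]) auto
 ultimately show ?thesis by blast
qed

end

end

section \<open>The cobar model of the square of the sphere\<close>

abbreviation merge :: "'a list \<times> 'b list => 'a list \<times> 'b list => 'a list \<times> 'b list" where
 "merge c e \<equiv> (fst c @ fst e, snd c @ snd e)"

text \<open>The cobar differential in terms of the coefficient functions of the words.\<close>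

fun mdiff :: "(('a list \<times> 'b list) list => int) => ('a list \<times> 'b list) list => int" where
 "mdiff F (c # e # w) = F (merge c e # w) - mdiff (%v. F (c # v)) (e # w)"
| "mdiff F _ = 0"

lemma merge_diff_lin:
 "mdiff (%v. F v + G v) w = mdiff F w + mdiff G w" "mdiff (%v. F v - G v) w = mdiff F w - mdiff G w"
 "mdiff (%v. k * F v) w = k * mdiff F w" "mdiff (%v. 0) w = 0"
proof -
 show "mdiff (%v. F v + G v) w = mdiff F w + mdiff G w"
  by (induction F w arbitrary: G rule: mdiff.induct) auto
 show "mdiff (%v. F v - G v) w = mdiff F w - mdiff G w"
  by (induction F w arbitrary: G rule: mdiff.induct) auto
 show "mdiff (%v. k * F v) w = k * mdiff F w"
  by (induction F w rule: mdiff.induct) (auto simp: algebra_simps)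
 show "mdiff (%v. 0) w = 0" by (induction "%v::('a list \<times> 'b list) list. 0::int" w rule: mdiff.induct) auto
qed

text \<open>Takes the first letter off the first nonempty left component. A component may become
  empty in this way and leave the pair \<open>([], [])\<close>, which is not a letter of the cobar
  construction; coefficient functions vanish on words that contain it.\<close>

fun lower :: "('a list \<times> 'b list) list => ('a list \<times> 'b list) list" where
 "lower [] = []"
| "lower (c # w) = (if fst c = [] then c # lower w else (tl (fst c), snd c) # w)"

lemma merge_diff_lower: "mdiff (%v. F (lower v)) w = mdiff F (lower w)"
proof (induction w arbitrary: F)
 case (Cons c w)
 show ?case
 proof (cases w)
  case (Cons e w')
  obtain e' s where s: "lower w = e' # s" "lower (merge c e # w') = (if fst c = [] then merge c e' # s else (tl (fst c) @ fst e, snd c @ snd e) # w')"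
   using Cons by (cases "fst e = []") auto
  show ?thesis
  proof (cases "fst c = []")
   case True
   have "mdiff (%v. F (c # lower v)) w = mdiff (%v. F (c # v)) (lower w)" by (rule Cons.IH)
   then show ?thesis using True s by (simp add: Cons)
  qed (use s in \<open>simp add: Cons\<close>)
 qed simp
qed simp

text \<open>Dual form of a contraction: the letter \<open>([g], [])\<close> split off by
  \<open>lower\<close> is put, with alternating signs, at every place up to the pair from which it
  was taken.\<close>

fun cone_op :: "'a => (('a list \<times> 'b list) list => int) => ('a list \<times> 'b list) list => int" where
 "cone_op g F [] = 0"
| "cone_op g F (c # w) = F (([g], []) # lower (c # w)) - (if fst c = [] then cone_op g (%v. F (c # v)) w else 0)"

lemma cone_op_cong:
 assumes "!!v. v ~= [] ==> F v = G v"
 shows "cone_op g F w = cone_op g G w"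
 using assms
proof (induction w arbitrary: F G)
 case (Cons c w)
 have "cone_op g (%v. F (c # v)) w = cone_op g (%v. G (c # v)) w" by (rule Cons.IH) (rule Cons.prems, rule list.distinct)
 moreover have "F (([g], []) # lower (c # w)) = G (([g], []) # lower (c # w))" by (rule Cons.prems, rule list.distinct)
 ultimately show ?case by (simp only: cone_op.simps)
qed simp

lemma cone_op_diff: "cone_op g (%v. F v - G v) w = cone_op g F w - cone_op g G w"
proof (induction w arbitrary: F G)
 case (Cons c w)
 from Cons.IH[of "%v. F (c # v)" "%v. G (c # v)"] show ?case by simp
qed simp

lemma lower_merge:
 assumes "fst c = []" "lower (e # w) = e' # s'"
 shows "lower (merge c e # w) = merge c e' # s'"
 using assms by (auto split: if_splits)

text \<open>Merging the split letter with the pair from which it came restores the word; its other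
  positions cancel in neighbouring pairs, and the remaining merges cancel between the two
  composites.\<close>

lemma cone_op_homotopy:
 assumes "!!c. c \<in> set w ==> set (fst c) \<subseteq> {g}" "\<exists>c\<in>set w. fst c ~= []"
 shows "mdiff (cone_op g F) w + cone_op g (mdiff F) w = F w"
 using assms
proof (induction w arbitrary: F)
 case (Cons c w)
 show ?case
 proof (cases "fst c = []")
  case False
  then obtain a q where c: "c = (g # a, q)" using Cons.prems(1)[of c] by (cases c; cases "fst c") auto
  show ?thesis unfolding c by (cases w) simp_all
 next
  case True
  then obtain e w'' where w: "w = e # w''" using Cons.prems(2) by (cases w) auto
  obtain e' s where s: "lower w = e' # s" using w by (cases "lower w") (auto split: if_splits)
  have IH: "mdiff (cone_op g (%v. F (c # v))) w + cone_op g (mdiff (%v. F (c # v))) w = F (c # w)"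
   by (rule Cons.IH[of "%v. F (c # v)"]) (use Cons.prems True in auto)
  let ?m = "%v. F (merge c (hd v) # tl v)"
  have 1: "cone_op g (%v. mdiff F (c # v)) w = cone_op g ?m w - cone_op g (mdiff (%v. F (c # v))) w"
  proof -
   have "mdiff F (c # v) = ?m v - mdiff (%v. F (c # v)) v" if "v ~= []" for v
    using that by (cases v) simp_all
   from cone_op_cong[of "%v. mdiff F (c # v)" "%v. ?m v - mdiff (%v. F (c # v)) v", OF this] show ?thesis
    unfolding cone_op_diff .
  qed
  have 2: "mdiff (%v. cone_op g F (c # v)) w = mdiff (%v. F (([g], []) # c # v)) (lower w) - mdiff (cone_op g (%v. F (c # v))) w"
   using merge_diff_lower[of "%v. F (([g], []) # c # v)" w] True by (simp add: merge_diff_lin)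
  have m: "merge ([g], []) c = ([g], snd c)" "merge c ([g], []) = ([g], snd c)" using True by auto
  define t where "t = (if fst e = [] then cone_op g (%v. F (merge c e # v)) w'' else 0)"
  have 3: "cone_op g ?m w = F (([g], snd c) # lower w) - t"
   using True by (simp add: w t_def)
  have 4: "cone_op g F (merge c e # w'') = F (([g], []) # merge c e' # s) - t"
   using lower_merge[OF True s[unfolded w]] True by (simp add: t_def)
  have 5: "mdiff F (([g], []) # c # lower w) = F (([g], snd c) # lower w) - (F (([g], []) # merge c e' # s) - mdiff (%v. F (([g], []) # c # v)) (lower w))"
   using m(1) by (simp add: s)
  have 6: "mdiff (cone_op g F) (c # w) = cone_op g F (merge c e # w'') - mdiff (%v. cone_op g F (c # v)) w"
   by (simp add: w)
  have 7: "cone_op g (mdiff F) (c # w) = mdiff F (([g], []) # c # lower w) - cone_op g (%v. mdiff F (c # v)) w"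
   using True by simp
  show ?thesis unfolding 6 7 1 2 3 4 5 IH[symmetric] by (simp only: algebra_simps)
 qed
qed simp

text \<open>Merging \<open>([], [])\<close> to the left or to the right yields the same word with
  opposite signs, and all other merges keep the pair.\<close>

lemma merge_diff_interior_zero:
 assumes "!!v. ([], []) \<in> set v ==> F v = 0" "u ~= []" "w ~= []"
 shows "mdiff F (u @ ([], []) # w) = 0"
proof -
 have z: "mdiff F w = 0" if "!!v. F v = 0" for F and w :: "('a list \<times> 'b list) list"
 proof -
  have "F = (%v. 0)" using that by auto
  then show ?thesis using merge_diff_lin(4) by metis
 qed
 show ?thesis using assms
 proof (induction u arbitrary: F)
  case (Cons c u)
  obtain e w' where w: "w = e # w'" using Cons.prems by (cases w) auto
  show ?case
  proof (cases u)
   case Nil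
   show ?thesis using z[of "%v. F (c # ([], []) # v)" w] Cons.prems(1) by (simp add: Nil w)
  next
   case (Cons f u')
   have "mdiff (%v. F (c # v)) (u @ ([], []) # w) = 0" using Cons.prems Cons by (intro Cons.IH) auto
   moreover have "F (merge c f # u' @ ([], []) # w) = 0" by (rule Cons.prems(1)) simp
   ultimately show ?thesis by (simp add: Cons)
  qed
 qed simp
qed

lemma lookup_frag_extend: "lookup (frag_extend b x) w = (\<Sum>i\<in>keys x. lookup x i * lookup (b i) w)"
 by (simp add: frag_extend_def lookup_sum)

lemma lookup_frag_extend_inj:
 assumes "inj h"
 shows "lookup (frag_extend (%v. frag_of (h v)) x) (h v) = lookup x v"
proof -
 have "lookup (frag_extend (%v. frag_of (h v)) x) (h v) = (\<Sum>i\<in>keys x. if i = v then lookup x v else 0)"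
  unfolding lookup_frag_extend using inj_eq[OF assms] by (intro sum.cong) auto
 then show ?thesis by (simp add: in_keys_iff)
qed

lemma frag_extend_sum': "frag_extend b (sum f I) = (\<Sum>i\<in>I. frag_extend b (f i))"
 by (induction I rule: infinite_finite_induct) (simp_all add: frag_extend_add)

lemma merge_diff_sum: "mdiff (%v. \<Sum>i\<in>I. F i v) w = (\<Sum>i\<in>I. mdiff (F i) w)"
 by (induction I rule: infinite_finite_induct) (simp_all add: merge_diff_lin)

lemma merge_diff_cong:
 "(!!u c e v. w = u @ c # e # v ==> F (u @ merge c e # v) = G (u @ merge c e # v)) ==> mdiff F w = mdiff G w"
proof (induction w arbitrary: F G)
 case (Cons c w)
 show ?case
 proof (cases w)
  case w: (Cons e w')
  have "mdiff (%v. F (c # v)) w = mdiff (%v. G (c # v)) w"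
  proof (rule Cons.IH)
   fix u d f v assume "w = u @ d # f # v"
   then show "F (c # u @ merge d f # v) = G (c # u @ merge d f # v)" using Cons.prems[of "c # u" d f v] by simp
  qed
  moreover have "F (merge c e # w') = G (merge c e # w')" using Cons.prems[of "[]" c e w'] w by simp
  ultimately show ?thesis by (simp add: w)
 qed simp
qed simp

lemma cone_op_zero:
 "(!!u v. w = u @ v ==> v ~= [] ==> (\<forall>c\<in>set u. fst c = []) ==> F (u @ ([g], []) # lower v) = 0) ==> cone_op g F w = 0"
proof (induction w arbitrary: F)
 case (Cons c w)
 have "F (([g], []) # lower (c # w)) = 0" using Cons.prems[of "[]" "c # w"] by simp
 moreover have "cone_op g (%v. F (c # v)) w = 0" if "fst c = []"
 proof (rule Cons.IH)
  fix u v assume "w = u @ v" "v ~= []" "\<forall>c\<in>set u. fst c = []"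
  then show "F (c # u @ ([g], []) # lower v) = 0" using Cons.prems[of "c # u" v] that by simp
 qed
 ultimately show ?case by simp
qed simp

definition gwords :: "'a => ('a list \<times> 'a list) list set" where
 "gwords g = lists {(u, v). set u \<subseteq> {g} & set v \<subseteq> {g} & (u, v) ~= ([], [])}"

lemma gwords_simps [simp]:
 "[] \<in> gwords g" "c # w \<in> gwords g \<longleftrightarrow> set (fst c) \<subseteq> {g} & set (snd c) \<subseteq> {g} & c ~= ([], []) & w \<in> gwords g"
 "u @ w \<in> gwords g \<longleftrightarrow> u \<in> gwords g & w \<in> gwords g"
 by (auto simp: gwords_def)

abbreviation xdeg :: "('a list \<times> 'a list) list => nat" where
 "xdeg w \<equiv> \<Sum>c\<leftarrow>w. length (fst c)"

abbreviation ydeg :: "('a list \<times> 'a list) list => nat" where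
 "ydeg w \<equiv> \<Sum>c\<leftarrow>w. length (snd c)"

lemma lower_cases:
 "v \<in> gwords g ==> lower v \<in> gwords g \<or> (\<exists>v1 v2. v = v1 @ ([g], []) # v2 & lower v = v1 @ ([], []) # v2 & (\<forall>c\<in>set v1. fst c = []))"
proof (induction v)
 case (Cons c v)
 show ?case
 proof (cases "fst c = []")
  case True
  from Cons consider "lower v \<in> gwords g" | v1 v2 where "v = v1 @ ([g], []) # v2" "lower v = v1 @ ([], []) # v2" "\<forall>c\<in>set v1. fst c = []" by auto
  then show ?thesis
  proof cases
   case 1 then show ?thesis using True Cons.prems by simp
  next
   case 2 then show ?thesis using True by (intro disjI2 exI[of _ "c # v1"] exI[of _ v2]) simp
  qed
 next
  case False
  then obtain a q where c: "c = (g # a, q)" using Cons.prems by (cases c; cases "fst c") auto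
  show ?thesis
  proof (cases "a = [] & q = []")
   case True
   then show ?thesis by (intro disjI2 exI[of _ "[]"] exI[of _ v]) (simp add: c)
  qed (use Cons.prems c in auto)
 qed
qed simp

lemma xdeg_zero: "(\<forall>c\<in>set w. fst c = []) ==> xdeg w = 0"
 by (induction w) auto

text \<open>The words produced by \<open>lower\<close> either belong to the cobar construction,
  where the differential of \<open>F\<close> is zero, or contain \<open>([], [])\<close> in their
  interior.\<close>

lemma cone_exact:
 assumes "!!v. ([], []) \<in> set v ==> F v = 0" "w \<in> gwords g" "xdeg w \<ge> 2" "!!v. v \<in> gwords g ==> mdiff F v = 0"
 shows "mdiff (cone_op g F) w = F w"
proof -
 have "cone_op g (mdiff F) w = 0"
 proof (rule cone_op_zero)
  fix u v assume w: "w = u @ v" "v ~= []" "\<forall>c\<in>set u. fst c = []"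
  then have v: "u \<in> gwords g" "v \<in> gwords g" using assms(2) by simp_all
  from lower_cases[OF v(2)] show "mdiff F (u @ ([g], []) # lower v) = 0"
  proof (elim disjE exE conjE)
   assume "lower v \<in> gwords g"
   then show ?thesis using v by (intro assms(4)) simp
  next
   fix v1 v2 assume v1: "v = v1 @ ([g], []) # v2" "lower v = v1 @ ([], []) # v2" "\<forall>c\<in>set v1. fst c = []"
   \<comment> \<open>If the exhausted pair were the last of the word, the left degree would be
     one.\<close>
   have "v2 ~= []" using assms(3) w v1 xdeg_zero[of u] xdeg_zero[of v1] by auto
   then have "mdiff F ((u @ ([g], []) # v1) @ ([], []) # v2) = 0" by (intro merge_diff_interior_zero assms(1)) auto
   then show ?thesis by (simp add: v1(2))
  qed
 qed
 moreover have "\<exists>c\<in>set w. fst c ~= []"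
 proof (rule ccontr)
  assume "\<not> ?thesis"
  then have "xdeg w = 0" by (intro xdeg_zero) blast
  then show False using assms(3) by linarith
 qed
 moreover have "set (fst c) \<subseteq> {g}" if "c \<in> set w" for c
  using that assms(2) by (fastforce simp: gwords_def)
 ultimately show ?thesis using cone_op_homotopy[of w g F] by simp
qed

lemma merge_diff_swap: "mdiff (%v. F (map prod.swap v)) w = mdiff F (map prod.swap w)"
proof (induction w arbitrary: F)
 case (Cons c w)
 from Cons.IH[of "%v. F (prod.swap c # v)"] show ?case by (cases w) simp_all
qed simp

section \<open>Exactness in the cobar complex of two spheres\<close>

locale sphere_model =
 fixes n :: nat
 assumes n: "n > 0"
begin

abbreviation "A \<equiv> sphere_cochains n"
abbreviation "g \<equiv> sphere_gen n"
abbreviation "C2 \<equiv> tensor_coalgebra (bar A) (bar A)"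
abbreviation "B2 \<equiv> cobar C2"

lemma bas_bar: "bas (bar A) = lists {g}"
 using n by (auto simp: bar_def sphere_cochains_bas sphere_cochains_unt sphere_gen_def)

lemma sz_eq: "set u \<subseteq> {g} ==> u = sz n (length u)"
 by (rule replicate_eqI) auto

lemma bar_deg_g: "set u \<subseteq> {g} ==> bar_deg A u = 2 * n * length u"
 using degrees_sz(1)[of n "length u"] sz_eq[of u] by simp

lemma bas_B2: "bas B2 = gwords g"
proof -
 have "gl (bar A) = []" by (simp add: bar_def)
 moreover have "lists {g} \<times> lists {g} - {([], [])} = {(u, v). set u \<subseteq> {g} & set v \<subseteq> {g} & (u, v) ~= ([], [])}" by auto
 ultimately show ?thesis by (simp add: cobar_def gwords_def tensor_coalgebra_def bas_bar)
qed

lemma deg_B2: "w \<in> gwords g ==> deg B2 w = 2 * n * (xdeg w + ydeg w) + length w"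
proof (induction w)
 case (Cons c w)
 then show ?case using bar_deg_g[of "fst c"] bar_deg_g[of "snd c"]
  by (cases c) (simp add: cobar_def tensor_coalgebra_def bar_def algebra_simps)
qed (simp add: cobar_def)

text \<open>The bar differential of the sphere is zero and all bar degrees are even, so only
  deconcatenation in both components is left, without signs.\<close>

lemma cobar_gen_C2:
 assumes "set a \<subseteq> {g}" "set b \<subseteq> {g}"
 shows "cobar_gen_dif C2 (a, b) = (\<Sum>i\<le>length a. \<Sum>j\<le>length b.
   if (take i a, take j b) = ([], []) \<or> (drop i a, drop j b) = ([], []) then 0 else frag_of [(take i a, take j b), (drop i a, drop j b)])"
proof -
 have "bar_dif A u = 0" if "set u \<subseteq> {g}" for u
  by (subst sz_eq[OF that]) (rule bar_dif_sphere[OF n])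
 then have d: "dif C2 (a, b) = 0" using assms by (simp add: tensor_coalgebra_def bar_def)
 have e: "even (bar_deg A u)" if "set u \<subseteq> {g}" for u using bar_deg_g[OF that] by simp
 have s: "set (take i a) \<subseteq> {g}" "set (take i b) \<subseteq> {g}" "set (drop i a) \<subseteq> {g}" "set (drop i b) \<subseteq> {g}" for i
  using assms set_take_subset[of i a] set_take_subset[of i b] set_drop_subset[of i a] set_drop_subset[of i b] by blast+
 have B: "cop (bar A) u = (\<Sum>j\<le>length u. frag_of (take j u, drop j u))" "deg (bar A) u = bar_deg A u" "gl (bar A) = []" for u
  by (simp_all add: bar_def)
 have p: "psign (bar_deg A (drop i a) * k) = 1" "psign (bar_deg A (take i a) + bar_deg A (take j b)) = 1" for i j k
  using e[OF s(1)] e[OF s(2)] e[OF s(3)] by simp_all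
 have c: "cop C2 (a, b) = (\<Sum>i\<le>length a. \<Sum>j\<le>length b. frag_of ((take i a, take j b), (drop i a, drop j b)))"
  by (simp add: tensor_coalgebra_def B frag_extend_sum' p)
 have "gl C2 = ([], [])" "deg C2 (u, v) = bar_deg A u + bar_deg A v" for u v by (simp_all add: tensor_coalgebra_def B)
 then show ?thesis unfolding cobar_gen_dif_def d c frag_extend_sum'
  by (simp add: p cong: if_cong)
qed

lemma lookup_cobar_gen:
 assumes "c = (a, b)" "set a \<subseteq> {g}" "set b \<subseteq> {g}" "e ~= ([], [])" "f ~= ([], [])"
 shows "lookup (frag_extend (%v. frag_of (v @ k)) (cobar_gen_dif C2 c)) (e # f # w) = of_bool (c = merge e f & k = w)"
proof -
 have i: "i \<le> length x ==> take i x = y & drop i x = z \<longleftrightarrow> i = length y & x = y @ z" for i and x y z :: "'z list"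
  by (metis append_eq_conv_conj append_take_drop_id length_take min.absorb2)
 have "lookup (frag_extend (%v. frag_of (v @ k)) (cobar_gen_dif C2 c)) (e # f # w) =
  (\<Sum>i\<le>length a. \<Sum>j\<le>length b. of_bool (take i a = fst e & drop i a = fst f) * of_bool (take j b = snd e & drop j b = snd f) * of_bool (k = w))"
  unfolding assms(1) cobar_gen_C2[OF assms(2,3)] frag_extend_sum' lookup_sum
  using assms(4,5) by (intro sum.cong refl) (auto simp: prod_eq_iff)
 also have "... = (\<Sum>i\<le>length a. of_bool (i = length (fst e) & a = fst e @ fst f)) * (\<Sum>j\<le>length b. of_bool (j = length (snd e) & b = snd e @ snd f)) * of_bool (k = w)"
  unfolding sum_product sum_distrib_right by (intro sum.cong refl) (simp add: i)
 also have "(\<Sum>i\<le>length x. of_bool (i = length y & x = y @ z)) = (of_bool (x = y @ z) :: int)" for x y z :: "letter list"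
  by (cases "x = y @ z") (simp_all add: of_bool_def)
 finally show ?thesis by (auto simp: assms(1))
qed

lemma lookup_cobar_dif:
 "k \<in> gwords g ==> w \<in> gwords g ==> lookup (cobar_dif C2 k) w = mdiff (lookup (frag_of k)) w"
proof (induction k arbitrary: w)
 case Nil
 have "mdiff (lookup (frag_of [])) w = mdiff (%v. 0) w"
  by (rule merge_diff_cong) simp
 then show ?case by (simp add: merge_diff_lin)
next
 case (Cons c k)
 have p: "psign (deg C2 c + 1) = -1"
  using Cons.prems(1) bar_deg_g[of "fst c"] bar_deg_g[of "snd c"] by (cases c) (simp add: tensor_coalgebra_def bar_def psign_def)
 have D: "lookup (cobar_dif C2 (c # k)) w = lookup (frag_extend (%v. frag_of (v @ k)) (cobar_gen_dif C2 c)) w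
   - lookup (frag_extend (%v. frag_of (c # v)) (cobar_dif C2 k)) w"
  using p by (simp add: lookup_add lookup_minus)
 have cons: "lookup (frag_extend (%v. frag_of (c # v)) x) (e # v) = of_bool (e = c) * lookup x v" for x e v
 proof (cases "e = c")
  case True
  then show ?thesis using lookup_frag_extend_inj[of "(#) c" x v] by simp
 qed (simp add: lookup_frag_extend)
 obtain a b where c: "c = (a, b)" "set a \<subseteq> {g}" "set b \<subseteq> {g}" using Cons.prems(1) by (cases c) auto
 have short: "lookup (frag_extend (%v. frag_of (v @ k)) (cobar_gen_dif C2 c)) v = 0" if "length v < 2" for v
  unfolding c(1) cobar_gen_C2[OF c(2,3)] frag_extend_sum' lookup_sum using that by (intro sum.neutral ballI) auto
 consider "w = []" | e where "w = [e]" | e f w' where "w = e # f # w'" by (metis neq_Nil_conv)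
 then show ?case
 proof cases
  case 1
  show ?thesis unfolding D using short[of w] 1 by (simp add: lookup_frag_extend)
 next
  case (2 e)
  have "lookup (cobar_dif C2 k) [] = 0" using Cons.IH[of "[]"] Cons.prems(1) by simp
  then show ?thesis unfolding D using short[of w] 2 by (simp add: cons)
 next
  case (3 e f w')
  have "lookup (frag_of (c # k)) (e # v) = of_bool (e = c) * lookup (frag_of k) v" for v by simp
  then have "mdiff (%v. lookup (frag_of (c # k)) (e # v)) (f # w') = of_bool (e = c) * mdiff (lookup (frag_of k)) (f # w')"
   by (simp only: merge_diff_lin)
  moreover have "lookup (cobar_dif C2 k) (f # w') = mdiff (lookup (frag_of k)) (f # w')"
   using Cons.prems 3 by (intro Cons.IH) simp_all
  moreover have "lookup (frag_of (c # k)) (merge e f # w') = of_bool (c = merge e f & k = w')" by (simp, metis)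
  moreover have "lookup (frag_extend (%v. frag_of (v @ k)) (cobar_gen_dif C2 c)) (e # f # w') = of_bool (c = merge e f & k = w')"
   using lookup_cobar_gen[OF c, of e f k w'] Cons.prems(2) 3 by simp
  ultimately show ?thesis unfolding D unfolding 3 mdiff.simps cons by (simp only:)
 qed
qed

lemma lookup_diff_B2:
 assumes "keys x \<subseteq> gwords g" "w \<in> gwords g"
 shows "lookup (frag_extend (cobar_dif C2) x) w = mdiff (lookup x) w"
proof -
 have "lookup x = (%v. \<Sum>i\<in>keys x. lookup x i * lookup (frag_of i) v)"
 proof
  fix v show "lookup x v = (\<Sum>i\<in>keys x. lookup x i * lookup (frag_of i) v)"
   using lookup_frag_extend[of frag_of x v] unfolding frag_expansion[of x, symmetric] .
 qed
 from arg_cong[OF this, of "%F. mdiff F w"]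
 have "mdiff (lookup x) w = (\<Sum>i\<in>keys x. lookup x i * mdiff (lookup (frag_of i)) w)"
  unfolding merge_diff_sum merge_diff_lin(3) .
 then show ?thesis unfolding lookup_frag_extend using assms by (simp add: lookup_cobar_dif subset_iff)
qed

lemma finite_gwords: "finite {w \<in> gwords g. deg B2 w = p}"
proof -
 let ?S = "{u :: letter list. set u \<subseteq> {g} & length u \<le> p}"
 have "finite {w. set w \<subseteq> ?S \<times> ?S & length w \<le> p}"
  by (intro finite_lists_length_le finite_cartesian_product) (auto intro: finite_lists_length_le)
 then show ?thesis
 proof (rule finite_subset[rotated], intro subsetI)
  fix w assume "w \<in> {w \<in> gwords g. deg B2 w = p}"
  then have w: "w \<in> gwords g" "deg B2 w = p" by auto
  have d: "2 * n * (xdeg w + ydeg w) + length w = p" using deg_B2[OF w(1)] w(2) by simp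
  have "xdeg w + ydeg w \<le> 2 * n * (xdeg w + ydeg w)" using n by simp
  then have "xdeg w \<le> p" "ydeg w \<le> p" using d by linarith+
  moreover have "length (fst c) \<le> xdeg w" "length (snd c) \<le> ydeg w" if "c \<in> set w" for c
   using that by (auto intro!: member_le_sum_list)
  moreover have "set (fst c) \<subseteq> {g}" "set (snd c) \<subseteq> {g}" if "c \<in> set w" for c
   using that w(1) unfolding gwords_def by fastforce+
  ultimately have "c \<in> ?S \<times> ?S" if "c \<in> set w" for c
   using that by (cases c) fastforce
  then show "w \<in> {w. set w \<subseteq> ?S \<times> ?S & length w \<le> p}" using d by auto
 qed
qed

text \<open>With at least two letters on the left, the left contraction applies; otherwise with two
  on the right, the right one. Parity leaves the single word \<open>[([g], [g])]\<close>. For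
  \<open>m = 1\<close> the words \<open>[([g], [])]\<close> and \<open>[([], [g])]\<close> would
  escape both contractions.\<close>

lemma B2_exact:
 assumes B2: "is_cochain_complex (complex_of B2)" and m: "m \<ge> 2" and x: "x \<in> comp (complex_of B2) (2 * n * m + 1)" and dx: "diff (complex_of B2) x = 0"
 shows "\<exists>y\<in>comp (complex_of B2) (2 * n * m). diff (complex_of B2) y = x"
proof -
 let ?F = "lookup x"
 define valid where "valid = {w \<in> gwords g. deg B2 w = 2 * n * m}"
 \<comment> \<open>Restriction to words of the right degree gives finite support. Merging preserves
   left and right degree, so the case distinction is constant over the words that enter one value of
   \<open>mdiff\<close>.\<close>
 define \<psi> where "\<psi> w = (if w \<notin> valid then 0 else if xdeg w \<ge> 2 then cone_op g ?F w
   else if ydeg w \<ge> 2 then cone_op g (%v. ?F (map prod.swap v)) (map prod.swap w) else 0)" for w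
 have keys: "keys x \<subseteq> gwords g" and F0: "!!w. w \<notin> gwords g \<or> deg B2 w ~= 2 * n * m + 1 ==> ?F w = 0"
  using x by (auto simp: complex_of_def bas_B2 in_keys_iff)
 have d: "diff (complex_of B2) = frag_extend (cobar_dif C2)" by (simp add: complex_of_def cobar_def)
 have DF: "mdiff ?F w = 0" if "w \<in> gwords g" for w
  using lookup_diff_B2[OF keys that] dx by (simp add: d)
 have fin: "finite {w. \<psi> w ~= 0}"
  by (rule finite_subset[OF _ finite_gwords[of "2 * n * m"]]) (auto simp: \<psi>_def valid_def)
 define y where "y = Abs_poly_mapping \<psi>"
 have y: "lookup y = \<psi>" using fin by (simp add: y_def Abs_poly_mapping_inverse)
 have "keys y \<subseteq> valid"
 proof
  fix w assume "w \<in> keys y"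
  then have "\<psi> w ~= 0" unfolding in_keys_iff y .
  then show "w \<in> valid" by (cases "w \<in> valid") (simp_all add: \<psi>_def)
 qed
 then have ky: "keys y \<subseteq> gwords g" and yc: "y \<in> comp (complex_of B2) (2 * n * m)"
  by (auto simp: valid_def complex_of_def bas_B2)
 have swap: "w \<in> gwords g ==> map prod.swap w \<in> gwords g" for w by (induction w) auto
 have sx: "xdeg (map prod.swap w) = ydeg w" for w :: "('z list \<times> 'z list) list" by (simp add: o_def)
 have main: "mdiff \<psi> w = ?F w" if w: "w \<in> gwords g" "deg B2 w = 2 * n * m + 1" for w
 proof -
  have dw: "2 * n * (xdeg w + ydeg w) + length w = 2 * n * m + 1" using deg_B2[OF w(1)] w(2) by simp
  have mv: "u @ merge c e # v \<in> valid & xdeg (u @ merge c e # v) = xdeg w & ydeg (u @ merge c e # v) = ydeg w" if "w = u @ c # e # v" for u c e v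
  proof -
   have m: "u @ merge c e # v \<in> gwords g" using w(1) that by (cases c; cases e) auto
   have "xdeg (u @ merge c e # v) = xdeg w" "ydeg (u @ merge c e # v) = ydeg w" "Suc (length (u @ merge c e # v)) = length w" using that by simp_all
   then show ?thesis using deg_B2[OF m] dw m unfolding valid_def by simp
  qed
  consider "xdeg w \<ge> 2" | "xdeg w < 2" "ydeg w \<ge> 2" | "xdeg w < 2" "ydeg w < 2" by linarith
  then show ?thesis
  proof cases
   case 1
   have "mdiff \<psi> w = mdiff (cone_op g ?F) w"
    by (rule merge_diff_cong) (use mv 1 in \<open>simp add: \<psi>_def\<close>)
   also have "... = ?F w" using F0 by (intro cone_exact w(1) 1 DF) (auto simp: gwords_def)
   finally show ?thesis .
  next
   case 2
   have "mdiff \<psi> w = mdiff (%v. cone_op g (%v. ?F (map prod.swap v)) (map prod.swap v)) w"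
    by (rule merge_diff_cong) (use mv 2 in \<open>simp add: \<psi>_def\<close>)
   also have "... = mdiff (cone_op g (%v. ?F (map prod.swap v))) (map prod.swap w)"
    by (rule merge_diff_swap)
   also have "... = ?F (map prod.swap (map prod.swap w))"
   proof (rule cone_exact)
    show "?F (map prod.swap v) = 0" if "([], []) \<in> set v" for v
    proof -
     have "([], []) \<in> set (map prod.swap v)" using that by (force simp: image_iff)
     then have "map prod.swap v \<notin> gwords g" unfolding gwords_def by blast
     then show ?thesis using F0 by blast
    qed
    show "mdiff (%v. ?F (map prod.swap v)) v = 0" if "v \<in> gwords g" for v
     unfolding merge_diff_swap using DF swap that by blast
   qed (use swap w 2 in \<open>simp_all add: o_def\<close>)
   also have "... = ?F w" by (simp add: o_def)
   finally show ?thesis .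
  next
   case 3
   have l: "length v \<le> xdeg v + ydeg v" if "v \<in> gwords g" for v :: "(letter list \<times> letter list) list"
    using that
   proof (induction v)
    case (Cons c v)
    then have "length (fst c) + length (snd c) \<ge> 1" by (cases c; cases "fst c") (auto simp: Suc_le_eq)
    then show ?case using Cons by simp
   qed simp
   have lw: "length w \<le> 2" using l[OF w(1)] 3 by linarith
   have "odd (2 * n * (xdeg w + ydeg w) + length w)" unfolding dw by simp
   then have "odd (length w)" by simp
   then have "length w = 1" using lw by (metis One_nat_def even_zero le_antisym less_2_cases_iff less_eq_Suc_le not_less_eq_eq numeral_2_eq_2 even_numeral)
   then obtain c where c: "w = [c]" by (auto simp: length_Suc_conv)
   then have "2 * n * (xdeg w + ydeg w) = 2 * n * m" using dw by simp
   then have "xdeg w + ydeg w = m" using n by simp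
   then have "length (fst c) = 1" "length (snd c) = 1" using 3 m c by auto
   then have cg: "c = ([g], [g])" using w(1) c by (cases c) (auto simp: length_Suc_conv)
   \<comment> \<open>The coefficient of this word is the differential of \<open>?F\<close> at a word
     of two letters whose only merge it is.\<close>
   have "?F [([g], [g])] = mdiff ?F [([g], []), ([], [g])]" by simp
   also have "... = 0" by (rule DF) simp
   finally show ?thesis by (simp add: c cg)
  qed
 qed
 have "diff (complex_of B2) y = x"
 proof (rule poly_mapping_eqI)
  fix w
  show "lookup (diff (complex_of B2) y) w = ?F w"
  proof (cases "w \<in> gwords g & deg B2 w = 2 * n * m + 1")
   case True
   then have "lookup (diff (complex_of B2) y) w = mdiff \<psi> w"
    using lookup_diff_B2[OF ky] by (simp add: d y)
   then show ?thesis using main True by simp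
  next
   case False
   have "diff (complex_of B2) y \<in> comp (complex_of B2) (Suc (2 * n * m))" using B2 yc unfolding is_cochain_complex_def by blast
   then have "lookup (diff (complex_of B2) y) w = 0"
    using False by (auto simp: complex_of_def bas_B2 in_keys_iff)
   then show ?thesis using F0[of w] False by auto
  qed
 qed
 then show ?thesis using yc by blast
qed

end

section \<open>Restriction to endpoints is injective on cochains\<close>

lemma path_connected_space_nsphere:
 assumes "N > 0"
 shows "path_connected_space (nsphere N)"
proof -
 let ?U = "{x \<in> topspace (nsphere N). x (1::nat) \<ge> 0}" and ?L = "{x \<in> topspace (nsphere N). x (1::nat) \<le> 0}"
 have e: "subtopology (nsphere N) {x. P x} = subtopology (nsphere N) {x \<in> topspace (nsphere N). P x}" for P
  using subtopology_restrict[of "nsphere N" "{x. P x}"] by (simp add: Collect_conj_eq Int_commute)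
 have "path_connected_space (subtopology (nsphere N) ?U)"
  unfolding e[symmetric] using assms by (intro contractible_imp_path_connected_space contractible_space_upper_hemisphere) simp
 then have "path_connectedin (nsphere N) ?U" unfolding path_connectedin_def by blast
 moreover have "path_connected_space (subtopology (nsphere N) ?L)"
  unfolding e[symmetric] using assms by (intro contractible_imp_path_connected_space contractible_space_lower_hemisphere) simp
 then have "path_connectedin (nsphere N) ?L" unfolding path_connectedin_def by blast
 moreover have "(%n. if n = 0 then 1 else 0) \<in> ?U \<inter> ?L" using in_topspace_nsphere[of N] by simp
 ultimately have "path_connectedin (nsphere N) (?U \<union> ?L)" by (intro path_connectedin_Un) blast+
 moreover have "?U \<union> ?L = topspace (nsphere N)" by auto
 ultimately show ?thesis by (simp add: path_connectedin_topspace)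
qed

lemma contractible_std_cube: "contractible_space (std_cube m)"
 unfolding std_cube_def contractible_space_product_topology
 using convex_imp_contractible[of "{0..1::real}"] by simp

lemma cube_map_endpoints: "cube_map (path_space X) (prod_topology X X) endpoints"
 unfolding cube_map_def
proof (intro allI impI)
 fix m T assume T: "singular m (path_space X) T"
 have "continuous_map (std_cube m) (prod_topology X X) (%t. (T t 0, T t 1))"
  unfolding continuous_map_pairwise o_def fst_conv snd_conv
  by (intro conjI continuous_map_path_cube[OF T]) auto
 then have "continuous_map (std_cube m) (prod_topology X X) (push m endpoints T)"
  by (rule continuous_map_eq) (simp add: push_def endpoints_def)
 then show "singular m (prod_topology X X) (push m endpoints T)" by (simp add: singular_cube_def push_def)
qed

text \<open>The cube is contractible and the space path connected, so the two components are
  homotopic, and a homotopy is the adjoint of a cube of paths.\<close>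

lemma path_cube_lift:
 assumes "path_connected_space X" "singular m (prod_topology X X) T"
 shows "\<exists>V. singular m (path_space X) V & push m endpoints V = T"
proof -
 have "continuous_map (std_cube m) X (fst \<circ> T)" "continuous_map (std_cube m) X (snd \<circ> T)"
  using assms(2) by (auto simp: singular_cube_def continuous_map_pairwise)
 then have "homotopic_with (%x. True) (std_cube m) X (fst \<circ> T) (snd \<circ> T)"
  using assms(1) contractible_std_cube by (intro homotopic_from_contractible_space) blast
 then obtain h where h: "continuous_map (prod_topology (top_of_set {0..1::real}) (std_cube m)) X h"
  "!!t. h (0, t) = fst (T t)" "!!t. h (1, t) = snd (T t)"
  unfolding homotopic_with_def o_def by blast
 define V where "V = (\<lambda>t\<in>pts m. \<lambda>u\<in>{0..1::real}. h (u, t))"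
 have "continuous_map (prod_topology (std_cube m) (top_of_set {0..1})) X (h \<circ> (%(t, u). (u, t)))"
  by (rule continuous_map_compose[OF _ h(1)]) (simp add: continuous_map_pairwise o_def case_prod_unfold continuous_map_fst continuous_map_snd)
 then have "continuous_map (prod_topology (std_cube m) (top_of_set {0..1})) X (%(t, u). V t u)"
  by (rule continuous_map_eq) (auto simp: V_def)
 then have "singular m (path_space X) V" by (simp add: singular_path_cube V_def)
 moreover have "push m endpoints V = T"
  using assms(2) h by (auto simp: push_def V_def endpoints_def fun_eq_iff singular_cube_def extensional_def)
 ultimately show ?thesis by blast
qed

lemma endpoints_pullback_inject:
 assumes "path_connected_space X" "f \<in> cochains (prod_topology X X) S" "pullback (path_space X) endpoints f = 0"
 shows "f = 0"
proof (intro cochain_eqI)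
 fix m T
 show "f m T = 0 m T"
 proof (cases "singular m (prod_topology X X) T")
  case True
  then obtain V where V: "singular m (path_space X) V" "push m endpoints V = T" using path_cube_lift[OF assms(1)] by blast
  have "pullback (path_space X) endpoints f m V = 0" using assms(3) by simp
  then show ?thesis using V by (simp add: pullback_apply)
 qed (use cochains_zero[OF assms(2)] in simp)
qed

section \<open>The differential of the path model of the sphere\<close>

lemma sum_triangle:
 "(\<Sum>i\<le>k. \<Sum>j\<le>k - i. f i (i + j)) = (\<Sum>t\<le>k. \<Sum>i\<le>t. f i (t :: nat) :: 'a::comm_monoid_add)"
proof -
 have "(\<Sum>i\<le>k. \<Sum>j\<le>k - i. f i (i + j)) = (\<Sum>(i, j)\<in>(SIGMA i:{..k}. {..k - i}). f i (i + j))" by (simp add: sum.Sigma)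
 also have "... = (\<Sum>(t, i)\<in>(SIGMA t:{..k}. {..t}). f i t)"
  by (rule sum.reindex_bij_witness[of _ "%(t, i). (i, t - i)" "%(i, j). (i + j, i)"]) auto
 also have "... = (\<Sum>t\<le>k. \<Sum>i\<le>t. f i t)" by (simp add: sum.Sigma)
 finally show ?thesis .
qed

lemma frag_cmul_sum_left: "frag_cmul (\<Sum>i\<in>I. c i) x = (\<Sum>i\<in>I. frag_cmul (c i) x)"
 by (induction I rule: infinite_finite_induct) (simp_all add: frag_cmul_distrib)

lemma alternating_choose: "(\<Sum>j\<le>t. (-1) ^ (t - j) * int (t choose j)) = of_bool (t = 0)"
proof -
 have "(\<Sum>j\<le>t. int (t choose j) * (1::int) ^ j * (-1) ^ (t - j)) = (1 + (-1)) ^ t"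
  by (rule binomial_ring[symmetric])
 then show ?thesis by (simp add: mult.commute)
qed

context sphere_model
begin

abbreviation pw :: "nat => nat => nat => (letter list \<times> letter list) list \<times> letter list \<Rightarrow>\<^sub>0 int" where
 "pw a b c \<equiv> frag_of ([(sz n a, sz n b)], sz n c)"

abbreviation Q :: "nat => nat => (letter list \<times> letter list) list \<times> letter list \<Rightarrow>\<^sub>0 int" where
 "Q a k \<equiv> \<Sum>i\<le>k. pw a (k - i) i"

abbreviation L :: "nat => nat => (letter list \<times> letter list) list \<times> letter list \<Rightarrow>\<^sub>0 int" where
 "L a k \<equiv> left_act A sphere_star (sz n a) [] (sz n k)"

lemma take_drop_sz: "j \<le> m ==> take j (sz n m) = sz n j" "drop j (sz n m) = sz n (m - j)"
 by (auto simp: min_absorb1 min_def)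

lemma star_nil: "sphere_star (sz n k) [] = frag_of (sz n k)" "sphere_star [] (sz n k) = frag_of (sz n k)" "sphere_star [] [] = frag_of []"
 by (simp_all add: sphere_star_def)

text \<open>The recursive calls are collected on the left-hand side of the defining equation, where
  they form a convolution with binomial coefficients.\<close>

lemma left_act_rec: "(\<Sum>j\<le>k. frag_cmul (int ((a + j) choose a)) (L (a + j) (k - j))) = Q a k"
proof (cases "k = 0")
 case True
 have "L a 0 = pw a 0 0"
  by (subst left_act.simps) (simp add: star_nil bar_deg_def)
 then show ?thesis using True by simp
next
 case False
 have L0: "L c 0 = pw c 0 0" for c
  by (subst left_act.simps) (simp add: star_nil bar_deg_def)
 have p: "psign ((bar_deg A [] + theta A (sz n i)) * r) = 1" "psign (bar_deg A [] * r) = 1" for i r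
  by (simp_all add: degrees_sz bar_deg_def)
 have "L a k = pw a 0 k + (pw a k 0 - frag_cmul (int ((a + k) choose a)) (pw (a + k) 0 0))
   + (\<Sum>j\<in>{1..<k}. - frag_cmul (int ((a + j) choose a)) (L (a + j) (k - j)) + pw a (k - j) j)"
 proof -
  have "(\<Sum>j\<in>{1..<length (sz n k)}.
     - frag_cmul (psign (bar_deg A [] * theta A (take j (sz n k))))
       (frag_extend (%a'. left_act A sphere_star a' [] (drop j (sz n k))) (sphere_star (sz n a) (take j (sz n k))))
     + frag_cmul (psign ((bar_deg A [] + theta A (take j (sz n k)))
                * (theta A (sz n k) - theta A (take j (sz n k)))))
       (frag_extend (%b'. frag_of ([(sz n a, b')], take j (sz n k))) (sphere_star (drop j (sz n k)) [])))
   = (\<Sum>j\<in>{1..<k}. - frag_cmul (int ((a + j) choose a)) (L (a + j) (k - j)) + pw a (k - j) j)" (is "sum ?f _ = sum ?g _")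
  proof (rule sum.cong)
   fix j assume "j \<in> {1..<k}"
   then have j: "j \<le> k" by simp
   show "?f j = ?g j" unfolding take_drop_sz(1)[OF j] take_drop_sz(2) p star_nil sphere_star_sz frag_extend_cmul frag_extend_of by simp
  qed simp
  then show ?thesis
   by (subst left_act.simps) (simp only: p star_nil sphere_star_sz frag_extend_cmul frag_extend_of frag_cmul_one replicate_0)
 qed
 then have "L a k + (\<Sum>j\<in>{1..<k}. frag_cmul (int ((a + j) choose a)) (L (a + j) (k - j))) + frag_cmul (int ((a + k) choose a)) (L (a + k) 0)
   = pw a k 0 + (\<Sum>j\<in>{1..<k}. pw a (k - j) j) + pw a 0 k"
  unfolding L0 sum.distrib sum_negf by (simp add: algebra_simps)
 moreover have split: "(\<Sum>j\<le>k. f j) = f 0 + (\<Sum>j\<in>{1..<k}. f j) + f k" for f :: "nat => (letter list \<times> letter list) list \<times> letter list \<Rightarrow>\<^sub>0 int"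
 proof -
  have "{..k} = insert 0 (insert k {1..<k})" using False by auto
  then show ?thesis using False by (simp add: algebra_simps)
 qed
 ultimately show ?thesis by (simp add: split)
qed

text \<open>Binomial inversion of \<open>left_act_rec\<close>: the terms are collected by total
  shift, and the alternating sum of a row of binomial coefficients leaves only shift zero.\<close>

lemma left_act_formula: "L a k = (\<Sum>i\<le>k. frag_cmul ((-1) ^ i * int ((a + i) choose a)) (Q (a + i) (k - i)))"
proof (induction k arbitrary: a rule: less_induct)
 case (less k)
 define x where "x t = frag_cmul (int ((a + t) choose a)) (Q (a + t) (k - t))" for t
 have "frag_cmul (int ((a + j) choose a)) (L (a + j) (k - j)) = (\<Sum>i\<le>k - j. frag_cmul ((-1) ^ (j + i - j) * int ((j + i) choose j)) (x (j + i)))"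
  if "j \<in> {1..k}" for j
 proof -
  have "L (a + j) (k - j) = (\<Sum>i\<le>k - j. frag_cmul ((-1) ^ i * int ((a + j + i) choose (a + j))) (Q (a + j + i) (k - j - i)))"
   by (rule less) (use that in auto)
  moreover have "int ((a + j) choose a) * int ((a + j + i) choose (a + j)) = int ((j + i) choose j) * int ((a + (j + i)) choose a)" for i
   using choose_trinomial[of j i a] choose_trinomial[of j a i]
   by (metis (no_types, lifting) add.assoc add.commute binomial_symmetric add_diff_cancel_left' le_add1 mult.commute)
  ultimately show ?thesis
   by (simp add: frag_cmul_sum x_def) (intro sum.cong refl, simp add: ac_simps)
 qed
 then have "(\<Sum>j\<in>{1..k}. frag_cmul (int ((a + j) choose a)) (L (a + j) (k - j))) =
   (\<Sum>j\<in>{1..k}. \<Sum>i\<le>k - j. frag_cmul ((-1) ^ (j + i - j) * int ((j + i) choose j)) (x (j + i)))"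
  by (rule sum.cong[OF refl])
 also have "... = (\<Sum>j\<le>k. \<Sum>i\<le>k - j. frag_cmul ((-1) ^ (j + i - j) * int ((j + i) choose j)) (x (j + i))) - (\<Sum>i\<le>k. frag_cmul ((-1) ^ i) (x i))"
 proof -
  have "{..k} = insert 0 {1..k}" by auto
  then show ?thesis by simp
 qed
 also have "(\<Sum>j\<le>k. \<Sum>i\<le>k - j. frag_cmul ((-1) ^ (j + i - j) * int ((j + i) choose j)) (x (j + i)))
   = (\<Sum>t\<le>k. \<Sum>j\<le>t. frag_cmul ((-1) ^ (t - j) * int (t choose j)) (x t))"
  by (rule sum_triangle)
 also have "... = (\<Sum>t\<le>k. frag_cmul (of_bool (t = 0)) (x t))"
  by (simp only: frag_cmul_sum_left[symmetric] alternating_choose)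
 also have "... = x 0"
  by (subst sum.mono_neutral_right[of _ "{0}"]) auto
 finally have s: "(\<Sum>j\<in>{1..k}. frag_cmul (int ((a + j) choose a)) (L (a + j) (k - j))) = x 0 - (\<Sum>i\<le>k. frag_cmul ((-1) ^ i) (x i))" .
 have "(\<Sum>j\<le>k. frag_cmul (int ((a + j) choose a)) (L (a + j) (k - j))) = L a k + (\<Sum>j\<in>{1..k}. frag_cmul (int ((a + j) choose a)) (L (a + j) (k - j)))"
 proof -
  have "{..k} = insert 0 {1..k}" by auto
  then show ?thesis by simp
 qed
 then have "L a k = Q a k - (x 0 - (\<Sum>i\<le>k. frag_cmul ((-1) ^ i) (x i)))"
  unfolding left_act_rec s by (simp add: algebra_simps)
 then show ?case by (simp add: x_def)
qed

text \<open>The same inversion removes the recursion from the differential. The alternating inner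
  sum depends on the bar word only through \<open>m - i\<close>, which turns the recursion for the
  path map into one convolution.\<close>

lemma path_dif_sphere:
 assumes "m > 0"
 shows "path_dif A sphere_star (sz n m) = (\<Sum>i<m. \<Sum>r\<le>m - i. frag_cmul ((-1) ^ (r + 1)) (pw r (m - i - r) i))"
proof -
 have p: "psign (theta A (sz n i) * r) = 1" for i r by (simp add: degrees_sz)
 have L0: "L c 0 = pw c 0 0" for c
  by (subst left_act.simps) (simp add: star_nil bar_deg_def)
 have "path_dif A sphere_star (sz n m) = pw m 0 0 - pw 0 m 0 + (\<Sum>j\<in>{1..<m}. L j (m - j) - pw 0 (m - j) j)"
 proof -
  have "(\<Sum>j\<in>{1..<length (sz n m)}. left_act A sphere_star (take j (sz n m)) [] (drop j (sz n m))
     - frag_cmul (psign (theta A (take j (sz n m)) * (theta A (sz n m) - theta A (take j (sz n m)))))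
       (frag_of ([([], drop j (sz n m))], take j (sz n m)))) = (\<Sum>j\<in>{1..<m}. L j (m - j) - pw 0 (m - j) j)" (is "sum ?f _ = sum ?g _")
  proof (rule sum.cong)
   fix j assume "j \<in> {1..<m}"
   then have j: "j \<le> m" by simp
   show "?f j = ?g j" unfolding take_drop_sz(1)[OF j] take_drop_sz(2) p by simp
  qed simp
  then show ?thesis by (simp add: path_dif_def bar_dif_sphere[OF n])
 qed
 also have "... = (\<Sum>j\<in>{1..m}. L j (m - j)) - (\<Sum>j<m. pw 0 (m - j) j)"
 proof -
  have "{1..m} = insert m {1..<m}" "{..<m} = insert 0 {1..<m}" using assms by auto
  then show ?thesis using L0 by (simp add: sum_subtractf algebra_simps)
 qed
 also have "(\<Sum>j\<in>{1..m}. L j (m - j)) = (\<Sum>j\<le>m. \<Sum>i\<le>m - j. frag_cmul ((-1) ^ (j + i - j) * int ((j + i) choose j)) (Q (j + i) (m - (j + i)))) - (\<Sum>t\<le>m. frag_cmul ((-1) ^ t) (Q t (m - t)))"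
 proof -
  have "{..m} = insert 0 {1..m}" by auto
  then show ?thesis by (simp add: left_act_formula)
 qed
 also have "(\<Sum>j\<le>m. \<Sum>i\<le>m - j. frag_cmul ((-1) ^ (j + i - j) * int ((j + i) choose j)) (Q (j + i) (m - (j + i))))
   = (\<Sum>t\<le>m. \<Sum>j\<le>t. frag_cmul ((-1) ^ (t - j) * int (t choose j)) (Q t (m - t)))"
  by (rule sum_triangle)
 also have "... = (\<Sum>t\<le>m. frag_cmul (of_bool (t = 0)) (Q t (m - t)))"
  by (simp only: frag_cmul_sum_left[symmetric] alternating_choose)
 also have "... = Q 0 m"
  by (subst sum.mono_neutral_right[of _ "{0}"]) auto
 also have "Q 0 m = (\<Sum>j<m. pw 0 (m - j) j) + pw 0 0 m"
  by (simp add: lessThan_Suc_atMost[symmetric])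
 also have "(\<Sum>t\<le>m. frag_cmul ((-1) ^ t) (Q t (m - t))) = (\<Sum>i\<le>m. \<Sum>r\<le>m - i. frag_cmul ((-1) ^ r) (pw r (m - i - r) i))"
 proof -
  have "(\<Sum>t\<le>m. frag_cmul ((-1) ^ t) (Q t (m - t))) = (\<Sum>(t, i)\<in>(SIGMA t:{..m}. {..m - t}). frag_cmul ((-1) ^ t) (pw t (m - t - i) i))"
   by (simp add: frag_cmul_sum sum.Sigma)
  also have "... = (\<Sum>(i, t)\<in>(SIGMA i:{..m}. {..m - i}). frag_cmul ((-1) ^ t) (pw t (m - i - t) i))"
   by (rule sum.reindex_bij_witness[of _ prod.swap prod.swap]) (auto simp: diff_right_commute add.commute)
  also have "... = (\<Sum>i\<le>m. \<Sum>r\<le>m - i. frag_cmul ((-1) ^ r) (pw r (m - i - r) i))"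
   by (simp add: sum.Sigma)
  finally show ?thesis .
 qed
 also have "... = (\<Sum>i<m. \<Sum>r\<le>m - i. frag_cmul ((-1) ^ r) (pw r (m - i - r) i)) + pw 0 0 m"
  by (simp add: lessThan_Suc_atMost[symmetric])
 finally have "path_dif A sphere_star (sz n m) = - (\<Sum>i<m. \<Sum>r\<le>m - i. frag_cmul ((-1) ^ r) (pw r (m - i - r) i))"
  by simp
 then show ?thesis by (simp add: sum_negf[symmetric])
qed

end

section \<open>Cochain complexes\<close>

lemma complex_closed:
 assumes "is_cochain_complex C"
 shows "0 \<in> comp C p" "diff C 0 = 0" "x \<in> comp C p ==> y \<in> comp C p ==> x - y \<in> comp C p"
  "x \<in> comp C p ==> y \<in> comp C p ==> diff C (x - y) = diff C x - diff C y"
  "x \<in> comp C p ==> y \<in> comp C p ==> x + y \<in> comp C p"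
  "x \<in> comp C p ==> y \<in> comp C p ==> diff C (x + y) = diff C x + diff C y"
  "x \<in> comp C p ==> diff C x \<in> comp C (Suc p)" "x \<in> comp C p ==> diff C (diff C x) = 0"
proof -
 note C = assms[unfolded is_cochain_complex_def, rule_format, of p]
 show z: "0 \<in> comp C p" using C by blast
 have m: "x \<in> comp C p ==> y \<in> comp C p ==> x - y \<in> comp C p & diff C (x - y) = diff C x - diff C y" for x y using C by blast
 then show "x \<in> comp C p ==> y \<in> comp C p ==> x - y \<in> comp C p"
  "x \<in> comp C p ==> y \<in> comp C p ==> diff C (x - y) = diff C x - diff C y" by blast+
 have "diff C (0 - 0) = diff C 0 - diff C 0" using m z by blast
 then show d0: "diff C 0 = 0" by simp
 have "y \<in> comp C p ==> - y \<in> comp C p & diff C (- y) = - diff C y" for y using m[OF z, of y] d0 by simp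
 then show "x \<in> comp C p ==> y \<in> comp C p ==> x + y \<in> comp C p"
  "x \<in> comp C p ==> y \<in> comp C p ==> diff C (x + y) = diff C x + diff C y"
  using m[of x "- y"] by simp_all
 show "x \<in> comp C p ==> diff C x \<in> comp C (Suc p)" "x \<in> comp C p ==> diff C (diff C x) = 0" using C by blast+
qed

lemma coboundaries_closed:
 assumes "is_cochain_complex C"
 shows "0 \<in> coboundaries C p" "x \<in> coboundaries C p ==> y \<in> coboundaries C p ==> x - y \<in> coboundaries C p"
  "x \<in> coboundaries C p ==> y \<in> coboundaries C p ==> x + y \<in> coboundaries C p"
  "x \<in> coboundaries C p ==> x \<in> cocycles C p"
proof -
 note C = complex_closed[OF assms]
 show z: "0 \<in> coboundaries C p"
 proof (cases p)
  case (Suc q)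
  then show ?thesis using C(1)[of q] C(2) by (force simp: coboundaries_def image_iff)
 qed (simp add: coboundaries_def)
 have m: "x - y \<in> coboundaries C p" if xy: "x \<in> coboundaries C p" "y \<in> coboundaries C p" for x y
 proof (cases p)
  case (Suc q)
  then obtain u v where "u \<in> comp C q" "v \<in> comp C q" "x = diff C u" "y = diff C v" using xy by (auto simp: coboundaries_def)
  then have "x - y = diff C (u - v)" "u - v \<in> comp C q" using C(3,4) by auto
  then show ?thesis using Suc by (simp add: coboundaries_def)
 qed (use xy in \<open>simp add: coboundaries_def\<close>)
 then show "x \<in> coboundaries C p ==> y \<in> coboundaries C p ==> x - y \<in> coboundaries C p" .
 show "x \<in> coboundaries C p ==> y \<in> coboundaries C p ==> x + y \<in> coboundaries C p"
  using m[of x "0 - y"] m[OF z, of y] by simp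
 show "x \<in> coboundaries C p ==> x \<in> cocycles C p"
  using C by (cases p) (auto simp: coboundaries_def cocycles_def)
qed

lemma coh_class_eq:
 assumes "is_cochain_complex C" "x \<in> cocycles C p" "y \<in> cocycles C p"
 shows "coh_class C p x = coh_class C p y \<longleftrightarrow> x - y \<in> coboundaries C p"
proof
 note B = coboundaries_closed[OF assms(1)]
 assume "coh_class C p x = coh_class C p y"
 moreover have "x \<in> coh_class C p x" using assms B(1) by (simp add: coh_class_def)
 ultimately show "x - y \<in> coboundaries C p" by (simp add: coh_class_def)
next
 note B = coboundaries_closed[OF assms(1)]
 assume xy: "x - y \<in> coboundaries C p"
 have "z - x \<in> coboundaries C p \<longleftrightarrow> z - y \<in> coboundaries C p" for z
 proof -
  have "z - y = (z - x) + (x - y)" "z - x = (z - y) - (x - y)" by simp_all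
  then show ?thesis using B(2,3) xy by metis
 qed
 then show "coh_class C p x = coh_class C p y" by (simp add: coh_class_def)
qed

lemma cmap_simps:
 assumes "cochain_map C D h" "is_cochain_complex C"
 shows "x \<in> comp C p ==> h x \<in> comp D p" "x \<in> comp C p ==> h (diff C x) = diff D (h x)"
  "x \<in> comp C p ==> y \<in> comp C p ==> h (x + y) = h x + h y" "h 0 = 0"
  "x \<in> comp C p ==> y \<in> comp C p ==> h (x - y) = h x - h y"
proof -
 note h = assms(1)[unfolded cochain_map_def]
 show 1: "x \<in> comp C p ==> h x \<in> comp D p" "x \<in> comp C p ==> h (diff C x) = diff D (h x)" using h by blast+
 have a: "x \<in> comp C p ==> y \<in> comp C p ==> h (x + y) = h x + h y" for x y p using h by blast
 then show "x \<in> comp C p ==> y \<in> comp C p ==> h (x + y) = h x + h y" .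
 show "h 0 = 0" using a[OF complex_closed(1)[OF assms(2)] complex_closed(1)[OF assms(2)]] by simp
 show "x \<in> comp C p ==> y \<in> comp C p ==> h (x - y) = h x - h y"
  using a[OF complex_closed(3)[OF assms(2)], of x p y y] by (simp add: algebra_simps)
qed

lemma cochain_map_cocycles:
 assumes "cochain_map C D h" "is_cochain_complex C" "is_cochain_complex D"
 shows "x \<in> cocycles C p ==> h x \<in> cocycles D p" "x \<in> coboundaries C p ==> h x \<in> coboundaries D p"
proof -
 note h = cmap_simps[OF assms(1,2)]
 show "h x \<in> cocycles D p" if "x \<in> cocycles C p"
 proof -
  have x: "x \<in> comp C p" "diff C x = 0" using that by (simp_all add: cocycles_def)
  have "diff D (h x) = 0" using h(2)[OF x(1)] x(2) h(4) by simp
  then show ?thesis using h(1)[OF x(1)] by (simp add: cocycles_def)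
 qed
 show "h x \<in> coboundaries D p" if x: "x \<in> coboundaries C p"
 proof (cases p)
  case (Suc q)
  then obtain y where "y \<in> comp C q" "x = diff C y" using x by (auto simp: coboundaries_def)
  then have "h x = diff D (h y)" "h y \<in> comp D q" using h(1,2) by auto
  then show ?thesis using Suc by (simp add: coboundaries_def)
 qed (use x h(4) in \<open>simp add: coboundaries_def\<close>)
qed

lemma coh_class_image:
 assumes "cochain_map C D h" "is_cochain_complex C" "is_cochain_complex D" "x \<in> cocycles C p"
 shows "(\<Union>y\<in>coh_class C p x. coh_class D p (h y)) = coh_class D p (h x)"
proof -
 have "coh_class D p (h y) = coh_class D p (h x)" if "y \<in> coh_class C p x" for y
 proof -
  have y: "y \<in> cocycles C p" "y - x \<in> coboundaries C p" using that by (auto simp: coh_class_def)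
  have "h (y - x) = h y - h x" using y(1) assms(4) by (intro cmap_simps(5)[OF assms(1,2)]) (auto simp: cocycles_def)
  then have "h y - h x \<in> coboundaries D p" using cochain_map_cocycles(2)[OF assms(1-3) y(2)] by simp
  then show ?thesis
   using coh_class_eq[OF assms(3) cochain_map_cocycles(1)[OF assms(1-3) y(1)] cochain_map_cocycles(1)[OF assms(1-3) assms(4)]] by blast
 qed
 moreover have "x \<in> coh_class C p x" using assms coboundaries_closed(1)[OF assms(2)] by (simp add: coh_class_def)
 ultimately show ?thesis by blast
qed

text \<open>Injectivity and surjectivity on cohomology in terms of elements, so that no quotient
  sets are needed later.\<close>

lemma quasi_iso_iff:
 "quasi_iso C D h \<longleftrightarrow> is_cochain_complex C & is_cochain_complex D & cochain_map C D h &
   (\<forall>p. \<forall>x\<in>cocycles C p. h x \<in> coboundaries D p --> x \<in> coboundaries C p) &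
   (\<forall>p. \<forall>y\<in>cocycles D p. \<exists>x\<in>cocycles C p. y - h x \<in> coboundaries D p)"
proof (cases "is_cochain_complex C & is_cochain_complex D & cochain_map C D h")
 case True
 then have C: "is_cochain_complex C" and D: "is_cochain_complex D" and h: "cochain_map C D h" by auto
 have "bij_betw (%c. \<Union>x\<in>c. coh_class D p (h x)) (cohomology C p) (cohomology D p) \<longleftrightarrow>
  (\<forall>x\<in>cocycles C p. h x \<in> coboundaries D p --> x \<in> coboundaries C p) & (\<forall>y\<in>cocycles D p. \<exists>x\<in>cocycles C p. y - h x \<in> coboundaries D p)" for p
 proof -
  let ?F = "%c. \<Union>x\<in>c. coh_class D p (h x)"
  have F: "?F (coh_class C p x) = coh_class D p (h x)" if "x \<in> cocycles C p" for x
   by (rule coh_class_image[OF h C D that])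
  have hc: "h x \<in> cocycles D p" if "x \<in> cocycles C p" for x using cochain_map_cocycles[OF h C D] that by blast
  have hm: "h (x - y) = h x - h y" "x - y \<in> cocycles C p" if "x \<in> cocycles C p" "y \<in> cocycles C p" for x y
   using that cmap_simps(5)[OF h C] complex_closed(3,4)[OF C] by (auto simp: cocycles_def)
  have "inj_on ?F (cohomology C p) \<longleftrightarrow> (\<forall>x\<in>cocycles C p. \<forall>y\<in>cocycles C p. h x - h y \<in> coboundaries D p --> x - y \<in> coboundaries C p)"
   unfolding inj_on_def cohomology_def using F coh_class_eq[OF C, of _ p] coh_class_eq[OF D, of _ p] hc by simp
  also have "... \<longleftrightarrow> (\<forall>x\<in>cocycles C p. h x \<in> coboundaries D p --> x \<in> coboundaries C p)"
  proof
   assume L: "\<forall>x\<in>cocycles C p. \<forall>y\<in>cocycles C p. h x - h y \<in> coboundaries D p --> x - y \<in> coboundaries C p"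
   have "0 \<in> cocycles C p" "h 0 = 0" using complex_closed(1,2)[OF C] cmap_simps(4)[OF h C] by (auto simp: cocycles_def)
   then show "\<forall>x\<in>cocycles C p. h x \<in> coboundaries D p --> x \<in> coboundaries C p" using L by (metis diff_zero)
  qed (use hm in metis)
  finally have 1: "inj_on ?F (cohomology C p) \<longleftrightarrow> (\<forall>x\<in>cocycles C p. h x \<in> coboundaries D p --> x \<in> coboundaries C p)" .
  have img: "?F ` cohomology C p = (%x. coh_class D p (h x)) ` cocycles C p"
   unfolding cohomology_def image_image using F by (intro image_cong) auto
  have sub: "(%x. coh_class D p (h x)) ` cocycles C p \<subseteq> cohomology D p"
   unfolding cohomology_def by (intro image_subsetI imageI hc)
  have "?F ` cohomology C p = cohomology D p \<longleftrightarrow> cohomology D p \<subseteq> (%x. coh_class D p (h x)) ` cocycles C p"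
   unfolding img using sub by (simp only: set_eq_subset simp_thms)
  also have "... \<longleftrightarrow> (\<forall>y\<in>cocycles D p. \<exists>x\<in>cocycles C p. coh_class D p y = coh_class D p (h x))"
   unfolding cohomology_def[of D] image_subset_iff image_iff ..
  also have "... \<longleftrightarrow> (\<forall>y\<in>cocycles D p. \<exists>x\<in>cocycles C p. y - h x \<in> coboundaries D p)"
   by (intro ball_cong bex_cong refl coh_class_eq[OF D] hc)
  finally show ?thesis unfolding bij_betw_def by (simp only: 1)
 qed
 then show ?thesis using True by (simp only: quasi_iso_def simp_thms all_conj_distrib)
qed (auto simp: quasi_iso_def)

lemma quasi_iso_compose:
 assumes "quasi_iso C D h" "quasi_iso D E k"
 shows "quasi_iso C E (%x. k (h x))"
proof -
 have C: "is_cochain_complex C" and D: "is_cochain_complex D" and E: "is_cochain_complex E" and h: "cochain_map C D h" and k: "cochain_map D E k"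
  using assms by (auto simp: quasi_iso_def)
 note hs = cmap_simps[OF h C] cochain_map_cocycles[OF h C D]
 note ks = cmap_simps[OF k D] cochain_map_cocycles[OF k D E]
 have "cochain_map C E (%x. k (h x))"
  unfolding cochain_map_def using hs(1-3) ks(1-3) by metis
 moreover have "x \<in> coboundaries C p" if "x \<in> cocycles C p" "k (h x) \<in> coboundaries E p" for x p
  using assms that hs(6) unfolding quasi_iso_iff by blast
 moreover have "\<exists>x\<in>cocycles C p. y - k (h x) \<in> coboundaries E p" if y: "y \<in> cocycles E p" for y p
 proof -
  obtain x' where x': "x' \<in> cocycles D p" "y - k x' \<in> coboundaries E p" using assms(2) y unfolding quasi_iso_iff by blast
  obtain x where x: "x \<in> cocycles C p" "x' - h x \<in> coboundaries D p" using assms(1) x'(1) unfolding quasi_iso_iff by blast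
  have "k (x' - h x) = k x' - k (h x)" using x'(1) hs(6)[OF x(1)] by (intro ks(5)) (auto simp: cocycles_def)
  then have e: "y - k (h x) = (y - k x') + k (x' - h x)" by simp
  have "y - k (h x) \<in> coboundaries E p" unfolding e by (rule coboundaries_closed(3)[OF E x'(2) ks(7)[OF x(2)]])
  then show ?thesis using x(1) by blast
 qed
 ultimately show ?thesis using C E unfolding quasi_iso_iff by blast
qed

lemma scale_simps [simp]:
 "scale 0 f = 0" "scale 1 f = f" "scale k 0 = 0"
 by (intro cochain_eqI, simp add: scale_def)+

lemma scale_add: "scale (j + k) f = scale j f + scale k f" "scale k (f + g) = scale k f + scale k g" "scale k (scale j f) = scale (k * j) f"
 "scale k (- f) = - scale k f" "scale (- k) f = - scale k f" "scale k (f - g) = scale k f - scale k g"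
 by (intro cochain_eqI; simp add: scale_def algebra_simps)+

lemma scale_sum: "scale k (sum f I) = (\<Sum>i\<in>I. scale k (f i))" "scale (sum c I) g = (\<Sum>i\<in>I. scale (c i) g)"
 by (induction I rule: infinite_finite_induct) (simp_all only: sum_eqs scale_simps scale_add)

lemma lin_ext_superset:
 "finite S ==> keys x \<subseteq> S ==> lin_ext f x = (\<Sum>b\<in>S. scale (lookup x b) (f b))"
 unfolding lin_ext_def by (rule sum.mono_neutral_left) (auto simp: in_keys_iff)

lemma lin_ext_add: "lin_ext f (x + y) = lin_ext f x + lin_ext f y"
proof -
 let ?S = "keys x \<union> keys y"
 have "keys (x + y) \<subseteq> ?S" by (rule Poly_Mapping.keys_add)
 then show ?thesis
  using lin_ext_superset[of ?S x f] lin_ext_superset[of ?S y f] lin_ext_superset[of ?S "x + y" f]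
  by (simp add: lookup_add scale_add sum.distrib)
qed

lemma lin_ext_of [simp]: "lin_ext f (frag_of b) = f b"
 by (simp add: lin_ext_def)

lemma lin_ext_zero [simp]: "lin_ext f 0 = 0"
 by (simp add: lin_ext_def)

lemma lin_ext_cmul: "lin_ext f (frag_cmul k x) = scale k (lin_ext f x)"
proof -
 have "keys (frag_cmul k x) \<subseteq> keys x" by (rule keys_cmul)
 then show ?thesis using lin_ext_superset[of "keys x" "frag_cmul k x" f]
  by (simp add: lin_ext_def scale_sum scale_add)
qed

lemma lin_ext_sum: "lin_ext f (sum g I) = (\<Sum>i\<in>I. lin_ext f (g i))"
 by (induction I rule: infinite_finite_induct) (simp_all only: sum_eqs lin_ext_zero lin_ext_add)

text \<open>Additivity in each degree gives integer multiples by induction, and thereby the value on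
  a combination of basis elements.\<close>

lemma cochain_map_lin_ext:
 assumes h: "cochain_map (complex_of B) D h" and B: "is_cochain_complex (complex_of B)" and x: "x \<in> comp (complex_of B) p"
 shows "h x = lin_ext (%b. h (frag_of b)) x"
proof -
 note hs = cmap_simps[OF h B]
 have cm: "frag_cmul k y \<in> comp (complex_of B) p & h (frag_cmul k y) = scale k (h y)" if y: "y \<in> comp (complex_of B) p" for k y
 proof (induction k rule: int_induct[where k=0])
  case base
  show ?case using complex_closed(1)[OF B] hs(4) by simp
 next
  case (step1 i)
  have e: "frag_cmul (i + 1) y = frag_cmul i y + y" by (simp add: frag_cmul_distrib)
  show ?case unfolding e scale_add(1) scale_simps
   using complex_closed(5)[OF B conjunct1[OF step1(2)] y] hs(3)[OF conjunct1[OF step1(2)] y] step1(2) by simp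
 next
  case (step2 i)
  have e: "frag_cmul (i - 1) y = frag_cmul i y - y" using frag_cmul_distrib[of i "-1" y] by simp
  have e': "scale (i - 1) (h y) = scale i (h y) - h y" by (intro cochain_eqI) (simp add: scale_def algebra_simps)
  show ?case unfolding e e'
   using complex_closed(3)[OF B conjunct1[OF step2(2)] y] hs(5)[OF conjunct1[OF step2(2)] y] step2(2) by simp
 qed
 have "(\<Sum>b\<in>S. frag_cmul (c b) (frag_of b)) \<in> comp (complex_of B) p & h (\<Sum>b\<in>S. frag_cmul (c b) (frag_of b)) = (\<Sum>b\<in>S. scale (c b) (h (frag_of b)))"
  if "finite S" "!!b. b \<in> S ==> frag_of b \<in> comp (complex_of B) p" for S c
  using that
 proof (induction S rule: finite_induct)
  case empty
  show ?case using complex_closed(1)[OF B] hs(4) by simp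
 next
  case (insert b S)
  have b: "frag_cmul (c b) (frag_of b) \<in> comp (complex_of B) p" "h (frag_cmul (c b) (frag_of b)) = scale (c b) (h (frag_of b))"
   using cm[of "frag_of b" "c b"] insert.prems by simp_all
  have I: "(\<Sum>b\<in>S. frag_cmul (c b) (frag_of b)) \<in> comp (complex_of B) p" "h (\<Sum>b\<in>S. frag_cmul (c b) (frag_of b)) = (\<Sum>b\<in>S. scale (c b) (h (frag_of b)))"
   using insert.IH insert.prems by simp_all
  show ?case unfolding sum.insert[OF insert.hyps] using complex_closed(5)[OF B b(1) I(1)] hs(3)[OF b(1) I(1)] b(2) I(2) by simp
 qed
 note this[of "keys x" "lookup x"]
 moreover have "frag_of b \<in> comp (complex_of B) p" if "b \<in> keys x" for b
  using x that by (auto simp: complex_of_def)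
 moreover have "(\<Sum>b\<in>keys x. frag_cmul (lookup x b) (frag_of b)) = x"
  using frag_expansion[of x] by (simp add: frag_extend_def)
 ultimately show ?thesis by (simp add: lin_ext_def)
qed

lemma comp_frag:
 "frag_of b \<in> comp (complex_of B) p \<longleftrightarrow> b \<in> bas B & deg B b = p"
 "x \<in> comp (complex_of B) p ==> frag_cmul k x \<in> comp (complex_of B) p"
 using keys_cmul[of k x] by (auto simp: complex_of_def)

lemma comp_sum: "(!!i. i \<in> I ==> f i \<in> comp (complex_of B) p) ==> sum f I \<in> comp (complex_of B) p"
proof (induction I rule: infinite_finite_induct)
 case (insert i I)
 then show ?case using Poly_Mapping.keys_add[of "f i" "sum f I"] by (auto simp: complex_of_def)
qed (auto simp: complex_of_def)

lemma cube_map_loop_to_path: "cube_map (loops X) (path_space X) loop_to_path"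
 unfolding cube_map_def
proof (intro allI impI)
 fix m V assume V: "singular m (loops X) V"
 have "continuous_map (prod_topology (std_cube m) (top_of_set {0..1::real})) X (%y. V (fst y) (cis (2 * pi * snd y)))"
  by (intro continuous_map_loop_cube[OF V] continuous_map_cis continuous_map_interval_real continuous_map_fst continuous_map_snd)
 then have "continuous_map (prod_topology (std_cube m) (top_of_set {0..1::real})) X (%(t, u). push m loop_to_path V t u)"
  by (rule continuous_map_eq) (auto simp: push_def loop_to_path_def)
 moreover have "push m loop_to_path V \<in> extensional (pts m)" "\<forall>t\<in>pts m. push m loop_to_path V t \<in> extensional {0..1}"
  by (simp_all add: push_def loop_to_path_def)
 ultimately show "singular m (path_space X) (push m loop_to_path V)"
  unfolding singular_path_cube by blast
qed

lemma cube_map_loop_eval: "cube_map (loops X) X loop_eval"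
 unfolding cube_map_def
proof (intro allI impI)
 fix m V assume V: "singular m (loops X) V"
 have "continuous_map (std_cube m) X (%t. V t 1)"
  by (intro continuous_map_loop_cube[OF V]) auto
 then have "continuous_map (std_cube m) X (push m loop_eval V)"
  by (rule continuous_map_eq) (simp add: push_def loop_eval_def)
 then show "singular m X (push m loop_eval V)" by (simp add: singular_cube_def push_def)
qed

text \<open>Contracting a constant path does not change it, so the contracted cube ignores its first
  coordinate and is degenerate.\<close>

lemma J_op_const:
 assumes "f \<in> cochains (path_space X) S" "!!t. t \<in> pts k ==> T t = const_path (h t)"
 shows "J_op X f k T = 0"
proof -
 have "indep (Suc k) (contract_cube k T) 0" unfolding indep_def
 proof (intro ballI impI)
  fix t t' assume t: "t \<in> pts (Suc k)" "t' \<in> pts (Suc k)" "\<forall>j. j ~= 0 --> t j = t' j"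
  have e: "(%i. t (Suc i)) = (%i. t' (Suc i))" using t(3) by simp
  have m: "t 0 * u \<in> {0..1}" "t' 0 * u \<in> {0..1}" if "u \<in> {0..1}" for u
   using t(1,2) that by (auto simp: pts_iff mult_le_one)
  show "contract_cube k T t = contract_cube k T t'"
   unfolding contract_cube_apply[OF t(1)] contract_cube_apply[OF t(2)] e
   using m by (intro restrict_ext) (simp add: assms(2)[OF tail_pts[OF t(2)]] const_path_def)
 qed
 then have "degenerate_cube (Suc k) (contract_cube k T)" unfolding degenerate_iff by blast
 then show ?thesis using cochains_zero[OF assms(1)] by (simp add: J_op_def)
qed

section \<open>The free loop space of the sphere\<close>

locale sphere_loops = sphere_model n for n +
 fixes \<alpha> :: "((letter list \<times> letter list) list \<Rightarrow>\<^sub>0 int) => ((nat => real) \<times> (nat => real)) cochain"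
  and \<gamma> :: "(letter list list \<Rightarrow>\<^sub>0 int) => (nat => real) cochain"
  and \<beta> :: "((letter list \<times> letter list) list \<times> letter list \<Rightarrow>\<^sub>0 int) => (real => nat => real) cochain"
  and \<sigma> :: "(letter \<times> letter list \<Rightarrow>\<^sub>0 int) => (letter list list \<times> letter list \<Rightarrow>\<^sub>0 int)"
 assumes data: "thin_loop_data (sphere_cochains n) sphere_star (nsphere (2 * n + 1)) \<alpha> \<gamma> \<beta> \<sigma>"
begin

abbreviation "X \<equiv> nsphere (2 * n + 1)"
abbreviation "XX \<equiv> prod_topology X X"
abbreviation "LX \<equiv> loops X"
abbreviation "PX \<equiv> path_space X"
abbreviation "B1 \<equiv> cobar (bar A)"
abbreviation "PM \<equiv> path_model A sphere_star"

lemmas data' = data[unfolded thin_loop_data_def Let_def]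

lemma quasi_isos:
 "quasi_iso (complex_of B2) (CU XX) \<alpha>" "quasi_iso (complex_of B1) (CU X) \<gamma>" "quasi_iso (complex_of PM) (CU PX) \<beta>"
 "quasi_iso (complex_of (loop_model A sphere_star)) (CU LX) (loop_map A sphere_star X \<beta> \<gamma>)"
 "quasi_iso (complex_of (thin_model A sphere_star)) (complex_of (loop_model A sphere_star)) \<sigma>"
 using data' by blast+

lemma data_facts:
 "is_path_map A sphere_star X \<alpha> \<beta>" "is_thin_section A sphere_star \<sigma>"
 "x \<in> comp (complex_of B2) p ==> pullback X (%x. (x, x)) (\<alpha> x) = \<gamma> (frag_extend (cobar_star sphere_star) x)"
 "y \<in> comp (complex_of B1) p ==> frag_extend (counit A) y = 0 ==> \<gamma> y = 0"
 "y \<in> comp (complex_of B1) p ==> \<alpha> (frag_extend (%w. frag_of (map (%c. (c, [])) w)) y) = pullback XX fst (\<gamma> y)"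
 "y \<in> comp (complex_of B1) p ==> \<alpha> (frag_extend (%w. frag_of (map (%c. ([], c)) w)) y) = pullback XX snd (\<gamma> y)"
 "coh_algebra_map (complex_of B1) (mult_of B1) (frag_of (unt B1)) (CU X) (cup X) (cube_one X) \<gamma>"
 using data' by blast+

lemma complexes: "is_cochain_complex (complex_of B2)" "is_cochain_complex (complex_of B1)" "is_cochain_complex (complex_of PM)"
 "is_cochain_complex (CU XX)" "is_cochain_complex (CU X)" "is_cochain_complex (CU PX)" "is_cochain_complex (CU LX)"
 "is_cochain_complex (complex_of (thin_model A sphere_star))" "is_cochain_complex (complex_of (loop_model A sphere_star))"
 using quasi_isos unfolding quasi_iso_def by blast+

lemma chain_maps: "cochain_map (complex_of B2) (CU XX) \<alpha>" "cochain_map (complex_of B1) (CU X) \<gamma>" "cochain_map (complex_of PM) (CU PX) \<beta>"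
 "cochain_map (complex_of (thin_model A sphere_star)) (complex_of (loop_model A sphere_star)) \<sigma>"
 using quasi_isos unfolding quasi_iso_def by blast+

text \<open>The inner sum of \<open>path_dif_sphere\<close>. The case 0 is set apart because
  \<open>([], [])\<close> is not a letter of the cobar construction.\<close>

definition "xg s = (if s = 0 then 0 else \<Sum>r\<le>s. frag_cmul ((-1) ^ (r + 1)) (frag_of [(sz n r, sz n (s - r))]))"
definition "G s = \<alpha> (xg s)"
definition "P m = \<beta> (frag_of ([], sz n m))"

lemma word_in_B2:
 assumes "s > 0" "r \<le> s"
 shows "frag_of [(sz n r, sz n (s - r))] \<in> comp (complex_of B2) (2 * n * s + 1)"
proof -
 from assms have w: "[(sz n r, sz n (s - r))] \<in> gwords g" by auto
 show ?thesis unfolding comp_frag using w deg_B2[OF w] \<open>r \<le> s\<close> by (simp add: bas_B2)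
qed

lemma xg_in: "xg s \<in> comp (complex_of B2) (2 * n * s + 1)"
 unfolding xg_def using word_in_B2 complex_closed(1)[OF complexes(1)] by (auto intro!: comp_sum comp_frag)

lemma G_in: "G s \<in> cochains XX {2 * n * s + 1}"
 using cmap_simps(1)[OF chain_maps(1) complexes(1) xg_in] by (simp add: G_def comp_CU)

lemma G_zero: "G 0 = 0"
 using cmap_simps(4)[OF chain_maps(1) complexes(1)] by (simp add: G_def xg_def)

lemma G_eq: "s > 0 ==> G s = (\<Sum>r\<le>s. scale ((-1) ^ (r + 1)) (\<alpha> (frag_of [(sz n r, sz n (s - r))])))"
 unfolding G_def cochain_map_lin_ext[OF chain_maps(1) complexes(1) xg_in] by (simp add: xg_def lin_ext_sum lin_ext_cmul)

text \<open>On the diagonal the two factors \<open>sz(r)\<close> and \<open>sz(s - r)\<close>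
  multiply to a binomial multiple of \<open>sz(s)\<close>, and the alternating sum of these binomial
  coefficients is zero for \<open>s > 0\<close>.\<close>

lemma G_diagonal: "diag_vanish (G s)"
proof (rule vanishes_on_diagonalI[OF G_in])
 have "frag_extend (cobar_star sphere_star) (xg s) = 0"
 proof (cases "s = 0")
  case False
  have "frag_extend (cobar_star sphere_star) (xg s) = (\<Sum>r\<le>s. frag_cmul (- ((-1) ^ r * int (s choose r))) (frag_of [sz n s]))"
   using False by (simp add: xg_def frag_extend_sum' frag_extend_cmul sphere_star_sz)
  also have "... = frag_cmul (\<Sum>r\<le>s. - ((-1) ^ r * int (s choose r))) (frag_of [sz n s])" by (rule frag_cmul_sum_left[symmetric])
  also have "(\<Sum>r\<le>s. - ((-1) ^ r * int (s choose r))) = 0"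
   using choose_alternating_sum[of s, where 'a=int] False by (simp add: sum_negf)
  finally show ?thesis by simp
 qed (simp add: xg_def)
 then show "pullback X (%x. (x, x)) (G s) = 0"
  using data_facts(3)[OF xg_in] cmap_simps(4)[OF chain_maps(2) complexes(2)] by (simp add: G_def)
qed

lemma word_in_PM: "w \<in> gwords g ==> frag_of (w, sz n i) \<in> comp (complex_of PM) (deg B2 w + 2 * n * i)"
proof -
 have "deg (bar A) c = bar_deg A c" for c by (simp add: bar_def)
 then show "w \<in> gwords g ==> ?thesis"
  by (auto simp: comp_frag path_model_def free_module_def bas_B2 bas_bar degrees_sz(1))
qed

lemma path_dif_in:
 assumes m: "m > 0"
 shows "path_dif A sphere_star (sz n m) \<in> comp (complex_of PM) (2 * n * m + 1)"
proof -
 have "pw r (m - i - r) i \<in> comp (complex_of PM) (2 * n * m + 1)" if "i < m" "r \<le> m - i" for i r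
 proof -
  have w: "[(sz n r, sz n (m - i - r))] \<in> gwords g" using that by auto
  have "deg B2 [(sz n r, sz n (m - i - r))] + 2 * n * i = 2 * n * (m - i) + 2 * n * i + 1" using deg_B2[OF w] that by simp
  also have "... = 2 * n * m + 1" using that by (simp add: algebra_simps flip: distrib_left)
  finally show ?thesis using word_in_PM[OF w, of i] by simp
 qed
 then show ?thesis unfolding path_dif_sphere[OF m] by (intro comp_sum comp_frag(2)) auto
qed

definition "Gp s = pullback PX endpoints (G s)"

lemma P_in: "P m \<in> cochains PX {2 * n * m}"
 using cmap_simps(1)[OF chain_maps(3) complexes(3) word_in_PM[of "[]" m]] by (simp add: P_def comp_CU cobar_def)

lemma P_zero: "P 0 = cube_one PX"
 using data_facts(1) by (simp add: P_def is_path_map_def)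

lemma beta_path_dif:
 assumes m: "m > 0"
 shows "\<beta> (path_dif A sphere_star (sz n m)) = (\<Sum>i<m. cup PX (P i) (Gp (m - i)))"
proof -
 have e: "psign (d * bar_deg A (sz n i)) = 1" for d i by (simp add: degrees_sz)
 let ?h = "%(w, c). scale (psign (deg (cobar (tensor_coalgebra (bar A) (bar A))) w * bar_deg A c))
      (cup PX (\<beta> (frag_of ([], c))) (pullback PX endpoints (\<alpha> (frag_of w))))"
 have "\<beta> (path_dif A sphere_star (sz n m)) = lin_ext ?h (path_dif A sphere_star (sz n m))"
  using data_facts(1) path_dif_in[OF m] unfolding is_path_map_def by blast
 also have "... = (\<Sum>i<m. \<Sum>r\<le>m - i. scale ((-1) ^ (r + 1)) (cup PX (P i) (pullback PX endpoints (\<alpha> (frag_of [(sz n r, sz n (m - i - r))])))))"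
  unfolding path_dif_sphere[OF m] lin_ext_sum lin_ext_cmul by (simp only: lin_ext_of prod.case e scale_simps P_def)
 also have "... = (\<Sum>i<m. cup PX (P i) (Gp (m - i)))"
 proof (rule sum.cong)
  fix i assume "i \<in> {..<m}"
  then show "(\<Sum>r\<le>m - i. scale ((-1) ^ (r + 1)) (cup PX (P i) (pullback PX endpoints (\<alpha> (frag_of [(sz n r, sz n (m - i - r))]))))) = cup PX (P i) (Gp (m - i))"
   by (simp only: Gp_def G_eq lessThan_iff zero_less_diff pullback_sum cup_sum pullback_lin cup_lin)
 qed simp
 finally show ?thesis .
qed

lemma codiff_P: "codiff PX (P m) = conv PX P Gp m"
proof (cases "m = 0")
 case True
 have "Gp 0 = 0" by (simp add: Gp_def G_zero)
 then have "conv PX P Gp 0 = 0" by (intro conv_zero) simp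
 then show ?thesis using True by (simp add: P_zero)
next
 case False
 have r: "right_mult B2 (bar A) x (frag_of []) = x" for x
 proof -
  have "right_mult B2 (bar A) x (frag_of []) = frag_extend (%(w, c). frag_of (w, c)) x"
   by (simp add: right_mult_def cobar_def)
  then show ?thesis by (simp only: case_prod_beta' prod.collapse frag_expansion[symmetric])
 qed
 have "dif PM ([], sz n m) = path_dif A sphere_star (sz n m)"
  by (simp add: path_model_def free_module_def r) (simp add: cobar_def right_mult_def)
 then have "diff (complex_of PM) (frag_of ([], sz n m)) = path_dif A sphere_star (sz n m)" by (simp add: complex_of_def)
 then have "codiff PX (P m) = \<beta> (path_dif A sphere_star (sz n m))"
  using cmap_simps(2)[OF chain_maps(3) complexes(3) word_in_PM[of "[]" m]] by (simp add: P_def diff_CU)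
 moreover have "conv PX P Gp m = (\<Sum>i<m. cup PX (P i) (Gp (m - i)))"
  unfolding conv_def lessThan_Suc_atMost[symmetric] by (simp add: Gp_def G_zero)
 ultimately show ?thesis using beta_path_dif False by simp
qed

text \<open>Applying the differential to \<open>codiff_P\<close> twice gives \<open>P\<close> times
  the defect of the equation. As \<open>P 0\<close> is the unit, \<open>P\<close> cancels weight by
  weight, and restriction to endpoints is injective.\<close>

lemma codiff_G: "codiff XX (G s) = - conv XX G G s"
proof -
 have p: "cube_map PX XX endpoints" by (rule cube_map_endpoints)
 define E where "E = conv PX Gp Gp + seqd PX Gp"
 have "conv PX P E = 0"
 proof -
  have d: "seqd PX P = conv PX P Gp" by (rule ext) (rule codiff_P)
  have "seqd PX (conv PX P Gp) = conv PX (seqd PX P) Gp + (%s. sgn_if True (conv PX P (seqd PX Gp) s))"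
   by (rule seqd_conv[OF P_in]) simp
  also have "... = conv PX (conv PX P Gp) Gp + conv PX P (seqd PX Gp)" unfolding d by (simp only: sgn_if_def if_True)
  finally have "conv PX (conv PX P Gp) Gp + conv PX P (seqd PX Gp) = seqd PX (conv PX P Gp)" by (rule sym)
  also have "... = 0" unfolding codiff_P[symmetric] by (rule ext) (simp only: codiff_codiff zero_fun_apply)
  finally have "conv PX (conv PX P Gp) Gp + conv PX P (seqd PX Gp) = 0" .
  then show ?thesis unfolding conv_assoc E_def conv_lin .
 qed
 then have c0: "conv PX P E m = 0" for m by simp
 have Es: "E s = conv PX Gp Gp s + codiff PX (Gp s)" for s by (simp only: E_def plus_fun_apply)
 have Ein: "E s \<in> cochains PX UNIV" for s
  unfolding Es conv_def Gp_def
  by (intro cochains_lin cochains_sum; rule cochains_mono[OF cube_cup_in[OF pullback_in[OF G_in] pullback_in[OF G_in]]] cochains_mono[OF cube_codiff_in[OF pullback_in[OF G_in]]]; simp)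
 have E: "E s = 0" for s
 proof (induction s rule: less_induct)
  case (less s)
  have "cup PX (P i) (E (s - i)) = 0" if "i \<in> {..s} - {0}" for i
  proof -
   have "E (s - i) = 0" by (rule less) (use that in auto)
   then show ?thesis by (simp only: cup_lin)
  qed
  then have "conv PX P E s = (\<Sum>i\<in>{0}. cup PX (P i) (E (s - i)))"
   unfolding conv_def by (intro sum.mono_neutral_right) auto
  also have "... = E s" using cup_one_unit(1)[OF Ein] by (simp only: sum.insert finite.emptyI sum.empty empty_iff simp_thms P_zero diff_zero add_0_right)
  finally show ?case using c0[of s] by (simp only:)
 qed
 have "pullback PX endpoints (conv XX G G s + codiff XX (G s)) = E s"
  unfolding Es pullback_lin pullback_codiff[OF p] Gp_def conv_def pullback_sum pullback_cup[OF p] ..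
 then have "pullback PX endpoints (conv XX G G s + codiff XX (G s)) = 0" using E by simp
 moreover have "conv XX G G s + codiff XX (G s) \<in> cochains XX UNIV"
  unfolding conv_def
  by (intro cochains_lin cochains_sum; rule cochains_mono[OF cube_cup_in[OF G_in G_in]] cochains_mono[OF cube_codiff_in[OF G_in]]; simp)
 ultimately have z: "conv XX G G s + codiff XX (G s) = 0"
  by (intro endpoints_pullback_inject[OF path_connected_space_nsphere]) simp_all
 show ?thesis by (rule minus_unique[symmetric]) (rule z)
qed

end

sublocale sphere_loops \<subseteq> mc: diagonal_maurer_cartan X G n
 using G_in G_zero codiff_G G_diagonal by unfold_locales

lemma frag_extend_frag_extend: "frag_extend f (frag_extend h x) = frag_extend (%b. frag_extend f (h b)) x"
 by (simp add: frag_extend_def[of h] frag_extend_def[of "%b. frag_extend f (h b)"] frag_extend_sum' frag_extend_cmul)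

lemma lin_ext_frag_extend: "lin_ext f (frag_extend h x) = lin_ext (%b. lin_ext f (h b)) x"
 by (simp add: frag_extend_def lin_ext_sum lin_ext_cmul) (simp add: lin_ext_def)

lemma keys_singleton: "keys x \<subseteq> {b} ==> x = frag_cmul (lookup x b) (frag_of b)"
 by (rule poly_mapping_eqI) (auto simp: in_keys_iff)

section \<open>Classes on the free loop space\<close>

context sphere_loops
begin

definition "a m = (if m = 0 then cube_one LX else - lint X (G m))"
definition "cz = \<gamma> (frag_of [[g]])"
definition "ec = pullback LX loop_eval cz"
definition "b m = cup LX (a m) ec"
definition "Ups = Upsilon A sphere_star X \<gamma> \<beta> \<sigma>"

lemma a_in: "a m \<in> cochains LX {2 * n * m}"
proof (cases "m = 0")
 case False
 have "lint X (G m) \<in> cochains LX {2 * n * m}"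
  by (rule cochains_mono[OF loop_integral_in[OF G_in]]) auto
 then show ?thesis using False cochains_lin(4) by (simp add: a_def)
qed (simp add: a_def cube_one_in)

lemma codiff_a: "codiff LX (a m) = 0"
proof (cases "m = 0")
 case False
 have "lint X (codiff XX (G m)) = 0"
  unfolding codiff_G conv_def loop_integral_lin loop_integral_sum loop_integral_cup[OF G_diagonal G_diagonal] by simp
 then have "codiff LX (lint X (G m)) = 0" unfolding loop_integral_codiff[OF G_diagonal] by simp
 then show ?thesis using False by (simp only: a_def if_False codiff_lin neg_equal_zero) simp
qed (simp add: a_def)

lemma gen_in: "[[g]] \<in> bas B1" "deg B1 [[g]] = 2 * n + 1" "[] \<in> bas B1" "deg B1 [] = 0"
 using bar_deg_g[of "[g]"] by (simp_all add: cobar_def bas_bar) (simp_all add: bar_def)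

lemma cz_in: "cz \<in> cochains X {2 * n + 1}"
 using cmap_simps(1)[OF chain_maps(2) complexes(2), of "frag_of [[g]]" "2 * n + 1"] gen_in by (simp add: cz_def comp_frag comp_CU)

lemma ec_in: "ec \<in> cochains LX {2 * n + 1}"
 unfolding ec_def by (rule pullback_in[OF cz_in])

lemma codiff_cz: "codiff X cz = 0"
proof -
 have "bar_dif A [g] = 0" using bar_dif_sphere[OF n, of 1] by simp
 then have "cobar_dif (bar A) [[g]] = 0"
  by (simp add: cobar_gen_dif_def bar_def frag_extend_add)
 then have "diff (complex_of B1) (frag_of [[g]]) = 0" by (simp add: complex_of_def cobar_def)
 then show ?thesis
  using cmap_simps(2,4)[OF chain_maps(2) complexes(2)] gen_in comp_frag(1)[of "[[g]]" B1] by (metis cz_def diff_CU)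
qed

lemma codiff_ec: "codiff LX ec = 0"
 unfolding ec_def pullback_codiff[OF cube_map_loop_eval, symmetric] codiff_cz by (rule pullback_lin)

lemma b_in: "b m \<in> cochains LX {2 * n * m + 2 * n + 1}"
 unfolding b_def by (rule cochains_mono[OF cube_cup_in[OF a_in ec_in]]) auto

lemma codiff_b: "codiff LX (b m) = 0"
proof -
 have "codiff LX (b m) = cup LX (codiff LX (a m)) ec + sgn_if True (cup LX (a m) (codiff LX ec))"
  unfolding b_def by (rule leibniz[OF a_in]) simp
 then show ?thesis unfolding codiff_a codiff_ec by (simp add: sgn_if_def)
qed

lemma G_one: "G 1 = pullback XX fst cz - pullback XX snd cz"
proof -
 have f: "frag_of [[g]] \<in> comp (complex_of B1) (2 * n + 1)" using gen_in by (simp add: comp_frag)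
 have "\<alpha> (frag_of [([g], [])]) = pullback XX fst cz" "\<alpha> (frag_of [([], [g])]) = pullback XX snd cz"
  using data_facts(5)[OF f] data_facts(6)[OF f] by (simp_all add: cz_def)
 then show ?thesis using scale_add(5)[of 1] by (simp add: G_eq)
qed

lemma a_apply: "m > 0 ==> singular k LX V ==> a m k V = - G m (Suc k) (ecube k V)"
 by (simp add: a_def lint_def)

text \<open>The first component of \<open>ecube\<close> does not move with the loop parameter, so
  its part of \<open>G 1\<close> is evaluated on a degenerate cube; the second component is the
  rotated loop evaluated at the base point.\<close>

lemma omega_ec: "omega X 0 ec = a 1"
proof (intro cochain_eqI)
 fix k V
 show "omega X 0 ec k V = a 1 k V"
 proof (cases "singular k LX V")
  case True
  have t: "trees 0 = {Leaf}"
  proof -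
   have "tsize x = 0 \<longleftrightarrow> x = Leaf" for x by (cases x) auto
   then show ?thesis by (simp add: trees_def)
  qed
  have "omega X 0 ec k V = ec (Suc k) (ract 1 (%t. t 0) k V)" using True by (simp add: omega_op_eq t)
  also have "... = cz (Suc k) (push (Suc k) loop_eval (ract 1 (%t. t 0) k V))"
   using singular_ract[OF True, of Leaf] by (simp add: ec_def pullback_apply)
  also have "push (Suc k) loop_eval (ract 1 (%t. t 0) k V) = push (Suc k) snd (ecube k V)"
   by (auto simp: push_def ract_def ecube_def loop_eval_def fun_eq_iff)
  finally have 1: "omega X 0 ec k V = cz (Suc k) (push (Suc k) snd (ecube k V))" .
  have "indep (Suc k) (push (Suc k) fst (ecube k V)) 0" unfolding indep_def
  proof (intro ballI impI)
   fix t t' assume t: "t \<in> pts (Suc k)" "t' \<in> pts (Suc k)" "\<forall>j. j ~= 0 --> t j = t' j"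
   have e: "(%i. t (Suc i)) = (%i. t' (Suc i))" using t(3) by simp
   show "push (Suc k) fst (ecube k V) t = push (Suc k) fst (ecube k V) t'" using t(1,2) by (simp add: push_def ecube_def e)
  qed
  then have "degenerate_cube (Suc k) (push (Suc k) fst (ecube k V))" unfolding degenerate_iff by blast
  then have "cz (Suc k) (push (Suc k) fst (ecube k V)) = 0" using cochains_zero[OF cz_in] by blast
  then show ?thesis unfolding 1 a_apply[OF zero_less_one True] G_one
   using singular_ecube[OF True] by (simp add: pullback_apply)
 qed (simp add: omega_op_eq a_def lint_def)
qed

lemma P_J:
 assumes "m > 0"
 shows "P m = J_op X (\<beta> (path_dif A sphere_star (sz n m)))"
proof -
 have "sz n m \<in> bas (bar A)" by (auto simp: bas_bar)
 moreover have "bar_deg A (sz n m) > 0" using assms n by (simp add: degrees_sz(1))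
 ultimately show ?thesis using data_facts(1) unfolding is_path_map_def P_def by blast
qed

lemma P_const:
 assumes "i > 0" "!!t. t \<in> pts k ==> T t = const_path (h t)"
 shows "P i k T = 0"
proof -
 have "P i = J_op X (\<beta> (path_dif A sphere_star (sz n i)))"
  by (rule P_J[OF assms(1)])
 moreover have "\<beta> (path_dif A sphere_star (sz n i)) \<in> cochains PX {2 * n * i + 1}"
  using cmap_simps(1)[OF chain_maps(3) complexes(3) path_dif_in[OF assms(1)]] by (simp add: comp_CU)
 ultimately show ?thesis using J_op_const assms(2) by metis
qed

text \<open>The cochain \<open>P m\<close> is a contraction of a sum of products. At the full end of
  the contraction of a loop the endpoints agree, where \<open>G\<close> vanishes; at the other end
  are constant paths, where every \<open>P i\<close> with \<open>i > 0\<close> vanishes. Only the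
  unit \<open>P 0\<close> remains as first factor.\<close>

lemma a_path: "pullback LX loop_to_path (P m) = a m"
proof (cases "m = 0")
 case True
 then show ?thesis by (simp add: P_zero a_def pullback_one[OF cube_map_loop_to_path])
next
 case False
 show ?thesis
 proof (intro cochain_eqI)
  fix k V
  show "pullback LX loop_to_path (P m) k V = a m k V"
  proof (cases "singular k LX V")
   case True
   define V' where "V' = push k loop_to_path V"
   define C where "C = contract_cube k V'"
   have V': "singular k PX V'" using cube_map_loop_to_path True unfolding cube_map_def V'_def by blast
   have C: "singular (Suc k) PX C" unfolding C_def by (rule singular_contract_cube[OF V'])
   have PJ: "P m = J_op X (\<beta> (path_dif A sphere_star (sz n m)))"
    using False by (intro P_J) simp
   have "pullback LX loop_to_path (P m) k V = P m k V'" using True by (simp add: pullback_apply V'_def)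
   also have "... = - (\<Sum>i<m. cup PX (P i) (Gp (m - i)) (Suc k) C)"
    unfolding PJ using V' beta_path_dif False by (simp add: J_op_def C_def sum_apply2)
   also have "(\<Sum>i<m. cup PX (P i) (Gp (m - i)) (Suc k) C) = (\<Sum>i\<in>{0::nat}. G m (Suc k) (ecube k V))"
   proof (rule sum.mono_neutral_cong_right)
    have G0: "ev (Gp s) C (Some True # v) = 0" if "length v = k" for v s
    proof -
     have "fc (Some True # v) C = fc v V'" unfolding C_def by (rule fc_contract_cube(3)[OF that V'])
     moreover have "fst (push (nfree v) endpoints (fc v V') t) = snd (push (nfree v) endpoints (fc v V') t)" if t: "t \<in> pts (nfree v)" for t
     proof -
      have "ins v t \<in> pts k" using ins_pts[OF t] \<open>length v = k\<close> by simp
      then show ?thesis using t by (simp add: push_def endpoints_def fc_def V'_def loop_to_path_def)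
     qed
     then have "G s (nfree v) (push (nfree v) endpoints (fc v V')) = 0"
      using G_diagonal[of s] unfolding diag_vanish_def by blast
     ultimately show ?thesis using singular_fc[of "Some True # v" PX C] C that
      by (simp add: ev_def Gp_def pullback_apply)
    qed
    have exp: "cup PX (P i) (Gp (m - i)) (Suc k) C = diag (free k) (%u v. sg u * (ev (P i) C (Some False # u) * ev (Gp (m - i)) C (None # v)))" for i
    proof -
     have "diag (free k) (%u v. ev (P i) C (None # u) * ev (Gp (m - i)) C (Some True # v) + sg u * (ev (P i) C (Some False # u) * ev (Gp (m - i)) C (None # v)))
      = diag (free k) (%u v. sg u * (ev (P i) C (Some False # u) * ev (Gp (m - i)) C (None # v)))"
      by (rule diagonal_cong) (simp add: G0)
     then show ?thesis using C by (simp add: cube_cup_eq)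
    qed
    have z: "cup PX (P i) (Gp (m - i)) (Suc k) C = 0" if i: "i \<in> {..<m} - {0}" for i
    proof -
     have "ev (P i) C (Some False # u) = 0" if u: "length u = k" for u
     proof -
      have "P i (nfree u) (\<lambda>t\<in>pts (nfree u). const_path (fc u V' t 0)) = 0"
       by (rule P_const) (use i in auto)
      then show ?thesis unfolding C_def by (simp add: ev_def fc_contract_cube(2)[OF u])
     qed
     then have "diag (free k) (%u v. sg u * (ev (P i) C (Some False # u) * ev (Gp (m - i)) C (None # v))) = diag (free k) (%u v. 0)"
      by (intro diagonal_cong) simp
     then show ?thesis unfolding exp by (simp add: word_lin)
    qed
    show "\<forall>i\<in>{..<m} - {0}. cup PX (P i) (Gp (m - i)) (Suc k) C = 0" using z by blast
    show "cup PX (P i) (Gp (m - i)) (Suc k) C = G m (Suc k) (ecube k V)" if "i \<in> {0}" for i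
    proof -
     have "diag (free k) (%u v. sg u * (ev (P 0) C (Some False # u) * ev (Gp m) C (None # v)))
       = diag (free k) (%u v. of_bool (nfree u = 0) * ev (Gp m) C (None # v))"
     proof (rule diagonal_cong)
      fix u v :: face_word assume "length u = length (free k :: face_word)"
      then have "ev (P 0) C (Some False # u) = of_bool (nfree u = 0)" using ev_one[of "Some False # u" PX C] C by (simp add: P_zero)
      then show "sg u * (ev (P 0) C (Some False # u) * ev (Gp m) C (None # v)) = of_bool (nfree u = 0) * ev (Gp m) C (None # v)"
       by (cases "nfree u = 0") (simp_all add: sg_def)
     qed
     also have "... = ev (Gp m) C (None # free k)"
      by (rule diagonal_unit(1)[of "free k" "%v. ev (Gp m) C (None # v)"])
     also have "... = Gp m (Suc k) C"
     proof -
      have "fc (free (Suc k)) C = C" by (rule fc_replicate[OF C])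
      then show ?thesis by (simp add: ev_def)
     qed
     also have "... = G m (Suc k) (push (Suc k) endpoints C)" using C by (simp add: Gp_def pullback_apply)
     also have "push (Suc k) endpoints C = ecube k V"
     proof
      fix t
      show "push (Suc k) endpoints C t = ecube k V t"
      proof (cases "t \<in> pts (Suc k)")
       case t: True
       then have "t 0 \<in> {0..1}" by (auto simp: pts_iff)
       then show ?thesis using t tail_pts[OF t]
        by (simp add: push_def C_def contract_cube_apply endpoints_def ecube_def V'_def loop_to_path_def)
      qed (simp add: push_def ecube_def)
     qed
     finally show ?thesis using that unfolding exp by simp
    qed
   qed (use False in auto)
   finally show ?thesis using a_apply[of m k V] True False by simp
  qed (use False in \<open>simp add: pullback_nonsingular a_def lint_def\<close>)
 qed
qed

end

lemma quasi_isoD: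
 assumes "quasi_iso C D h"
 shows "y \<in> cocycles D p ==> \<exists>x\<in>cocycles C p. y - h x \<in> coboundaries D p"
  "x \<in> cocycles C p ==> h x \<in> coboundaries D p ==> x \<in> coboundaries C p"
 using assms unfolding quasi_iso_iff by simp_all

lemma comp_slice:
 assumes "t \<in> comp (complex_of (free_module M C D1)) p"
 shows "frag_extend (%(w, c'). if c' = c then frag_of w else 0) t \<in> comp (complex_of M) (p - deg C c)"
proof -
 have "frag_cmul k (case x of (w, c') => if c' = c then frag_of w else 0) \<in> comp (complex_of M) (p - deg C c)"
  if "x \<in> keys t" for k x
 proof (intro comp_frag(2))
  have "x \<in> bas M \<times> bas C" "(case x of (w, c) => deg M w + deg C c) = p"
   using that assms by (auto simp: complex_of_def free_module_def)
  then show "(case x of (w, c') => if c' = c then frag_of w else 0) \<in> comp (complex_of M) (p - deg C c)"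
   by (cases x; cases "snd x = c") (auto simp: complex_of_def)
 qed
 then show ?thesis unfolding frag_extend_def by (rule comp_sum)
qed

lemma lin_ext_linear:
 fixes x :: "'b \<Rightarrow>\<^sub>0 int"
 assumes "!!f g. \<phi> (f + g) = \<phi> f + \<phi> g" "!!k f. \<phi> (scale k f) = scale k (\<phi> f)"
 shows "\<phi> (lin_ext f x) = lin_ext (%b. \<phi> (f b)) x"
proof -
 have z: "\<phi> 0 = 0" using assms(2)[of 0 0] by simp
 have "\<phi> (sum h I) = (\<Sum>i\<in>I. \<phi> (h i))" for h and I :: "'b set"
  by (induction I rule: infinite_finite_induct) (simp_all only: sum_eqs assms z)
 then show ?thesis unfolding lin_ext_def by (simp only: assms)
qed

lemma lin_ext_sum_left: "lin_ext (%b. \<Sum>i\<in>I. f i b) x = (\<Sum>i\<in>I. lin_ext (f i) x)"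
 unfolding lin_ext_def scale_sum by (rule sum.swap)

lemma lin_ext_cong: "(!!b. b \<in> keys x ==> f b = h b) ==> lin_ext f x = lin_ext h x"
 unfolding lin_ext_def by (intro sum.cong) auto

section \<open>Cohomology of the free loop space\<close>

context sphere_loops
begin

abbreviation "LM \<equiv> loop_model A sphere_star"
abbreviation "TM \<equiv> thin_model A sphere_star"

lemma loop_map_gen:
 assumes "m \<ge> 0"
 shows "scale (psign (deg B1 w * bar_deg A (sz n m))) (cup LX
     (if bar_deg A (sz n m) = 0 then cube_one LX else pullback LX loop_to_path (J_op X (\<beta> (path_dif A sphere_star (sz n m)))))
     (pullback LX loop_eval (\<gamma> (frag_of w)))) = cup LX (a m) (pullback LX loop_eval (\<gamma> (frag_of w)))"
proof (cases "m = 0")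
 case False
 then show ?thesis using a_path[of m] P_J[of m] n by (simp add: degrees_sz(1))
qed (simp add: degrees_sz(1)[of n 0, simplified] a_def)

lemma bas_LM: "bas LM = bas B1 \<times> lists {g}" "deg LM = (%(w, c). deg B1 w + bar_deg A c)"
 by (simp_all add: loop_model_def free_module_def bas_bar) (simp add: bar_def)

text \<open>Sorting by bar words reduces this to the vanishing of \<open>\<gamma>\<close> on the
  kernel of the counit. Hence any lift may replace the value of \<open>\<sigma>\<close>, also on
  words longer than two, where \<open>\<sigma>\<close> is known only to be a section.\<close>

lemma loop_map_kernel:
 assumes t: "t \<in> comp (complex_of LM) p" and k: "tensor_id (counit A) t = 0"
 shows "loop_map A sphere_star X \<beta> \<gamma> t = 0"
proof -
 let ?slice = "%c. frag_extend (%(w, c'). if c' = c then frag_of w else 0) t"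
 let ?C = "snd ` keys t"
 let ?\<phi> = "%c f. cup LX (a (length c)) (pullback LX loop_eval f)"
 have keys: "w \<in> bas B1 & c = sz n (length c)" if "(w, c) \<in> keys t" for w c
 proof -
  have "w \<in> bas B1" "set c \<subseteq> {g}" using that t by (auto simp: complex_of_def bas_LM)
  then show ?thesis using sz_eq by blast
 qed
 have "loop_map A sphere_star X \<beta> \<gamma> t = lin_ext (%(w, c). ?\<phi> c (\<gamma> (frag_of w))) t"
  unfolding loop_map_def
 proof (rule lin_ext_cong)
  fix x assume "x \<in> keys t"
  then obtain w m where x: "x = (w, sz n m)" using keys by (cases x) blast
  show "(case x of (w, c) => scale (psign (deg B1 w * bar_deg A c)) (cup LX
     (if bar_deg A c = 0 then cube_one LX else pullback LX loop_to_path (J_op X (\<beta> (path_dif A sphere_star c))))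
     (pullback LX loop_eval (\<gamma> (frag_of w))))) = (case x of (w, c) => ?\<phi> c (\<gamma> (frag_of w)))"
   unfolding x prod.case loop_map_gen[OF le0] length_replicate ..
 qed
 also have "... = lin_ext (%(w, c). \<Sum>d\<in>?C. if c = d then ?\<phi> d (\<gamma> (frag_of w)) else 0) t"
 proof (rule lin_ext_cong)
  fix x assume "x \<in> keys t"
  then obtain w c where x: "x = (w, c)" "c \<in> ?C" by (cases x) force
  then show "(case x of (w, c) => ?\<phi> c (\<gamma> (frag_of w))) = (case x of (w, c) => \<Sum>d\<in>?C. if c = d then ?\<phi> d (\<gamma> (frag_of w)) else 0)"
   by simp
 qed
 also have "... = (\<Sum>d\<in>?C. lin_ext (%(w, c). if c = d then ?\<phi> d (\<gamma> (frag_of w)) else 0) t)"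
  unfolding lin_ext_sum_left[symmetric] by (rule lin_ext_cong) (simp add: case_prod_unfold)
 also have "... = (\<Sum>d\<in>?C. 0)"
 proof (rule sum.cong)
  fix d assume "d \<in> ?C"
  have "t \<in> comp (complex_of (free_module B1 (bar A) (loop_dif A sphere_star))) p" using t by (simp add: loop_model_def)
  note s = comp_slice[OF this, of d]
  have "frag_extend (counit A) (?slice d) = frag_extend (%(w, c'). if c' = d then frag_of w else 0) (tensor_id (counit A) t)"
  proof -
   have "frag_extend (%(w, c'). if c' = d then frag_of w else 0) (frag_extend (%v. frag_of (v, e)) z) = (if e = d then z else 0)"
    for e and z :: "letter \<Rightarrow>\<^sub>0 int"
   proof (cases "e = d")
    case True
    then show ?thesis unfolding frag_extend_frag_extend by (simp only: frag_extend_of prod.case simp_thms if_True frag_expansion[symmetric])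
   qed (simp add: frag_extend_frag_extend, simp add: frag_extend_def)
   note H = this
   have "frag_extend (counit A) (?slice d) = frag_extend (%b. frag_extend (counit A) (case b of (w, c') => if c' = d then frag_of w else 0)) t"
    by (rule frag_extend_frag_extend)
   also have "... = frag_extend (%b. frag_extend (%(w, c'). if c' = d then frag_of w else 0) (case b of (w, c) => frag_extend (%v. frag_of (v, c)) (counit A w))) t"
    by (rule frag_extend_eq) (auto simp: H)
   also have "... = frag_extend (%(w, c'). if c' = d then frag_of w else 0) (tensor_id (counit A) t)"
    unfolding tensor_id_def by (rule frag_extend_frag_extend[symmetric])
   finally show ?thesis .
  qed
  then have "frag_extend (counit A) (?slice d) = 0" by (simp add: k)
  then have z: "\<gamma> (?slice d) = 0" by (rule data_facts(4)[OF s])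
  have lin: "?\<phi> d (lin_ext f x) = lin_ext (%b. ?\<phi> d (f b)) x" for f and x :: "letter list list \<Rightarrow>\<^sub>0 int"
   by (rule lin_ext_linear) (simp_all only: pullback_lin cup_lin)
  have "lin_ext (%(w, c). if c = d then ?\<phi> d (\<gamma> (frag_of w)) else 0) t = lin_ext (%w. ?\<phi> d (\<gamma> (frag_of w))) (?slice d)"
   unfolding lin_ext_frag_extend by (rule lin_ext_cong) (simp add: case_prod_unfold)
  also have "... = ?\<phi> d (lin_ext (%w. \<gamma> (frag_of w)) (?slice d))" by (rule lin[symmetric])
  also have "lin_ext (%w. \<gamma> (frag_of w)) (?slice d) = \<gamma> (?slice d)"
   by (rule cochain_map_lin_ext[OF chain_maps(2) complexes(2) s, symmetric])
  finally show "lin_ext (%(w, c). if c = d then ?\<phi> d (\<gamma> (frag_of w)) else 0) t = 0"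
   unfolding z by (simp only: pullback_lin cup_lin)
 qed simp
 finally show ?thesis by (simp only: sum.neutral_const)
qed

lemma gamma_unit: "\<gamma> (frag_of []) = cube_one X"
proof -
 have f: "frag_of [] \<in> comp (complex_of B1) 0" using gen_in by (simp add: comp_frag)
 have "frag_of [] \<in> cocycles (complex_of B1) 0" using f by (simp add: cocycles_def complex_of_def cobar_def)
 then have 1: "\<gamma> (frag_of []) \<in> cocycles (CU X) 0" by (rule cochain_map_cocycles(1)[OF chain_maps(2) complexes(2,5)])
 have 2: "cube_one X \<in> cocycles (CU X) 0" using cube_one_in by (simp add: cocycles_def comp_CU diff_CU)
 have "coh_class (CU X) 0 (\<gamma> (frag_of [])) = coh_class (CU X) 0 (cube_one X)"
  using data_facts(7) unfolding coh_algebra_map_def by (simp add: cobar_def)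
 then show ?thesis using coh_class_eq[OF complexes(5) 1 2] by (simp add: coboundaries_def)
qed

lemma Ups_gen:
 assumes "(y, w) \<in> {(unt A, []), (g, [[g]])}"
 shows "Ups (frag_of (y, sz n m)) = cup LX (a m) (pullback LX loop_eval (\<gamma> (frag_of w)))"
proof -
 let ?p = "deg B1 w + 2 * n * m"
 have w: "w \<in> bas B1" "y \<in> bas A" "deg B1 w = deg A y" and c: "counit A w = frag_of y"
  using assms gen_in n sphere_cochains_mul(3)[OF n]
  by (auto simp: sphere_cochains_bas sphere_cochains_unt sphere_cochains_deg sphere_gen_def[of n])
 have x: "frag_of (y, sz n m) \<in> comp (complex_of TM) ?p"
  using w bas_bar degrees_sz(1)[of n m] by (auto simp: comp_frag thin_model_def free_module_def bar_def[of A])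
 have t0: "frag_of (w, sz n m) \<in> comp (complex_of LM) ?p"
  using w degrees_sz(1)[of n m] by (auto simp: comp_frag bas_LM)
 have s: "\<sigma> (frag_of (y, sz n m)) \<in> comp (complex_of LM) ?p"
  by (rule cmap_simps(1)[OF chain_maps(4) complexes(8) x])
 have "tensor_id (counit A) (\<sigma> (frag_of (y, sz n m))) = frag_of (y, sz n m)"
  using data_facts(2) x unfolding is_thin_section_def by blast
 moreover have "tensor_id (counit A) (frag_of (w, sz n m)) = frag_of (y, sz n m)" by (simp add: tensor_id_def c)
 ultimately have "tensor_id (counit A) (\<sigma> (frag_of (y, sz n m)) - frag_of (w, sz n m)) = 0" by (simp add: tensor_id_diff)
 from loop_map_kernel[OF complex_closed(3)[OF complexes(9) s t0] this]
 have 0: "loop_map A sphere_star X \<beta> \<gamma> (\<sigma> (frag_of (y, sz n m)) - frag_of (w, sz n m)) = 0" .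
 have "Ups (frag_of (y, sz n m)) = loop_map A sphere_star X \<beta> \<gamma> (\<sigma> (frag_of (y, sz n m)) - frag_of (w, sz n m) + frag_of (w, sz n m))"
  by (simp add: Ups_def Upsilon_def)
 also have "... = loop_map A sphere_star X \<beta> \<gamma> (frag_of (w, sz n m))"
  using 0 unfolding loop_map_def lin_ext_add by (simp only: add_0)
 also have "... = cup LX (a m) (pullback LX loop_eval (\<gamma> (frag_of w)))"
  unfolding loop_map_def lin_ext_of prod.case by (rule loop_map_gen[OF le0])
 finally show ?thesis .
qed

lemma Ups_unt: "Ups (frag_of (unt A, sz n m)) = a m"
 using Ups_gen[of "unt A" "[]" m] unfolding gamma_unit pullback_one[OF cube_map_loop_eval] cup_one_unit(2)[OF a_in] by simp

lemma Ups_g: "Ups (frag_of (g, sz n m)) = b m"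
 using Ups_gen[of g "[[g]]" m] by (simp add: b_def ec_def cz_def)

lemma Ups_quasi_iso: "quasi_iso (complex_of TM) (CU LX) Ups"
 using quasi_iso_compose[OF quasi_isos(5,4)] by (simp add: Ups_def Upsilon_def[abs_def])

lemma bas_TM: "bas TM = {unt A, g} \<times> lists {g}" "deg TM (unt A, sz n m) = 2 * n * m" "deg TM (g, sz n m) = 2 * n * m + 2 * n + 1"
 using n degrees_sz(1)[of n m]
 by (auto simp: thin_model_def free_module_def bas_bar sphere_cochains_bas sphere_cochains_unt sphere_cochains_deg sphere_gen_def[of n] bar_def[of A])

lemma diff_TM:
 assumes x: "x \<in> comp (complex_of TM) p"
 shows "diff (complex_of TM) x = 0"
proof -
 have "dif TM b = 0" if "b \<in> keys x" for b
  by (rule thin_dif_zero[OF n]) (use that x in \<open>auto simp: complex_of_def\<close>)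
 then have "frag_extend (dif TM) x = frag_extend (%_. 0) x" by (intro frag_extend_eq)
 then show ?thesis by (simp add: complex_of_def frag_extend_def)
qed

lemma cob_TM: "coboundaries (complex_of TM) p = {0}"
proof (cases p)
 case (Suc q)
 have "0 \<in> comp (complex_of TM) q" by (rule complex_closed(1)[OF complexes(8)])
 then show ?thesis unfolding Suc coboundaries_def using diff_TM[of _ q] by auto
qed (simp add: coboundaries_def)

definition "gen p = {(unt A, sz n m) | m. p = 2 * n * m} \<union> {(g, sz n m) | m. p = 2 * n * m + 2 * n + 1}"

lemma comp_TM: "comp (complex_of TM) p = {x. keys x \<subseteq> gen p}"
proof -
 have "{x \<in> bas TM. deg TM x = p} = gen p"
 proof (rule Set.set_eqI)
  fix x :: "letter \<times> letter list"
  have "x \<in> bas TM \<longleftrightarrow> (\<exists>m. x = (unt A, sz n m) \<or> x = (g, sz n m))"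
  proof
   assume "x \<in> bas TM"
   then obtain y c where x: "x = (y, c)" "y \<in> {unt A, g}" "set c \<subseteq> {g}" by (auto simp: bas_TM(1))
   then show "\<exists>m. x = (unt A, sz n m) \<or> x = (g, sz n m)" using sz_eq[OF x(3)] by blast
  qed (auto simp: bas_TM(1))
  moreover have "g ~= unt A" using n by (simp add: sphere_gen_def sphere_cochains_unt)
  ultimately show "x \<in> {x \<in> bas TM. deg TM x = p} \<longleftrightarrow> x \<in> gen p" by (auto simp: gen_def bas_TM(2,3))
 qed
 then show ?thesis by (simp add: complex_of_def)
qed

lemma degree_parity: "2 * n * m ~= 2 * n * k + 2 * n + 1"
proof
 assume h: "2 * n * m = 2 * n * k + 2 * n + 1"
 have "even (2 * n * m)" by simp
 then show False unfolding h by simp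
qed

lemma gen_a: "gen (2 * n * m) = {(unt A, sz n m)}"
 using n degree_parity[of m] by (auto simp: gen_def)

lemma gen_b: "gen (2 * n * m + 2 * n + 1) = {(g, sz n m)}"
proof -
 have "(2 * n * m + 2 * n + 1 = 2 * n * k + 2 * n + 1) = (k = m)" "(2 * n * m + 2 * n + 1 = 2 * n * k) = False" for k
  using n degree_parity[of k m] by auto
 then show ?thesis unfolding gen_def by (simp only: simp_thms) simp
qed

lemma cohomology_LX:
 assumes "f \<in> cocycles (CU LX) p"
 shows "\<exists>x. keys x \<subseteq> gen p & f - Ups x \<in> coboundaries (CU LX) p"
proof -
 obtain x where x: "x \<in> cocycles (complex_of TM) p" "f - Ups x \<in> coboundaries (CU LX) p"
  using quasi_isoD(1)[OF Ups_quasi_iso assms] by blast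
 then have "keys x \<subseteq> gen p" by (simp add: cocycles_def comp_TM)
 then show ?thesis using x(2) by blast
qed

lemma cohomology_LX_free:
 assumes "keys x \<subseteq> gen p" "Ups x \<in> coboundaries (CU LX) p"
 shows "x = 0"
proof -
 have "x \<in> cocycles (complex_of TM) p" using assms(1) diff_TM[of x p] by (simp add: cocycles_def comp_TM)
 from quasi_isoD(2)[OF Ups_quasi_iso this assms(2)] show ?thesis by (simp add: cob_TM)
qed

lemma Ups_cmul:
 assumes "keys y \<subseteq> gen p"
 shows "Ups (frag_cmul k y) = scale k (Ups y)"
proof -
 from assms have y: "y \<in> comp (complex_of TM) p" by (simp add: comp_TM)
 have c: "cochain_map (complex_of TM) (CU LX) Ups" using Ups_quasi_iso by (simp add: quasi_iso_def)
 show ?thesis using cochain_map_lin_ext[OF c complexes(8) y] cochain_map_lin_ext[OF c complexes(8) comp_frag(2)[OF y]]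
  by (simp only: lin_ext_cmul)
qed

lemma class_gen:
 assumes "gen p = {x}" "f \<in> cocycles (CU LX) p"
 shows "\<exists>k. f - scale k (Ups (frag_of x)) \<in> coboundaries (CU LX) p"
proof -
 obtain y where y: "keys y \<subseteq> {x}" "f - Ups y \<in> coboundaries (CU LX) p" using cohomology_LX[OF assms(2)] assms(1) by auto
 have "Ups y = scale (lookup y x) (Ups (frag_of x))"
  by (subst keys_singleton[OF y(1)]) (rule Ups_cmul[of "frag_of x" p], simp add: assms(1))
 then show ?thesis using y(2) by (intro exI) (simp only:)
qed

lemma class_a: "f \<in> cocycles (CU LX) (2 * n * m) ==> \<exists>k. f - scale k (a m) \<in> coboundaries (CU LX) (2 * n * m)"
 using class_gen[OF gen_a] by (simp add: Ups_unt)

lemma class_b: "f \<in> cocycles (CU LX) (2 * n * m + 2 * n + 1) ==> \<exists>k. f - scale k (b m) \<in> coboundaries (CU LX) (2 * n * m + 2 * n + 1)"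
 using class_gen[OF gen_b] unfolding Ups_g by blast

lemma free_a:
 assumes "scale k (a m) \<in> coboundaries (CU LX) (2 * n * m)"
 shows "k = 0"
proof -
 have "Ups (frag_cmul k (frag_of (unt A, sz n m))) = scale k (a m)"
  using Ups_cmul[of "frag_of (unt A, sz n m)" "2 * n * m"] by (simp add: gen_a Ups_unt)
 then have "frag_cmul k (frag_of (unt A, sz n m)) = 0"
  using cohomology_LX_free[of "frag_cmul k (frag_of (unt A, sz n m))" "2 * n * m"] keys_cmul[of k "frag_of (unt A, sz n m)"] assms by (simp add: gen_a)
 from arg_cong[OF this, of "%x. lookup x (unt A, sz n m)"] show ?thesis by simp
qed

lemma class_none: "f \<in> cocycles (CU LX) p ==> (!!m. p ~= 2 * n * m) ==> (!!m. p ~= 2 * n * m + 2 * n + 1) ==> f \<in> coboundaries (CU LX) p"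
proof -
 assume f: "f \<in> cocycles (CU LX) p" "!!m. p ~= 2 * n * m" "!!m. p ~= 2 * n * m + 2 * n + 1"
 then have "gen p = {}" unfolding gen_def by blast
 then obtain x where "keys x = {}" "f - Ups x \<in> coboundaries (CU LX) p" using cohomology_LX[OF f(1)] by auto
 moreover have "Ups 0 = 0" using cmap_simps(4)[OF _ complexes(8)] Ups_quasi_iso unfolding quasi_iso_def by blast
 ultimately show ?thesis by simp
qed

end

section \<open>Products and rotation on loop cohomology\<close>

definition const_loop :: "'y => (complex => 'y)" where
 "const_loop x = (\<lambda>u\<in>sphere 0 1. x)"

lemma cube_map_const_loop: "cube_map X (loops X) const_loop"
 unfolding cube_map_def
proof (intro allI impI)
 fix m T assume T: "singular m X T"
 have "continuous_map (prod_topology (std_cube m) (top_of_set (sphere 0 1 :: complex set))) X (T \<circ> fst)"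
  using T by (intro continuous_map_compose[OF continuous_map_fst]) (simp add: singular_cube_def)
 then have "continuous_map (prod_topology (std_cube m) (top_of_set (sphere 0 1 :: complex set))) X (%(t, u). push m const_loop T t u)"
  by (rule continuous_map_eq) (auto simp: push_def const_loop_def)
 moreover have "push m const_loop T \<in> extensional (pts m)" "\<forall>t\<in>pts m. push m const_loop T t \<in> extensional (sphere 0 1)"
  by (simp_all add: push_def const_loop_def)
 ultimately show "singular m (loops X) (push m const_loop T)"
  unfolding singular_loop_cube by blast
qed

lemma cob_CU: "f \<in> coboundaries (CU Y) (Suc q) \<longleftrightarrow> (\<exists>u\<in>cochains Y {q}. f = codiff Y u)"
 by (auto simp: coboundaries_def comp_CU diff_CU)

lemma cocycles_CU: "f \<in> cocycles (CU Y) p \<longleftrightarrow> f \<in> cochains Y {p} & codiff Y f = 0"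
 by (simp add: cocycles_def comp_CU diff_CU)

lemma cup_in: "f \<in> cochains Y {p} ==> h \<in> cochains Y {q} ==> cup Y f h \<in> cochains Y {p + q}"
 by (rule cochains_mono[OF cube_cup_in]) auto

lemma codiff_cup_cocycle:
 assumes "f \<in> cochains Y {p}"
 shows "codiff Y h = 0 ==> codiff Y (cup Y f h) = cup Y (codiff Y f) h"
  "codiff Y f = 0 ==> codiff Y (cup Y f h) = sgn_if (even p) (cup Y f (codiff Y h))"
proof -
 have "codiff Y (cup Y f h) = cup Y (codiff Y f) h + sgn_if (even p) (cup Y f (codiff Y h))"
  by (rule leibniz[OF assms]) simp
 then show "codiff Y h = 0 ==> codiff Y (cup Y f h) = cup Y (codiff Y f) h"
  "codiff Y f = 0 ==> codiff Y (cup Y f h) = sgn_if (even p) (cup Y f (codiff Y h))"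
  by (simp_all add: sgn_if_def)
qed

lemma cocycles_cup:
 assumes "f \<in> cocycles (CU Y) p" "h \<in> cocycles (CU Y) q"
 shows "cup Y f h \<in> cocycles (CU Y) (p + q)"
proof -
 from assms have f: "f \<in> cochains Y {p}" "codiff Y f = 0" and h: "h \<in> cochains Y {q}" "codiff Y h = 0" by (simp_all add: cocycles_CU)
 have "codiff Y (cup Y f h) = 0" unfolding codiff_cup_cocycle(1)[OF f(1) h(2)] f(2) by (rule cup_lin)
 then show ?thesis using cup_in[OF f(1) h(1)] by (simp add: cocycles_CU)
qed

lemma coboundaries_cup:
 "f \<in> coboundaries (CU Y) p ==> h \<in> cocycles (CU Y) q ==> cup Y f h \<in> coboundaries (CU Y) (p + q)"
 "h \<in> cocycles (CU Y) q ==> f \<in> coboundaries (CU Y) p ==> cup Y h f \<in> coboundaries (CU Y) (q + p)"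
proof -
 have z: "0 \<in> coboundaries (CU Y) r" for r
  by (cases r) (auto simp: cob_CU coboundaries_def[of _ 0] intro!: bexI[of _ 0])
 show "cup Y f h \<in> coboundaries (CU Y) (p + q)" if "f \<in> coboundaries (CU Y) p" "h \<in> cocycles (CU Y) q"
 proof (cases p)
  case (Suc r)
  then obtain u where u: "u \<in> cochains Y {r}" "f = codiff Y u" using \<open>f \<in> _\<close> by (auto simp: cob_CU)
  have h: "h \<in> cochains Y {q}" "codiff Y h = 0" using \<open>h \<in> _\<close> by (simp_all add: cocycles_CU)
  have "cup Y f h = codiff Y (cup Y u h)" unfolding u(2) codiff_cup_cocycle(1)[OF u(1) h(2)] ..
  then show ?thesis using cup_in[OF u(1) h(1)] unfolding Suc add_Suc cob_CU by blast
 qed (use that z in \<open>simp add: coboundaries_def[of _ 0]\<close>)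
 show "cup Y h f \<in> coboundaries (CU Y) (q + p)" if "h \<in> cocycles (CU Y) q" "f \<in> coboundaries (CU Y) p"
 proof (cases p)
  case (Suc r)
  then obtain u where u: "u \<in> cochains Y {r}" "f = codiff Y u" using \<open>f \<in> _\<close> by (auto simp: cob_CU)
  have h: "h \<in> cochains Y {q}" "codiff Y h = 0" using \<open>h \<in> _\<close> by (auto simp: cocycles_CU)
  have "cup Y h f = codiff Y (sgn_if (even q) (cup Y h u))"
   unfolding sgn_if_def using codiff_cup_cocycle(2)[OF h(1) h(2), of u] u(2) by (simp add: sgn_if_def split: if_splits)
  moreover have "sgn_if (even q) (cup Y h u) \<in> cochains Y {q + r}" using cup_in[OF h(1) u(1)] by (simp add: sgn_if_def)
  ultimately show ?thesis by (auto simp: Suc cob_CU)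
 qed (use that z in \<open>simp add: coboundaries_def[of _ 0]\<close>)
qed

lemma coboundaries_omega:
 assumes "f \<in> coboundaries (CU (loops X)) (Suc p)"
 shows "omega X 0 f \<in> coboundaries (CU (loops X)) p"
proof -
 obtain u where u: "u \<in> cochains (loops X) {p}" "f = codiff (loops X) u" using assms by (auto simp: cob_CU)
 have e: "omega X 0 f = codiff (loops X) (- omega X 0 u)"
  using omega_codiff[OF u(1), of 0] by (simp add: u(2) eq_neg_iff_add_eq_0 add.commute)
 have o: "omega X 0 u \<in> cochains (loops X) {m. 1 + m \<in> {p}}" using omega_in[OF u(1), of 0] by simp
 show ?thesis
 proof (cases p)
  case 0
  then have "omega X 0 u \<in> cochains (loops X) {}" using o by simp
  then have "omega X 0 u = 0" by (intro cochain_eqI) (simp add: cochains_zero)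
  then show ?thesis using e 0 by (simp add: coboundaries_def)
 next
  case (Suc r)
  then have "- omega X 0 u \<in> cochains (loops X) {r}" using o by (intro cochains_lin) simp
  then show ?thesis using e unfolding Suc cob_CU by blast
 qed
qed

context sphere_loops
begin

abbreviation "cob \<equiv> coboundaries (CU LX)"

lemmas cob_closed = coboundaries_closed[OF complexes(7)]

lemma scale_cob: "f \<in> cob p ==> scale k f \<in> cob p"
proof (cases p)
 case (Suc q)
 assume "f \<in> cob p"
 then obtain u where "u \<in> cochains LX {q}" "f = codiff LX u" using Suc by (auto simp: cob_CU)
 then show ?thesis unfolding Suc cob_CU by (intro bexI[of _ "scale k u"] scale_in) simp_all
qed (simp add: coboundaries_def)

text \<open>The classes of the thin model form a basis of cohomology, so a relation may be divided
  by a nonzero integer.\<close>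

lemma torsion_free:
 assumes "f \<in> cocycles (CU LX) p" "k ~= 0" "scale k f \<in> cob p"
 shows "f \<in> cob p"
proof -
 obtain x where x: "keys x \<subseteq> gen p" "f - Ups x \<in> cob p" using cohomology_LX[OF assms(1)] by blast
 have "scale k f - scale k (f - Ups x) \<in> cob p" using assms(3) scale_cob[OF x(2)] cob_closed(2) by blast
 then have "scale k (Ups x) \<in> cob p" by (simp add: scale_add)
 then have "Ups (frag_cmul k x) \<in> cob p" by (simp add: Ups_cmul[OF x(1)])
 then have "frag_cmul k x = 0" using cohomology_LX_free[of "frag_cmul k x" p] keys_cmul[of k x] x(1) by blast
 then have "x = 0" using assms(2) by simp
 moreover have "Ups 0 = 0" using cmap_simps(4)[OF _ complexes(8)] Ups_quasi_iso unfolding quasi_iso_def by blast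
 ultimately show ?thesis using x(2) by simp
qed

lemma H1:
 assumes "s \<ge> 2" "f \<in> cochains XX {2 * n * s + 1}" "codiff XX f = 0"
 shows "\<exists>h\<in>cochains XX {2 * n * s}. f = codiff XX h"
proof -
 have "f \<in> cocycles (CU XX) (2 * n * s + 1)" using assms by (simp add: cocycles_CU)
 from quasi_isoD(1)[OF quasi_isos(1) this] obtain x where x: "x \<in> comp (complex_of B2) (2 * n * s + 1)" "diff (complex_of B2) x = 0"
  "f - \<alpha> x \<in> coboundaries (CU XX) (Suc (2 * n * s))" by (auto simp: cocycles_def)
 obtain u where u: "u \<in> cochains XX {2 * n * s}" "f - \<alpha> x = codiff XX u" using x(3) unfolding cob_CU by blast
 obtain y where y: "y \<in> comp (complex_of B2) (2 * n * s)" "diff (complex_of B2) y = x"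
  using B2_exact[OF complexes(1) assms(1) x(1,2)] by blast
 have "\<alpha> x = codiff XX (\<alpha> y)" "\<alpha> y \<in> cochains XX {2 * n * s}"
  using cmap_simps(1,2)[OF chain_maps(1) complexes(1) y(1)] y(2) by (simp_all add: comp_CU diff_CU)
 then show ?thesis using u by (intro bexI[of _ "u + \<alpha> y"]) (auto simp: algebra_simps)
qed

lemma const_a: "s > 0 ==> pullback X const_loop (a s) = 0"
proof (intro cochain_eqI)
 fix k T assume s: "s > 0"
 show "pullback X const_loop (a s) k T = 0 k T"
 proof (cases "singular k X T")
  case True
  have V: "singular k LX (push k const_loop T)" using cube_map_const_loop True unfolding cube_map_def by blast
  have "\<forall>t\<in>pts (Suc k). fst (ecube k (push k const_loop T) t) = snd (ecube k (push k const_loop T) t)"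
   using tail_pts by (simp add: ecube_def push_def const_loop_def)
  then have "G s (Suc k) (ecube k (push k const_loop T)) = 0" using G_diagonal[of s] unfolding diag_vanish_def by blast
  then show ?thesis using True a_apply[OF s V] by (simp add: pullback_apply)
 qed (simp add: pullback_nonsingular)
qed

text \<open>Pulled back to loops by evaluation the class is a multiple of \<open>a s\<close>;
  constant loops are a section of evaluation, and \<open>a s\<close> vanishes on them.\<close>

lemma H2:
 assumes "s \<ge> 1" "f \<in> cochains X {2 * n * s}" "codiff X f = 0"
 shows "\<exists>h\<in>cochains X {2 * n * s - 1}. f = codiff X h"
proof -
 obtain q where q: "2 * n * s = Suc q" using n assms(1) by (cases "2 * n * s") auto
 have "pullback LX loop_eval f \<in> cocycles (CU LX) (2 * n * s)"
  using pullback_in[OF assms(2)] pullback_codiff[OF cube_map_loop_eval, where f=f, symmetric] assms(3) by (simp add: cocycles_CU)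
 from class_a[OF this] obtain k where "pullback LX loop_eval f - scale k (a s) \<in> cob (2 * n * s)" by blast
 then obtain u where u: "u \<in> cochains LX {q}" "pullback LX loop_eval f - scale k (a s) = codiff LX u" unfolding q cob_CU by blast
 have "pullback X const_loop (pullback LX loop_eval f) = pullback X (loop_eval \<circ> const_loop) f"
  by (rule pullback_pullback[OF cube_map_const_loop])
 also have "... = f" by (rule pullback_id[OF assms(2)]) (simp add: loop_eval_def const_loop_def)
 finally have "pullback X const_loop (pullback LX loop_eval f - scale k (a s)) = f"
  using const_a assms(1) by simp
 then have "f = codiff X (pullback X const_loop u)" unfolding u(2) pullback_codiff[OF cube_map_const_loop] by simp
 moreover have "pullback X const_loop u \<in> cochains X {2 * n * s - 1}" using pullback_in[OF u(1)] q by simp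
 ultimately show ?thesis by blast
qed

lemma a_cocycle: "a m \<in> cocycles (CU LX) (2 * n * m)" and b_cocycle: "b m \<in> cocycles (CU LX) (2 * n * m + 2 * n + 1)"
 and ec_cocycle: "ec \<in> cocycles (CU LX) (2 * n + 1)"
 using a_in codiff_a b_in codiff_b ec_in codiff_ec by (simp_all add: cocycles_CU)

lemma relation: "scale (int (Suc m)) (a (Suc m)) - cup LX (a m) (a 1) \<in> cob (2 * n * Suc m)"
proof (cases "m = 0")
 case True
 have "a 0 = cube_one LX" by (simp add: a_def)
 then have "cup LX (a 0) (a 1) = a 1" using cup_one_unit(1)[OF a_in] by simp
 then show ?thesis using True cob_closed(1) by simp
next
 case False
 obtain q where q: "2 * n * Suc m = Suc q" using n by (cases "2 * n * Suc m") auto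
 from mc.loop_integral_relation[OF n H1 H2, of m] False obtain y where y: "y \<in> cochains LX {q}"
  "scale (int (Suc m)) (lint X (G (Suc m))) = - cup LX (lint X (G m)) (lint X (G 1)) + codiff LX y"
  unfolding q by auto
 have "scale (int (Suc m)) (a (Suc m)) - cup LX (a m) (a 1) = - (scale (int (Suc m)) (lint X (G (Suc m)))) - cup LX (lint X (G m)) (lint X (G 1))"
  using False by (simp add: a_def scale_add)
 also have "... = codiff LX (- y)" unfolding y(2) by simp
 finally show ?thesis unfolding q cob_CU using y(1) by (intro bexI[of _ "- y"]) auto
qed

lemma omega_codiff_zero:
 assumes f: "f \<in> cocycles (CU LX) (Suc p)"
 shows "omega X 0 f \<in> cocycles (CU LX) p"
proof -
 from assms have f': "f \<in> cochains LX {Suc p}" "codiff LX f = 0" by (simp_all add: cocycles_CU)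
 have "codiff LX (omega X 0 f) = 0" using omega_codiff[OF f'(1), of 0] f'(2) by simp
 moreover have "omega X 0 f \<in> cochains LX {p}" by (rule cochains_mono[OF omega_in[OF f'(1)]]) auto
 ultimately show ?thesis by (simp add: cocycles_CU)
qed

lemma omega_cup_even: "f \<in> cochains LX {p} ==> even p ==> h \<in> cochains LX {q} ==>
  omega X k (cup LX f h) = cup LX (omega X k f) h + cup LX f (omega X k h)"
 using omega_cup[of f X "{p}" h "{q}" True k] by (simp add: sgn_if_def)

text \<open>For \<open>a 1\<close>, which is the rotation of \<open>ec\<close>, the double rotation
  is exact by the operation of index one. The derivation rule and \<open>relation\<close> carry this
  over to a multiple of \<open>a m\<close>, and torsion-freeness divides.\<close>

lemma omega_a: "m > 0 ==> omega X 0 (a m) \<in> cob (2 * n * m - 1)"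
proof (induction m)
 case (Suc m)
 obtain q where q: "2 * n * Suc m = Suc q" using n by (cases "2 * n * Suc m") auto
 have a1: "omega X 0 (a 1) \<in> cob (2 * n - 1)"
 proof -
  obtain r where r: "2 * n = Suc (Suc r)" using n by (metis add_2_eq_Suc mult_2 not0_implies_Suc add_Suc_right add_Suc_shift less_not_refl)
  have "omega X 1 ec \<in> cochains LX {r}" by (rule cochains_mono[OF omega_in[OF ec_in]]) (use r in auto)
  then have w: "- omega X 1 ec \<in> cochains LX {r}" by (rule cochains_lin)
  have "codiff LX (omega X 1 ec) + omega X 1 (codiff LX ec) = - (\<Sum>i<1. omega X i (omega X (1 - 1 - i) ec))"
   by (rule omega_codiff[OF ec_in])
  then have "codiff LX (omega X 1 ec) = - omega X 0 (omega X 0 ec)" unfolding codiff_ec by simp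
  then have "omega X 0 (a 1) = codiff LX (- omega X 1 ec)" unfolding omega_ec codiff_lin by simp
  moreover have r': "2 * n - 1 = Suc r" using r by simp
  ultimately show ?thesis using w unfolding r' cob_CU by blast
 qed
 have aq: "a (Suc m) \<in> cocycles (CU LX) (Suc q)" using a_cocycle[of "Suc m"] q by simp
 have c: "omega X 0 (a (Suc m)) \<in> cocycles (CU LX) q" by (rule omega_codiff_zero[OF aq])
 have "omega X 0 (scale (int (Suc m)) (a (Suc m)) - cup LX (a m) (a 1)) \<in> cob q"
  using relation[of m] unfolding q by (rule coboundaries_omega)
 moreover have "omega X 0 (cup LX (a m) (a 1)) \<in> cob q"
 proof -
  have "cup LX (a m) (omega X 0 (a 1)) \<in> cob (2 * n * m + (2 * n - 1))" by (rule coboundaries_cup(2)[OF a_cocycle a1])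
  moreover have "2 * n * m + (2 * n - 1) = q" using q n by simp
  moreover have "cup LX (omega X 0 (a m)) (a 1) \<in> cob q"
  proof (cases "m = 0")
   case True
   have "omega X 0 (a 0) \<in> cochains LX {}" by (rule cochains_mono[OF omega_in[OF a_in]]) auto
   then have "omega X 0 (a 0) = 0" by (intro cochain_eqI) (simp add: cochains_zero)
   then show ?thesis using True cob_closed(1) by simp
  next
   case False
   then have "cup LX (omega X 0 (a m)) (a 1) \<in> cob (2 * n * m - 1 + 2 * n * 1)" using Suc.IH by (intro coboundaries_cup(1) a_cocycle) simp
   moreover have "2 * n * m - 1 + 2 * n * 1 = q" using q n False by (cases m) auto
   ultimately show ?thesis by simp
  qed
  ultimately show ?thesis using omega_cup_even[OF a_in _ a_in, of m 0 1] cob_closed(3) by simp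
 qed
 ultimately have "scale (int (Suc m)) (omega X 0 (a (Suc m))) \<in> cob q"
  using cob_closed(3)[of "omega X 0 (scale (int (Suc m)) (a (Suc m)) - cup LX (a m) (a 1))" q "omega X 0 (cup LX (a m) (a 1))"] by simp
 then have "omega X 0 (a (Suc m)) \<in> cob q" by (intro torsion_free[OF c, of "int (Suc m)"]) simp
 then show ?case using q by simp
qed simp

lemma omega_b: "omega X 0 (b m) - scale (int (Suc m)) (a (Suc m)) \<in> cob (2 * n * Suc m)"
proof -
 have e: "omega X 0 (b m) = cup LX (omega X 0 (a m)) ec + cup LX (a m) (a 1)"
  unfolding b_def using omega_cup_even[OF a_in _ ec_in, of m 0] unfolding omega_ec by simp
 have "cup LX (omega X 0 (a m)) ec \<in> cob (2 * n * Suc m)"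
 proof (cases "m = 0")
  case True
  have "omega X 0 (a 0) \<in> cochains LX {}" by (rule cochains_mono[OF omega_in[OF a_in]]) auto
  then have "omega X 0 (a 0) = 0" by (intro cochain_eqI) (simp add: cochains_zero)
  then show ?thesis using True cob_closed(1) by simp
 next
  case False
  then have "cup LX (omega X 0 (a m)) ec \<in> cob (2 * n * m - 1 + (2 * n + 1))" by (intro coboundaries_cup(1) omega_a ec_cocycle) simp
  moreover have "2 * n * m - 1 + (2 * n + 1) = 2 * n * Suc m" using n False by (cases m) auto
  ultimately show ?thesis by (simp only:)
 qed
 from cob_closed(2)[OF this relation[of m]] show ?thesis unfolding e by (simp add: algebra_simps)
qed

text \<open>By induction on \<open>j\<close>: \<open>relation\<close> at \<open>j\<close> and at
  \<open>i + j\<close>, with the case before, gives \<open>j + 1\<close> times the claim, and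
  torsion-freeness divides by it.\<close>

lemma a_cup_a: "cup LX (a i) (a j) - scale (int ((i + j) choose i)) (a (i + j)) \<in> cob (2 * n * (i + j))"
proof (induction j)
 case 0
 have "a 0 = cube_one LX" by (simp add: a_def)
 then have "cup LX (a i) (a 0) = a i" using cup_one_unit(2)[OF a_in] by metis
 then have "cup LX (a i) (a 0) - scale (int ((i + 0) choose i)) (a (i + 0)) = 0" by simp
 then show ?case using cob_closed(1) by (metis)
next
 case (Suc j)
 let ?N = "int ((i + j) choose i)" and ?d = "2 * n * (i + Suc j)"
 have d: "2 * n * i + 2 * n * Suc j = ?d" "2 * n * (i + j) + 2 * n * 1 = ?d" by (simp_all add: algebra_simps)
 have 1: "cup LX (a i) (scale (int (Suc j)) (a (Suc j)) - cup LX (a j) (a 1)) \<in> cob ?d"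
  using coboundaries_cup(2)[OF a_cocycle[of i] relation[of j]] unfolding d .
 have 2: "cup LX (cup LX (a i) (a j) - scale ?N (a (i + j))) (a 1) \<in> cob ?d"
  using coboundaries_cup(1)[OF Suc a_cocycle, of 1] unfolding d .
 have 3: "scale ?N (scale (int (Suc (i + j))) (a (Suc (i + j))) - cup LX (a (i + j)) (a 1)) \<in> cob ?d"
  using scale_cob[OF relation[of "i + j"]] by simp
 have s: "int (Suc (i + j)) * ?N = int (Suc j) * int ((i + Suc j) choose i)"
 proof -
  have "Suc (i + j) * ((i + j) choose j) = (Suc (i + j) choose Suc j) * Suc j" by (rule Suc_times_binomial_eq)
  moreover have "(i + j) choose j = (i + j) choose i" "Suc (i + j) choose Suc j = (i + Suc j) choose i"
   using binomial_symmetric[of j "i + j"] binomial_symmetric[of "Suc j" "i + Suc j"] by simp_all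
  ultimately show ?thesis by (metis mult.commute of_nat_mult)
 qed
 have alg: "scale J (c - scale C z) = (scale J c - cup LX x y) + (cup LX x y - scale M w) - scale M (scale K z - w)"
  if "K * M = J * C" for J K C M :: int and c z x y w :: "(complex => nat => real) cochain"
 proof -
  have "scale M (scale K z) = scale J (scale C z)" unfolding scale_add using that by (simp add: mult.commute)
  then show ?thesis by (simp only: scale_add(2,6)) simp
 qed
 have "scale (int (Suc j)) (cup LX (a i) (a (Suc j)) - scale (int ((i + Suc j) choose i)) (a (i + Suc j)))
   = cup LX (a i) (scale (int (Suc j)) (a (Suc j)) - cup LX (a j) (a 1)) + cup LX (cup LX (a i) (a j) - scale ?N (a (i + j))) (a 1)
    - scale ?N (scale (int (Suc (i + j))) (a (Suc (i + j))) - cup LX (a (i + j)) (a 1))"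
  using alg[OF s, of "cup LX (a i) (a (Suc j))" "a (Suc (i + j))" "a i" "cup LX (a j) (a 1)" "cup LX (a (i + j)) (a 1)"]
  by (simp only: cup_lin cup_assoc add_Suc_right)
 moreover have "... \<in> cob ?d" using 1 2 3 cob_closed(2,3) by blast
 ultimately have t: "scale (int (Suc j)) (cup LX (a i) (a (Suc j)) - scale (int ((i + Suc j) choose i)) (a (i + Suc j))) \<in> cob ?d" by simp
 have "cup LX (a i) (a (Suc j)) \<in> cocycles (CU LX) ?d" using cocycles_cup[OF a_cocycle a_cocycle] d(1) by metis
 moreover have "scale k f \<in> cocycles (CU LX) p" if "f \<in> cocycles (CU LX) p" for k f p
  using that scale_in[of f LX "{p}"] by (simp add: cocycles_CU)
 ultimately have "cup LX (a i) (a (Suc j)) - scale (int ((i + Suc j) choose i)) (a (i + Suc j)) \<in> cocycles (CU LX) ?d"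
  using a_cocycle[of "i + Suc j"] by (simp add: cocycles_CU)
 then show ?case by (rule torsion_free[OF _ _ t]) simp
qed

end

section \<open>Homotopy orbit cochains\<close>

lemma omega_sum: "omega X k (sum f I) = (\<Sum>i\<in>I. omega X k (f i))"
 by (induction I rule: infinite_finite_induct) (simp_all only: sum_eqs omega_lin)

text \<open>Multiplication by \<upsilon>, which has degree two.\<close>

definition vsh :: "(nat => 'y cochain) => nat => 'y cochain" where
 "vsh F = (%r. case r of 0 => 0 | Suc s => F s)"

definition lead :: "'y cochain => nat => 'y cochain" where
 "lead f = (%r. if r = 0 then f else 0)"

definition orb_in :: "'y topology => nat => (nat => (complex => 'y) cochain) => bool" where
 "orb_in X p F \<longleftrightarrow> (\<forall>k. F k \<in> cochains (loops X) (if 2 * k \<le> p then {p - 2 * k} else {}))"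

abbreviation orb_diff :: "'y topology => (nat => (complex => 'y) cochain) => nat => (complex => 'y) cochain" where
 "orb_diff X \<equiv> diff (orbit_cochains X)"

definition Om :: "'y topology => (nat => (complex => 'y) cochain) => nat => (complex => 'y) cochain" where
 "Om X F = (%r. \<Sum>i<r. omega X (r - 1 - i) (F i))"

lemma cochains_empty: "f \<in> cochains Y {} \<longleftrightarrow> f = 0"
 by (auto intro!: cochain_eqI simp: cochains_zero)

lemma comp_orbit: "comp (orbit_cochains X) p = {F. orb_in X p F}"
 by (auto simp: orbit_cochains_def orb_in_def comp_CU cochains_empty)

lemma orb_diff_apply: "orb_diff X F r = codiff (loops X) (F r) + Om X F r"
proof -
 have "(\<Sum>(m, k)\<in>{(m, k). m + k + 1 = r}. omega X k (F m)) = Om X F r"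
  unfolding Om_def by (rule sum.reindex_bij_witness[of _ "%i. (i, r - 1 - i)" fst]) auto
 then show ?thesis by (simp add: orbit_cochains_def)
qed

lemma orb_diff_eq: "orb_diff X F = seqd (loops X) F + Om X F"
 by (rule ext) (simp only: orb_diff_apply plus_fun_apply)

lemma orb_diff_zero: "orb_diff X F 0 = codiff (loops X) (F 0)"
 by (simp add: orb_diff_apply Om_def)

lemma orb_diff_one: "orb_diff X F 1 = codiff (loops X) (F 1) + omega X 0 (F 0)"
 by (simp add: orb_diff_apply Om_def)

lemma Om_lin: "Om X (F + G) = Om X F + Om X G" "Om X (F - G) = Om X F - Om X G" "Om X (- F) = - Om X F"
 "Om X (%r. scale k (F r)) = (%r. scale k (Om X F r))"
 by (rule ext, simp only: Om_def plus_fun_apply minus_apply uminus_apply omega_lin sum.distrib sum_subtractf sum_negf scale_sum)+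

lemma orb_diff_lin: "orb_diff X (F + G) = orb_diff X F + orb_diff X G" "orb_diff X (F - G) = orb_diff X F - orb_diff X G"
 "orb_diff X (- F) = - orb_diff X F" "orb_diff X (%r. scale k (F r)) = (%r. scale k (orb_diff X F r))"
proof -
 show "orb_diff X (F + G) = orb_diff X F + orb_diff X G" "orb_diff X (F - G) = orb_diff X F - orb_diff X G" "orb_diff X (- F) = - orb_diff X F"
  unfolding orb_diff_eq Om_lin seqd_lin by (simp_all add: algebra_simps)
 show "orb_diff X (%r. scale k (F r)) = (%r. scale k (orb_diff X F r))"
  by (rule ext) (simp only: orb_diff_apply Om_lin codiff_lin scale_add)
qed

lemma orb_in_lin: "orb_in X p F ==> orb_in X p G ==> orb_in X p (F + G)" "orb_in X p F ==> orb_in X p G ==> orb_in X p (F - G)"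
 "orb_in X p F ==> orb_in X p (- F)" "orb_in X p F ==> orb_in X p (%r. scale k (F r))" "orb_in X p 0"
 unfolding orb_in_def by (simp_all only: plus_fun_apply minus_apply uminus_apply zero_fun_apply cochains_lin scale_in simp_thms)

lemma orb_diff_in:
 assumes "orb_in X p F"
 shows "orb_in X (Suc p) (orb_diff X F)"
 unfolding orb_in_def
proof
 fix r
 let ?S = "%p k. if 2 * k \<le> p then {p - 2 * k} else {} :: nat set"
 have "codiff (loops X) (F r) \<in> cochains (loops X) (?S (Suc p) r)"
  using assms[unfolded orb_in_def, rule_format, of r] by (rule cochains_mono[OF cube_codiff_in]) auto
 moreover have "omega X (r - 1 - i) (F i) \<in> cochains (loops X) (?S (Suc p) r)" if "i < r" for i
  using assms[unfolded orb_in_def, rule_format, of i] by (rule cochains_mono[OF omega_in]) (use that in auto)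
 ultimately show "orb_diff X F r \<in> cochains (loops X) (?S (Suc p) r)"
  unfolding orb_diff_apply Om_def by (intro cochains_lin cochains_sum) auto
qed

text \<open>Each composite of two operations occurs once from applying the differential twice and
  once, with the opposite sign, from \<open>omega_codiff\<close>.\<close>

lemma orb_diff_diff:
 assumes "orb_in X p F"
 shows "orb_diff X (orb_diff X F) = 0"
proof
 fix r
 let ?L = "loops X"
 let ?w = "%i j. omega X (r - 1 - j) (omega X (j - 1 - i) (F i))"
 have 1: "codiff ?L (omega X (r - 1 - i) (F i)) + omega X (r - 1 - i) (codiff ?L (F i)) = - (\<Sum>j\<in>{i<..<r}. ?w i j)"
  if "i < r" for i
 proof -
  have "codiff ?L (omega X (r - 1 - i) (F i)) + omega X (r - 1 - i) (codiff ?L (F i))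
   = - (\<Sum>l<r - 1 - i. omega X l (omega X (r - 1 - i - 1 - l) (F i)))"
   using assms[unfolded orb_in_def, rule_format, of i] by (rule omega_codiff)
  also have "(\<Sum>l<r - 1 - i. omega X l (omega X (r - 1 - i - 1 - l) (F i))) = (\<Sum>j\<in>{i<..<r}. ?w i j)"
   by (rule sum.reindex_bij_witness[of _ "%j. r - 1 - j" "%l. r - 1 - l"]) (auto simp: algebra_simps)
  finally show ?thesis .
 qed
 have "orb_diff X (orb_diff X F) r = (\<Sum>i<r. codiff ?L (omega X (r - 1 - i) (F i)) + omega X (r - 1 - i) (codiff ?L (F i))) + (\<Sum>j<r. \<Sum>i<j. ?w i j)"
  by (simp only: orb_diff_apply Om_def codiff_lin codiff_codiff omega_lin codiff_sum omega_sum sum.distrib add_0 add.assoc)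
 also have "(\<Sum>i<r. codiff ?L (omega X (r - 1 - i) (F i)) + omega X (r - 1 - i) (codiff ?L (F i))) = (\<Sum>i<r. - (\<Sum>j\<in>{i<..<r}. ?w i j))"
  by (rule sum.cong[OF refl]) (use 1 in auto)
 also have "(\<Sum>j<r. \<Sum>i<j. ?w i j) = (\<Sum>i<r. \<Sum>j\<in>{i<..<r}. ?w i j)"
 proof -
  have "(\<Sum>j<r. \<Sum>i<j. ?w i j) = (\<Sum>(j, i)\<in>(SIGMA j:{..<r}. {..<j}). ?w i j)" by (simp add: sum.Sigma)
  also have "... = (\<Sum>(i, j)\<in>(SIGMA i:{..<r}. {i<..<r}). ?w i j)"
   by (rule sum.reindex_bij_witness[of _ prod.swap prod.swap]) auto
  finally show ?thesis by (simp add: sum.Sigma)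
 qed
 also have "(\<Sum>i<r. - (\<Sum>j\<in>{i<..<r}. ?w i j)) + (\<Sum>i<r. \<Sum>j\<in>{i<..<r}. ?w i j) = 0"
  by (simp only: sum_negf left_minus)
 finally show "orb_diff X (orb_diff X F) r = 0 r" unfolding zero_fun_apply[of r] .
qed

lemma is_cochain_complex_orbit: "is_cochain_complex (orbit_cochains X)"
 unfolding is_cochain_complex_def comp_orbit mem_Collect_eq
 by (intro allI conjI ballI impI orb_in_lin orb_diff_lin(2) orb_diff_in orb_diff_diff) (simp_all only: mem_Collect_eq)

lemma vsh_simps [simp]: "vsh F 0 = 0" "vsh F (Suc r) = F r"
 by (simp_all add: vsh_def)

lemma vsh_lin: "vsh (F + G) = vsh F + vsh G" "vsh (F - G) = vsh F - vsh G" "vsh (%r. scale k (F r)) = (%r. scale k (vsh F r))"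
proof -
 have *: "vsh H = K" if "K 0 = 0" "!!r. K (Suc r) = H r" for H K :: "nat => 'a cochain"
 proof
  fix r show "vsh H r = K r" using that by (cases r) simp_all
 qed
 show "vsh (F + G) = vsh F + vsh G" "vsh (F - G) = vsh F - vsh G" "vsh (%r. scale k (F r)) = (%r. scale k (vsh F r))"
  by (rule *; simp)+
qed

lemma vsh_in: "orb_in X p F ==> orb_in X (p + 2) (vsh F)"
 unfolding orb_in_def
proof
 fix k assume F: "\<forall>k. F k \<in> cochains (loops X) (if 2 * k \<le> p then {p - 2 * k} else {})"
 show "vsh F k \<in> cochains (loops X) (if 2 * k \<le> p + 2 then {p + 2 - 2 * k} else {})"
 proof (cases k)
  case (Suc j)
  have "(if 2 * k \<le> p + 2 then {p + 2 - 2 * k} else {}) = (if 2 * j \<le> p then {p - 2 * j} else {})" by (simp add: Suc)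
  then show ?thesis using F Suc by simp
 qed (simp only: vsh_simps cochains_lin(1))
qed

lemma Om_vsh: "Om X (vsh F) = vsh (Om X F)"
proof
 fix r show "Om X (vsh F) r = vsh (Om X F) r"
 proof (cases r)
  case (Suc s)
  have "Om X (vsh F) (Suc s) = (\<Sum>i<Suc s. omega X (s - i) (vsh F i))" by (simp add: Om_def)
  also have "... = (\<Sum>i<s. omega X (s - Suc i) (F i))" by (simp only: sum.lessThan_Suc_shift vsh_simps omega_lin add_0)
  finally show ?thesis by (simp add: Suc Om_def)
 qed (simp add: Om_def)
qed

lemma orb_diff_vsh: "orb_diff X (vsh F) = vsh (orb_diff X F)"
proof
 fix r show "orb_diff X (vsh F) r = vsh (orb_diff X F) r"
  by (cases r) (simp_all only: orb_diff_apply Om_vsh vsh_simps codiff_lin add_0)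
qed

lemma vsh_tail: "F 0 = 0 ==> F = vsh (%r. F (Suc r))"
proof
 fix r assume "F 0 = 0" then show "F r = vsh (%r. F (Suc r)) r" by (cases r) simp_all
qed

lemma tail_in: "orb_in X (p + 2) F ==> orb_in X p (%r. F (Suc r))"
 unfolding orb_in_def
proof
 fix k assume "\<forall>k. F k \<in> cochains (loops X) (if 2 * k \<le> p + 2 then {p + 2 - 2 * k} else {})"
 note F = this[rule_format, of "Suc k"]
 have "(if 2 * Suc k \<le> p + 2 then {p + 2 - 2 * Suc k} else {}) = (if 2 * k \<le> p then {p - 2 * k} else {})" by simp
 then show "F (Suc k) \<in> cochains (loops X) (if 2 * k \<le> p then {p - 2 * k} else {})"
  using F by (simp only:)
qed

lemma vsh_inject: "vsh F = vsh G ==> F = G"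
proof
 fix r assume "vsh F = vsh G"
 from fun_cong[OF this, of "Suc r"] show "F r = G r" by simp
qed

lemma lead_simps [simp]: "lead f 0 = f" "lead f (Suc r) = 0"
 by (simp_all add: lead_def)

lemma lead_in: "f \<in> cochains (loops X) {p} ==> orb_in X p (lead f)"
 unfolding orb_in_def lead_def by (simp add: cochains_lin)

lemma orbit_leibniz:
 assumes F: "orb_in X p F" and G: "orb_in X q G"
 shows "orb_diff X (conv (loops X) F G) = conv (loops X) (orb_diff X F) G + (%r. sgn_if (even p) (conv (loops X) F (orb_diff X G) r))"
proof -
 let ?L = "loops X"
 let ?S = "%p k. if 2 * k \<le> p then {p - 2 * k} else {} :: nat set"
 have Fin: "F k \<in> cochains ?L (?S p k)" and Gin: "G k \<in> cochains ?L (?S q k)" for k using F G by (simp_all only: orb_in_def)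
 have par: "even m = even p" if "m \<in> ?S p k" for m k using that by (auto split: if_splits)
 have s_sum: "sgn_if b (sum f I) = (\<Sum>i\<in>I. sgn_if b (f i))" for b and f :: "nat => (complex => 'a) cochain" and I
  by (simp add: sgn_if_def sum_negf)
 have 1: "seqd ?L (conv ?L F G) = conv ?L (seqd ?L F) G + (%s. sgn_if (even p) (conv ?L F (seqd ?L G) s))"
  by (rule seqd_conv[OF Fin par])
 have w: "omega X k (cup ?L (F j) (G l)) = cup ?L (omega X k (F j)) (G l) + sgn_if (even p) (cup ?L (F j) (omega X k (G l)))" for j k l
  by (rule omega_cup[OF Fin Gin par])
 have 2: "Om X (conv ?L F G) r = conv ?L (Om X F) G r + sgn_if (even p) (conv ?L F (Om X G) r)" for r
 proof -
  have "Om X (conv ?L F G) r = (\<Sum>i<r. \<Sum>j\<le>i. cup ?L (omega X (r - 1 - i) (F j)) (G (i - j)))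
    + sgn_if (even p) (\<Sum>i<r. \<Sum>j\<le>i. cup ?L (F j) (omega X (r - 1 - i) (G (i - j))))"
   by (simp only: Om_def conv_def omega_sum w sum.distrib s_sum)
  also have "(\<Sum>i<r. \<Sum>j\<le>i. cup ?L (omega X (r - 1 - i) (F j)) (G (i - j))) = (\<Sum>s\<le>r. \<Sum>j<s. cup ?L (omega X (s - 1 - j) (F j)) (G (r - s)))"
  proof -
   have "(\<Sum>i<r. \<Sum>j\<le>i. cup ?L (omega X (r - 1 - i) (F j)) (G (i - j))) = (\<Sum>(i, j)\<in>(SIGMA i:{..<r}. {..i}). cup ?L (omega X (r - 1 - i) (F j)) (G (i - j)))"
    by (simp add: sum.Sigma)
   also have "... = (\<Sum>(s, j)\<in>(SIGMA s:{..r}. {..<s}). cup ?L (omega X (s - 1 - j) (F j)) (G (r - s)))"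
    by (rule sum.reindex_bij_witness[of _ "%(s, j). (r - s + j, j)" "%(i, j). (r - i + j, j)"]) auto
   finally show ?thesis by (simp add: sum.Sigma)
  qed
  also have "(\<Sum>i<r. \<Sum>j\<le>i. cup ?L (F j) (omega X (r - 1 - i) (G (i - j)))) = (\<Sum>j\<le>r. \<Sum>l<r - j. cup ?L (F j) (omega X (r - j - 1 - l) (G l)))"
  proof -
   have "(\<Sum>i<r. \<Sum>j\<le>i. cup ?L (F j) (omega X (r - 1 - i) (G (i - j)))) = (\<Sum>(i, j)\<in>(SIGMA i:{..<r}. {..i}). cup ?L (F j) (omega X (r - 1 - i) (G (i - j))))"
    by (simp add: sum.Sigma)
   also have "... = (\<Sum>(j, l)\<in>(SIGMA j:{..r}. {..<r - j}). cup ?L (F j) (omega X (r - j - 1 - l) (G l)))"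
    by (rule sum.reindex_bij_witness[of _ "%(j, l). (j + l, j)" "%(i, j). (j, i - j)"]) (auto simp: algebra_simps)
   finally show ?thesis by (simp add: sum.Sigma)
  qed
  finally show ?thesis by (simp only: Om_def conv_def cup_sum)
 qed
 show ?thesis
 proof
  fix r
  have sg: "sgn_if b (f + h) = sgn_if b f + sgn_if b h" for b and f h :: "(complex => 'a) cochain" by (simp add: sgn_if_def)
  have "orb_diff X (conv ?L F G) r = seqd ?L (conv ?L F G) r + Om X (conv ?L F G) r" by (simp only: orb_diff_apply)
  also have "... = (conv ?L (seqd ?L F) G r + conv ?L (Om X F) G r) + (sgn_if (even p) (conv ?L F (seqd ?L G) r) + sgn_if (even p) (conv ?L F (Om X G) r))"
   unfolding 2 fun_cong[OF 1, of r] by (simp only: plus_fun_apply add.assoc add.commute add.left_commute)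
  also have "... = conv ?L (orb_diff X F) G r + sgn_if (even p) (conv ?L F (orb_diff X G) r)"
   by (simp only: orb_diff_eq conv_lin sg plus_fun_apply[of "conv ?L _ _"])
  finally show "orb_diff X (conv ?L F G) r = (conv ?L (orb_diff X F) G + (%r. sgn_if (even p) (conv ?L F (orb_diff X G) r))) r"
   by (simp only: plus_fun_apply)
 qed
qed

lemma conv_orb_in:
 assumes "orb_in X p F" "orb_in X q G"
 shows "orb_in X (p + q) (conv (loops X) F G)"
 unfolding orb_in_def conv_def
proof (intro allI cochains_sum)
 fix k i :: nat assume "i \<in> {..k}"
 have "cup (loops X) (F i) (G (k - i)) \<in> cochains (loops X) {u + v |u v. u \<in> (if 2 * i \<le> p then {p - 2 * i} else {}) & v \<in> (if 2 * (k - i) \<le> q then {q - 2 * (k - i)} else {})}"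
  by (rule cube_cup_in[OF assms(1)[unfolded orb_in_def, rule_format, of i] assms(2)[unfolded orb_in_def, rule_format, of "k - i"]])
 then show "cup (loops X) (F i) (G (k - i)) \<in> cochains (loops X) (if 2 * k \<le> p + q then {p + q - 2 * k} else {})"
  by (rule cochains_mono) (use \<open>i \<in> {..k}\<close> in \<open>auto split: if_splits\<close>)
qed

lemma conv_vsh: "conv Y (vsh F) G = vsh (conv Y F G)" "conv Y F (vsh G) = vsh (conv Y F G)"
proof -
 show "conv Y (vsh F) G = vsh (conv Y F G)"
 proof
  fix r show "conv Y (vsh F) G r = vsh (conv Y F G) r"
  proof (cases r)
   case (Suc s)
   show ?thesis unfolding Suc vsh_simps conv_def by (simp only: sum.atMost_Suc_shift vsh_simps cup_lin add_0 diff_Suc_Suc)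
  qed (simp add: conv_def)
 qed
 show "conv Y F (vsh G) = vsh (conv Y F G)"
 proof
  fix r show "conv Y F (vsh G) r = vsh (conv Y F G) r"
  proof (cases r)
   case (Suc s)
   have "(\<Sum>i\<le>Suc s. cup Y (F i) (vsh G (Suc s - i))) = (\<Sum>i\<le>s. cup Y (F i) (vsh G (Suc s - i)))"
    by (simp only: sum.atMost_Suc diff_self_eq_0 vsh_simps cup_lin add_0_right)
   also have "... = (\<Sum>i\<le>s. cup Y (F i) (G (s - i)))"
    by (rule sum.cong) (simp_all add: Suc_diff_le)
   finally show ?thesis unfolding Suc vsh_simps conv_def .
  qed (simp add: conv_def)
 qed
qed

definition ssc :: "int => (nat => 'y cochain) => nat => 'y cochain" where
 "ssc k F = (%r. scale k (F r))"

lemma ssc_apply: "ssc k F r = scale k (F r)" by (simp add: ssc_def)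

lemma zero_seq: "(0 :: nat => 'y cochain) r = 0" by (rule zero_fun_apply)

lemma seq_eqI: "(!!r. F r = G r) ==> F = (G :: nat => 'y cochain)" by (rule ext)

lemma ssc_simps: "ssc (j + k) F = ssc j F + ssc k F" "ssc k (F + G) = ssc k F + ssc k G" "ssc k (F - G) = ssc k F - ssc k G"
 "ssc j (ssc k F) = ssc (j * k) F" "ssc k (vsh F) = vsh (ssc k F)" "ssc 1 F = F" "vsh 0 = 0" "ssc 0 F = 0" "ssc k 0 = 0"
 "conv Y (ssc k F) G = ssc k (conv Y F G)" "conv Y F (ssc k G) = ssc k (conv Y F G)"
proof -
 show "ssc k (vsh F) = vsh (ssc k F)"
 proof (rule seq_eqI)
  fix r show "ssc k (vsh F) r = vsh (ssc k F) r" by (cases r) (simp_all add: ssc_apply)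
 qed
 show "vsh 0 = (0 :: nat => 'd cochain)"
 proof (rule seq_eqI)
  fix r show "vsh 0 r = (0 :: nat => 'd cochain) r" by (cases r) (simp_all only: vsh_simps zero_seq)
 qed
qed (rule seq_eqI, simp only: ssc_apply plus_fun_apply minus_apply zero_seq scale_add scale_simps conv_def cup_lin scale_sum; fail)+

lemma orb_diff_ssc: "orb_diff X (ssc k F) = ssc k (orb_diff X F)"
 unfolding ssc_def by (rule orb_diff_lin(4))

lemma orb_in_ssc: "orb_in X p F ==> orb_in X p (ssc k F)"
 unfolding ssc_def by (rule orb_in_lin(4))

text \<open>The least positive element divides every element, in particular \<open>m\<close>; a
  prime divisor of it would divide the whole of \<open>S\<close>.\<close>

lemma multiple_ideal:
 fixes S :: "int set" and m :: nat
 assumes S: "!!j k x y. x \<in> S ==> y \<in> S ==> j * x + k * y \<in> S" and m: "int m \<in> S" "m > 0"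
  and p: "!!p. prime p ==> p dvd m ==> \<exists>x\<in>S. \<not> int p dvd x"
 shows "1 \<in> S"
proof -
 define d where "d = (LEAST d. d > 0 & int d \<in> S)"
 have d: "d > 0 & int d \<in> S" unfolding d_def by (rule LeastI[of _ m]) (use m in simp)
 have least: "d \<le> k" if "k > 0" "int k \<in> S" for k unfolding d_def by (rule Least_le) (use that in simp)
 have dvd: "int d dvd x" if "x \<in> S" for x
 proof (rule ccontr)
  assume nd: "\<not> int d dvd x"
  have "1 * x + (- (x div int d)) * int d \<in> S" using S that d by blast
  then have r: "x mod int d \<in> S" by (simp add: minus_div_mult_eq_mod[symmetric])
  have "x mod int d > 0" using nd d by (metis dvd_eq_mod_eq_0 of_nat_0_less_iff pos_mod_sign order_le_less)
  then obtain k where k: "x mod int d = int k" "k > 0" by (metis of_nat_0_less_iff zero_less_imp_eq_int)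
  have "x mod int d < int d" using d by simp
  then show False using least[of k] r k by simp
 qed
 have "d = 1"
 proof (rule ccontr)
  assume "d ~= 1"
  then obtain p where "prime p" "p dvd d" using prime_factor_nat by blast
  moreover have "d dvd m" using dvd[OF m(1)] by simp
  ultimately obtain x where "x \<in> S" "\<not> int p dvd x" using p by (meson dvd_trans)
  then show False using dvd \<open>p dvd d\<close> by (meson dvd_trans int_dvd_int_iff)
 qed
 then show ?thesis using d by simp
qed

section \<open>Cocycles of the orbit complex\<close>

context sphere_loops
begin

abbreviation "D \<equiv> orb_diff X"
abbreviation "cobO \<equiv> coboundaries (orbit_cochains X)"
abbreviation "cocO \<equiv> cocycles (orbit_cochains X)"

lemmas cobO_closed = coboundaries_closed[OF is_cochain_complex_orbit[of X]]

lemma cocO_iff: "F \<in> cocO p \<longleftrightarrow> orb_in X p F & D F = 0"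
 by (simp only: cocycles_def comp_orbit mem_Collect_eq)

lemma cobO_Suc: "F \<in> cobO (Suc q) \<longleftrightarrow> (\<exists>K. orb_in X q K & F = D K)"
 by (auto simp: coboundaries_def comp_orbit)

lemma cobO_zero: "F \<in> cobO 0 \<longleftrightarrow> F = 0"
 by (simp only: coboundaries_def nat.case singleton_iff)

lemma vsh_coc: "F \<in> cocO p ==> vsh F \<in> cocO (p + 2)"
 unfolding cocO_iff orb_diff_vsh by (elim conjE) (intro conjI vsh_in; simp only: ssc_simps)

lemma vsh_cob: "F \<in> cobO p ==> vsh F \<in> cobO (p + 2)"
proof (cases p)
 case (Suc q)
 assume "F \<in> cobO p"
 then obtain K where K: "orb_in X q K" "F = D K" unfolding Suc cobO_Suc by blast
 have "vsh F = D (vsh K)" unfolding K(2) orb_diff_vsh ..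
 moreover have "p + 2 = Suc (q + 2)" by (simp add: Suc)
 ultimately show ?thesis using vsh_in[OF K(1)] unfolding cobO_Suc by (metis cobO_Suc)
next
 case 0
 assume "F \<in> cobO p"
 then have "F = 0" using 0 cobO_zero by metis
 then show ?thesis unfolding ssc_simps by (simp only: ssc_simps cobO_closed(1))
qed

lemma ssc_cob: "F \<in> cobO p ==> ssc k F \<in> cobO p"
proof (cases p)
 case (Suc q)
 assume "F \<in> cobO p"
 then obtain K where K: "orb_in X q K" "F = D K" unfolding Suc cobO_Suc by blast
 then show ?thesis unfolding Suc cobO_Suc using orb_in_ssc[OF K(1)] orb_diff_ssc by metis
next
 case 0
 assume "F \<in> cobO p"
 then have "F = 0" using 0 cobO_zero by metis
 then show ?thesis by (simp only: ssc_simps cobO_closed(1))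
qed

lemma ssc_coc: "F \<in> cocO p ==> ssc k F \<in> cocO p"
 unfolding cocO_iff orb_diff_ssc by (elim conjE) (intro conjI orb_in_ssc; simp only: ssc_simps)

lemma cocO_lin: "F \<in> cocO p ==> H \<in> cocO p ==> F + H \<in> cocO p" "F \<in> cocO p ==> H \<in> cocO p ==> F - H \<in> cocO p"
 unfolding cocO_iff orb_diff_lin by (elim conjE; intro conjI orb_in_lin; simp only: add_0 diff_self)+

lemma lead_cocycle:
 assumes F: "F \<in> cocO p"
 shows "F 0 \<in> cocycles (CU LX) p"
proof -
 have "F 0 \<in> cochains LX (if 2 * 0 \<le> p then {p - 2 * 0} else {})" using F unfolding cocO_iff orb_in_def by blast
 then have "F 0 \<in> cochains LX {p}" by simp
 moreover have "codiff LX (F 0) = 0"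
  unfolding orb_diff_zero[symmetric] using F[unfolded cocO_iff] by (simp only: zero_seq)
 ultimately show ?thesis by (simp add: cocycles_CU)
qed

text \<open>A primitive of the leading coefficient, taken as a cochain without higher terms, has a
  differential that removes it. What remains is divisible by \<upsilon>, and zero in degrees below
  two.\<close>

lemma strip:
 assumes F: "F \<in> cocO p" and l: "F 0 \<in> cob p"
 shows "F \<in> cobO p \<or> (\<exists>q F'. p = q + 2 & F' \<in> cocO q & F - vsh F' \<in> cobO p)"
proof -
 have "\<exists>F1\<in>cocO p. F1 0 = 0 & F - F1 \<in> cobO p"
 proof (cases p)
  case 0
  then have "F 0 = 0" using l by (simp only: coboundaries_def nat.case singleton_iff)
  then show ?thesis using F cobO_closed(1)[of p] by (intro bexI[of _ F]) (simp_all only: diff_self simp_thms)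
 next
  case (Suc q)
  then obtain u where u: "u \<in> cochains LX {q}" "F 0 = codiff LX u" using l unfolding Suc cob_CU by blast
  have b: "D (lead u) \<in> cobO p" unfolding Suc cobO_Suc using lead_in[OF u(1)] by blast
  have "F - D (lead u) \<in> cocO p" by (rule cocO_lin(2)[OF F cobO_closed(4)[OF b]])
  moreover have "(F - D (lead u)) 0 = 0" by (simp only: minus_apply orb_diff_zero lead_simps u(2) diff_self)
  moreover have "F - (F - D (lead u)) \<in> cobO p" using b by (simp only: diff_diff_eq2 add_diff_cancel_left')
  ultimately show ?thesis by blast
 qed
 then obtain F1 where F1: "F1 \<in> cocO p" "F1 0 = 0" "F - F1 \<in> cobO p" by blast
 have o1: "orb_in X p F1" "D F1 = 0" using F1(1) unfolding cocO_iff by blast+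
 show ?thesis
 proof (cases "p < 2")
  case True
  have "F1 = 0"
  proof (rule seq_eqI)
   fix r show "F1 r = 0 r"
   proof (cases r)
    case (Suc s)
    then have "\<not> 2 * r \<le> p" using True by simp
    moreover have "F1 r \<in> cochains LX (if 2 * r \<le> p then {p - 2 * r} else {})" using o1(1) unfolding orb_in_def by blast
    ultimately have "F1 r \<in> cochains LX {}" by simp
    then show ?thesis unfolding zero_seq cochains_empty .
   qed (simp only: F1(2) zero_seq)
  qed
  then show ?thesis using F1(3) by (simp only: diff_zero simp_thms)
 next
  case False
  define q where "q = p - 2"
  have p: "p = q + 2" using False by (simp add: q_def)
  define F' where "F' = (%r. F1 (Suc r))"
  have v: "F1 = vsh F'" unfolding F'_def by (rule vsh_tail[of F1, OF F1(2)])
  have "orb_in X q F'" unfolding F'_def by (rule tail_in) (use o1(1) p in simp)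
  moreover have "D F' = 0"
  proof (rule vsh_inject)
   show "vsh (D F') = vsh 0" unfolding orb_diff_vsh[symmetric] v[symmetric] o1(2) by (simp only: ssc_simps)
  qed
  ultimately have "F' \<in> cocO q" unfolding cocO_iff by blast
  then show ?thesis using F1(3) p unfolding v by blast
 qed
qed

text \<open>In odd degree the leading class can only be a multiple \<open>k\<close> of
  \<open>b m\<close>. Closedness in the next coefficient makes \<open>k\<close> times the rotation
  of \<open>b m\<close> exact, which is \<open>k (m + 1)\<close> times the nonzero class of
  \<open>a (m + 1)\<close>; so \<open>k = 0\<close>, and stripping lowers the degree.\<close>

lemma odd_exact: "odd p ==> F \<in> cocO p ==> F \<in> cobO p"
proof (induction p arbitrary: F rule: less_induct)
 case (less p)
 note F = less.prems(2)
 have F0: "F 0 \<in> cocycles (CU LX) p" by (rule lead_cocycle[OF F])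
 have "F 0 \<in> cob p"
 proof (cases "\<exists>m. p = 2 * n * m + 2 * n + 1")
  case False
  have "p ~= 2 * n * m" for m using less.prems(1) by auto
  then show ?thesis using class_none[OF F0] False by blast
 next
  case True
  then obtain m where m: "p = 2 * n * m + 2 * n + 1" by blast
  have d: "2 * n * Suc m = 2 * n * m + 2 * n" by simp
  obtain q where q: "2 * n * m + 2 * n = Suc q" using n by (cases "2 * n * m + 2 * n") auto
  obtain k where k: "F 0 - scale k (b m) \<in> cob p" using class_b[OF F0[unfolded m]] m by blast
  have "D F = 0" using F unfolding cocO_iff by blast
  then have "codiff LX (F 1) + omega X 0 (F 0) = 0"
   unfolding orb_diff_one[symmetric] by (simp only: zero_seq)
  then have w: "omega X 0 (F 0) = codiff LX (- F 1)" unfolding codiff_lin by (simp only: eq_neg_iff_add_eq_0 add.commute)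
  have "F 1 \<in> cochains LX {q}"
  proof -
   have "F 1 \<in> cochains LX (if 2 * 1 \<le> p then {p - 2 * 1} else {})" using F unfolding cocO_iff orb_in_def by blast
   then show ?thesis using m q by simp
  qed
  then have "- F 1 \<in> cochains LX {q}" by (rule cochains_lin)
  then have w0: "omega X 0 (F 0) \<in> cob (Suc q)" unfolding cob_CU using w by blast
  have "omega X 0 (F 0 - scale k (b m)) \<in> cob (Suc q)" using k unfolding m q by (intro coboundaries_omega) simp
  then have "scale k (omega X 0 (b m)) \<in> cob (Suc q)"
   using cob_closed(2)[OF w0] unfolding omega_lin by (metis add_diff_cancel_left' diff_add_cancel)
  note kb = this
  have dq: "2 * n * Suc m = Suc q" using q d by simp
  have "scale k (omega X 0 (b m)) - scale k (omega X 0 (b m) - scale (int (Suc m)) (a (Suc m))) \<in> cob (Suc q)"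
   by (rule cob_closed(2)[OF kb scale_cob[OF omega_b[of m, unfolded dq]]])
  then have "scale (k * int (Suc m)) (a (Suc m)) \<in> cob (2 * n * Suc m)" unfolding dq scale_add(6) scale_add(3) by simp
  then have "k * int (Suc m) = 0" by (rule free_a)
  then have "k = 0" by simp
  then show ?thesis using k by (simp only: scale_simps diff_zero)
 qed
 from strip[OF F this] show ?case
 proof (elim disjE exE conjE)
  fix q F' assume q: "p = q + 2" "F' \<in> cocO q" "F - vsh F' \<in> cobO p"
  have "F' \<in> cobO q" using q less.prems(1) by (intro less.IH) auto
  then have "vsh F' \<in> cobO p" unfolding q(1) by (rule vsh_cob)
  from cobO_closed(3)[OF q(3) this] show ?thesis by (simp only: diff_add_cancel)
 qed
qed

text \<open>The differential of \<open>a m\<close>, taken as a cochain without higher terms, is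
  \<upsilon> times an odd cocycle, which is exact.\<close>

lemma extend_a: "\<exists>A'\<in>cocO (2 * n * m). A' 0 = a m"
proof -
 let ?F = "lead (a m)"
 have F: "orb_in X (2 * n * m) ?F" by (rule lead_in[OF a_in])
 have DF: "orb_in X (Suc (2 * n * m)) (D ?F)" by (rule orb_diff_in[OF F])
 have D0: "D ?F 0 = 0" by (simp only: orb_diff_zero lead_simps codiff_a)
 show ?thesis
 proof (cases "m = 0")
  case True
  have "D ?F = 0"
  proof (rule seq_eqI)
   fix r show "D ?F r = 0 r"
   proof (cases r)
    case (Suc s)
    have "D ?F r \<in> cochains LX (if 2 * r \<le> Suc (2 * n * m) then {Suc (2 * n * m) - 2 * r} else {})" using DF unfolding orb_in_def by blast
    then have "D ?F r \<in> cochains LX {}" using True Suc by simp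
    then show ?thesis unfolding zero_seq cochains_empty .
   qed (simp only: D0 zero_seq)
  qed
  then have "?F \<in> cocO (2 * n * m)" using F unfolding cocO_iff by blast
  then show ?thesis using lead_simps(1) by blast
 next
  case False
  define q where "q = 2 * (n * m - 1)"
  have q: "2 * n * m = q + 2" using False n by (cases "n * m") (auto simp: q_def)
  define H where "H = (%r. D ?F (Suc r))"
  have v: "D ?F = vsh H" unfolding H_def by (rule vsh_tail[of "D ?F", OF D0])
  have "orb_in X (Suc q) H" unfolding H_def by (rule tail_in) (use DF q in simp)
  moreover have "D H = 0"
  proof (rule vsh_inject)
   show "vsh (D H) = vsh 0" unfolding orb_diff_vsh[symmetric] v[symmetric] orb_diff_diff[OF F] by (simp only: ssc_simps)
  qed
  ultimately have "H \<in> cocO (Suc q)" unfolding cocO_iff by blast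
  then have "H \<in> cobO (Suc q)" by (intro odd_exact) (simp_all add: q_def)
  then obtain K where K: "orb_in X q K" "H = D K" unfolding cobO_Suc by blast
  have "orb_in X (q + 2) (?F - vsh K)" using F vsh_in[OF K(1)] unfolding q by (rule orb_in_lin(2))
  moreover have "D (?F - vsh K) = 0" unfolding orb_diff_lin orb_diff_vsh v K(2) by (rule diff_self)
  ultimately have "?F - vsh K \<in> cocO (2 * n * m)" unfolding cocO_iff q by blast
  moreover have "(?F - vsh K) 0 = a m" by (simp only: minus_apply lead_simps vsh_simps diff_zero)
  ultimately show ?thesis by blast
 qed
qed

end

lemma upsilon_power_simps: "upsilon_power X 0 = lead (cube_one (loops X))" "upsilon_power X (Suc k) = vsh (upsilon_power X k)"
proof -
 show "upsilon_power X 0 = lead (cube_one (loops X))" by (simp add: upsilon_power_def lead_def)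
 show "upsilon_power X (Suc k) = vsh (upsilon_power X k)"
 proof (rule seq_eqI)
  fix r show "upsilon_power X (Suc k) r = vsh (upsilon_power X k) r" by (cases r) (simp_all add: upsilon_power_def)
 qed
qed

section \<open>Augmentation and integral lifts\<close>

context sphere_loops
begin

text \<open>Evaluation at a constant loop is an augmentation on even degrees.\<close>

definition "x0 = (%i :: nat. if i = 0 then 1 else 0 :: real)"
definition "V0 = (\<lambda>t\<in>pts 0. const_loop x0)"
definition "eps k F = F k 0 V0"

lemma singular_V0: "singular 0 LX V0"
proof -
 have "x0 \<in> topspace X" using in_topspace_nsphere[of "2 * n + 1"] by (simp add: x0_def)
 then have "singular 0 X (\<lambda>t\<in>pts 0. x0)"
  unfolding singular_cube_def by (auto intro: continuous_map_eq[where f = "%_. x0"])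
 then have "singular 0 LX (push 0 const_loop (\<lambda>t\<in>pts 0. x0))" using cube_map_const_loop unfolding cube_map_def by blast
 moreover have "push 0 const_loop (\<lambda>t\<in>pts 0. x0) = V0" by (auto simp: push_def V0_def)
 ultimately show ?thesis by simp
qed

text \<open>Rotation fixes a constant loop, so the rotated cube is constant and, having positive
  dimension, degenerate.\<close>

lemma eps_omega:
 assumes f: "f \<in> cochains LX S"
 shows "omega X k f 0 V0 = 0"
proof -
 have "f (tdim x + 0) (tract x 0 V0) = 0" for x
 proof -
  let ?a = "tdim x"
  have "indep (?a + 0) (ract ?a (tfun x) 0 V0) 0" unfolding indep_def
  proof (intro ballI impI)
   fix t t' assume t: "t \<in> pts (?a + 0)" "t' \<in> pts (?a + 0)"
   have c: "ract ?a (tfun x) 0 V0 s = const_loop x0" if s: "s \<in> pts (?a + 0)" for s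
   proof -
    have "(%i. s (?a + i)) \<in> pts 0" using shift_pts[OF s] .
    then show ?thesis using s by (auto simp: ract_def V0_def const_loop_def norm_mult fun_eq_iff)
   qed
   show "ract ?a (tfun x) 0 V0 t = ract ?a (tfun x) 0 V0 t'" unfolding c[OF t(1)] c[OF t(2)] ..
  qed
  then have "degenerate_cube (?a + 0) (ract ?a (tfun x) 0 V0)" unfolding degenerate_iff by fastforce
  then show ?thesis using cochains_zero[OF f] by blast
 qed
 then show ?thesis using singular_V0 by (simp add: omega_op_eq)
qed

lemma eps_cob: "F \<in> cobO (2 * k) ==> eps k F = 0"
proof (cases k)
 case 0
 assume "F \<in> cobO (2 * k)"
 then have "F = 0" using 0 cobO_zero by (metis mult_0_right)
 then show ?thesis unfolding eps_def by (simp only: zero_seq) simp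
next
 case (Suc j)
 assume "F \<in> cobO (2 * k)"
 then obtain K where K: "orb_in X (Suc (2 * j)) K" "F = D K" using Suc cobO_Suc[of F "Suc (2 * j)"] by auto
 have Kin: "K i \<in> cochains LX (if 2 * i \<le> Suc (2 * j) then {Suc (2 * j) - 2 * i} else {})" for i using K(1) unfolding orb_in_def by blast
 have "K k \<in> cochains LX {}" using Kin[of k] Suc by simp
 then have "K k = 0" unfolding cochains_empty .
 then have "eps k F = (\<Sum>i<k. omega X (k - 1 - i) (K i) 0 V0)"
  unfolding eps_def K(2) orb_diff_apply by (simp only: codiff_lin add_0 Om_def sum_apply2)
 also have "... = 0" using eps_omega[OF Kin] by simp
 finally show ?thesis .
qed

lemma eps_lin: "eps k (F + H) = eps k F + eps k H" "eps k (F - H) = eps k F - eps k H" "eps k (ssc c F) = c * eps k F" "eps (Suc k) (vsh F) = eps k F"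
 by (simp_all add: eps_def ssc_apply scale_def)

lemma eps_conv:
 assumes "orb_in X (2 * k) F" "orb_in X (2 * l) H"
 shows "eps (k + l) (conv LX F H) = eps k F * eps l H"
proof -
 have c: "cup LX f h 0 V0 = f 0 V0 * h 0 V0" for f h :: "(complex => nat => real) cochain"
 proof -
  have "fc [] V0 = V0" using fc_replicate[OF singular_V0] by simp
  then show ?thesis using singular_V0 by (simp add: cube_cup_eq ev_def)
 qed
 have "F i 0 V0 = 0" if "i ~= k" for i
 proof -
  have "F i \<in> cochains LX (if 2 * i \<le> 2 * k then {2 * k - 2 * i} else {})" using assms(1) unfolding orb_in_def by blast
  then show ?thesis by (rule cochains_zero) (use that in auto)
 qed
 then have "(\<Sum>i\<le>k + l. F i 0 V0 * H (k + l - i) 0 V0) = (\<Sum>i\<in>{k}. F i 0 V0 * H (k + l - i) 0 V0)"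
  by (intro sum.mono_neutral_right) auto
 then have "(\<Sum>i\<le>k + l. F i 0 V0 * H (k + l - i) 0 V0) = F k 0 V0 * H l 0 V0" by simp
 then show ?thesis unfolding eps_def conv_def sum_apply2 c .
qed

definition good :: "nat => (nat => (complex => nat => real) cochain) => bool" where
 "good m F \<longleftrightarrow> F \<in> cocO (2 * n * m) & F 0 = a m & vsh (ssc (int m) F) \<in> cobO (2 * n * m + 2)"

lemma good_eps:
 assumes F: "good m F" "m > 0"
 shows "eps (n * m) F = 0"
proof -
 have "2 * n * m + 2 = 2 * Suc (n * m)" by simp
 then have "eps (Suc (n * m)) (vsh (ssc (int m) F)) = 0" using F(1) eps_cob[of _ "Suc (n * m)"] unfolding good_def by metis
 then show ?thesis using F(2) by (simp add: eps_lin)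
qed

text \<open>Stripping downwards, the leading class is a multiple of some \<open>a j\<close> with
  \<open>0 < j < m\<close>, whose good lift is annihilated by \<open>j\<close> \<upsilon>, or of the
  unit. The latter generates no torsion, and the augmentation excludes it.\<close>

lemma torsion:
 assumes IH: "!!j. 0 < j ==> j < m ==> \<exists>F. good j F" and t: "!!j. 0 < j ==> j < m ==> int j dvd t"
 shows "F \<in> cocO (2 * k) ==> k < n * m ==> eps k F = 0 ==> vsh (ssc t F) \<in> cobO (2 * k + 2)"
proof (induction k arbitrary: F rule: less_induct)
 case (less k)
 note F = less.prems(1)
 have F0: "F 0 \<in> cocycles (CU LX) (2 * k)" by (rule lead_cocycle[OF F])
 have "\<exists>H\<in>cocO (2 * k). F 0 - H 0 \<in> cob (2 * k) & eps k H = 0 & vsh (ssc t H) \<in> cobO (2 * k + 2)"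
 proof -
  have z: "\<exists>H\<in>cocO (2 * k). F 0 - H 0 \<in> cob (2 * k) & eps k H = 0 & vsh (ssc t H) \<in> cobO (2 * k + 2)" if "F 0 \<in> cob (2 * k)"
  proof (intro bexI[of _ 0] conjI)
   show "0 \<in> cocO (2 * k)" by (rule cobO_closed(4)[OF cobO_closed(1)])
   show "F 0 - (0 :: nat => (complex => nat => real) cochain) 0 \<in> cob (2 * k)" unfolding zero_seq diff_zero by (rule that)
   show "eps k 0 = 0" unfolding eps_def zero_seq by simp
   show "vsh (ssc t 0) \<in> cobO (2 * k + 2)" by (simp only: ssc_simps cobO_closed(1))
  qed
  consider "k = 0" | j where "j > 0" "k = n * j" | "k > 0" "\<nexists>j. k = n * j" by (metis mult_0_right neq0_conv)
  then show ?thesis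
  proof cases
   case 1
   from class_a[of "F 0" 0] obtain c where c: "F 0 - scale c (a 0) \<in> cob 0" using F0 1 by auto
   then have F0c: "F 0 = scale c (a 0)" by (simp only: coboundaries_def nat.case singleton_iff right_minus_eq)
   \<comment> \<open>In degree zero the leading class is a multiple of the unit, and the
     augmentation is that multiple.\<close>
   have "c = 0" using less.prems(3) singular_V0 by (simp add: eps_def 1 F0c a_def scale_def cube_one_def)
   then have "F 0 = 0" unfolding F0c by (simp only: scale_simps)
   then show ?thesis using z cob_closed(1)[of "2 * k"] by (simp only:)
  next
   case (2 j)
   have jm: "j < m" using less.prems(2) 2 by simp
   obtain H where H: "good j H" using IH 2(1) jm by blast
   have k2: "2 * k = 2 * n * j" by (simp add: 2)
   obtain c where c: "F 0 - scale c (a j) \<in> cob (2 * k)" using class_a[of "F 0" j] F0 unfolding k2 by blast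
   obtain s where s: "t = int j * s" using t[OF 2(1) jm] by auto
   have "vsh (ssc t (ssc c H)) = ssc (s * c) (vsh (ssc (int j) H))"
    unfolding ssc_simps s by (simp only: ac_simps)
   then have "vsh (ssc t (ssc c H)) \<in> cobO (2 * k + 2)" using ssc_cob H unfolding good_def k2 by metis
   moreover have "ssc c H \<in> cocO (2 * k)" using H ssc_coc unfolding good_def k2 by blast
   moreover have "eps k (ssc c H) = 0" using good_eps[OF H 2(1)] by (simp add: eps_lin 2)
   moreover have "F 0 - ssc c H 0 \<in> cob (2 * k)" using c H unfolding good_def ssc_apply by simp
   ultimately show ?thesis by blast
  next
   case 3
   have "2 * k ~= 2 * n * j" for j using 3(2) by auto
   moreover have "2 * k ~= 2 * n * j + 2 * n + 1" for j
   proof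
    assume e: "2 * k = 2 * n * j + 2 * n + 1"
    have "odd (2 * n * j + 2 * n + 1)" by simp
    then show False unfolding e[symmetric] by simp
   qed
   ultimately show ?thesis using z class_none[OF F0] by blast
  qed
 qed
 then obtain H where H: "H \<in> cocO (2 * k)" "F 0 - H 0 \<in> cob (2 * k)" "eps k H = 0" "vsh (ssc t H) \<in> cobO (2 * k + 2)" by blast
 have FH: "F - H \<in> cocO (2 * k)" by (rule cocO_lin(2)[OF F H(1)])
 have "(F - H) 0 \<in> cob (2 * k)" using H(2) by (simp only: minus_apply)
 from strip[OF FH this] have "vsh (ssc t (F - H)) \<in> cobO (2 * k + 2)"
 proof (elim disjE exE conjE)
  assume "F - H \<in> cobO (2 * k)"
  then show ?thesis by (intro vsh_cob ssc_cob)
 next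
  fix q F' assume q: "2 * k = q + 2" "F' \<in> cocO q" "F - H - vsh F' \<in> cobO (2 * k)"
  then obtain k' where k': "k = Suc k'" by (cases k) auto
  have qk: "q = 2 * k'" using q(1) k' by simp
  have "eps k (F - H - vsh F') = 0" by (rule eps_cob[OF q(3)])
  then have e: "eps k' F' = 0" using less.prems(3) H(3) by (simp add: eps_lin k')
  have "vsh (ssc t F') \<in> cobO (2 * k' + 2)" using q(2) e less.prems(2) k' unfolding qk by (intro less.IH) auto
  then have 1: "vsh (vsh (ssc t F')) \<in> cobO (2 * k + 2)" using vsh_cob[of "vsh (ssc t F')" "2 * k' + 2"] k' by simp
  have 2: "vsh (ssc t (F - H - vsh F')) \<in> cobO (2 * k + 2)" using q(3) by (intro vsh_cob ssc_cob)
  have "vsh (ssc t (F - H)) = vsh (ssc t (F - H - vsh F')) + vsh (vsh (ssc t F'))"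
   unfolding ssc_simps vsh_lin by (simp only: diff_add_cancel)
  then show ?thesis using cobO_closed(3)[OF 2 1] by (simp only:)
 qed
 from cobO_closed(3)[OF this H(4)] show ?case unfolding ssc_simps vsh_lin by (simp only: diff_add_cancel)
qed

definition liftable :: "nat => int set" where
 "liftable m = {N. \<exists>F\<in>cocO (2 * n * m). F 0 - scale N (a m) \<in> cob (2 * n * m) & vsh (ssc (int m) F) \<in> cobO (2 * n * m + 2)}"

lemma liftable_lin:
 assumes "N \<in> liftable m" "M \<in> liftable m"
 shows "j * N + k * M \<in> liftable m"
proof -
 obtain F H where F: "F \<in> cocO (2 * n * m)" "F 0 - scale N (a m) \<in> cob (2 * n * m)" "vsh (ssc (int m) F) \<in> cobO (2 * n * m + 2)"
  and H: "H \<in> cocO (2 * n * m)" "H 0 - scale M (a m) \<in> cob (2 * n * m)" "vsh (ssc (int m) H) \<in> cobO (2 * n * m + 2)"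
  using assms unfolding liftable_def by blast
 have "(ssc j F + ssc k H) 0 - scale (j * N + k * M) (a m) = scale j (F 0 - scale N (a m)) + scale k (H 0 - scale M (a m))"
  unfolding plus_fun_apply ssc_apply by (intro cochain_eqI) (simp add: scale_def algebra_simps)
 moreover have "... \<in> cob (2 * n * m)" by (intro cob_closed(3) scale_cob F(2) H(2))
 moreover have "vsh (ssc (int m) (ssc j F + ssc k H)) = ssc j (vsh (ssc (int m) F)) + ssc k (vsh (ssc (int m) H))"
  unfolding ssc_simps vsh_lin by (simp only: mult.commute)
 moreover have "... \<in> cobO (2 * n * m + 2)" by (intro cobO_closed(3) ssc_cob F(3) H(3))
 moreover have "ssc j F + ssc k H \<in> cocO (2 * n * m)" by (intro cocO_lin(1) ssc_coc F(1) H(1))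
 ultimately show ?thesis unfolding liftable_def by (metis (mono_tags, lifting) mem_Collect_eq)
qed

text \<open>The differential of \<open>b (m - 1)\<close>, without higher terms, is \<upsilon> times
  a cocycle whose leading class is \<open>m a m\<close>. That product with \<upsilon> is already
  exact.\<close>

lemma liftable_self:
 assumes "m > 0"
 shows "int m \<in> liftable m"
proof -
 obtain k where k: "m = Suc k" using assms by (cases m) auto
 let ?F = "lead (b k)"
 have F: "orb_in X (2 * n * k + 2 * n + 1) ?F" by (rule lead_in[OF b_in])
 have DF: "orb_in X (Suc (2 * n * k + 2 * n + 1)) (D ?F)" by (rule orb_diff_in[OF F])
 have D0: "D ?F 0 = 0" by (simp only: orb_diff_zero lead_simps codiff_b)
 define H where "H = (%r. D ?F (Suc r))"
 have v: "D ?F = vsh H" unfolding H_def by (rule vsh_tail[of "D ?F", OF D0])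
 have d: "2 * n * m = 2 * n * k + 2 * n" by (simp add: k)
 have "orb_in X (2 * n * m) H" unfolding H_def d by (rule tail_in) (use DF in simp)
 moreover have "D H = 0"
 proof (rule vsh_inject)
  show "vsh (D H) = vsh 0" unfolding orb_diff_vsh[symmetric] v[symmetric] orb_diff_diff[OF F] by (simp only: ssc_simps)
 qed
 ultimately have H: "H \<in> cocO (2 * n * m)" unfolding cocO_iff by blast
 have "H 0 = codiff LX (lead (b k) (Suc 0)) + omega X 0 (b k)" unfolding H_def using orb_diff_one[of X ?F] by simp
 then have "H 0 = omega X 0 (b k)" unfolding lead_simps codiff_lin by (simp only: add_0)
 then have 1: "H 0 - scale (int m) (a m) \<in> cob (2 * n * m)" using omega_b[of k] unfolding k by (simp only:)
 have "vsh (ssc (int m) H) = ssc (int m) (D ?F)" unfolding v by (simp only: ssc_simps)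
 moreover have "D ?F \<in> cobO (2 * n * m + 2)"
 proof -
  have "2 * n * m + 2 = Suc (2 * n * k + 2 * n + 1)" by (simp add: d)
  then show ?thesis using F cobO_Suc by metis
 qed
 ultimately have "vsh (ssc (int m) H) \<in> cobO (2 * n * m + 2)" using ssc_cob by metis
 then show ?thesis using H 1 unfolding liftable_def by blast
qed

lemma conv_cocO:
 assumes F: "F \<in> cocO (2 * k)" and H: "H \<in> cocO (2 * l)"
 shows "conv LX F H \<in> cocO (2 * k + 2 * l)"
proof -
 have z: "conv LX 0 K = 0" "conv LX K 0 = 0" for K
  by (rule seq_eqI, simp only: conv_def zero_seq cup_lin sum.neutral_const)+
 have "D (conv LX F H) = conv LX (D F) H + (%r. sgn_if (even (2 * k)) (conv LX F (D H) r))"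
  using F H unfolding cocO_iff by (intro orbit_leibniz) blast+
 also have "... = 0"
 proof -
  have "D F = 0" "D H = 0" using F H unfolding cocO_iff by blast+
  then show ?thesis by (intro seq_eqI) (simp only: z plus_fun_apply zero_seq sgn_if_def minus_zero if_cancel add_0)
 qed
 finally show ?thesis using conv_orb_in[of X "2 * k" F "2 * l" H] F H unfolding cocO_iff by blast
qed

lemma conv_cobO:
 "F \<in> cobO (2 * k + 2) ==> H \<in> cocO (2 * l) ==> conv LX F H \<in> cobO (2 * k + 2 * l + 2)"
 "H \<in> cocO (2 * l) ==> F \<in> cobO (2 * k + 2) ==> conv LX H F \<in> cobO (2 * l + 2 * k + 2)"
proof -
 have z: "conv LX 0 K = 0" "conv LX K 0 = 0" for K
  by (rule seq_eqI, simp only: conv_def zero_seq cup_lin sum.neutral_const)+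
 have s: "2 * k + 2 = Suc (2 * k + 1)" by simp
 assume "F \<in> cobO (2 * k + 2)" and H: "H \<in> cocO (2 * l)"
 then obtain K where K: "orb_in X (2 * k + 1) K" "F = D K" unfolding s cobO_Suc by blast
 have H': "orb_in X (2 * l) H" "D H = 0" using H unfolding cocO_iff by blast+
 have "D (conv LX K H) = conv LX (D K) H + (%r. sgn_if (even (2 * k + 1)) (conv LX K (D H) r))"
  by (rule orbit_leibniz[OF K(1) H'(1)])
 also have "... = conv LX F H"
  unfolding H'(2) z K(2) by (intro seq_eqI) (simp only: plus_fun_apply zero_seq sgn_if_def minus_zero if_cancel add_0_right)
 finally have "conv LX F H = D (conv LX K H)" by (rule sym)
 moreover have "2 * k + 2 * l + 2 = Suc (2 * k + 1 + 2 * l)" by simp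
 ultimately show "conv LX F H \<in> cobO (2 * k + 2 * l + 2)" using conv_orb_in[OF K(1) H'(1)] cobO_Suc by metis
 have "D (conv LX H K) = conv LX (D H) K + (%r. sgn_if (even (2 * l)) (conv LX H (D K) r))"
  by (rule orbit_leibniz[OF H'(1) K(1)])
 also have "... = conv LX H F"
  unfolding H'(2) z K(2) by (intro seq_eqI) (simp only: plus_fun_apply zero_seq sgn_if_def add_0 even_mult_iff even_numeral simp_thms if_True)
 finally have "conv LX H F = D (conv LX H K)" by (rule sym)
 moreover have "2 * l + 2 * k + 2 = Suc (2 * l + (2 * k + 1))" by simp
 ultimately show "conv LX H F \<in> cobO (2 * l + 2 * k + 2)" using conv_orb_in[OF H'(1) K(1)] cobO_Suc by metis
qed

lemma orb_in_0: "orb_in X 0 F ==> F = lead (F 0)"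
proof (rule seq_eqI)
 fix r assume F: "orb_in X 0 F"
 show "F r = lead (F 0) r"
 proof (cases r)
  case (Suc s)
  have "F r \<in> cochains LX (if 2 * r \<le> 0 then {0 - 2 * r} else {})" using F unfolding orb_in_def by blast
  then have "F r \<in> cochains LX {}" by (simp add: Suc)
  then show ?thesis unfolding Suc lead_simps cochains_empty .
 qed simp
qed

lemma power_coc: "upsilon_power X k \<in> cocO (2 * k)" "eps k (upsilon_power X k) = 1"
proof -
 have "upsilon_power X k \<in> cocO (2 * k) & eps k (upsilon_power X k) = 1"
 proof (induction k)
  case 0
  obtain F where F: "F \<in> cocO (2 * n * 0)" "F 0 = a 0" using extend_a by blast
  have "orb_in X 0 F" using F(1) unfolding cocO_iff by simp
  from orb_in_0[OF this] have "F = upsilon_power X 0" unfolding upsilon_power_simps F(2) by (simp add: a_def)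
  moreover have "eps 0 (upsilon_power X 0) = 1" using singular_V0 by (simp add: eps_def upsilon_power_simps cube_one_def)
  ultimately show ?case using F(1) by simp
 next
  case (Suc k)
  then show ?case using vsh_coc[of "upsilon_power X k" "2 * k"] by (simp add: upsilon_power_simps eps_lin)
 qed
 then show "upsilon_power X k \<in> cocO (2 * k)" "eps k (upsilon_power X k) = 1" by blast+
qed

text \<open>For \<open>m > 0\<close>, subtracting a multiple of a power of \<upsilon> adjusts the
  augmentation and keeps the leading term.\<close>

lemma extend_a_eps:
 assumes m: "m > 0"
 shows "\<exists>A'\<in>cocO (2 * n * m). A' 0 = a m & eps (n * m) A' = 0"
proof -
 obtain A1 where A1: "A1 \<in> cocO (2 * n * m)" "A1 0 = a m" using extend_a by blast
 define A2 where "A2 = A1 - ssc (eps (n * m) A1) (upsilon_power X (n * m))"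
 have "2 * n * m = 2 * (n * m)" by simp
 then have "upsilon_power X (n * m) \<in> cocO (2 * n * m)" using power_coc(1)[of "n * m"] by metis
 then have "A2 \<in> cocO (2 * n * m)" unfolding A2_def by (intro cocO_lin(2) A1(1) ssc_coc)
 moreover have "A2 0 = a m"
 proof -
  obtain s where s: "n * m = Suc s" using n m by (cases "n * m") auto
  show ?thesis unfolding A2_def s minus_apply ssc_apply upsilon_power_simps vsh_simps scale_simps diff_zero by (rule A1(2))
 qed
 moreover have "eps (n * m) A2 = 0" unfolding A2_def eps_lin power_coc(2) by simp
 ultimately show ?thesis by blast
qed

lemma good_conv:
 assumes F: "good i F" and H: "good j H"
 shows "conv LX F H \<in> cocO (2 * n * (i + j))" "conv LX F H 0 - scale (int ((i + j) choose i)) (a (i + j)) \<in> cob (2 * n * (i + j))"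
  "vsh (ssc (int i) (conv LX F H)) \<in> cobO (2 * n * (i + j) + 2)" "vsh (ssc (int j) (conv LX F H)) \<in> cobO (2 * n * (i + j) + 2)"
  "eps (n * (i + j)) (conv LX F H) = eps (n * i) F * eps (n * j) H"
proof -
 have e: "2 * n * (i + j) = 2 * (n * i) + 2 * (n * j)" "2 * n * i = 2 * (n * i)" "2 * n * j = 2 * (n * j)" "n * (i + j) = n * i + n * j"
  by (simp_all add: algebra_simps)
 note F' = F[unfolded good_def e(2)] and H' = H[unfolded good_def e(3)]
 show "conv LX F H \<in> cocO (2 * n * (i + j))" unfolding e(1) using F' H' by (intro conv_cocO) blast+
 have "conv LX F H 0 = cup LX (a i) (a j)" using F H by (simp add: conv_def good_def)
 then show "conv LX F H 0 - scale (int ((i + j) choose i)) (a (i + j)) \<in> cob (2 * n * (i + j))" using a_cup_a[of i j] by (simp only:)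
 have "vsh (ssc (int i) (conv LX F H)) = conv LX (vsh (ssc (int i) F)) H" unfolding conv_vsh ssc_simps ..
 then show "vsh (ssc (int i) (conv LX F H)) \<in> cobO (2 * n * (i + j) + 2)" using F' H' conv_cobO(1) unfolding e(1) by metis
 have "vsh (ssc (int j) (conv LX F H)) = conv LX F (vsh (ssc (int j) H))" unfolding conv_vsh ssc_simps ..
 then show "vsh (ssc (int j) (conv LX F H)) \<in> cobO (2 * n * (i + j) + 2)" using F' H' conv_cobO(2) unfolding e(1) by metis
 show "eps (n * (i + j)) (conv LX F H) = eps (n * i) F * eps (n * j) H"
  unfolding e(4) using F' H' unfolding cocO_iff by (intro eps_conv) blast+
qed

text \<open>The product of the two lifts is annihilated by both \<open>i\<close> \<upsilon> and
  \<open>j\<close> \<upsilon>, hence by their sum; the binomial coefficient is the one in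
  \<open>a_cup_a\<close>.\<close>

lemma liftable_choose:
 assumes F: "good i F" and H: "good j H"
 shows "int ((i + j) choose i) \<in> liftable (i + j)"
proof -
 have "vsh (ssc (int (i + j)) (conv LX F H)) = vsh (ssc (int i) (conv LX F H)) + vsh (ssc (int j) (conv LX F H))"
  unfolding of_nat_add ssc_simps vsh_lin ..
 also have "... \<in> cobO (2 * n * (i + j) + 2)" by (intro cobO_closed(3) good_conv(3,4)[OF F H])
 finally show ?thesis using good_conv(1,2)[OF F H] unfolding liftable_def by blast
qed

text \<open>The \<open>p\<close>-part of a positive number below \<open>p ^ e\<close> is at most
  \<open>p ^ (e - 1)\<close>. The product of all prime-to-\<open>p\<close> parts serves as
  \<open>u\<close>.\<close>

lemma prime_free_multiple:
 assumes p: "prime (p :: nat)" and e: "e > 0"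
 shows "\<exists>u. \<not> p dvd u & (\<forall>j. 0 < j --> j < p ^ e --> j dvd p ^ (e - 1) * u)"
proof (intro exI conjI allI impI)
 define f where "f j = j div p ^ multiplicity p j" for j
 define u where "u = (\<Prod>j\<in>{0<..<p ^ e}. f j)"
 have f: "j = p ^ multiplicity p j * f j" for j unfolding f_def by (simp add: multiplicity_dvd)
 show "\<not> p dvd u"
 proof
  assume "p dvd u"
  then have "\<exists>j\<in>{0<..<p ^ e}. p dvd f j" unfolding u_def using prime_dvd_prod_iff[of "{0<..<p ^ e}" p f] p by simp
  then obtain j where j: "j > 0" "p dvd f j" by auto
  have "\<not> is_unit p" using p not_prime_unit by blast
  then show False using multiplicity_decompose[of j p] j unfolding f_def by simp
 qed
 fix j assume j: "0 < j" "j < p ^ e"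
 have "p ^ multiplicity p j \<le> j" using j(1) by (intro dvd_imp_le multiplicity_dvd)
 then have "p ^ multiplicity p j < p ^ e" using j(2) by simp
 then have "multiplicity p j < e" using power_less_imp_less_exp[OF prime_gt_1_nat[OF p]] by blast
 then have "p ^ multiplicity p j dvd p ^ (e - 1)" by (intro le_imp_power_dvd) simp
 moreover have "f j dvd u" unfolding u_def using j by (intro dvd_prodI) auto
 ultimately have "p ^ multiplicity p j * f j dvd p ^ (e - 1) * u" by (rule mult_dvd_mono)
 then show "j dvd p ^ (e - 1) * u" using f[of j] by metis
qed

text \<open>In the critical case \<open>m = p ^ e\<close> the product of the lifts of \<open>a (p ^ (e - 1))\<close> and \<open>a (m - p ^ (e - 1))\<close> has leading
 coefficient divisible by \<open>p\<close> exactly once, but it is already annihilated by \<open>p ^ (e - 1) \<upsilon>\<close>.\<close>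

lemma liftable_prime_power:
 assumes IH: "!!j. 0 < j ==> j < m ==> \<exists>F. good j F" and p: "prime p" and e: "e > 0" and m: "m = p ^ e"
 shows "\<exists>N\<in>liftable m. \<not> int p dvd N"
proof -
 define q where "q = p ^ (e - 1)"
 have mq: "m = p * q" using e unfolding m q_def by (cases e) auto
 have p1: "p > 1" by (rule prime_gt_1_nat[OF p])
 have q: "0 < q" "q < m" using p1 unfolding mq by (auto simp: q_def)
 have mm: "q + (m - q) = m" using q by simp
 obtain F where F: "good q F" using IH q by blast
 obtain H where H: "good (m - q) H" using IH[of "m - q"] q by auto
 define E where "E = conv LX F H"
 note E = good_conv[OF F H, unfolded mm, folded E_def]
 \<comment> \<open>The binomial coefficient of \<open>p * q\<close> over a power \<open>q\<close> of
   \<open>p\<close> has the same multiplicity at \<open>p\<close> as the cofactor \<open>p\<close>,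
   namely one.\<close>
 define N where "N = m choose q"
 have "multiplicity p N = multiplicity p p" unfolding N_def mq using const_p_fac[OF _ p, of p "e - 1"] p1 by (simp add: q_def mult.commute)
 also have "... = 1" using p1 p by (intro multiplicity_self) (auto simp: prime_nat_iff)
 finally have "multiplicity p N = 1" .
 moreover have "N ~= 0" using q unfolding N_def by simp
 moreover have "\<not> is_unit p" using p not_prime_unit by blast
 ultimately obtain s where s: "N = p * s" "\<not> p dvd s" using multiplicity_decompose'[of N p] by (metis power_one_right)
 obtain u where u: "\<not> p dvd u" "!!j. 0 < j ==> j < m ==> j dvd q * u"
  using prime_free_multiple[OF p e] unfolding q_def m by blast
 define t where "t = int (q * u)"
 obtain A1 where A1: "A1 \<in> cocO (2 * n * m)" "A1 0 = a m" "eps (n * m) A1 = 0" using extend_a_eps[of m] q by auto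
 \<comment> \<open>The product and \<open>N\<close> times a lift of \<open>a m\<close> have the same
   leading class and the same augmentation, so their difference strips to a cocycle covered by
   \<open>torsion\<close>, and \<open>t\<close> makes it exact.\<close>
 define T where "T = E - ssc (int N) A1"
 have T: "T \<in> cocO (2 * n * m)" unfolding T_def by (intro cocO_lin(2) E(1) ssc_coc A1(1))
 have "T 0 = E 0 - scale (int N) (a m)" unfolding T_def minus_apply ssc_apply A1(2) ..
 then have T0: "T 0 \<in> cob (2 * n * m)" using E(2) unfolding N_def by (simp only:)
 have "eps (n * m) T = 0" unfolding T_def eps_lin E(5) A1(3) using good_eps[OF F q(1)] by simp
 note eT = this
 have "ssc t T \<in> cobO (2 * n * m)" using strip[OF T T0]
 proof (elim disjE exE conjE)
  fix d F' assume d: "2 * n * m = d + 2" "F' \<in> cocO d" "T - vsh F' \<in> cobO (2 * n * m)"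
  obtain k where k: "n * m = Suc k" using n q by (cases "n * m") auto
  have dk: "d = 2 * k" using d(1) k by simp
  have "2 * n * m = 2 * Suc k" using k by simp
  then have "eps (Suc k) (T - vsh F') = 0" using d(3) eps_cob by metis
  then have "eps k F' = 0" using eT by (simp add: eps_lin k)
  moreover have "int j dvd t" if "0 < j" "j < m" for j unfolding t_def int_dvd_int_iff by (rule u(2)[OF that])
  ultimately have "vsh (ssc t F') \<in> cobO (2 * k + 2)" using d(2) k unfolding dk by (intro torsion[OF IH]) auto
  then have 1: "vsh (ssc t F') \<in> cobO (2 * n * m)" unfolding d(1) dk .
  have "ssc t T = ssc t (T - vsh F') + vsh (ssc t F')" unfolding ssc_simps by (simp only: diff_add_cancel)
  then show ?thesis using cobO_closed(3)[OF ssc_cob[OF d(3)] 1] by (simp only:)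
 qed (rule ssc_cob)
 note 1 = vsh_cob[OF this]
 have "vsh (ssc t E) = ssc (int u) (vsh (ssc (int q) E))" unfolding ssc_simps t_def of_nat_mult by (simp only: mult.commute)
 then have 2: "vsh (ssc t E) \<in> cobO (2 * n * m + 2)" using ssc_cob[OF E(3), of "int u"] by (simp only:)
 \<comment> \<open>The single factor \<open>p\<close> of \<open>N\<close> makes up for the one
   missing in \<open>q\<close>; hence the prime-to-\<open>p\<close> number \<open>u * s\<close> is
   liftable.\<close>
 have tN: "int m * int (u * s) = t * int N" unfolding t_def mq s(1) by simp
 have "vsh (ssc (int m) (ssc (int (u * s)) A1)) = vsh (ssc t E) - vsh (ssc t T)"
  unfolding T_def ssc_simps vsh_lin tN by (simp only: diff_diff_eq2 add_diff_cancel_left')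
 then have "vsh (ssc (int m) (ssc (int (u * s)) A1)) \<in> cobO (2 * n * m + 2)" using cobO_closed(2)[OF 2 1] by (simp only:)
 moreover have "ssc (int (u * s)) A1 \<in> cocO (2 * n * m)" by (rule ssc_coc[OF A1(1)])
 moreover have "ssc (int (u * s)) A1 0 - scale (int (u * s)) (a m) \<in> cob (2 * n * m)"
  unfolding ssc_apply A1(2) diff_self by (rule cob_closed(1))
 ultimately have "int (u * s) \<in> liftable m" unfolding liftable_def by blast
 moreover have "\<not> int p dvd int (u * s)" unfolding int_dvd_int_iff using u(1) s(2) prime_dvd_mult_iff[OF p] by blast
 ultimately show ?thesis by blast
qed

text \<open>If \<open>m\<close> is not a power of \<open>p\<close>, let \<open>q\<close> be its full
  \<open>p\<close>-part. Then \<open>m choose q\<close> is prime to \<open>p\<close>, and the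
  product of good lifts for \<open>q\<close> and \<open>m - q\<close> is enough.\<close>

lemma liftable_prime:
 assumes IH: "!!j. 0 < j ==> j < m ==> \<exists>F. good j F" and p: "prime p" "p dvd m" and m: "m > 0"
 shows "\<exists>N\<in>liftable m. \<not> int p dvd N"
proof -
 have nu: "\<not> is_unit p" using p not_prime_unit by blast
 define e where "e = multiplicity p m"
 obtain k where k: "m = p ^ e * k" "\<not> p dvd k" using multiplicity_decompose'[of m p] nu m unfolding e_def by (metis less_not_refl)
 have e0: "e > 0" using p(2) k by (cases e) auto
 show ?thesis
 proof (cases "k = 1")
  case True
  then show ?thesis using liftable_prime_power[OF IH p(1) e0] k(1) by simp
 next
  case False
  define q where "q = p ^ e"
  have "k > 1" using False m k(1) by (cases k) auto
  then have q: "0 < q" "q < m" using k(1) m by (auto simp: q_def)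
  have mm: "q + (m - q) = m" using q by simp
  obtain F where F: "good q F" using IH q by blast
  obtain H where H: "good (m - q) H" using IH[of "m - q"] q by auto
  have "multiplicity p (m choose q) = multiplicity p k" unfolding k(1) q_def using const_p_fac[OF _ p(1), of k e] \<open>k > 1\<close> by simp
  also have "... = 0" using k(2) by (rule not_dvd_imp_multiplicity_0)
  finally have "multiplicity p (m choose q) = 0" .
  moreover have "m choose q ~= 0" using q by simp
  ultimately have "\<not> p dvd (m choose q)" using nu by (simp add: multiplicity_eq_zero_iff)
  then show ?thesis using liftable_choose[OF F H] unfolding mm by (metis int_dvd_int_iff)
 qed
qed

lemma good_exists: "\<exists>F. good m F"
proof (induction m rule: less_induct)
 case (less m)
 show ?case
 proof (cases "m = 0")
  case True
  obtain F where "F \<in> cocO (2 * n * m)" "F 0 = a m" using extend_a by blast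
  then show ?thesis unfolding good_def True of_nat_0 ssc_simps using cobO_closed(1) by blast
 next
  case False
  have "1 \<in> liftable m"
  proof (rule multiple_ideal[where m = m])
   show "!!j k x y. x \<in> liftable m ==> y \<in> liftable m ==> j * x + k * y \<in> liftable m" by (rule liftable_lin)
   show "int m \<in> liftable m" "m > 0" using False liftable_self by blast+
   show "!!p. prime p ==> p dvd m ==> \<exists>x\<in>liftable m. \<not> int p dvd x" using liftable_prime[of m] less.IH False by blast
  qed
  then obtain F where F: "F \<in> cocO (2 * n * m)" "F 0 - a m \<in> cob (2 * n * m)" "vsh (ssc (int m) F) \<in> cobO (2 * n * m + 2)"
   unfolding liftable_def mem_Collect_eq scale_simps by blast
  obtain d where d: "2 * n * m = Suc d" using False n by (cases "2 * n * m") auto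
  \<comment> \<open>So far the leading term is \<open>a m\<close> only up to a coboundary, which is
    now removed exactly.\<close>
  obtain w where w: "w \<in> cochains LX {d}" "F 0 - a m = codiff LX w" using F(2) unfolding d cob_CU by blast
  have b: "D (lead w) \<in> cobO (2 * n * m)" unfolding d cobO_Suc using lead_in[OF w(1)] by blast
  have "F - D (lead w) \<in> cocO (2 * n * m)" by (rule cocO_lin(2)[OF F(1) cobO_closed(4)[OF b]])
  moreover have "(F - D (lead w)) 0 = a m"
   unfolding minus_apply orb_diff_zero lead_simps w(2)[symmetric] by (simp only: diff_diff_eq2 add_diff_cancel_left')
  moreover have "vsh (ssc (int m) (F - D (lead w))) \<in> cobO (2 * n * m + 2)"
   unfolding ssc_simps(3) vsh_lin by (intro cobO_closed(2) F(3) vsh_cob ssc_cob b)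
  ultimately show ?thesis unfolding good_def by blast
 qed
qed

text \<open>A primitive of \<open>(m + 1)\<close> \<upsilon> \<open>F\<close> has a closed leading
  term, cohomologous to some \<open>k b m\<close>. Its next coefficient makes
  \<open>(1 - k)(m + 1) a (m + 1)\<close> exact, so \<open>k = 1\<close>, and a coboundary corrects
  the leading term to \<open>b m\<close>.\<close>

lemma good_bound:
 assumes F: "good (Suc m) F"
 shows "\<exists>B. orb_in X (2 * n * m + 2 * n + 1) B & B 0 = b m & D B = vsh (ssc (int (Suc m)) F)"
proof -
 let ?p = "2 * n * m + 2 * n"
 have d: "2 * n * Suc m = ?p" by simp
 have "2 * n * Suc m + 2 = Suc (?p + 1)" by simp
 then obtain K where K: "orb_in X (?p + 1) K" "vsh (ssc (int (Suc m)) F) = D K" using F cobO_Suc unfolding good_def by metis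
 have K0: "K 0 \<in> cochains LX {?p + 1}" and K1: "K 1 \<in> cochains LX {?p + 1 - 2}"
 proof -
  have "K r \<in> cochains LX (if 2 * r \<le> ?p + 1 then {?p + 1 - 2 * r} else {})" for r using K(1) unfolding orb_in_def by blast
  from this[of 0] this[of 1] show "K 0 \<in> cochains LX {?p + 1}" "K 1 \<in> cochains LX {?p + 1 - 2}" using n by simp_all
 qed
 have "D K 0 = 0" unfolding K(2)[symmetric] by (rule vsh_simps)
 then have "K 0 \<in> cocycles (CU LX) (?p + 1)" using K0 unfolding cocycles_CU orb_diff_zero by blast
 then obtain k where k: "K 0 - scale k (b m) \<in> cob (?p + 1)" using class_b by blast
 have F0: "F 0 = a (Suc m)" using F unfolding good_def by blast
 have "D K (Suc 0) = scale (int (Suc m)) (a (Suc m))"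
  unfolding K(2)[symmetric] vsh_simps ssc_apply F0 ..
 then have 1: "codiff LX (K 1) + omega X 0 (K 0) = scale (int (Suc m)) (a (Suc m))"
  using orb_diff_one[of X K] by (simp only: One_nat_def)
 obtain q where q: "?p = Suc q" using n by (cases ?p) auto
 have "K 1 \<in> cochains LX {q}" using K1 q by simp
 then have 2: "codiff LX (K 1) \<in> cob ?p" unfolding q cob_CU by blast
 have 3: "omega X 0 (K 0) - scale k (omega X 0 (b m)) \<in> cob ?p"
  using coboundaries_omega[of "K 0 - scale k (b m)" X ?p] k unfolding omega_lin by simp
 have 4: "scale k (omega X 0 (b m)) - scale k (scale (int (Suc m)) (a (Suc m))) \<in> cob ?p"
  using scale_cob[OF omega_b[of m, unfolded d], of k] unfolding scale_add(6) .
 have "scale (int (Suc m)) (a (Suc m)) - scale k (scale (int (Suc m)) (a (Suc m)))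
  = codiff LX (K 1) + ((omega X 0 (K 0) - scale k (omega X 0 (b m))) + (scale k (omega X 0 (b m)) - scale k (scale (int (Suc m)) (a (Suc m)))))"
  unfolding 1[symmetric] by (simp only: diff_add_cancel add_diff_eq)
 also have "... \<in> cob ?p" by (intro cob_closed(3) 2 3 4)
 also have "scale (int (Suc m)) (a (Suc m)) - scale k (scale (int (Suc m)) (a (Suc m))) = scale ((1 - k) * int (Suc m)) (a (Suc m))"
  by (intro cochain_eqI) (simp add: scale_def algebra_simps)
 finally have "(1 - k) * int (Suc m) = 0" unfolding d[symmetric] by (rule free_a)
 then have "k = 1" by simp
 then have "K 0 - b m \<in> cob (Suc ?p)" using k by simp
 then obtain w where w: "w \<in> cochains LX {?p}" "K 0 - b m = codiff LX w" unfolding cob_CU by blast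
 note l = lead_in[OF w(1)]
 have "orb_in X (?p + 1) (K - D (lead w))" using orb_in_lin(2)[OF K(1)] orb_diff_in[OF l] by simp
 moreover have "(K - D (lead w)) 0 = b m"
  unfolding minus_apply orb_diff_zero lead_simps w(2)[symmetric] by (simp only: diff_diff_eq2 add_diff_cancel_left')
 moreover have "D (K - D (lead w)) = vsh (ssc (int (Suc m)) F)"
  unfolding orb_diff_lin orb_diff_diff[OF l] K(2) by (rule diff_zero)
 ultimately show ?thesis by blast
qed

end

section \<open>The quasi-isomorphism\<close>

lemma diff_split_middle: "k - (p + q) = (k - p - l) + (l - (q :: 'a :: ab_group_add))"
 by simp

type_synonym ochain = "nat \<times> letter \<times> letter list \<Rightarrow>\<^sub>0 int"

context sphere_loops
begin

lemma good_0: "good 0 (upsilon_power X 0)"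
 using power_coc(1)[of 0, unfolded upsilon_power_simps] cobO_closed(1)[of "2 * n * 0 + 2"]
 unfolding good_def of_nat_0 ssc_simps upsilon_power_simps lead_simps by (simp only: a_def mult_0_right simp_thms if_True)

text \<open>The unit is chosen for \<open>m = 0\<close>, in order that the map restricts to the
  inclusion of the powers of \<upsilon>.\<close>

definition "AA m = (if m = 0 then upsilon_power X 0 else SOME F. good m F)"
definition "BB m = (SOME B. orb_in X (2 * n * m + 2 * n + 1) B & B 0 = b m & D B = vsh (ssc (int (Suc m)) (AA (Suc m))))"

lemma good_AA: "good m (AA m)"
proof (cases "m = 0")
 case False
 then show ?thesis using someI_ex[OF good_exists[of m]] by (simp only: AA_def if_False)
qed (simp only: AA_def good_0 if_True simp_thms)

lemma AA: "orb_in X (2 * n * m) (AA m)" "D (AA m) = 0" "AA m 0 = a m"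
 using good_AA[of m] unfolding good_def cocO_iff by blast+

lemma BB: "orb_in X (2 * n * m + 2 * n + 1) (BB m)" "BB m 0 = b m" "D (BB m) = vsh (ssc (int (Suc m)) (AA (Suc m)))"
 using someI_ex[OF good_bound[OF good_AA[of "Suc m"]]] unfolding BB_def[symmetric] by blast+

abbreviation "OM \<equiv> orbit_model A sphere_star"

definition "og p = {(k, x). \<exists>q. x \<in> gen q & p = 2 * k + q}"

lemma comp_OM: "comp (complex_of OM) p = {x. keys x \<subseteq> og p}"
proof -
 have "x \<in> gen q \<longleftrightarrow> x \<in> bas TM & deg TM x = q" for x q
  using comp_frag(1)[of x TM q] unfolding comp_TM by simp
 then have "{x \<in> bas OM. deg OM x = p} = og p" by (auto simp: orbit_model_def og_def)
 then show ?thesis by (simp add: complex_of_def)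
qed

lemma og_cases [consumes 1]:
 assumes "x \<in> og p"
 obtains (even) k m where "x = (k, unt A, sz n m)" "p = 2 * k + 2 * n * m" | (odd) k m where "x = (k, g, sz n m)" "p = 2 * k + (2 * n * m + 2 * n + 1)"
 using assms unfolding og_def gen_def by blast

lemma dif_OM: "dif OM (k, unt A, sz n m) = 0" "dif OM (k, g, sz n m) = frag_cmul (int (Suc m)) (frag_of (Suc k, unt A, sz n (Suc m)))"
proof -
 have "(unt A, sz n m) \<in> bas TM" "(g, sz n m) \<in> bas TM" by (auto simp: bas_TM(1))
 then have "dif TM (unt A, sz n m) = 0" "dif TM (g, sz n m) = 0" using thin_dif_zero[OF n] by blast+
 then show "dif OM (k, unt A, sz n m) = 0" "dif OM (k, g, sz n m) = frag_cmul (int (Suc m)) (frag_of (Suc k, unt A, sz n (Suc m)))"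
  unfolding orbit_model_def using S_op_sphere[OF n, of m]
  by (simp_all only: based.simps prod.case frag_extend_0 add_0 Suc_eq_plus1 frag_extend_cmul frag_extend_of) (simp add: S_op_def)
qed

lemma keys_extend: "keys x \<subseteq> S ==> (!!y. y \<in> S ==> keys (f y) \<subseteq> T) ==> keys (frag_extend f x) \<subseteq> T"
 using keys_frag_extend[of f x] by blast

lemma dif_OM_keys:
 assumes "x \<in> og p"
 shows "keys (dif OM x) \<subseteq> og (Suc p)"
 using assms
proof (cases x p rule: og_cases)
 case (odd k m)
 have "(unt A, sz n (Suc m)) \<in> gen (2 * n * Suc m)" unfolding gen_a by blast
 moreover have "Suc p = 2 * Suc k + 2 * n * Suc m" by (simp add: odd(2))
 ultimately have "(Suc k, unt A, sz n (Suc m)) \<in> og (Suc p)" unfolding og_def by blast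
 moreover have "keys (frag_cmul (int (Suc m)) (frag_of (Suc k, unt A, sz n (Suc m)))) \<subseteq> {(Suc k, unt A, sz n (Suc m))}"
  using keys_cmul[of "int (Suc m)" "frag_of (Suc k, unt A, sz n (Suc m))"] by (simp only: keys_frag_of)
 ultimately show ?thesis unfolding odd(1) dif_OM by blast
qed (simp_all add: dif_OM)

lemma diff_OM: "diff (complex_of OM) = frag_extend (dif OM)"
 by (simp add: complex_of_def)

lemma is_cochain_complex_OM: "is_cochain_complex (complex_of OM)"
proof -
 have "frag_extend (dif OM) (frag_extend (dif OM) x) = 0" if "keys x \<subseteq> og p" for x p
  using that
 proof (induction rule: frag_induction)
  case (one x)
  then show ?case by (cases x p rule: og_cases) (simp_all add: dif_OM frag_extend_cmul del: replicate_Suc)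
 qed (simp_all add: frag_extend_diff)
 moreover have "keys (frag_extend (dif OM) x) \<subseteq> og (Suc p)" if "keys x \<subseteq> og p" for x p
  by (rule keys_extend[OF that dif_OM_keys])
 moreover have "keys (x - y) \<subseteq> og p" if "keys x \<subseteq> og p" "keys y \<subseteq> og p" for x y p
  using keys_diff[of x y] that by blast
 ultimately show ?thesis unfolding is_cochain_complex_def comp_OM diff_OM mem_Collect_eq frag_extend_diff
  by (intro allI conjI ballI) (simp_all only: mem_Collect_eq keys_zero empty_subsetI)
qed

definition phi :: "nat \<times> letter \<times> letter list => nat => (complex => nat => real) cochain" where
 "phi = (%(k, y, w). (vsh ^^ k) (if y = unt A then AA (length w) else BB (length w)))"
definition "Phi x = (%r. lin_ext (%i. phi i r) x)"

lemma unt_not_g: "g ~= unt A" using n by (simp add: sphere_gen_def sphere_cochains_unt)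

lemma phi_simps: "phi (k, unt A, sz n m) = (vsh ^^ k) (AA m)" "phi (k, g, sz n m) = (vsh ^^ k) (BB m)" "phi (Suc k, y) = vsh (phi (k, y))"
 using unt_not_g by (simp_all add: phi_def case_prod_unfold)

lemma Phi_simps: "Phi (frag_of i) = phi i" "Phi 0 = 0" "Phi (x + y) = Phi x + Phi y" "Phi (frag_cmul c x) = ssc c (Phi x)" "Phi (x - y) = Phi x - Phi y"
proof -
 show "Phi (frag_of i) = phi i" "Phi 0 = 0" by (rule seq_eqI; simp only: Phi_def lin_ext_of lin_ext_zero zero_seq)+
 show a: "Phi (x + y) = Phi x + Phi y" for x y by (rule seq_eqI) (simp only: Phi_def lin_ext_add plus_fun_apply)
 show "Phi (frag_cmul c x) = ssc c (Phi x)" for x by (rule seq_eqI) (simp only: Phi_def lin_ext_cmul ssc_apply)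
 show "Phi (x - y) = Phi x - Phi y" using a[of "x - y" y] by (simp only: diff_add_cancel eq_diff_eq)
qed

lemma vsh_power: "orb_in X p F ==> orb_in X (2 * k + p) ((vsh ^^ k) F)" "D ((vsh ^^ k) F) = (vsh ^^ k) (D F)" "(vsh ^^ k) (0 :: nat => (complex => nat => real) cochain) = 0"
 "(vsh ^^ k) (ssc c F) = ssc c ((vsh ^^ k) F)"
proof -
 show "orb_in X p F ==> orb_in X (2 * k + p) ((vsh ^^ k) F)"
 proof (induction k)
  case (Suc k)
  then show ?case using vsh_in[of X "2 * k + p" "(vsh ^^ k) F"] by simp
 qed simp
 show "D ((vsh ^^ k) F) = (vsh ^^ k) (D F)" by (induction k) (simp_all only: funpow.simps o_apply id_apply orb_diff_vsh)
 show "(vsh ^^ k) (0 :: nat => (complex => nat => real) cochain) = 0" by (induction k) (simp_all only: funpow.simps o_apply id_apply ssc_simps)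
 show "(vsh ^^ k) (ssc c F) = ssc c ((vsh ^^ k) F)" by (induction k) (simp_all only: funpow.simps o_apply id_apply ssc_simps)
qed

lemma Phi_in: "keys x \<subseteq> og p ==> orb_in X p (Phi x)"
proof (induction rule: frag_induction)
 case (one x)
 then show ?case
 proof (cases x p rule: og_cases)
  case (even k m)
  show ?thesis unfolding even Phi_simps phi_simps by (rule vsh_power(1)[OF AA(1)])
 next
  case (odd k m)
  show ?thesis unfolding odd Phi_simps phi_simps by (rule vsh_power(1)[OF BB(1)])
 qed
next
 case (diff x y)
 then show ?case unfolding Phi_simps by (rule orb_in_lin(2))
qed (simp only: Phi_simps orb_in_lin(5))

lemma D_Phi: "keys x \<subseteq> og p ==> D (Phi x) = Phi (frag_extend (dif OM) x)"
proof (induction rule: frag_induction)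
 case (one x)
 then show ?case
 proof (cases x p rule: og_cases)
  case (even k m)
  show ?thesis unfolding even(1) Phi_simps phi_simps frag_extend_of dif_OM vsh_power AA(2) ..
 next
  case (odd k m)
  show ?thesis unfolding odd(1) Phi_simps phi_simps frag_extend_of dif_OM vsh_power BB(3) phi_simps(3)[symmetric]
   by (simp only: phi_simps ssc_simps(5)[symmetric] vsh_power(4) funpow_swap1[symmetric] funpow.simps o_apply)
 qed
next
 case (diff x y)
 show ?case unfolding Phi_simps orb_diff_lin frag_extend_diff diff.IH ..
next
 case zero
 have "D 0 = 0" using orb_diff_lin(2)[of X 0 0] by (simp only: diff_self)
 then show ?case by (simp only: Phi_simps frag_extend_0)
qed

lemma cochain_map_Phi: "cochain_map (complex_of OM) (orbit_cochains X) Phi"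
 unfolding cochain_map_def comp_OM comp_orbit diff_OM mem_Collect_eq
 using Phi_in D_Phi Phi_simps(3) by (intro allI conjI ballI) (simp_all only: mem_Collect_eq)

section \<open>Division by \<upsilon> in the model\<close>

abbreviation (input) "proj \<equiv> orbit_model_proj :: ochain => _"
definition incl :: "(letter \<times> letter list \<Rightarrow>\<^sub>0 int) => ochain" where "incl = frag_extend (%y. frag_of (0, y))"
definition up :: "ochain => ochain" where "up = frag_extend (%(k, y). frag_of (Suc k, y))"
definition down :: "ochain => ochain" where
 "down = frag_extend (%(k, y). case k of 0 => 0 | Suc j => frag_of (j, y))"

lemma split: "x = incl (proj x) + up (down x)"
proof -
 have "keys x \<subseteq> UNIV" by simp
 then show ?thesis
 proof (induction rule: frag_induction)
  case (one x)
  obtain k y where "x = (k, y)" by (cases x)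
  then show ?case by (cases k) (simp_all add: incl_def up_def down_def orbit_model_proj_def)
 next
  case (diff x y)
  have "incl (proj (x - y)) + up (down (x - y)) = (incl (proj x) + up (down x)) - (incl (proj y) + up (down y))"
   by (simp add: incl_def up_def down_def orbit_model_proj_def frag_extend_diff)
  then show ?case by (simp only: diff.IH[symmetric])
 qed (simp add: incl_def up_def down_def orbit_model_proj_def)
qed

lemma proj_incl: "proj (incl y) = y" "proj (up x) = 0" "proj (x - z) = proj x - proj z" "incl 0 = 0" "up 0 = 0"
proof -
 have "keys y \<subseteq> UNIV" by simp
 then show "proj (incl y) = y"
  by (induction rule: frag_induction) (simp_all add: incl_def orbit_model_proj_def frag_extend_diff)
 have "keys x \<subseteq> UNIV" by simp
 then show "proj (up x) = 0"
  by (induction rule: frag_induction) (simp_all add: up_def orbit_model_proj_def frag_extend_diff case_prod_unfold)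
qed (simp_all add: incl_def up_def orbit_model_proj_def frag_extend_diff)

lemma shift_keys: "keys x \<subseteq> og p ==> keys (proj x) \<subseteq> gen p" "keys x \<subseteq> og p ==> keys (up x) \<subseteq> og (p + 2)"
 "keys x \<subseteq> og (p + 2) ==> keys (down x) \<subseteq> og p" "p < 2 ==> keys x \<subseteq> og p ==> down x = 0"
 "keys y \<subseteq> gen p ==> keys (incl y) \<subseteq> og p"
proof -
 show "keys x \<subseteq> og p ==> keys (proj x) \<subseteq> gen p"
  unfolding orbit_model_proj_def by (rule keys_extend) (auto simp: og_def split: if_splits)
 show "keys x \<subseteq> og p ==> keys (up x) \<subseteq> og (p + 2)"
  unfolding up_def by (rule keys_extend) (auto simp: og_def)
 show "keys x \<subseteq> og (p + 2) ==> keys (down x) \<subseteq> og p"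
  unfolding down_def by (rule keys_extend) (auto simp: og_def split: nat.splits)
 have "keys (down x) \<subseteq> {}" if "p < 2" "keys x \<subseteq> og p"
  unfolding down_def using that(2) by (rule keys_extend) (use that(1) in \<open>auto simp: og_def split: nat.splits\<close>)
 then show "p < 2 ==> keys x \<subseteq> og p ==> down x = 0" by simp
 show "keys y \<subseteq> gen p ==> keys (incl y) \<subseteq> og p"
  unfolding incl_def by (rule keys_extend) (auto simp: og_def)
qed

lemma up_props: "Phi (up x) = vsh (Phi x)" "keys x \<subseteq> og p ==> frag_extend (dif OM) (up x) = up (frag_extend (dif OM) x)" "up x = 0 ==> x = 0"
proof -
 have S: "keys x \<subseteq> UNIV" by simp
 then show "Phi (up x) = vsh (Phi x)"
 proof (induction rule: frag_induction)
  case (one x)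
  obtain k y where x: "x = (k, y)" by (cases x)
  show ?case unfolding x by (simp only: up_def frag_extend_of prod.case Phi_simps phi_simps)
 next
  case (diff x y)
  then show ?case by (simp only: up_def frag_extend_diff Phi_simps vsh_lin)
 qed (simp only: up_def frag_extend_0 Phi_simps ssc_simps)
 show "frag_extend (dif OM) (up x) = up (frag_extend (dif OM) x)" if "keys x \<subseteq> og p"
  using that
 proof (induction rule: frag_induction)
  case (one x)
  then show ?case
   by (cases x p rule: og_cases) (simp_all add: up_def dif_OM frag_extend_cmul del: replicate_Suc)
 qed (simp_all add: up_def frag_extend_diff)
 have "down (up x) = x" using S
  by (induction rule: frag_induction) (simp_all add: up_def down_def frag_extend_diff case_prod_unfold)
 then show "up x = 0 ==> x = 0" by (metis down_def frag_extend_0)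
qed

lemma Ups_map: "cochain_map (complex_of TM) (CU LX) Ups"
 using Ups_quasi_iso unfolding quasi_iso_def by blast

lemma Phi_lead: "keys x \<subseteq> og p ==> Phi x 0 = Ups (proj x)"
proof -
 note U = cmap_simps[OF Ups_map complexes(8), unfolded comp_TM mem_Collect_eq]
 assume "keys x \<subseteq> og p"
 then have "keys x \<subseteq> og p & Phi x 0 = Ups (proj x)"
 proof (induction rule: frag_induction)
  case zero
  show ?case unfolding Phi_simps orbit_model_proj_def frag_extend_0 U(4) by (simp only: zero_seq) simp
 next
  case (one x)
  have v: "(vsh ^^ k) F 0 = (if k = 0 then F 0 else 0)" for k and F :: "nat => (complex => nat => real) cochain"
   by (cases k) (simp_all only: funpow.simps o_apply id_apply vsh_simps if_True simp_thms nat.distinct if_False)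
  have "Phi (frag_of x) 0 = Ups (proj (frag_of x))"
   using one
  proof (cases x p rule: og_cases)
   case (even k m)
   show ?thesis unfolding even(1) Phi_simps phi_simps v AA(3) orbit_model_proj_def frag_extend_of prod.case
    by (cases "k = 0") (simp_all only: if_True if_False simp_thms Ups_unt U(4))
  next
   case (odd k m)
   show ?thesis unfolding odd(1) Phi_simps phi_simps v BB(2) orbit_model_proj_def frag_extend_of prod.case
    by (cases "k = 0") (simp_all only: if_True if_False simp_thms Ups_g U(4))
  qed
  then show ?case using one by simp
 next
  case (diff x y)
  have "keys (x - y) \<subseteq> og p" using diff keys_diff[of x y] by blast
  moreover have "Ups (proj x - proj y) = Ups (proj x) - Ups (proj y)" using diff by (intro U(5)[where p = p] shift_keys(1)) blast+
  then have "Phi (x - y) 0 = Ups (proj (x - y))" using diff unfolding Phi_simps proj_incl minus_apply by simp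
  ultimately show ?case by blast
 qed
 then show "Phi x 0 = Ups (proj x)" by blast
qed

text \<open>The cone of \<open>Phi\<close> is acyclic: strip the part of \<open>\<upsilon>\<close>-degree zero with \<open>Ups\<close> and divide by \<open>\<upsilon>\<close>.\<close>

lemma Phi_cone:
 "keys x \<subseteq> og (Suc p) ==> frag_extend (dif OM) x = 0 ==> orb_in X p K ==> Phi x = D K ==>
  \<exists>w. keys w \<subseteq> og p & x = frag_extend (dif OM) w & K - Phi w \<in> cobO p"
proof (induction p arbitrary: x K rule: less_induct)
 case (less p)
 let ?d = "frag_extend (dif OM)"
 note x = less.prems(1,2) and K = less.prems(3,4)
 have K0: "K 0 \<in> cochains LX {p}"
 proof -
  have "K 0 \<in> cochains LX (if 2 * 0 \<le> p then {p - 2 * 0} else {})" using K(1) unfolding orb_in_def by blast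
  then show ?thesis by simp
 qed
 have e0: "Ups (proj x) = codiff LX (K 0)" using Phi_lead[OF x(1)] K(2) orb_diff_zero by metis
 \<comment> \<open>The leading part of \<open>x\<close> goes to a coboundary under
   \<open>Ups\<close>, and the thin model has zero differential, so the leading part itself is
   zero.\<close>
 have p0: "proj x = 0"
  by (rule cohomology_LX_free[OF shift_keys(1)[OF x(1)]]) (use e0 K0 cob_CU in blast)
 have U0: "Ups 0 = 0" by (rule cmap_simps(4)[OF Ups_map complexes(8)])
 have "K 0 \<in> cocycles (CU LX) p" unfolding cocycles_CU using K0 e0[unfolded p0 U0] by (intro conjI) (assumption, rule sym)
 then obtain y where y: "keys y \<subseteq> gen p" "K 0 - Ups y \<in> cob p" using cohomology_LX by blast
 define w0 where "w0 = incl y"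
 have w0: "keys w0 \<subseteq> og p" "proj w0 = y" unfolding w0_def using shift_keys(5)[OF y(1)] proj_incl(1) by blast+
 have w0': "keys (?d w0) \<subseteq> og (Suc p)" by (rule keys_extend[OF w0(1) dif_OM_keys])
 have dd: "?d (?d w0) = 0" using is_cochain_complex_OM w0(1) unfolding is_cochain_complex_def comp_OM diff_OM by blast
 define x1 where "x1 = x - ?d w0"
 have x1: "keys x1 \<subseteq> og (Suc p)" "?d x1 = 0"
  unfolding x1_def using keys_diff[of x "?d w0"] x(1) w0' by (blast, simp add: frag_extend_diff x(2) dd)
 define K1 where "K1 = K - Phi w0"
 have K1: "orb_in X p K1" "Phi x1 = D K1" "K1 0 \<in> cob p"
 proof -
  show "orb_in X p K1" unfolding K1_def by (intro orb_in_lin K(1) Phi_in w0(1))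
  show "Phi x1 = D K1" unfolding K1_def x1_def Phi_simps orb_diff_lin K(2) D_Phi[OF w0(1)] ..
  have "K1 0 = K 0 - Ups y" unfolding K1_def minus_apply Phi_lead[OF w0(1)] w0(2) ..
  then show "K1 0 \<in> cob p" using y(2) by (simp only:)
 qed
 \<comment> \<open>The leading term of \<open>K1\<close> is exact; a coboundary removes it and does
   not change the differential, after which both \<open>x1\<close> and \<open>K2\<close> are
   divisible by \<upsilon>.\<close>
 have "\<exists>K2. orb_in X p K2 & Phi x1 = D K2 & K2 0 = 0 & K1 - K2 \<in> cobO p"
 proof (cases p)
  case 0
  then have "K1 0 = 0" using K1(3) by (simp only: coboundaries_def nat.case singleton_iff)
  then show ?thesis using K1(1,2) cobO_closed(1)[of p] by (intro exI[of _ K1]) (simp_all only: diff_self simp_thms)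
 next
  case (Suc q)
  obtain u where u: "u \<in> cochains LX {q}" "K1 0 = codiff LX u" using K1(3) unfolding Suc cob_CU by blast
  note l = lead_in[OF u(1)]
  show ?thesis
  proof (intro exI[of _ "K1 - D (lead u)"] conjI)
   show "orb_in X p (K1 - D (lead u))" using K1(1) orb_diff_in[OF l] unfolding Suc by (rule orb_in_lin(2))
   show "Phi x1 = D (K1 - D (lead u))" unfolding orb_diff_lin orb_diff_diff[OF l] K1(2) by (rule diff_zero[symmetric])
   show "(K1 - D (lead u)) 0 = 0" by (simp only: minus_apply orb_diff_zero lead_simps u(2) diff_self)
   show "K1 - (K1 - D (lead u)) \<in> cobO p" unfolding Suc cobO_Suc using l by (intro exI[of _ "lead u"]) (simp only: diff_diff_eq2 add_diff_cancel_left' simp_thms)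
  qed
 qed
 then obtain K2 where K2: "orb_in X p K2" "Phi x1 = D K2" "K2 0 = 0" "K1 - K2 \<in> cobO p" by blast
 have "Ups (proj x1) = codiff LX (K2 0)" using Phi_lead[OF x1(1)] K2(2) orb_diff_zero by metis
 then have "Ups (proj x1) \<in> cob (Suc p)" unfolding K2(3) codiff_lin using cob_closed(1)[of "Suc p"] by (simp only:)
 then have "proj x1 = 0" by (rule cohomology_LX_free[OF shift_keys(1)[OF x1(1)]])
 then have x1up: "x1 = up (down x1)" using split[of x1] by (simp add: proj_incl)
 define K3 where "K3 = (%r. K2 (Suc r))"
 have v: "K2 = vsh K3" unfolding K3_def by (rule vsh_tail[of K2, OF K2(3)])
 have P3: "Phi (down x1) = D K3"
  by (rule vsh_inject) (simp only: up_props(1)[symmetric] x1up[symmetric] orb_diff_vsh[symmetric] v[symmetric] K2(2))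
 have "\<exists>w. keys w \<subseteq> og p & x1 = ?d w & K2 - Phi w \<in> cobO p"
 proof (cases "p < 2")
  case True
  have "K3 = 0"
  proof (rule seq_eqI)
   fix r
   have "K2 (Suc r) \<in> cochains LX (if 2 * Suc r \<le> p then {p - 2 * Suc r} else {})" using K2(1) unfolding orb_in_def by blast
   then have "K2 (Suc r) \<in> cochains LX {}" using True by simp
   then show "K3 r = 0 r" unfolding K3_def zero_seq cochains_empty .
  qed
  then have k: "K2 = 0" "Phi (down x1) = 0" unfolding v P3 using orb_diff_lin(2)[of X 0 0] by (simp_all only: ssc_simps diff_self)
  \<comment> \<open>For \<open>p = 1\<close> the quotient has degree zero, consists of its leading
    part alone, and is therefore detected by \<open>Ups\<close>.\<close>
  have "down x1 = 0"
  proof (cases p)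
   case 0
   then show ?thesis using shift_keys(4)[OF _ x1(1)] by simp
  next
   case (Suc q)
   then have d0: "keys (down x1) \<subseteq> og 0" using shift_keys(3)[of x1 0] x1(1) True by simp
   have "Ups (proj (down x1)) = 0" using Phi_lead[OF d0] unfolding k(2) by (simp only: zero_seq)
   then have "proj (down x1) = 0" using cohomology_LX_free[OF shift_keys(1)[OF d0]] cob_closed(1) by (simp only:)
   moreover have "down (down x1) = 0" by (rule shift_keys(4)[OF _ d0]) simp
   ultimately show ?thesis using split[of "down x1"] by (simp add: proj_incl)
  qed
  then have "x1 = 0" using x1up by (simp add: proj_incl)
  then show ?thesis using k(1) cobO_closed(1)[of p] by (intro exI[of _ 0]) (simp only: Phi_simps diff_zero frag_extend_0 keys_zero empty_subsetI simp_thms)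
 next
  case False
  define q where "q = p - 2"
  have q: "p = q + 2" "Suc p = Suc q + 2" using False by (simp_all add: q_def)
  have d: "keys (down x1) \<subseteq> og (Suc q)" using shift_keys(3)[OF x1(1)[unfolded q(2)]] .
  have "up (?d (down x1)) = 0" unfolding up_props(2)[OF d, symmetric] x1up[symmetric] by (rule x1(2))
  then have d': "?d (down x1) = 0" by (rule up_props(3))
  have "orb_in X q K3" unfolding K3_def by (rule tail_in[OF K2(1)[unfolded q(1)]])
  moreover have "q < p" using q(1) by simp
  ultimately have "\<exists>w. keys w \<subseteq> og q & down x1 = ?d w & K3 - Phi w \<in> cobO q"
   by (intro less.IH d d' P3)
  then obtain w where w: "keys w \<subseteq> og q" "down x1 = ?d w" "K3 - Phi w \<in> cobO q" by blast
  have "x1 = ?d (up w)" unfolding up_props(2)[OF w(1)] w(2)[symmetric] by (rule x1up)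
  moreover have "K2 - Phi (up w) \<in> cobO p" unfolding v up_props vsh_lin(2)[symmetric] q(1) by (rule vsh_cob[OF w(3)])
  ultimately show ?thesis using shift_keys(2)[OF w(1)] unfolding q(1) by blast
 qed
 then obtain w where w: "keys w \<subseteq> og p" "x1 = ?d w" "K2 - Phi w \<in> cobO p" by blast
 have "K - Phi (w0 + w) = (K1 - K2) + (K2 - Phi w)" unfolding K1_def Phi_simps by (rule diff_split_middle)
 also have "... \<in> cobO p" by (rule cobO_closed(3)[OF K2(4) w(3)])
 finally have "K - Phi (w0 + w) \<in> cobO p" .
 moreover have "x = ?d (w0 + w)" unfolding frag_extend_add w(2)[symmetric] x1_def by simp
 moreover have "keys (w0 + w) \<subseteq> og p" using Poly_Mapping.keys_add[of w0 w] w0(1) w(1) by blast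
 ultimately show ?case by blast
qed

text \<open>Both halves of the criterion are instances of \<open>Phi_cone\<close>: injectivity with
  \<open>K\<close> a primitive of \<open>Phi x\<close>, surjectivity with \<open>x = 0\<close> and a
  given cocycle as \<open>K\<close>. In degree zero there is no primitive, and injectivity follows
  from the leading term.\<close>

lemma quasi_iso_Phi: "quasi_iso (complex_of OM) (orbit_cochains X) Phi"
proof -
 have "x \<in> coboundaries (complex_of OM) p" if x: "x \<in> cocycles (complex_of OM) p" "Phi x \<in> cobO p" for x p
 proof -
  have x': "keys x \<subseteq> og p" "frag_extend (dif OM) x = 0" using x(1) by (auto simp: cocycles_def comp_OM diff_OM)
  show ?thesis
  proof (cases p)
   case 0
   then have z: "Phi x = 0" using x(2) cobO_zero by metis
   have "Ups (proj x) = 0" using Phi_lead[OF x'(1)] unfolding z by (simp only: zero_seq)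
   then have "proj x = 0" using cohomology_LX_free[OF shift_keys(1)[OF x'(1)]] cob_closed(1) by (simp only:)
   moreover have "down x = 0" by (rule shift_keys(4)[OF _ x'(1)]) (simp add: 0)
   ultimately have "x = 0" using split[of x] by (simp add: proj_incl)
   then show ?thesis by (simp add: coboundaries_closed[OF is_cochain_complex_OM])
  next
   case (Suc q)
   obtain K where "orb_in X q K" "Phi x = D K" using x(2) unfolding Suc cobO_Suc by blast
   from Phi_cone[OF x'(1)[unfolded Suc] x'(2) this] show ?thesis by (auto simp: Suc coboundaries_def comp_OM diff_OM)
  qed
 qed
 moreover have "\<exists>x\<in>cocycles (complex_of OM) p. F - Phi x \<in> cobO p" if F: "F \<in> cocO p" for F p
 proof -
  have F': "orb_in X p F" "D F = 0" using F unfolding cocO_iff by blast+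
  have "keys (0 :: nat \<times> letter \<times> letter list \<Rightarrow>\<^sub>0 int) \<subseteq> og (Suc p)" "frag_extend (dif OM) 0 = 0" "Phi 0 = D F"
   by (simp_all only: F'(2) Phi_simps keys_zero empty_subsetI frag_extend_0)
  from Phi_cone[OF this(1,2) F'(1) this(3)] obtain w
   where w: "keys w \<subseteq> og p" "0 = frag_extend (dif OM) w" "F - Phi w \<in> cobO p" by blast
  then have "w \<in> cocycles (complex_of OM) p" by (simp add: cocycles_def comp_OM diff_OM)
  then show ?thesis using w(3) by blast
 qed
 ultimately show ?thesis
  unfolding quasi_iso_iff using is_cochain_complex_OM is_cochain_complex_orbit cochain_map_Phi by blast
qed

end

theorem theorem2p4p3:
  fixes n :: nat
    and \<alpha> :: "((letter list \<times> letter list) list \<Rightarrow>\<^sub>0 int) \<Rightarrow> ((nat \<Rightarrow> real) \<times> (nat \<Rightarrow> real)) cochain"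
    and \<gamma> :: "(letter list list \<Rightarrow>\<^sub>0 int) \<Rightarrow> (nat \<Rightarrow> real) cochain"
    and \<beta> :: "((letter list \<times> letter list) list \<times> letter list \<Rightarrow>\<^sub>0 int) \<Rightarrow> (real \<Rightarrow> nat \<Rightarrow> real) cochain"
    and \<sigma> :: "(letter \<times> letter list \<Rightarrow>\<^sub>0 int) \<Rightarrow> (letter list list \<times> letter list \<Rightarrow>\<^sub>0 int)"
  assumes "n > 0"
    and "thin_loop_data (sphere_cochains n) sphere_star (nsphere (2 * n + 1)) \<alpha> \<gamma> \<beta> \<sigma>"
  shows "\<exists>\<Phi> :: (nat \<times> letter \<times> letter list \<Rightarrow>\<^sub>0 int) \<Rightarrow> (nat \<Rightarrow> (complex \<Rightarrow> nat \<Rightarrow> real) cochain).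
     quasi_iso (complex_of (orbit_model (sphere_cochains n) sphere_star))
       (orbit_cochains (nsphere (2 * n + 1))) \<Phi> \<and>
     (\<forall>k. \<Phi> (frag_of (k, unt (sphere_cochains n), [])) = upsilon_power (nsphere (2 * n + 1)) k) \<and>
     (\<forall>p. \<forall>x\<in>comp (complex_of (orbit_model (sphere_cochains n) sphere_star)) p.
        orbit_cochains_proj (\<Phi> x) =
        Upsilon (sphere_cochains n) sphere_star (nsphere (2 * n + 1)) \<gamma> \<beta> \<sigma> (orbit_model_proj x))"
proof -
 interpret sphere_loops n \<alpha> \<gamma> \<beta> \<sigma> using assms by unfold_locales
 have "Phi (frag_of (k, unt A, [])) = upsilon_power X k" for k
 proof -
  have "Phi (frag_of (k, unt A, [])) = (vsh ^^ k) (upsilon_power X 0)" by (simp only: Phi_simps phi_def prod.case if_True simp_thms list.size AA_def)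
  also have "... = upsilon_power X k" by (induction k) (simp_all only: funpow.simps o_apply id_apply upsilon_power_simps)
  finally show ?thesis .
 qed
 moreover have "orbit_cochains_proj (Phi x) = Ups (orbit_model_proj x)" if "x \<in> comp (complex_of OM) p" for x p
  using Phi_lead that unfolding comp_OM orbit_cochains_proj_def by blast
 ultimately show ?thesis using quasi_iso_Phi unfolding Ups_def by blast
qed

end
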